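(* Let $n\ge 2$ and $s\ge n+3$ be integers, let $p_1,\dots,p_s$ be distinct points on a rational normal curve of degree $n$ in $\mathbb{P}^n$ (over $\mathbb{C}$), let $X_s^n$ be the blow-up of $\mathbb{P}^n$ at these points, with hyperplane class $H$ and exceptional divisors $E_1,\dots,E_s$, and let $D=dH-\sum_{i=1}^s 2E_i$ be an effective divisor on $X_s^n$. (1) If $d\ge\dfrac{2s-1}{n}$, then the linear system $|D|$ is non-special. (2) If $\dfrac{s+n+2}{n}\le d<\dfrac{2s-1}{n}$, then $|D|$ is special and $$h^1(X_s^n,\mathcal O(D))=F_1(n+1-1-1,\,s,\,nd-n-s-2,\,n)=2s-nd-1.$$ (3) If $d<\dfrac{s+n+2}{n}$, then $|D|$ is special and $$h^1(X_s^n,\mathcal O(D))=F_1(n+2-1-1,\,s,\,n(d-2)-4,\,n)=s(n+1)-n^2(d-1)-2.$$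
   Context: A divisor $D$ is effective if $h^0(X_s^n,\mathcal O(D))>0$. For $D=dH-\sum_{i=1}^s m_iE_i$ the virtual dimension is $\operatorname{vdim}(D)=\binom{n+d}{n}-\sum_{i=1}^s\binom{n+m_i-1}{n}$, which equals $h^0(X_s^n,\mathcal O(D))-h^1(X_s^n,\mathcal O(D))$. The linear system $|D|$ is non-special if $h^0(X_s^n,\mathcal O(D))=\max(\operatorname{vdim}(D),0)$, and special if $h^0(X_s^n,\mathcal O(D))>\max(\operatorname{vdim}(D),0)$. The function $F_1$ is $$F_1(a,s,\varepsilon,n)=\binom{a}{n}+(s-n-3)\binom{a+1}{n}-\varepsilon\binom{a}{n-1},$$ with the convention $\binom{a}{n}=0$ for $a<n$. *)

theory Defs
  imports "HOL-Analysis.Analysis" "HOL-Library.Function_Algebras"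
begin

section \<open>Dimensions of spaces of complex-valued functions\<close>

global_interpretation cfun: vector_space "\<lambda>(c::complex) (f :: 'a \<Rightarrow> complex) x. c * f x"
  by unfold_locales (auto simp: fun_eq_iff algebra_simps)

text \<open>The dimension of \<open>Z / B\<close> for subspaces \<open>B \<subseteq> Z\<close>: the set \<open>S\<close> maps bijectively to a basis
  of the quotient. As for the library's \<open>dim\<close>, an infinite dimension is rendered as \<open>0\<close>.\<close>

definition quot_dim :: "('a \<Rightarrow> complex) set \<Rightarrow> ('a \<Rightarrow> complex) set \<Rightarrow> nat" where
  "quot_dim Z B = card (SOME S. \<not> cfun.dependent S \<and> cfun.span S \<inter> B = {0} \<and> cfun.span (S \<union> B) = Z)"


section \<open>Zeroth and first cohomology of a sheaf\<close>

text \<open>The points of the space \<open>T\<close> are sets, and the sections over an open set \<open>U\<close> are functions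
  on \<open>\<Union>U\<close>, the part of the total space lying over \<open>U\<close>. The predicate \<open>sec U \<phi>\<close> says that \<open>\<phi>\<close> restricts
  to a section over \<open>U\<close>; it must depend only on the values of \<open>\<phi>\<close> on \<open>\<Union>U\<close>.\<close>

definition global_sections :: "'e set topology \<Rightarrow> ('e set set \<Rightarrow> ('e \<Rightarrow> complex) \<Rightarrow> bool) \<Rightarrow> ('e \<Rightarrow> complex) set" where
  "global_sections T sec = {\<phi>. sec (topspace T) \<phi> \<and> (\<forall>e. e \<notin> \<Union>(topspace T) \<longrightarrow> \<phi> e = 0)}"

definition pointed_cover :: "'e set topology \<Rightarrow> ('e set \<Rightarrow> 'e set set) \<Rightarrow> bool" where
  "pointed_cover T U \<longleftrightarrow> (\<forall>x\<in>topspace T. openin T (U x) \<and> x \<in> U x)"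

text \<open>Cech cohomology, in the direct limit over all open covers. The covers indexed by the points, with
  \<open>x \<in> U x\<close>, are cofinal among all open covers. A class in the limit is represented by a cochain
  on some cover, extended arbitrarily to all of the total space, and is zero iff the cochain becomes
  a coboundary on a finer cover. Hence the limit is the quotient of the following two subspaces.\<close>

definition cech_cocycles ::
    "'e set topology \<Rightarrow> ('e set set \<Rightarrow> ('e \<Rightarrow> complex) \<Rightarrow> bool) \<Rightarrow> ('e set \<times> 'e set \<times> 'e \<Rightarrow> complex) set" where
  "cech_cocycles T sec = {f. \<exists>U. pointed_cover T U \<and>
     (\<forall>x\<in>topspace T. \<forall>y\<in>topspace T. sec (U x \<inter> U y) (\<lambda>e. f (x, y, e))) \<and>
     (\<forall>x\<in>topspace T. \<forall>y\<in>topspace T. \<forall>z\<in>topspace T. \<forall>e\<in>\<Union>(U x \<inter> U y \<inter> U z).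
        f (x, y, e) + f (y, z, e) = f (x, z, e))}"

definition cech_coboundaries ::
    "'e set topology \<Rightarrow> ('e set set \<Rightarrow> ('e \<Rightarrow> complex) \<Rightarrow> bool) \<Rightarrow> ('e set \<times> 'e set \<times> 'e \<Rightarrow> complex) set" where
  "cech_coboundaries T sec = {f. \<exists>U h. pointed_cover T U \<and>
     (\<forall>x\<in>topspace T. sec (U x) (h x)) \<and>
     (\<forall>x\<in>topspace T. \<forall>y\<in>topspace T. \<forall>e\<in>\<Union>(U x \<inter> U y). f (x, y, e) = h y e - h x e)}"

definition dim_H0 :: "'e set topology \<Rightarrow> ('e set set \<Rightarrow> ('e \<Rightarrow> complex) \<Rightarrow> bool) \<Rightarrow> nat" where
  "dim_H0 T sec = cfun.dim (global_sections T sec)"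

definition dim_H1 :: "'e set topology \<Rightarrow> ('e set set \<Rightarrow> ('e \<Rightarrow> complex) \<Rightarrow> bool) \<Rightarrow> nat" where
  "dim_H1 T sec = quot_dim (cech_cocycles T sec) (cech_coboundaries T sec)"


section \<open>Projective space and rational normal curves\<close>

text \<open>\<open>\<P>\<^sup>n\<close> is the set of \<open>proj_pt v\<close> for nonzero \<open>v :: complex ^ 'm\<close>, where \<open>CARD('m) = n + 1\<close>.\<close>

definition proj_pt :: "complex ^ 'm \<Rightarrow> (complex ^ 'm::finite) set" where
  "proj_pt v = {c *s v | c. c \<noteq> 0}"

text \<open>The images of the standard curve \<open>(u\<^sup>n : u\<^bsup>n-1\<^esup>w : \<dots> : w\<^sup>n)\<close> under projective
  transformations; \<open>\<sigma>\<close> numbers the coordinates.\<close>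

definition rational_normal_curve :: "(complex ^ 'm::finite) set set \<Rightarrow> bool" where
  "rational_normal_curve C \<longleftrightarrow> (\<exists>(A :: complex ^ 'm ^ 'm) (\<sigma> :: 'm \<Rightarrow> nat).
     invertible A \<and> bij_betw \<sigma> UNIV {..CARD('m) - 1} \<and>
     C = {proj_pt (A *v (\<chi> j. u ^ (CARD('m) - 1 - \<sigma> j) * w ^ \<sigma> j)) | u w. (u, w) \<noteq> (0, 0)})"


section \<open>The blow-up of projective space at points\<close>

text \<open>The linear forms \<open>v \<mapsto> minors q v $ (a, b)\<close> generate the homogeneous ideal of the point \<open>q\<close>.\<close>

definition minors :: "complex ^ 'm \<Rightarrow> complex ^ 'm \<Rightarrow> complex ^ ('m \<times> 'm)" where
  "minors q v = (\<chi> ab. q $ fst ab * v $ snd ab - q $ snd ab * v $ fst ab)"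

type_synonym 'm coords = "(complex ^ 'm) \<times> (nat \<Rightarrow> complex ^ ('m \<times> 'm))"

text \<open>The blow-up at the points \<open>p 1, \<dots>, p s\<close> is the closure of the graph of
  \<open>v \<mapsto> (minors (p i) v)\<^sub>i\<close> in \<open>\<P>\<^sup>n \<times> \<Prod>\<^sub>i \<P>(\<complex>\<^bsup>(n+1)(n+1)\<^esup>)\<close>. As in the textbook equations
  \<open>x\<^sub>i y\<^sub>j = x\<^sub>j y\<^sub>i\<close> for the blow-up of affine space at the origin, this is the locus where \<open>y i\<close>
  is in the linear space \<open>range (minors (p i))\<close> of dimension \<open>n\<close> and \<open>minors (p i) v\<close> is a multiple of \<open>y i\<close>.
  \<open>blowup_cone\<close> is the set of multihomogeneous coordinates of its points.\<close>

definition blowup_cone :: "(nat \<Rightarrow> complex ^ 'm::finite) \<Rightarrow> nat \<Rightarrow> 'm coords set" where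
  "blowup_cone p s = {(v, y). v \<noteq> 0 \<and>
     (\<forall>i\<in>{1..s}. y i \<noteq> 0 \<and> y i \<in> range (minors (p i)) \<and> (\<exists>c. minors (p i) v = c *s y i)) \<and>
     (\<forall>i. i \<notin> {1..s} \<longrightarrow> y i = 0)}"

definition rescale :: "complex \<Rightarrow> (nat \<Rightarrow> complex) \<Rightarrow> ('m::finite) coords \<Rightarrow> 'm coords" where
  "rescale c \<gamma> e = (c *s fst e, \<lambda>i. \<gamma> i *s snd e i)"

definition multiproj_pt :: "('m::finite) coords \<Rightarrow> 'm coords set" where
  "multiproj_pt e = {rescale c \<gamma> e | c \<gamma>. c \<noteq> 0 \<and> (\<forall>i. \<gamma> i \<noteq> 0)}"

definition blowup :: "(nat \<Rightarrow> complex ^ 'm::finite) \<Rightarrow> nat \<Rightarrow> 'm coords set set" where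
  "blowup p s = multiproj_pt ` blowup_cone p s"

inductive_set poly_funs :: "nat \<Rightarrow> (('m::finite) coords \<Rightarrow> complex) set" for s :: nat where
  "(\<lambda>e. c) \<in> poly_funs s"
| "(\<lambda>e. fst e $ a) \<in> poly_funs s"
| "i \<in> {1..s} \<Longrightarrow> (\<lambda>e. snd e i $ ab) \<in> poly_funs s"
| "F \<in> poly_funs s \<Longrightarrow> G \<in> poly_funs s \<Longrightarrow> (\<lambda>e. F e + G e) \<in> poly_funs s"
| "F \<in> poly_funs s \<Longrightarrow> G \<in> poly_funs s \<Longrightarrow> (\<lambda>e. F e * G e) \<in> poly_funs s"

text \<open>Polynomials of multidegree \<open>(k, b 1, \<dots>, b s)\<close>.\<close>

definition multihom :: "nat \<Rightarrow> nat \<Rightarrow> (nat \<Rightarrow> nat) \<Rightarrow> (('m::finite) coords \<Rightarrow> complex) set" where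
  "multihom s k b = {F \<in> poly_funs s. \<forall>c \<gamma> e. F (rescale c \<gamma> e) = c ^ k * (\<Prod>i\<in>{1..s}. \<gamma> i ^ b i) * F e}"

definition zariski :: "(nat \<Rightarrow> complex ^ 'm::finite) \<Rightarrow> nat \<Rightarrow> 'm coords set topology" where
  "zariski p s = topology_generated_by
     {{x \<in> blowup p s. \<forall>e\<in>x. F e \<noteq> 0} | F. \<exists>k b. F \<in> multihom s k b}"


section \<open>The line bundles of the divisors \<open>d H - (\<Sum>i = 1..s. m i * E i)\<close>\<close>

text \<open>\<open>\<O>(d H)\<close> is the pullback of \<open>\<O>(d)\<close> from \<open>\<P>\<^sup>n\<close>: its sections are locally quotients of
  multihomogeneous polynomials whose multidegrees differ by \<open>(d, 0, \<dots>, 0)\<close>. For \<open>d = 0\<close> this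
  is the structure sheaf.\<close>

definition sec_H :: "(nat \<Rightarrow> complex ^ 'm::finite) \<Rightarrow> nat \<Rightarrow> int \<Rightarrow> 'm coords set set \<Rightarrow> ('m coords \<Rightarrow> complex) \<Rightarrow> bool" where
  "sec_H p s d U \<phi> \<longleftrightarrow> (\<forall>x\<in>U. \<exists>W. openin (zariski p s) W \<and> x \<in> W \<and> W \<subseteq> U \<and>
     (\<exists>k l b. \<exists>F\<in>multihom s k b. \<exists>G\<in>multihom s l b. int k - int l = d \<and>
        (\<forall>e\<in>\<Union>W. G e \<noteq> 0 \<and> \<phi> e = F e / G e)))"

text \<open>The ideal sheaf \<open>\<O>(-E i)\<close> of the exceptional divisor over \<open>p i\<close>.\<close>

definition sec_ideal :: "(nat \<Rightarrow> complex ^ 'm::finite) \<Rightarrow> nat \<Rightarrow> nat \<Rightarrow> 'm coords set set \<Rightarrow> ('m coords \<Rightarrow> complex) \<Rightarrow> bool" where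
  "sec_ideal p s i U \<theta> \<longleftrightarrow> sec_H p s 0 U \<theta> \<and>
     (\<forall>e\<in>\<Union>U. proj_pt (fst e) = proj_pt (p i) \<longrightarrow> \<theta> e = 0)"

text \<open>For multiplicities \<open>m i \<ge> 0\<close>, the line bundle of \<open>d H - (\<Sum>i = 1..s. m i * E i)\<close> is
  \<open>\<O>(d H) \<otimes> \<Otimes>\<^sub>i \<O>(-E i)\<^bsup>\<otimes> m i\<^esup>\<close>, which is the subsheaf \<open>\<O>(d H) \<cdot> \<Prod>\<^sub>i \<O>(-E i)\<^bsup>m i\<^esup>\<close> of \<open>\<O>(d H)\<close>.\<close>

definition sec_D ::
    "(nat \<Rightarrow> complex ^ 'm::finite) \<Rightarrow> nat \<Rightarrow> int \<Rightarrow> (nat \<Rightarrow> nat) \<Rightarrow> 'm coords set set \<Rightarrow> ('m coords \<Rightarrow> complex) \<Rightarrow> bool" where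
  "sec_D p s d m U \<phi> \<longleftrightarrow> (\<forall>x\<in>U. \<exists>W. openin (zariski p s) W \<and> x \<in> W \<and> W \<subseteq> U \<and>
     (\<exists>(N::nat) \<psi> \<theta>. (\<forall>k<N. sec_H p s d W (\<psi> k)) \<and>
        (\<forall>k<N. \<forall>i\<in>{1..s}. \<forall>j<m i. sec_ideal p s i W (\<theta> k i j)) \<and>
        (\<forall>e\<in>\<Union>W. \<phi> e = (\<Sum>k<N. \<psi> k e * (\<Prod>i\<in>{1..s}. \<Prod>j<m i. \<theta> k i j e)))))"

definition h0 :: "(nat \<Rightarrow> complex ^ 'm::finite) \<Rightarrow> nat \<Rightarrow> int \<Rightarrow> (nat \<Rightarrow> nat) \<Rightarrow> nat" where
  "h0 p s d m = dim_H0 (zariski p s) (sec_D p s d m)"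

definition h1 :: "(nat \<Rightarrow> complex ^ 'm::finite) \<Rightarrow> nat \<Rightarrow> int \<Rightarrow> (nat \<Rightarrow> nat) \<Rightarrow> nat" where
  "h1 p s d m = dim_H1 (zariski p s) (sec_D p s d m)"

definition effective :: "(nat \<Rightarrow> complex ^ 'm::finite) \<Rightarrow> nat \<Rightarrow> int \<Rightarrow> (nat \<Rightarrow> nat) \<Rightarrow> bool" where
  "effective p s d m \<longleftrightarrow> h0 p s d m > 0"


section \<open>Virtual dimension and speciality\<close>

definition binom :: "int \<Rightarrow> int \<Rightarrow> int" where
  "binom a k = (if k < 0 \<or> a < k then 0 else int (nat a choose nat k))"

definition vdim :: "nat \<Rightarrow> nat \<Rightarrow> int \<Rightarrow> (nat \<Rightarrow> nat) \<Rightarrow> int" where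
  "vdim n s d m = binom (int n + d) (int n) - (\<Sum>i\<in>{1..s}. binom (int n + int (m i) - 1) (int n))"

definition non_special :: "(nat \<Rightarrow> complex ^ 'm::finite) \<Rightarrow> nat \<Rightarrow> int \<Rightarrow> (nat \<Rightarrow> nat) \<Rightarrow> bool" where
  "non_special p s d m \<longleftrightarrow> int (h0 p s d m) = max (vdim (CARD('m) - 1) s d m) 0"

definition special :: "(nat \<Rightarrow> complex ^ 'm::finite) \<Rightarrow> nat \<Rightarrow> int \<Rightarrow> (nat \<Rightarrow> nat) \<Rightarrow> bool" where
  "special p s d m \<longleftrightarrow> int (h0 p s d m) > max (vdim (CARD('m) - 1) s d m) 0"

definition F1 :: "int \<Rightarrow> int \<Rightarrow> int \<Rightarrow> int \<Rightarrow> int" where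
  "F1 a s \<epsilon> n = binom a n + (s - n - 3) * binom (a + 1) n - \<epsilon> * binom a (n - 1)"

end

theory Submission
  imports Defs "HOL-Computational_Algebra.Fundamental_Theorem_Algebra"
begin

text \<open>A form of degree \<open>d\<close> is a section of \<open>\<O>(D)\<close> iff its gradient vanishes at every point. On an affine
  chart around one exceptional divisor the first cohomology vanishes, by a Hartogs argument in Cox
  coordinates, and so does that of \<open>\<O>(d H)\<close>; hence every class of \<open>\<O>(D)\<close> is given by prescribed gradients at
  the points, modulo the gradients of forms. So \<open>h\<^sup>1\<close> is the dimension of the space of linear
  relations between the gradients at the points of all forms of degree \<open>d\<close>, and
  \<open>h\<^sup>0 = vdim + h\<^sup>1\<close>.

  On the curve a relation becomes a family of moment conditions on binary forms of degree
  \<open>M = n (d - 1)\<close>. If \<open>s < M\<close> they force the coefficient vectors to be tangent to the curve, and the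
  remaining relations are those of Hermite interpolation in degree \<open>n d\<close>, of dimension
  \<open>max 0 (2 s - n d - 1)\<close>. If \<open>s \<ge> M - 1\<close>, the gradients span a space of the maximal dimension
  \<open>n M + 2\<close> of gradients restricted to the curve.\<close>

section \<open>Linear algebra in spaces of functions\<close>

text \<open>Cohomology is a limit over covers indexed by points, so both vanishing statements are
  obtained by splitting cocycles of fractions by hand: the polynomials \<open>r\<close> for which
  \<open>r\<close> times the cocycle splits include powers of two coordinates, and a Koszul argument
  descends from there to \<open>1\<close>. The descent asks for a third coordinate. Projective space
  has one because n >= 2, but a chart of the blown-up plane has not; there the weight 2 of a section
  divided by the square of the exceptional equation, for the action that rescales
  \<open>y i\<close>, takes its place.

  The thresholds come from the curve. Second differences of the relations are moment conditions of
  degree M - 2, which separate s points iff s <= M - 1, that is, n d >= s + n + 1. At equality both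
  formulas for \<open>h1\<close> agree, so this degree fits either case; the statement puts it in
  (3). Effectivity enters twice: it forces d >= 3, and with h0 > 0 the equation h0 = vdim + h1 makes
  speciality equivalent to h1 > 0.\<close>

abbreviation clinear :: "(('a => complex) => 'b => complex) => bool" where
 "clinear T \<equiv> Vector_Spaces.linear (%c f x. c * f x) (%c f x. c * f x) T"

interpretation cpair: vector_space_pair
 "%(c::complex) (f :: 'a => complex) x. c * f x" "%(c::complex) (f :: 'b => complex) x. c * f x" ..

lemma clinearI:
 assumes "!!f g. T (%x. f x + g x) = (%x. T f x + T g x)" "!!c f. T (%x. c * f x) = (%x. c * T f x)"
 shows "clinear T"
 using assms by (simp add: Vector_Spaces.linear_iff plus_fun_def cfun.vector_space_axioms)

lemma cfun_subspaceI:
 assumes "(%x. 0) : V" "!!f g. f : V ==> g : V ==> (%x. f x + g x) : V"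
  "!!c f. f : V ==> (%x. c * f x) : V"
 shows "cfun.subspace V"
 using assms by (simp add: cfun.subspace_def zero_fun_def plus_fun_def)

lemma cfun_span_Un_iff: "z : cfun.span (S \<union> T) \<longleftrightarrow> (EX a:cfun.span S. EX b:cfun.span T. z = a + b)"
 unfolding cfun.span_Un by blast

lemma sum_fun_def': "(\<Sum>i\<in>I. f i) = (%x. \<Sum>i\<in>I. f i x)" for f :: "'i => 'a => complex"
 by (induction I rule: infinite_finite_induct) (auto simp: fun_eq_iff)

lemma cfun_span_sum:
 assumes "!!i. i : I ==> f i : cfun.span S"
 shows "(%x. \<Sum>i\<in>I. c i * f i x) : cfun.span S"
proof -
 have "(\<Sum>i\<in>I. (%x. c i * f i x)) : cfun.span S"
  using assms by (intro cfun.span_sum cfun.span_scale)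
 then show ?thesis by (simp add: sum_fun_def')
qed

section \<open>Finite-dimensional subspaces and rank-nullity\<close>

definition fin_dim :: "('a => complex) set => bool" where
 "fin_dim V \<longleftrightarrow> cfun.subspace V & (EX W. finite W & V <= cfun.span W)"

lemma fin_dim_subspace: "fin_dim V ==> cfun.subspace V"
 by (simp add: fin_dim_def)

lemma fin_dim_mono: "fin_dim W ==> V <= W ==> cfun.subspace V ==> fin_dim V"
 unfolding fin_dim_def by blast

lemma fin_dim_extend_basis:
 assumes "fin_dim V" "\<not> cfun.dependent S" "S <= V"
 obtains B where "finite B" "\<not> cfun.dependent B" "cfun.span B = V" "S <= B" "card B = cfun.dim V"
proof -
 obtain B where B: "S <= B" "B <= V" "\<not> cfun.dependent B" "V <= cfun.span B"
  using cfun.maximal_independent_subset_extend[OF assms(3,2)] by blast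
 obtain W where W: "finite W" "V <= cfun.span W"
  using assms(1) by (auto simp: fin_dim_def)
 have "cfun.span B = V"
  using B assms(1) by (metis cfun.span_subspace fin_dim_subspace)
 moreover have "finite B"
  using cfun.independent_span_bound[OF W(1) B(3)] B(2) W(2) by auto
 ultimately show ?thesis
  using that B cfun.dim_eq_card[of B V] by (metis cfun.span_span)
qed

lemma fin_dim_basis:
 assumes "fin_dim V"
 obtains B where "finite B" "\<not> cfun.dependent B" "cfun.span B = V" "card B = cfun.dim V"
 using fin_dim_extend_basis[OF assms cfun.independent_empty] by auto

lemma dim_mono_fin:
 assumes "fin_dim V" "W <= V" "cfun.subspace W"
 shows "cfun.dim W <= cfun.dim V"
proof -
 obtain B where "finite B" "cfun.span B = V" "card B = cfun.dim V"
  using fin_dim_basis[OF assms(1)] .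
 then show ?thesis
  using cfun.dim_le_card assms(2) by metis
qed

text \<open>The expansions of \<open>f\<close> over \<open>S\<close> and over \<open>S'\<close> both
  extend to its unique expansion over \<open>B\<close>, whose support therefore lies in both
  sets.\<close>

lemma cfun_span_disjoint:
 assumes B: "\<not> cfun.dependent B" and "S <= B" "S' <= B" "S \<inter> S' = {}"
  and f: "f : cfun.span S" "f : cfun.span S'"
 shows "f = 0"
proof -
 have "cfun.representation B f = cfun.representation S f" "cfun.representation B f = cfun.representation S' f"
  using cfun.representation_extend[OF B f(1) assms(2)] cfun.representation_extend[OF B f(2) assms(3)] by simp_all
 then have "cfun.representation B f b = 0" for b
  using assms(4) cfun.representation_ne_zero by (metis IntI empty_iff)
 then show ?thesis
  using cfun.sum_nonzero_representation_eq[OF B, of f] f(1) cfun.span_mono[OF assms(2)] by auto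
qed

text \<open>The ambient function spaces are infinite-dimensional, so the argument is relative to
  \<open>V\<close>: a basis of the kernel is extended to one of \<open>V\<close>, and
  \<open>T\<close> is injective on the span of the added vectors.\<close>

lemma rank_nullity:
 assumes T: "clinear T" and V: "fin_dim V"
 shows "cfun.dim V = cfun.dim {f : V. T f = 0} + cfun.dim (T ` V)" "fin_dim (T ` V)"
proof -
 let ?K = "{f : V. T f = 0}"
 have K: "cfun.subspace ?K"
  using cpair.linear_subspace_kernel[OF T] fin_dim_subspace[OF V] cfun.subspace_inter[of V "{f. T f = 0}"]
  by (simp add: Int_def)
 have fK: "fin_dim ?K"
  by (rule fin_dim_mono[OF V _ K]) auto
 obtain S where S: "finite S" "\<not> cfun.dependent S" "cfun.span S = ?K" "card S = cfun.dim ?K"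
  using fin_dim_basis[OF fK] .
 have "S <= V"
  using S(3) cfun.span_superset by blast
 then obtain B where B: "finite B" "\<not> cfun.dependent B" "cfun.span B = V" "S <= B" "card B = cfun.dim V"
  using fin_dim_extend_basis[OF V S(2)] by metis
 have inj: "inj_on T (cfun.span (B - S))"
 proof (subst cpair.linear_inj_on_iff_eq_0[OF T cfun.subspace_span], intro ballI impI)
  fix f assume f: "f : cfun.span (B - S)" "T f = 0"
  then have "f : V"
   using B(3) cfun.span_mono[of "B - S" B] by auto
  then have "f : cfun.span S"
   using f S(3) by simp
  then show "f = 0"
   using cfun_span_disjoint[OF B(2), of "B - S" S f] f(1) B(4) by blast
 qed
 have img: "T ` V = cfun.span (T ` (B - S))"
 proof -
  have "T ` V = cfun.span (T ` B)"
   using cpair.linear_span_image[OF T] B(3) by metis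
  also have "\<dots> = cfun.span (T ` (B - S))"
  proof -
   have "T ` B <= insert 0 (T ` (B - S))"
    using S(3) cfun.span_superset[of S] by auto
   then have "cfun.span (T ` B) <= cfun.span (insert 0 (T ` (B - S)))"
    by (rule cfun.span_mono)
   moreover have "cfun.span (T ` (B - S)) <= cfun.span (T ` B)"
    by (rule cfun.span_mono) auto
   ultimately show ?thesis unfolding cfun.span_insert_0 by (rule equalityI)
  qed
  finally show ?thesis .
 qed
 have ind: "\<not> cfun.dependent (T ` (B - S))"
  using cpair.linear_independent_injective_image[OF T _ inj] B(2) cfun.independent_mono by blast
 have "inj_on T (B - S)"
  using inj cfun.span_superset inj_on_subset by blast
 then have "cfun.dim (T ` V) = card (B - S)"
  using img ind cfun.dim_span_eq_card_independent card_image by metis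
 moreover have "card B = card S + card (B - S)"
  using B(1,4) by (metis card_Diff_subset card_mono finite_subset le_add_diff_inverse)
 ultimately show "cfun.dim V = cfun.dim {f : V. T f = 0} + cfun.dim (T ` V)"
  using B(5) S(4) by simp
 show "fin_dim (T ` V)"
  unfolding fin_dim_def img using B(1) by (metis cfun.subspace_span finite_Diff finite_imageI subset_refl)
qed

lemma dim_image_inj:
 assumes T: "clinear T" and V: "fin_dim V" and inj: "!!f. f : V ==> T f = 0 ==> f = 0"
 shows "cfun.dim (T ` V) = cfun.dim V"
proof -
 have "{f : V. T f = 0} = {0}"
  using inj cfun.subspace_0[OF fin_dim_subspace[OF V]] cpair.linear_0[OF T] by auto
 moreover have "cfun.dim {0 :: 'a => complex} = 0"
  using cfun.dim_le_card[of "{0}" "{}"] by simp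
 ultimately show ?thesis
  using rank_nullity(1)[OF T V] by simp
qed

section \<open>Coordinate spaces and annihilators\<close>

definition supp_in :: "'a set => ('a => complex) set" where
 "supp_in A = {f. ALL x. x ~: A --> f x = 0}"

abbreviation unit_fun :: "'a => 'a => complex" where
 "unit_fun a \<equiv> (%x. if x = a then 1 else 0)"

lemma supp_in_expand:
 assumes "finite A" "f : supp_in A"
 shows "f = (%x. \<Sum>a\<in>A. f a * unit_fun a x)"
proof
 fix x
 have "(\<Sum>a\<in>A. f a * unit_fun a x) = (\<Sum>a\<in>A. if x = a then f a else 0)"
  by (intro sum.cong) auto
 also have "\<dots> = (if x : A then f x else 0)"
  using assms(1) by simp
 finally show "f x = (\<Sum>a\<in>A. f a * unit_fun a x)"
  using assms(2) by (simp add: supp_in_def)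
qed

lemma subspace_supp_in: "cfun.subspace (supp_in A)"
 by (rule cfun_subspaceI) (auto simp: supp_in_def)

lemma supp_in_dim:
 assumes A: "finite A"
 shows "cfun.dim (supp_in A) = card A" "fin_dim (supp_in A)"
proof -
 let ?U = "unit_fun ` A"
 have sp: "cfun.span ?U = supp_in A"
 proof
  show "cfun.span ?U <= supp_in A"
   using subspace_supp_in by (intro cfun.span_minimal) (auto simp: supp_in_def)
  show "supp_in A <= cfun.span ?U"
  proof
   fix f assume "f : supp_in A"
   then have "f = (%x. \<Sum>a\<in>A. f a * unit_fun a x)" by (rule supp_in_expand[OF A])
   also have "\<dots> : cfun.span ?U" by (intro cfun_span_sum cfun.span_base) auto
   finally show "f : cfun.span ?U" .
  qed
 qed
 have inj: "inj_on unit_fun A"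
  by (intro inj_onI) (metis zero_neq_one)
 have "\<not> cfun.dependent ?U"
 proof (rule cfun.independent_if_scalars_zero)
  fix c and v :: "'a => complex"
  assume c: "(\<Sum>v\<in>?U. (%x. c v * v x)) = 0" and v: "v : ?U"
  then obtain a where a: "a : A" "v = unit_fun a" by auto
  have "(\<Sum>v\<in>?U. (%x. c v * v x)) a = (\<Sum>b\<in>A. c (unit_fun b) * unit_fun b a)"
   by (simp add: sum_fun_def' sum.reindex[OF inj])
  also have "\<dots> = (\<Sum>b\<in>A. if a = b then c (unit_fun b) else 0)"
   by (intro sum.cong) auto
  also have "\<dots> = c v" using a A by simp
  finally show "c v = 0" using c by simp
 qed (use A in auto)
 then show "cfun.dim (supp_in A) = card A"
  using cfun.dim_span_eq_card_independent[of ?U] sp card_image[OF inj] by simp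
 show "fin_dim (supp_in A)"
  unfolding fin_dim_def using A sp subspace_supp_in by (metis finite_imageI subset_refl)
qed

lemma supp_in_fin_dim: "finite A ==> V <= supp_in A ==> cfun.subspace V ==> fin_dim V"
 using fin_dim_mono supp_in_dim(2) by blast

text \<open>For upper bounds on dimensions: the entries of \<open>T f\<close> are finitely many
  linear conditions which together determine \<open>f\<close>.\<close>

lemma dim_le_supp_in:
 assumes "clinear T" "fin_dim V" "finite A" "T ` V <= supp_in A" "!!f. f : V ==> T f = 0 ==> f = 0"
 shows "cfun.dim V <= card A"
proof -
 have "cfun.dim (T ` V) <= cfun.dim (supp_in A)"
  using assms by (intro dim_mono_fin supp_in_dim fin_dim_subspace rank_nullity(2))
 then show ?thesis
  using dim_image_inj[OF assms(1,2,5)] supp_in_dim(1)[OF assms(3)] by simp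
qed

definition annihilator :: "'a set => ('a => complex) set => ('a => complex) set" where
 "annihilator A K = {c : supp_in A. ALL k:K. (\<Sum>x\<in>A. c x * k x) = 0}"

text \<open>\<open>Ph\<close> pairs \<open>c\<close> with a basis of \<open>K\<close>. Its kernel is
  the annihilator, and it is onto because every functional on \<open>K\<close> extends to the
  coordinate space.\<close>

lemma dim_annihilator:
 assumes A: "finite A" and K: "cfun.subspace K" "K <= supp_in A"
 shows "cfun.dim K + cfun.dim (annihilator A K) = card A"
proof -
 have "fin_dim K" using supp_in_fin_dim[OF A K(2,1)] .
 then obtain B where B: "finite B" "\<not> cfun.dependent B" "cfun.span B = K" "card B = cfun.dim K"
  using fin_dim_basis by blast
 define Ph where "Ph = (%(c :: 'a => complex) k. if k : B then \<Sum>x\<in>A. c x * k x else 0)"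
 have lin: "clinear Ph"
  by (rule clinearI) (auto simp: Ph_def fun_eq_iff ring_distribs sum.distrib sum_distrib_left mult.assoc)
 have ker: "{c : supp_in A. Ph c = 0} = annihilator A K"
 proof (intro set_eqI iffI)
  fix c assume c: "c : {c : supp_in A. Ph c = 0}"
  have "(\<Sum>x\<in>A. c x * k x) = 0" if "k : cfun.span B" for k
   using that
  proof (induction rule: cfun.span_induct_alt)
   case base then show ?case by simp
  next
   case (step r b k)
   have "(\<Sum>x\<in>A. c x * b x) = 0"
    using c step(1) by (auto simp: Ph_def fun_eq_iff split: if_splits)
   then show ?case
    using step(2) by (simp add: ring_distribs sum.distrib mult.left_commute flip: sum_distrib_left)
  qed
  then show "c : annihilator A K"
   using c B(3) by (simp add: annihilator_def)
 next
  fix c assume "c : annihilator A K"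
  then show "c : {c : supp_in A. Ph c = 0}"
   using B(3) cfun.span_superset[of B] by (auto simp: annihilator_def Ph_def fun_eq_iff)
 qed
 have "supp_in B <= Ph ` supp_in A"
 proof
  fix f assume f: "f : supp_in B"
  \<comment> \<open>\<open>T\<close> extends the dual basis of \<open>B\<close> linearly to all
    functions; \<open>c\<close> lists the values on the unit functions of the functional with
    coordinates \<open>f\<close>.\<close>
  obtain T where T: "clinear T" "!!b. b : B ==> T b = unit_fun b"
   using cpair.linear_independent_extend[OF B(2), of unit_fun] by blast
  define c where "c = (%x. if x : A then \<Sum>b\<in>B. f b * T (unit_fun x) b else 0)"
  have "Ph c k = f k" for k
  proof (cases "k : B")
   case True
   have kA: "k : supp_in A" using True B(3) K(2) cfun.span_superset by blast
   have Tk: "T k = (%y. \<Sum>x\<in>A. k x * T (unit_fun x) y)"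
   proof -
    have "T k = T (\<Sum>x\<in>A. (%y. k x * unit_fun x y))"
     using arg_cong[OF supp_in_expand[OF A kA], of T] by (simp only: sum_fun_def')
    also have "\<dots> = (\<Sum>x\<in>A. (%y. k x * T (unit_fun x) y))"
     by (simp only: cpair.linear_sum[OF T(1)] cpair.linear_scale[OF T(1)])
    finally show ?thesis by (simp add: sum_fun_def')
   qed
   have "Ph c k = (\<Sum>x\<in>A. \<Sum>b\<in>B. f b * (k x * T (unit_fun x) b))"
    using True by (simp add: Ph_def c_def sum_distrib_left mult_ac)
   also have "\<dots> = (\<Sum>b\<in>B. f b * T k b)"
    by (subst sum.swap) (simp add: Tk sum_distrib_left)
   also have "\<dots> = (\<Sum>b\<in>B. if k = b then f b else 0)"
    using T(2)[OF True] by (intro sum.cong) auto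
   finally show ?thesis using True B(1) by simp
  next
   case False then show ?thesis using f by (simp add: Ph_def supp_in_def)
  qed
  moreover have "c : supp_in A" by (simp add: c_def supp_in_def)
  ultimately show "f : Ph ` supp_in A" by (metis ext imageI)
 qed
 then have "Ph ` supp_in A = supp_in B"
  by (auto simp: Ph_def supp_in_def)
 then show ?thesis
  using rank_nullity(1)[OF lin supp_in_dim(2)[OF A]] ker supp_in_dim(1)[OF A] supp_in_dim(1)[OF B(1)] B(4)
  by simp
qed

text \<open>Any two sets as in \<open>quot_dim\<close> are bases of the same quotient, so the choice does not matter.\<close>

lemma quotient_basis_card_le:
 assumes S1: "finite S1" "cfun.span (S1 \<union> B) = Z" and B: "cfun.subspace B"
  and S2: "\<not> cfun.dependent S2" "cfun.span S2 \<inter> B = {0}" "S2 <= Z"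
 shows "finite S2 & card S2 <= card S1"
proof -
 have "EX a : cfun.span S1. s - a : B" if "s : S2" for s
 proof -
  have "s : cfun.span (S1 \<union> B)" using that S1(2) S2(3) by auto
  then obtain a b where "a : cfun.span S1" "b : cfun.span B" "s = a + b"
   unfolding cfun_span_Un_iff by auto
  then show ?thesis using B by (metis add_diff_cancel_left' cfun.span_eq_iff)
 qed
 then obtain \<pi> where \<pi>: "!!s. s : S2 ==> \<pi> s : cfun.span S1" "!!s. s : S2 ==> s - \<pi> s : B"
  by metis
 obtain T where T: "clinear T" "!!s. s : S2 ==> T s = \<pi> s"
  using cpair.linear_independent_extend[OF S2(1), of \<pi>] by metis
 \<comment> \<open>\<open>T\<close> changes vectors only modulo \<open>B\<close>, and the span of
   \<open>S2\<close> meets \<open>B\<close> trivially, so \<open>T\<close> embeds the span of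
   \<open>S2\<close> into that of \<open>S1\<close>.\<close>
 have diff: "f - T f : B" if "f : cfun.span S2" for f
  using that
 proof (induction rule: cfun.span_induct_alt)
  case base then show ?case using cpair.linear_0[OF T(1)] cfun.subspace_0[OF B] by (metis diff_self)
 next
  case (step c s f)
  have "(%x. c * (s - \<pi> s) x) + (f - T f) : B"
   using step(2) \<pi>(2)[OF step(1)] by (intro cfun.subspace_add[OF B] cfun.subspace_scale[OF B])
  also have "(%x. c * (s - \<pi> s) x) + (f - T f) = (%x. c * s x) + f - T ((%x. c * s x) + f)"
   using step(1) T(2) by (simp add: cpair.linear_add[OF T(1)] cpair.linear_scale[OF T(1)] fun_eq_iff algebra_simps)
  finally show ?case .
 qed
 have inj: "inj_on T (cfun.span S2)"
 proof (subst cpair.linear_inj_on_iff_eq_0[OF T(1) cfun.subspace_span], intro ballI impI)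
  fix f assume "f : cfun.span S2" "T f = 0"
  then show "f = 0" using diff[of f] S2(2) by auto
 qed
 have "\<not> cfun.dependent (T ` S2)"
  by (rule cpair.linear_independent_injective_image[OF T(1) S2(1) inj])
 moreover have "T ` S2 <= cfun.span S1" using \<pi>(1) T(2) by auto
 ultimately have "finite (T ` S2) & card (T ` S2) <= card S1"
  using cfun.independent_span_bound[OF S1(1)] by blast
 moreover have "inj_on T S2" using inj cfun.span_superset inj_on_subset by blast
 ultimately show ?thesis using card_image finite_imageD by metis
qed

lemma quot_dim_eq:
 assumes S: "finite S" "\<not> cfun.dependent S" "cfun.span S \<inter> B = {0}" "cfun.span (S \<union> B) = Z"
  and B: "cfun.subspace B"
 shows "quot_dim Z B = card S"
proof -
 let ?P = "%S. \<not> cfun.dependent S & cfun.span S \<inter> B = {0} & cfun.span (S \<union> B) = Z"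
 define S' where "S' = (SOME S. ?P S)"
 have P: "?P S'" unfolding S'_def using S by (intro someI[of ?P S]) auto
 have sub: "S' <= Z" "S <= Z"
  using P S(4) cfun.span_superset[of "S' \<union> B"] cfun.span_superset[of "S \<union> B"] by auto
 have S': "finite S'" "card S' <= card S"
  using quotient_basis_card_le[OF S(1,4) B, of S'] P sub(1) by simp_all
 have "card S <= card S'"
  using quotient_basis_card_le[OF S'(1) _ B S(2,3) sub(2)] P by simp
 with S' show ?thesis by (simp add: quot_dim_def S'_def)
qed

text \<open>Every element of \<open>Z\<close> is some \<open>T v\<close> modulo \<open>B\<close>, so
  the quotient is \<open>V\<close> modulo the preimage of \<open>B\<close>. With \<open>T\<close>
  the connecting map from prescribed gradients this computes the first cohomology.\<close>

lemma quot_dim_linear: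
 assumes T: "clinear T" and V: "fin_dim V" and B: "cfun.subspace B"
  and Z: "!!z. z : Z \<longleftrightarrow> (EX v:V. z - T v : B)"
 shows "quot_dim Z B + cfun.dim {v : V. T v : B} = cfun.dim V"
proof -
 let ?K = "{v : V. T v : B}"
 have K: "cfun.subspace ?K"
  using cpair.linear_subspace_vimage[OF T B] fin_dim_subspace[OF V] cfun.subspace_inter[of V "T -` B"]
  by (simp add: Int_def vimage_def)
 have fK: "fin_dim ?K"
  by (rule fin_dim_mono[OF V _ K]) auto
 obtain S where S: "finite S" "\<not> cfun.dependent S" "cfun.span S = ?K" "card S = cfun.dim ?K"
  using fin_dim_basis[OF fK] .
 have "S <= V"
  using S(3) cfun.span_superset by blast
 then obtain C where C: "finite C" "\<not> cfun.dependent C" "cfun.span C = V" "S <= C" "card C = cfun.dim V"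
  using fin_dim_extend_basis[OF V S(2)] by metis
 have zero: "f = 0" if f: "f : cfun.span (C - S)" "T f : B" for f
 proof -
  have "f : V" using f C(3) cfun.span_mono[of "C - S" C] by auto
  then have "f : cfun.span S" using f S(3) by simp
  then show "f = 0" using cfun_span_disjoint[OF C(2), of "C - S" S f] f(1) C(4) by blast
 qed
 have B0: "0 : B" using cfun.subspace_0[OF B] .
 have inj: "inj_on T (cfun.span (C - S))"
  by (subst cpair.linear_inj_on_iff_eq_0[OF T cfun.subspace_span]) (use zero B0 in auto)
 have ind: "\<not> cfun.dependent (T ` (C - S))"
  using cpair.linear_independent_injective_image[OF T _ inj] C(2) cfun.independent_mono by blast
 have span: "cfun.span (T ` (C - S)) = T ` cfun.span (C - S)"
  using cpair.linear_span_image[OF T] by metis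
 have "quot_dim Z B = card (T ` (C - S))"
 proof (rule quot_dim_eq[OF _ ind _ _ B])
  show "cfun.span (T ` (C - S)) \<inter> B = {0}"
  proof (intro equalityI subsetI)
   fix z assume "z : cfun.span (T ` (C - S)) \<inter> B"
   then show "z : {0}" using zero cpair.linear_0[OF T] unfolding span by blast
  qed (use B0 cfun.span_zero in auto)
  have BB: "cfun.span B = B" using B by (simp add: cfun.span_eq_iff)
  show "cfun.span (T ` (C - S) \<union> B) = Z"
  proof (intro set_eqI iffI)
   fix z assume "z : cfun.span (T ` (C - S) \<union> B)"
   then obtain v b where v: "v : cfun.span (C - S)" and "b : B" "z = T v + b"
    unfolding cfun_span_Un_iff span BB by auto
   then have "z - T v : B" by simp
   moreover have "v : V" using v C(3) cfun.span_mono[of "C - S" C] by auto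
   ultimately show "z : Z" using Z by auto
  next
   fix z assume "z : Z"
   then obtain v where v: "v : V" "z - T v : B" using Z by auto
   have "v : cfun.span ((C - S) \<union> S)" using C(3,4) v(1) by (simp add: Un_absorb2)
   then obtain v1 v2 where v12: "v1 : cfun.span (C - S)" "v2 : cfun.span S" "v = v1 + v2"
    unfolding cfun_span_Un_iff by auto
   have "T v2 + (z - T v) : B"
    using v12(2) S(3) v(2) by (intro cfun.subspace_add[OF B]) auto
   moreover have "z = T v1 + (T v2 + (z - T v))"
    using v12(3) cpair.linear_add[OF T] by simp
   ultimately show "z : cfun.span (T ` (C - S) \<union> B)"
    unfolding cfun_span_Un_iff span BB using v12(1) by (meson imageI)
  qed
 qed (simp add: C(1))
 moreover have "card (T ` (C - S)) = card (C - S)"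
  by (rule card_image[OF inj_on_subset[OF inj cfun.span_superset]])
 moreover have "card C = card S + card (C - S)"
  using C(1,4) by (metis card_Diff_subset card_mono finite_subset le_add_diff_inverse)
 ultimately show ?thesis using C(5) S(4) by simp
qed

section \<open>Polynomial functions\<close>

text \<open>Polynomials are represented by their functions. Over an infinite field nothing is lost,
  and identities can be checked by evaluation on dense sets.\<close>

inductive_set PF :: "(('k::finite => complex) => complex) set" where
 PF_const: "(%x. c) : PF"
| PF_var: "(%x. x k) : PF"
| PF_add: "F : PF ==> G : PF ==> (%x. F x + G x) : PF"
| PF_mult: "F : PF ==> G : PF ==> (%x. F x * G x) : PF"

lemma PF_uminus: "F : PF ==> (%x. - F x) : PF"
 using PF_mult[OF PF_const[of "-1"], of F] by simp

lemma PF_diff: "F : PF ==> G : PF ==> (%x. F x - G x) : PF"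
 using PF_add[OF _ PF_uminus, of F G] by simp

lemma PF_sum: "(!!i. i : I ==> F i : PF) ==> (%x. \<Sum>i\<in>I. F i x) : PF"
 by (induction I rule: infinite_finite_induct) (auto intro: PF_const PF_add)

lemma PF_prod: "(!!i. i : I ==> F i : PF) ==> (%x. \<Prod>i\<in>I. F i x) : PF"
 by (induction I rule: infinite_finite_induct) (auto intro: PF_const PF_mult)

lemma PF_power: "F : PF ==> (%x. F x ^ m) : PF"
 by (induction m) (auto intro: PF_const PF_mult)

lemmas PF_intros = PF_const PF_var PF_add PF_mult PF_uminus PF_diff PF_sum PF_prod PF_power

lemma PF_compose: "F : PF ==> (!!k. s k : PF) ==> (%x. F (%k. s k x)) : PF"
 by (induction rule: PF.induct) (auto intro: PF_intros)

lemma PF_upd: "F : PF ==> (%x. F (x(a := c))) : PF"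
proof -
 assume F: "F : PF"
 have "(%x. (x(a := c)) k) : PF" for k
  by (cases "k = a") (auto intro: PF_intros)
 from PF_compose[OF F, of "%k x. (x(a := c)) k", OF this] show ?thesis by (simp add: fun_upd_def)
qed

section \<open>Monomials and expansions in them\<close>

definition mon :: "('k::finite => nat) => ('k => complex) => complex" where
 "mon al x = (\<Prod>k\<in>UNIV. x k ^ al k)"

lemma mono_add: "mon (%k. al k + bet k) x = mon al x * mon bet x"
 by (simp add: mon_def power_add prod.distrib)

lemma mono_0 [simp]: "mon (%_. 0) x = 1"
 by (simp add: mon_def)

lemma PF_mono: "mon al : PF"
 unfolding mon_def[abs_def] by (intro PF_intros)

lemma subspace_PF: "cfun.subspace PF"
 by (intro cfun_subspaceI PF_intros)

lemma span_mono_PF: "cfun.span (mon ` B) <= PF"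
 using subspace_PF PF_mono by (intro cfun.span_minimal) auto

lemma span_mono_mult:
 assumes "F : cfun.span (mon ` A)" "G : cfun.span (mon ` B)"
  "!!al bet. al : A ==> bet : B ==> (%k. al k + bet k) : C"
 shows "(%x. F x * G x) : cfun.span (mon ` C)"
 using assms(1)
proof (induction rule: cfun.span_induct_alt)
 case base
 then show ?case using cfun.span_zero by (simp add: zero_fun_def)
next
 case (step c m F)
 then obtain al where al: "al : A" "m = mon al" by auto
 have "(%x. m x * G x) : cfun.span (mon ` C)"
  using assms(2)
 proof (induction rule: cfun.span_induct_alt)
  case base
  then show ?case using cfun.span_zero by (simp add: zero_fun_def)
 next
  case (step r m' G)
  then obtain bet where bet: "bet : B" "m' = mon bet" by auto
  have "(%x. r * mon (%k. al k + bet k) x) + (%x. m x * G x) : cfun.span (mon ` C)"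
   using step(2) assms(3)[OF al(1) bet(1)]
   by (intro cfun.span_add cfun.span_scale) (auto intro: cfun.span_base)
  then show ?case
   by (simp add: plus_fun_def mono_add al(2) bet(2) algebra_simps)
 qed
 then have "(%x. c * (m x * G x)) + (%x. F x * G x) : cfun.span (mon ` C)"
  using step(2) by (intro cfun.span_add cfun.span_scale)
 then show ?case by (simp add: plus_fun_def algebra_simps)
qed

lemma mono_single: "mon (%j. if j = k then 1 else 0) x = x k"
 by (simp add: mon_def if_distrib[of "power _"] cong: if_cong)

lemma PF_eq_span: "(PF :: (('k::finite => complex) => complex) set) = cfun.span (range mon)"
proof
 show "(PF :: (('k => complex) => complex) set) <= cfun.span (range mon)"
 proof
  fix F :: "('k => complex) => complex" assume "F : PF"
  then show "F : cfun.span (range mon)"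
  proof (induction rule: PF.induct)
   case (PF_const c)
   have "(%x. c * mon (%_. 0) x) : cfun.span (range mon)"
    by (intro cfun.span_scale cfun.span_base rangeI)
   then show ?case by simp
  next
   case (PF_var k)
   have "mon (%j. if j = k then 1 else 0) : cfun.span (range mon)"
    by (intro cfun.span_base) auto
   then show ?case by (simp add: mono_single[abs_def])
  next
   case (PF_add F G)
   then show ?case using cfun.span_add[of F _ G] by (simp add: plus_fun_def)
  next
   case (PF_mult F G)
   then show ?case by (intro span_mono_mult) auto
  qed
 qed
qed (rule span_mono_PF)

lemma span_monoE:
 assumes "F : cfun.span (mon ` B)"
 obtains A r where "finite A" "A <= B" "F = (%x. \<Sum>al\<in>A. r al * mon al x)"
proof -
 have "EX A r. finite A & A <= B & F = (%x. \<Sum>al\<in>A. r al * mon al x)"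
  using assms
 proof (induction rule: cfun.span_induct_alt)
  case base
  show ?case by (intro exI[of _ "{}"]) (simp add: zero_fun_def)
 next
  case (step c m F)
  then obtain bet where bet: "bet : B" "m = mon bet" by auto
  obtain A r where A: "finite A" "A <= B" "F = (%x. \<Sum>al\<in>A. r al * mon al x)"
   using step(2) by auto
  define r' where "r' = r(bet := (if bet : A then r bet else 0) + c)"
  have "(%x. c * m x) + F = (%x. \<Sum>al\<in>insert bet A. r' al * mon al x)"
  proof
   fix x
   have *: "(\<Sum>al\<in>A - {bet}. r' al * mon al x) = (\<Sum>al\<in>A - {bet}. r al * mon al x)"
    by (intro sum.cong) (auto simp: r'_def)
   show "((%x. c * m x) + F) x = (\<Sum>al\<in>insert bet A. r' al * mon al x)"
    using A(1) by (simp add: sum.insert_remove A(3) bet(2) * sum.remove[of A bet "%al. r al * mon al x"] r'_def ring_distribs)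
  qed
  then show ?case using A bet by (intro exI[of _ "insert bet A"] exI[of _ r']) auto
 qed
 then show ?thesis using that by blast
qed

section \<open>Density and divisibility by a variable\<close>

lemma PF_line:
 assumes "F : PF"
 obtains q where "!!z. F (%k. a k + z * b k) = poly q z"
proof -
 have "EX q. ALL z. F (%k. a k + z * b k) = poly q z"
  using assms
 proof (induction rule: PF.induct)
  case (PF_const c) show ?case by (intro exI[of _ "[:c:]"]) simp
 next
  case (PF_var k) show ?case by (intro exI[of _ "[:a k, b k:]"]) simp
 next
  case (PF_add F G) then show ?case by (metis poly_add)
 next
  case (PF_mult F G) then show ?case by (metis poly_mult)
 qed
 then show ?thesis using that by blast
qed

text \<open>The points \<open>a\<close> and \<open>b\<close> are joined by a line, on which both
  functions become nonzero polynomials in one variable.\<close>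

lemma PF_domain:
 assumes "F : PF" "G : PF" "F a ~= 0" "G b ~= 0"
 shows "EX x. F x ~= 0 & G x ~= 0"
proof -
 let ?l = "%z k. a k + z * (b k - a k)"
 obtain q where q: "!!z. F (?l z) = poly q z" using PF_line[OF assms(1), of a "%k. b k - a k"] by metis
 obtain r where r: "!!z. G (?l z) = poly r z" using PF_line[OF assms(2), of a "%k. b k - a k"] by metis
 have "poly q 0 ~= 0" using q[of 0] assms(3) by simp
 moreover have "poly r 1 ~= 0" using r[of 1] assms(4) by simp
 ultimately have "q * r ~= 0" by auto
 then obtain z where "poly (q * r) z ~= 0" using poly_all_0_iff_0[of "q * r"] by auto
 then show ?thesis by (intro exI[of _ "?l z"]) (simp add: q r)
qed

text \<open>Plays the part of Zariski density: identities between fractions are proved where a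
  common denominator \<open>G\<close> does not vanish, and then hold everywhere.\<close>

lemma PF_dense:
 assumes "F : PF" "G : PF" "G b ~= 0" "!!x. G x ~= 0 ==> F x = 0"
 shows "F x = 0"
 using PF_domain[OF assms(1,2) _ assms(3)] assms(4) by blast

lemma PF_eq_dense:
 assumes "F : PF" "F' : PF" "G : PF" "G b ~= 0" "!!x. G x ~= 0 ==> F x = F' x"
 shows "F x = F' x"
 using PF_dense[OF PF_diff[OF assms(1,2)] assms(3,4)] assms(5) by simp

lemma PF_prod_nonzero:
 assumes "finite I" "!!i. i : I ==> F i : PF" "!!i. i : I ==> EX x. F i x ~= 0"
 shows "EX x. (\<Prod>i\<in>I. F i x) ~= 0"
 using assms
proof (induction I)
 case (insert i I)
 obtain b where "(\<Prod>i\<in>I. F i b) ~= 0" using insert by auto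
 moreover obtain a where "F i a ~= 0" using insert(5)[of i] by blast
 ultimately have ab: "F i a ~= 0" "(\<Prod>i\<in>I. F i b) ~= 0" by blast+
 have "(%x. \<Prod>i\<in>I. F i x) : PF" using insert by (intro PF_prod) auto
 from PF_domain[of "F i", OF _ this ab(1), of b] ab(2) show ?case
  using insert by auto
qed auto

lemma PF_div:
 assumes "F : PF"
 obtains G where "G : PF" "!!x. F x = F (x(a := 0)) + x a * G x"
proof -
 have "EX G:PF. ALL x. F x = F (x(a := 0)) + x a * G x"
  using assms
 proof (induction rule: PF.induct)
  case (PF_const c) show ?case by (intro bexI[of _ "%x. 0"] PF_intros) simp
 next
  case (PF_var k)
  show ?case by (intro bexI[of _ "%x. if k = a then 1 else 0"]) (auto intro: PF_intros)
 next
  case (PF_add F G)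
  obtain F1 where F1: "F1 : PF" "!!x. F x = F (x(a := 0)) + x a * F1 x"
   using PF_add.IH(1) by meson
  obtain G1 where G1: "G1 : PF" "!!x. G x = G (x(a := 0)) + x a * G1 x"
   using PF_add.IH(2) by meson
  show ?case
  proof (intro bexI[of _ "%x. F1 x + G1 x"] allI)
   fix x show "F x + G x = F (x(a := 0)) + G (x(a := 0)) + x a * (F1 x + G1 x)"
    using F1(2)[of x] G1(2)[of x] by (simp add: algebra_simps)
  qed (intro PF_intros F1(1) G1(1))
 next
  case (PF_mult F G)
  obtain F1 where F1: "F1 : PF" "!!x. F x = F (x(a := 0)) + x a * F1 x"
   using PF_mult.IH(1) by meson
  obtain G1 where G1: "G1 : PF" "!!x. G x = G (x(a := 0)) + x a * G1 x"
   using PF_mult.IH(2) by meson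
  show ?case
  proof (intro bexI[of _ "%x. F1 x * G x + F (x(a := 0)) * G1 x"] allI)
   fix x
   have "F x * G x - F (x(a := 0)) * G (x(a := 0)) = (F x - F (x(a := 0))) * G x + F (x(a := 0)) * (G x - G (x(a := 0)))"
    by (simp add: algebra_simps)
   also have "\<dots> = x a * (F1 x * G x + F (x(a := 0)) * G1 x)"
    using F1(2)[of x] G1(2)[of x] by (simp add: algebra_simps)
   finally show "F x * G x = F (x(a := 0)) * G (x(a := 0)) + x a * (F1 x * G x + F (x(a := 0)) * G1 x)"
    by (simp add: algebra_simps)
  qed (intro PF_intros PF_upd F1(1) G1(1) PF_mult.hyps)
 qed
 then show ?thesis using that by blast
qed

text \<open>\<open>x a\<close> is prime to \<open>x b\<close>: putting \<open>x a = 0\<close> in the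
  identity shows that \<open>A\<close> vanishes there wherever \<open>x b\<close> does not, so one
  factor \<open>x a\<close> splits off \<open>A\<close>, and the induction continues with the
  quotient.\<close>

lemma PF_div_power:
 fixes a b :: "'k::finite"
 assumes "a ~= b" "A : PF" "B : PF" "!!x. x b ^ n * A x = x a ^ m * B x"
 shows "EX C:PF. ALL x. A x = x a ^ m * C x"
 using assms(2-4)
proof (induction m arbitrary: A)
 case 0
 then show ?case by auto
next
 case (Suc m)
 obtain A' where A': "A' : PF" "!!x. A x = A (x(a := 0)) + x a * A' x"
  using PF_div[OF Suc(2)] by metis
 have "A (x(a := 0)) = 0" for x
 proof (rule PF_dense[OF PF_upd[OF Suc(2)] PF_var[of b], of "%_. 1"])
  fix x :: "'k => complex" assume "x b ~= 0"
  then show "A (x(a := 0)) = 0"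
   using Suc(4)[of "x(a := 0)"] assms(1) by (simp del: fun_upd_apply add: fun_upd_other fun_upd_same)
 qed simp
 then have AA: "A x = x a * A' x" for x using A'(2)[of x] by simp
 have "x b ^ n * A' x = x a ^ m * B x" for x
 proof -
  have 1: "(%x. x b ^ n * A' x) : PF" "(%x. x a ^ m * B x) : PF"
   by (intro PF_mult PF_power PF_var A'(1) Suc(3))+
  have "x b ^ n * A' x = x a ^ m * B x" if "x a ~= 0" for x
   using Suc(4)[of x] AA[of x] that by simp
  then show ?thesis
   using PF_eq_dense[OF 1 PF_var[of a], of "%_. 1" x] by simp
 qed
 then obtain C where "C : PF" "!!x. A' x = x a ^ m * C x" using Suc(1)[OF A'(1) Suc(3)] by blast
 then show ?case using AA by (intro bexI[of _ C]) auto
qed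

subsection \<open>Torus actions and weights\<close>

text \<open>The weights are integers because the equation of the exceptional divisor will have
  weight -1; for this reason \<open>hom\<close> speaks of invertible scalars only.\<close>

definition act :: "('k => int) => complex => ('k => complex) => 'k => complex" where
 "act w c x = (%k. c powi w k * x k)"

definition hom :: "('k => int) => int => (('k => complex) => complex) => bool" where
 "hom w de F \<longleftrightarrow> (ALL c x. c ~= 0 --> F (act w c x) = c powi de * F x)"

definition wt :: "('k::finite => int) => ('k => nat) => int" where
 "wt w al = (\<Sum>k\<in>UNIV. w k * int (al k))"

lemma homD: "hom w de F ==> c ~= 0 ==> F (act w c x) = c powi de * F x"
 by (simp add: hom_def)

lemma hom_mult: "hom w de F ==> hom w ga G ==> hom w (de + ga) (%x. F x * G x)"
 by (simp add: hom_def power_int_add)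

lemma hom_add: "hom w de F ==> hom w de G ==> hom w de (%x. F x + G x)"
 by (simp add: hom_def ring_distribs)

lemma hom_diff: "hom w de F ==> hom w de G ==> hom w de (%x. F x - G x)"
 by (simp add: hom_def ring_distribs)

lemma hom_const: "hom w 0 (%x. c)"
 by (simp add: hom_def)

lemma hom_var: "hom w (w k) (%x. x k)"
 by (simp add: hom_def act_def)

lemma hom_power: "hom w de F ==> hom w (int m * de) (%x. F x ^ m)"
 by (simp add: hom_def power_mult_distrib mult.commute[of "int m"] power_int_mult)

lemma hom_prod: "(!!i. i : I ==> hom w (de i) (F i)) ==> hom w (\<Sum>i\<in>I. de i) (%x. \<Prod>i\<in>I. F i x)"
 by (induction I rule: infinite_finite_induct) (auto intro: hom_const hom_mult)

lemma power_int_sum: "c ~= 0 ==> (c::complex) powi (\<Sum>i\<in>I. f i) = (\<Prod>i\<in>I. c powi f i)"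
 by (induction I rule: infinite_finite_induct) (auto simp: power_int_add)

lemma mono_act: "c ~= 0 ==> mon al (act w c x) = c powi wt w al * mon al x"
 by (simp add: mon_def act_def wt_def power_int_sum power_mult_distrib prod.distrib power_int_mult)

lemma hom_mono: "hom w (wt w al) (mon al)"
 by (simp add: hom_def mono_act)

lemma hom_span: "F : cfun.span (mon ` {al. wt w al = de}) ==> hom w de F"
proof (induction rule: cfun.span_induct_alt)
 case base then show ?case by (simp add: hom_def)
next
 case (step c m F)
 then show ?case using hom_mono by (auto simp: hom_def mono_act algebra_simps)
qed

definition root1 :: "nat => complex" where
 "root1 M = exp (2 * of_real pi * \<i> / of_nat M)"

lemma root1_nz: "root1 M ~= 0"
 by (simp add: root1_def)

text \<open>Averaging over the \<open>M\<close>-th roots of unity projects a polynomial function to its part of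
 weight \<open>de\<close>, provided that \<open>M\<close> is large.\<close>

definition average :: "nat => ('k => int) => int => (('k => complex) => complex) => ('k => complex) => complex" where
 "average M w de F x = (\<Sum>j<M. (root1 M ^ j) powi (- de) * F (act w (root1 M ^ j) x)) / of_nat M"

text \<open>Orthogonality of the characters of the cyclic group of order \<open>M\<close>; the bound
  on \<open>b\<close> excludes its nonzero multiples of \<open>M\<close>.\<close>

lemma root1_sum:
 assumes "\<bar>b\<bar> < int M"
 shows "(\<Sum>j<M. (root1 M ^ j) powi b) = (if b = 0 then of_nat M else 0)"
proof (cases "b = 0")
 case False
 have M: "M > 0" using assms by auto
 let ?z = "root1 M powi b"
 have e: "?z = exp (of_int b * (2 * of_real pi * \<i> / of_nat M))"
  unfolding root1_def by (simp add: exp_power_int)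
 have "?z ^ M = exp (of_nat M * (of_int b * (2 * of_real pi * \<i> / of_nat M)))"
  unfolding e by (rule exp_of_nat_mult[symmetric])
 also have "of_nat M * (of_int b * (2 * of_real pi * \<i> / of_nat M)) = 2 * of_int b * of_real pi * \<i>"
  using M by simp
 also have "exp (2 * of_int b * of_real pi * \<i>) = 1"
  by (subst exp_eq_1) (auto intro: exI[of _ b])
 finally have 1: "?z ^ M = 1" .
 have 2: "?z ~= 1"
 proof
  assume "?z = 1"
  then obtain n :: int where "Im (of_int b * (2 * of_real pi * \<i> / of_nat M)) = of_int (2 * n) * pi"
   unfolding e exp_eq_1 by auto
  then have "real_of_int b / real M * (2 * pi) = real_of_int n * (2 * pi)"
   by (simp add: mult_ac)
  then have "real_of_int b / real M = real_of_int n"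
   by (metis mult_cancel_right pi_neq_zero mult_eq_0_iff zero_neq_numeral)
  then have "real_of_int b = real_of_int (n * int M)"
   using M by (simp add: field_simps)
  then have bn: "b = n * int M" by linarith
  then have "n ~= 0" using False by auto
  then have "1 * int M <= \<bar>n\<bar> * int M" by (intro mult_right_mono) auto
  then have "int M <= \<bar>b\<bar>" by (simp add: bn abs_mult)
  then show False using assms by simp
 qed
 have "(\<Sum>j<M. (root1 M ^ j) powi b) = (\<Sum>j<M. ?z ^ j)"
  by (intro sum.cong refl) (metis mult.commute power_int_mult power_int_of_nat)
 also have "\<dots> = 0" using 1 2 by (simp add: sum_gp_strict)
 finally show ?thesis using False by simp
qed simp

text \<open>\<open>M\<close> exceeds all differences of weights, so no other weight is congruent to
  \<open>de\<close> modulo \<open>M\<close>.\<close>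

lemma average_sum_mono:
 assumes A: "finite A" and M: "!!al. al : A ==> \<bar>wt w al - de\<bar> < int M" and M0: "M > 0"
 shows "average M w de (%x. \<Sum>al\<in>A. r al * mon al x) = (%x. \<Sum>al\<in>{al:A. wt w al = de}. r al * mon al x)"
proof
 fix x
 have "average M w de (%x. \<Sum>al\<in>A. r al * mon al x) x
  = (\<Sum>j<M. \<Sum>al\<in>A. (r al * mon al x) * (root1 M ^ j) powi (wt w al - de)) / of_nat M"
  unfolding average_def
  by (simp add: sum_distrib_left mono_act root1_nz power_int_diff power_int_minus field_simps)
 also have "\<dots> = (\<Sum>al\<in>A. (r al * mon al x) * (\<Sum>j<M. (root1 M ^ j) powi (wt w al - de))) / of_nat M"
  by (subst sum.swap) (simp add: sum_distrib_left)
 also have "(\<Sum>al\<in>A. (r al * mon al x) * (\<Sum>j<M. (root1 M ^ j) powi (wt w al - de)))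
   = (\<Sum>al\<in>A. if wt w al = de then (r al * mon al x) * of_nat M else 0)"
  using root1_sum M by (intro sum.cong) auto
 also have "\<dots> = (\<Sum>al\<in>{al:A. wt w al = de}. (r al * mon al x) * of_nat M)"
  using A by (simp add: sum.inter_filter)
 also have "\<dots> / of_nat M = (\<Sum>al\<in>{al:A. wt w al = de}. r al * mon al x)"
  using M0 by (simp flip: sum_distrib_right)
 finally show "average M w de (%x. \<Sum>al\<in>A. r al * mon al x) x = \<dots>" .
qed

text \<open>All large \<open>M\<close> work, so finitely many functions can be averaged with one
  common \<open>M\<close>.\<close>

lemma average_span:
 assumes "F : cfun.span (mon ` B)"
 shows "EX M0. ALL M>=M0. average M w de F : cfun.span (mon ` {al:B. wt w al = de})"
proof -
 obtain A r where A: "finite A" "A <= B" "F = (%x. \<Sum>al\<in>A. r al * mon al x)"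
  using span_monoE[OF assms] .
 define M0 where "M0 = nat (\<Sum>al\<in>A. \<bar>wt w al - de\<bar>) + 1"
 have "average M w de F : cfun.span (mon ` {al:B. wt w al = de})" if M: "M >= M0" for M
 proof -
  have "\<bar>wt w al - de\<bar> < int M" if "al : A" for al
  proof -
   have "\<bar>wt w al - de\<bar> <= (\<Sum>al\<in>A. \<bar>wt w al - de\<bar>)"
    using A(1) that by (intro member_le_sum) auto
   then show ?thesis using M by (simp add: M0_def)
  qed
  then have "average M w de F = (%x. \<Sum>al\<in>{al:A. wt w al = de}. r al * mon al x)"
   unfolding A(3) using A(1) M by (intro average_sum_mono) (auto simp: M0_def)
  also have "\<dots> : cfun.span (mon ` {al:B. wt w al = de})"
   using A(2) by (intro cfun_span_sum cfun.span_base) auto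
  finally show ?thesis .
 qed
 then show ?thesis by blast
qed

lemma average_hom:
 assumes "hom w de F" "M > 0"
 shows "average M w de F = F"
proof
 fix x
 have "(root1 M ^ j) powi (- de) * F (act w (root1 M ^ j) x) = F x" for j
  using homD[OF assms(1), of "root1 M ^ j"] by (simp add: root1_nz power_int_minus)
 then show "average M w de F x = F x"
  using assms(2) by (simp add: average_def)
qed

text \<open>Averaging is linear over homogeneous factors: homogeneous denominators can be cleared
  before the numerators are projected.\<close>

lemma average_mult:
 assumes "hom w ga G"
 shows "average M w (de + ga) (%x. F x * G x) = (%x. average M w de F x * G x)"
proof
 fix x
 have "z powi (- (de + ga)) * (F (act w z x) * G (act w z x)) = z powi (- de) * F (act w z x) * G x"
  if "z ~= 0" for z
  using that homD[OF assms(1) that] by (simp add: power_int_minus power_int_add power_int_diff field_simps)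
 then show "average M w (de + ga) (%x. F x * G x) x = average M w de F x * G x"
  unfolding average_def by (simp only: power_not_zero[OF root1_nz] not_False_eq_True sum_distrib_right times_divide_eq_left)
qed

lemma average_diff: "average M w de (%x. F x - G x) = (%x. average M w de F x - average M w de G x)"
 by (auto simp: fun_eq_iff average_def ring_distribs sum_subtractf diff_divide_distrib)

lemma span_mono_hom:
 assumes "F : cfun.span (mon ` B)" "hom w de F"
 shows "F : cfun.span (mon ` {al:B. wt w al = de})"
proof -
 obtain M0 where "!!M. M >= M0 ==> average M w de F : cfun.span (mon ` {al:B. wt w al = de})"
  using average_span[OF assms(1)] by blast
 then have "average (Suc M0) w de F : cfun.span (mon ` {al:B. wt w al = de})"
  by simp
 then show ?thesis using average_hom[OF assms(2)] by simp
qed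

text \<open>Projecting to the exponent of one variable after another isolates the term of
  \<open>bet\<close>, which is then evaluated at the point with all coordinates
  \<open>1\<close>.\<close>

lemma mono_lin_indep:
 assumes A: "finite A" and zero: "!!x. (\<Sum>al\<in>A. r al * mon al x) = 0" and bet: "bet : A"
 shows "r bet = 0"
proof -
 have "ALL x. (\<Sum>al\<in>{al:A. ALL k:K. al k = bet k}. r al * mon al x) = 0" if "finite K" for K
  using that
 proof (induction K)
  case empty
  then show ?case using zero by simp
 next
  case (insert k K)
  define w where "w = (%j. if j = k then 1 else 0 :: int)"
  have w: "wt w al = int (al k)" for al
   by (simp add: wt_def w_def if_distrib[of "%x. x * _"] cong: if_cong)
  define A' where "A' = {al:A. ALL k:K. al k = bet k}"
  define M where "M = nat (\<Sum>al\<in>A'. \<bar>wt w al - int (bet k)\<bar>) + 1"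
  have A': "finite A'" using A by (simp add: A'_def)
  have M: "\<bar>wt w al - int (bet k)\<bar> < int M" if "al : A'" for al
  proof -
   have "\<bar>wt w al - int (bet k)\<bar> <= (\<Sum>al\<in>A'. \<bar>wt w al - int (bet k)\<bar>)"
    using A' that by (intro member_le_sum) auto
   then show ?thesis by (simp add: M_def)
  qed
  have "average M w (int (bet k)) (%x. \<Sum>al\<in>A'. r al * mon al x) = (%x. 0)"
   using insert(3) by (simp add: A'_def average_def fun_eq_iff)
  moreover have "average M w (int (bet k)) (%x. \<Sum>al\<in>A'. r al * mon al x)
   = (%x. \<Sum>al\<in>{al:A'. wt w al = int (bet k)}. r al * mon al x)"
   by (rule average_sum_mono[OF A' M]) (auto simp: M_def)
  moreover have "{al:A'. wt w al = int (bet k)} = {al:A. ALL k:insert k K. al k = bet k}"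
   by (auto simp: w A'_def)
  ultimately show ?case by (metis (no_types, lifting))
 qed
 from this[of UNIV] have "(\<Sum>al\<in>{al:A. ALL k. al k = bet k}. r al * mon al (%_. 1)) = 0"
  by auto
 also have "{al:A. ALL k. al k = bet k} = {bet}" using bet by auto
 finally show ?thesis by (simp add: mon_def)
qed

section \<open>The Nullstellensatz\<close>

definition pideal :: "(('k::finite => complex) => complex) set => bool" where
 "pideal I \<longleftrightarrow> I <= PF & (%x. 0) : I & (ALL F:I. ALL G:I. (%x. F x + G x) : I) &
   (ALL F:PF. ALL G:I. (%x. F x * G x) : I)"

lemma pidealD:
 assumes "pideal I"
 shows "F : I ==> F : PF" "(%x. 0) : I" "F : I ==> G : I ==> (%x. F x + G x) : I"
  "H : PF ==> G : I ==> (%x. H x * G x) : I"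
 using assms unfolding pideal_def by auto

lemma pideal_sum: "pideal I ==> (!!i. i : A ==> F i : I) ==> (%x. \<Sum>i\<in>A. F i x) : I"
 by (induction A rule: infinite_finite_induct) (auto simp: pidealD)

lemma pideal_diff:
 assumes "pideal I" "F : I" "G : I"
 shows "(%x. F x - G x) : I"
proof -
 have "(%x. F x + (-1) * G x) : I"
  by (rule pidealD(3)[OF assms(1,2) pidealD(4)[OF assms(1) PF_const assms(3)]])
 then show ?thesis by simp
qed

definition gen_ideal :: "'i set => ('i => ('k::finite => complex) => complex) => (('k => complex) => complex) set" where
 "gen_ideal A G = {F. EX J c. finite J & J <= A & (ALL j:J. c j : PF) & F = (%x. \<Sum>j\<in>J. c j x * G j x)}"

lemma gen_idealI:
 assumes "finite J" "J <= A" "!!j. j : J ==> c j : PF" "!!x. F x = (\<Sum>j\<in>J. c j x * G j x)"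
 shows "F : gen_ideal A G"
 using assms unfolding gen_ideal_def by (auto simp: fun_eq_iff intro!: exI[of _ J] exI[of _ c])

lemma gen_idealE:
 assumes "F : gen_ideal A G"
 obtains J c where "finite J" "J <= A" "ALL j:J. c j : PF" "F = (%x. \<Sum>j\<in>J. c j x * G j x)"
 using assms unfolding gen_ideal_def mem_Collect_eq by (elim exE conjE)

lemma gen_ideal_pideal:
 fixes G :: "'i => ('k::finite => complex) => complex"
 assumes "!!i. i : A ==> G i : PF"
 shows "pideal (gen_ideal A G)"
 unfolding pideal_def
proof (intro conjI ballI subsetI)
 fix F assume "F : gen_ideal A G"
 then obtain J c where "finite J" "J <= A" "ALL j:J. c j : PF" "F = (%x. \<Sum>j\<in>J. c j x * G j x)"
  by (rule gen_idealE)
 then have "F = (%x. \<Sum>j\<in>J. c j x * G j x)" "!!j. j : J ==> c j : PF" "!!j. j : J ==> G j : PF"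
  using assms by auto
 then show "F : PF" by (auto intro!: PF_sum PF_mult)
next
 show "(%x. 0) : gen_ideal A G" by (rule gen_idealI[of "{}"]) auto
next
 fix F F' assume F: "F : gen_ideal A G" and F': "F' : gen_ideal A G"
 obtain J c where 1: "finite J" "J <= A" "ALL j:J. c j : PF" "F = (%x. \<Sum>j\<in>J. c j x * G j x)"
  using F by (rule gen_idealE)
 obtain J' c' where 2: "finite J'" "J' <= A" "ALL j:J'. c' j : PF" "F' = (%x. \<Sum>j\<in>J'. c' j x * G j x)"
  using F' by (rule gen_idealE)
 note * = 1(1,2) bspec[OF 1(3)] fun_cong[OF 1(4)] 2(1,2) bspec[OF 2(3)] fun_cong[OF 2(4)]
 define c'' where "c'' = (%j x. (if j : J then c j x else 0) + (if j : J' then c' j x else 0))"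
 have cPF: "c'' j : PF" for j
  unfolding c''_def using *(3,7) by (cases "j : J"; cases "j : J'") (auto intro: PF_intros)
 show "(%x. F x + F' x) : gen_ideal A G"
 proof (rule gen_idealI[of "J \<union> J'" _ c''])
  fix x
  have "(\<Sum>j\<in>J \<union> J'. c'' j x * G j x)
   = (\<Sum>j\<in>J \<union> J'. if j : J then c j x * G j x else 0) + (\<Sum>j\<in>J \<union> J'. if j : J' then c' j x * G j x else 0)"
   unfolding sum.distrib[symmetric] by (intro sum.cong) (auto simp: c''_def ring_distribs)
  also have "\<dots> = F x + F' x"
   using *(1,5) by (simp add: *(4,8) Int_absorb1 flip: sum.inter_restrict)
  finally show "F x + F' x = (\<Sum>j\<in>J \<union> J'. c'' j x * G j x)" by simp
 qed (use * cPF in auto)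
next
 fix H :: "('k => complex) => complex" and F assume H: "H : PF" "F : gen_ideal A G"
 from H(2) obtain J c where 1: "finite J" "J <= A" "ALL j:J. c j : PF" "F = (%x. \<Sum>j\<in>J. c j x * G j x)"
  by (rule gen_idealE)
 note * = 1(1,2) bspec[OF 1(3)] fun_cong[OF 1(4)]
 show "(%x. H x * F x) : gen_ideal A G"
  by (rule gen_idealI[of J _ "%j x. H x * c j x"])
    (use *(1-3) H(1) in \<open>auto simp: *(4) sum_distrib_left mult.assoc intro: PF_mult\<close>)
qed

text \<open>There are only countably many finite sets of exponents but uncountably many scalars
  \<open>c\<close>, so one finite set serves infinitely many \<open>r c\<close>.\<close>

lemma pigeonhole_span:
 fixes r :: "complex => ('k::finite => complex) => complex"
 assumes "!!c. r c : PF"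
 shows "EX A. finite A & infinite {c. r c : cfun.span (mon ` A)}"
proof -
 have "EX A. finite A & r c : cfun.span (mon ` A)" for c
 proof -
  have "r c : cfun.span (mon ` UNIV)" using assms PF_eq_span by auto
  then obtain A s where A: "finite A" "r c = (%x. \<Sum>al\<in>A. s al * mon al x)"
   by (rule span_monoE)
  have "r c : cfun.span (mon ` A)"
   unfolding A(2) by (intro cfun_span_sum cfun.span_base) auto
  then show ?thesis using A(1) by auto
 qed
 then obtain A where A: "!!c. finite (A c)" "!!c. r c : cfun.span (mon ` A c)" by metis
 have "countable {B :: ('k => nat) set. finite B}" by (rule countable_Collect_finite)
 moreover have "uncountable (UNIV :: complex set)" by (rule uncountable_UNIV_complex)
 moreover have "UNIV = (\<Union>B\<in>{B. finite B}. {c. A c = B})" using A(1) by auto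
 ultimately obtain B where B: "finite B" "uncountable {c. A c = B}"
  by (metis (no_types, lifting) countable_UN mem_Collect_eq)
 have "infinite {c. A c = B}" using B(2) countable_finite by blast
 moreover have "{c. A c = B} <= {c. r c : cfun.span (mon ` B)}" using A(2) by auto
 ultimately show ?thesis using B(1) infinite_super by blast
qed

text \<open>A finite-dimensional space has no infinite independent family. If \<open>r\<close>
  repeats a value, the difference of the two equal members is already a relation.\<close>

lemma infinite_span_relation:
 fixes r :: "'c => 'a => complex"
 assumes "finite W" "infinite C" "!!c. c : C ==> r c : cfun.span W"
 shows "EX D b e. finite D & D <= C & e : D & b e ~= 0 & (ALL x. (\<Sum>c\<in>D. b c * r c x) = 0)"
proof (cases "inj_on r C")
 case False
 then obtain c c' where c: "c : C" "c' : C" "c ~= c'" "r c = r c'" by (auto simp: inj_on_def)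
 then show ?thesis
  by (intro exI[of _ "{c, c'}"] exI[of _ "%d. if d = c then 1 else -1"] exI[of _ c]) auto
next
 case True
 have "cfun.dependent (r ` C)"
 proof (rule ccontr)
  assume "\<not> cfun.dependent (r ` C)"
  then have "finite (r ` C)"
   using cfun.independent_span_bound[OF assms(1), of "r ` C"] assms(3) by auto
  then show False using assms(2) finite_imageD[OF _ True] by blast
 qed
 then obtain T v b where T: "finite T" "T <= r ` C" "(\<Sum>v\<in>T. (%x. b v * v x)) = 0" "v : T" "b v ~= 0"
  unfolding cfun.dependent_explicit by auto
 obtain D where D: "finite D" "D <= C" "T = r ` D" using finite_subset_image[OF T(1,2)] by auto
 obtain e where e: "e : D" "v = r e" using T(4) D(3) by auto
 have "(\<Sum>c\<in>D. b (r c) * r c x) = 0" for x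
 proof -
  have "(\<Sum>v\<in>T. b v * v x) = 0" using fun_cong[OF T(3), of x] by (simp add: sum_fun_def')
  then show ?thesis unfolding D(3) using True D(2) by (subst (asm) sum.reindex) (auto intro: inj_on_subset)
 qed
 then show ?thesis using D(1,2) e T(5) by (intro exI[of _ D] exI[of _ "%c. b (r c)"] exI[of _ e]) auto
qed

lemma PF_poly: "F : PF ==> (%x. poly Q (F x)) : PF"
 by (induction Q) (auto intro: PF_intros)

text \<open>\<open>Q\<close> splits into linear factors over the complex numbers and each
  \<open>F - e\<close> is invertible modulo \<open>I\<close>, so the factors are removed one by one
  until a nonzero constant lies in \<open>I\<close>.\<close>

lemma pideal_root:
 assumes I: "pideal I" and F: "F : PF"
  and all: "!!e. EX a:I. EX r:PF. ALL x. a x + r x * (F x - e) = 1"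
  and Q: "Q ~= 0" "(%x. poly Q (F x)) : I"
 shows "(%x. 1) : I"
 using Q
proof (induction "degree Q" arbitrary: Q rule: less_induct)
 case less
 show ?case
 proof (cases "degree Q = 0")
  case True
  then obtain c where c: "Q = [:c:]" by (auto elim: degree_eq_zeroE)
  have "(%x. (1 / c) * poly Q (F x)) : I"
   by (rule pidealD(4)[OF I PF_const less(3)])
  then show ?thesis using c less(2) by simp
 next
  case False
  then obtain e where "poly Q e = 0"
   using fundamental_theorem_of_algebra[of Q] by (auto simp: constant_degree)
  then obtain Q' where Q': "Q = [:- e, 1:] * Q'" by (auto simp: poly_eq_0_iff_dvd dvd_def)
  obtain a r where ar: "a : I" "r : PF" "!!x. a x + r x * (F x - e) = 1" using all[of e] by blast
  have "(%x. poly Q' (F x) * a x + r x * poly Q (F x)) : I"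
   by (intro pidealD(3)[OF I] pidealD(4)[OF I] PF_poly F ar less(3))
  also have "(%x. poly Q' (F x) * a x + r x * poly Q (F x)) = (%x. poly Q' (F x))"
  proof
   fix x
   have "poly Q' (F x) * a x + r x * poly Q (F x) = poly Q' (F x) * (a x + r x * (F x - e))"
    by (simp add: Q' algebra_simps)
   then show "poly Q' (F x) * a x + r x * poly Q (F x) = poly Q' (F x)" using ar(3)[of x] by simp
  qed
  finally have "(%x. poly Q' (F x)) : I" .
  moreover have "Q' ~= 0" using Q' less(2) by auto
  moreover have "degree Q' < degree Q"
   unfolding Q' using \<open>Q' ~= 0\<close> by (subst degree_mult_eq) auto
  ultimately show ?thesis using less(1) by blast
 qed
qed

text \<open>If \<open>F - c\<close> were invertible modulo \<open>I\<close> for all \<open>c\<close>, the inverses would be uncountably many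
 elements of a space of countable dimension, and a linear relation between them yields a
 polynomial in \<open>F\<close> that lies in \<open>I\<close>.\<close>

lemma pideal_extend:
 assumes I: "pideal I" "(%x. 1) ~: I" and F: "F : PF"
 shows "EX e. ALL a:I. ALL r:PF. EX x. a x + r x * (F x - e) ~= 1"
proof (rule ccontr)
 assume "\<not> ?thesis"
 then have all: "EX a:I. EX r:PF. ALL x. a x + r x * (F x - e) = 1" for e by blast
 define P where "P = (%e a r. a : I & r : PF & (ALL x. a x + r x * (F x - e) = 1))"
 have "ALL e. EX a r. P e a r" using all unfolding P_def by blast
 then obtain a r where "!!e. P e (a e) (r e)" by metis
 then have ar: "a e : I" "r e : PF" "a e x + r e x * (F x - e) = 1" for e x
  unfolding P_def by blast+
 have "EX A. finite A & infinite {c. r c : cfun.span (mon ` A)}" by (rule pigeonhole_span[OF ar(2)])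
 then obtain A where A: "finite A" "infinite {c. r c : cfun.span (mon ` A)}" by (elim exE conjE)
 have "EX D b e. finite D & D <= {c. r c : cfun.span (mon ` A)} & e : D & b e ~= 0 & (ALL x. (\<Sum>c\<in>D. b c * r c x) = 0)"
  by (rule infinite_span_relation[OF finite_imageI[OF A(1)] A(2)]) simp
 then obtain D b e where D0: "finite D" "D <= {c. r c : cfun.span (mon ` A)}" "e : D" "b e ~= 0"
  "ALL x. (\<Sum>c\<in>D. b c * r c x) = 0" by (elim exE conjE)
 note D = D0(1,3,4) D0(5)[rule_format]
 \<comment> \<open>The numerator of the sum of the fractions \<open>b c / (z - c)\<close>. Modulo
   \<open>I\<close> the inverses of \<open>F - c\<close> are the \<open>r c\<close>, whose
   combination with coefficients \<open>b c\<close> is zero.\<close>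
 define Q where "Q = (\<Sum>c\<in>D. smult (b c) (\<Prod>d\<in>D - {c}. [:- d, 1:]))"
 have pQ: "poly Q z = (\<Sum>c\<in>D. b c * (\<Prod>d\<in>D - {c}. z - d))" for z
  by (simp add: Q_def poly_sum poly_prod)
 \<comment> \<open>At \<open>e\<close> only the summand without the factor \<open>z - e\<close>
   survives.\<close>
 have "poly Q e = (\<Sum>c\<in>D. if c = e then b e * (\<Prod>d\<in>D - {e}. e - d) else 0)"
  unfolding pQ using D(1,2) by (intro sum.cong) auto
 also have "\<dots> = b e * (\<Prod>d\<in>D - {e}. e - d)" using D by simp
 finally have "poly Q e ~= 0" using D by auto
 then have Q0: "Q ~= 0" by auto
 have "poly Q (F x) = (\<Sum>c\<in>D. (b c * (\<Prod>d\<in>D - {c}. F x - d)) * a c x)" for x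
 proof -
  have "0 = (\<Sum>c\<in>D. b c * r c x) * (\<Prod>d\<in>D. F x - d)" using D(4) by simp
  also have "\<dots> = (\<Sum>c\<in>D. b c * (\<Prod>d\<in>D - {c}. F x - d) * (r c x * (F x - c)))"
   unfolding sum_distrib_right using D(1) by (intro sum.cong) (auto simp: prod.remove)
  also have "\<dots> = (\<Sum>c\<in>D. b c * (\<Prod>d\<in>D - {c}. F x - d) * (1 - a c x))"
   using ar(3)[of _ x] by (intro sum.cong refl arg_cong2[where f="(*)"]) (simp add: eq_diff_eq add.commute)
  also have "\<dots> = poly Q (F x) - (\<Sum>c\<in>D. (b c * (\<Prod>d\<in>D - {c}. F x - d)) * a c x)"
   by (simp add: pQ right_diff_distrib sum_subtractf)
  finally show ?thesis by simp
 qed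
 moreover have "(%x. \<Sum>c\<in>D. (b c * (\<Prod>d\<in>D - {c}. F x - d)) * a c x) : I"
  by (intro pideal_sum[OF I(1)] pidealD(4)[OF I(1)] PF_intros F ar(1))
 ultimately have "(%x. poly Q (F x)) : I" by simp
 then show False using pideal_root[OF I(1) F all Q0] I(2) by blast
qed

text \<open>Adjoining \<open>x k - e\<close> for one variable at a time keeps the ideal proper by
  \<open>pideal_extend\<close>; this takes the place of a maximal ideal.\<close>

lemma pideal_point:
 fixes I :: "(('k::finite => complex) => complex) set"
 assumes I: "pideal I" "(%x. 1) ~: I" and "finite K"
 shows "EX I' c. pideal I' & (%x. 1) ~: I' & I <= I' & (ALL k:K. (%x. x k - c k) : I')"
 using assms(3)
proof (induction K)
 case empty
 then show ?case using I by (intro exI[of _ I]) auto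
next
 case (insert k K)
 then obtain I' c where I': "pideal I'" "(%x. 1) ~: I'" "I <= I'" "!!k. k : K ==> (%x. x k - c k) : I'"
  by auto
 obtain e where e: "!!a r. a : I' ==> r : PF ==> EX x. a x + r x * (x k - e) ~= 1"
  using pideal_extend[OF I'(1,2) PF_var[of k]] by blast
 define I'' where "I'' = {%x :: 'k => complex. a x + r x * (x k - e) | a r. a : I' & r : PF}"
 have mem: "F : I''" if "a : I'" "r : PF" "!!x. F x = a x + r x * (x k - e)" for F a r
  unfolding I''_def using that by blast
 have "pideal I''"
  unfolding pideal_def
 proof (intro conjI ballI subsetI)
  fix F assume "F : I''"
  then show "F : PF" using pidealD(1)[OF I'(1)] by (auto simp: I''_def intro!: PF_intros)
 next
  show "(%x. 0) : I''" by (rule mem[OF pidealD(2)[OF I'(1)] PF_const[of 0]]) simp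
 next
  fix F G assume "F : I''" "G : I''"
  then obtain a r a' r' where *: "a : I'" "r : PF" "F = (%x. a x + r x * (x k - e))"
   "a' : I'" "r' : PF" "G = (%x. a' x + r' x * (x k - e))" unfolding I''_def by blast
  show "(%x. F x + G x) : I''"
   by (rule mem[OF pidealD(3)[OF I'(1) *(1,4)] PF_add[OF *(2,5)]]) (simp add: *(3,6) algebra_simps)
 next
  fix H :: "('k => complex) => complex" and F assume H: "H : PF" "F : I''"
  then obtain a r where *: "a : I'" "r : PF" "F = (%x. a x + r x * (x k - e))" unfolding I''_def by blast
  show "(%x. H x * F x) : I''"
   by (rule mem[OF pidealD(4)[OF I'(1) H(1) *(1)] PF_mult[OF H(1) *(2)]]) (simp add: *(3) algebra_simps)
 qed
 moreover have "(%x. 1) ~: I''"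
 proof
  assume "(%x. 1) : I''"
  then obtain a r where "a : I'" "r : PF" "(%x. 1) = (%x. a x + r x * (x k - e))" unfolding I''_def by blast
  then show False using e by (metis (no_types))
 qed
 moreover have sub: "I' <= I''"
 proof
  fix F assume "F : I'" then show "F : I''" by (rule mem[OF _ PF_const[of 0]]) simp
 qed
 moreover have "(%x. x k - e) : I''" by (rule mem[OF pidealD(2)[OF I'(1)] PF_const[of 1]]) simp
 ultimately show ?case
  using I'(3,4) insert(2) by (intro exI[of _ I''] exI[of _ "c(k := e)"]) auto
qed

text \<open>Modulo a proper ideal containing all \<open>x k - c k\<close>, every polynomial equals
  its value at \<open>c\<close>. An element of \<open>I\<close> that does not vanish at
  \<open>c\<close> then puts a nonzero constant into that ideal.\<close>

theorem weak_nullstellensatz: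
 assumes I: "pideal I" and zero: "!!x. EX F:I. F x ~= 0"
 shows "(%x. 1) : I"
proof (rule ccontr)
 assume "(%x. 1) ~: I"
 then obtain I' c where I': "pideal I'" "(%x. 1) ~: I'" "I <= I'" "!!k. (%x. x k - c k) : I'"
  using pideal_point[OF I _ finite[of UNIV]] by auto
 have *: "(%x. F x - F c) : I'" if "F : PF" for F
  using that
 proof (induction rule: PF.induct)
  case (PF_const r) then show ?case using pidealD(2)[OF I'(1)] by simp
 next
  case (PF_var k) then show ?case using I'(4) by simp
 next
  case (PF_add F G)
  show ?case using pidealD(3)[OF I'(1) PF_add.IH] by (simp add: algebra_simps)
 next
  case (PF_mult F G)
  have "(%x. G x * (F x - F c) + F c * (G x - G c)) : I'"
   by (intro pidealD(3,4)[OF I'(1)] PF_mult.IH PF_mult.hyps PF.PF_const)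
  then show ?case by (simp add: algebra_simps)
 qed
 obtain F where F: "F : I" "F c ~= 0" using zero by blast
 then have "F : I'" "F : PF" using I'(3) pidealD(1)[OF I] by auto
 then have "(%x. F x - (F x - F c)) : I'" using pideal_diff[OF I'(1)] * by blast
 then have "(%x. (1 / F c) * F c) : I'" using pidealD(4)[OF I'(1) PF_const[of "1 / F c"]] by fastforce
 then show False using F(2) I'(2) by simp
qed

text \<open>Rabinowitsch's trick: with one more variable \<open>y None\<close>, the
  \<open>G i\<close> and \<open>1 - y None * g\<close> have no common zero. Substituting
  \<open>1 / g\<close> for this variable and clearing powers of \<open>g\<close> gives the
  claim.\<close>

theorem nullstellensatz:
 fixes g :: "('k::finite => complex) => complex"
 assumes G: "!!i. i : A ==> G i : PF" and g: "g : PF"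
  and zero: "!!x. g x ~= 0 ==> EX i:A. G i x ~= 0"
 shows "EX N. (%x. g x ^ N) : gen_ideal A G"
proof -
 define A' where "A' = insert None (Some ` A)"
 define G' where "G' = (%i (y :: 'k option => complex). case i of
   None => 1 - y None * g (%k. y (Some k)) | Some j => G j (%k. y (Some k)))"
 have G': "G' i : PF" if "i : A'" for i
 proof (cases i)
  case None
  have "(%y. g (%k. y (Some k))) : PF" by (rule PF_compose[OF g PF_var])
  then show ?thesis unfolding G'_def None by (auto intro!: PF_intros)
 next
  case (Some j)
  then show ?thesis using that PF_compose[OF G[of j] PF_var] by (auto simp: A'_def G'_def)
 qed
 have I: "pideal (gen_ideal A' G')" by (rule gen_ideal_pideal[OF G'])
 have gen: "G' i : gen_ideal A' G'" if "i : A'" for i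
  by (rule gen_idealI[of "{i}" _ "%_ x. 1"]) (use that in \<open>auto intro: PF_const\<close>)
 have "(%x. 1) : gen_ideal A' G'"
 proof (rule weak_nullstellensatz[OF I])
  fix y :: "'k option => complex"
  show "EX F:gen_ideal A' G'. F y ~= 0"
  proof (cases "g (%k. y (Some k)) = 0")
   case True
   then have "G' None y ~= 0" by (simp add: G'_def)
   then show ?thesis using gen[of None] by (auto simp: A'_def)
  next
   case False
   then obtain i where "i : A" "G i (%k. y (Some k)) ~= 0" using zero by blast
   then have "G' (Some i) y ~= 0" "Some i : A'" by (auto simp: G'_def A'_def)
   then show ?thesis using gen by blast
  qed
 qed
 then obtain J c where 1: "finite J" "J <= A'" "ALL j:J. c j : PF"
  "(%x. 1) = (%x. \<Sum>j\<in>J. c j x * G' j x)" by (rule gen_idealE)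
 note J = 1(1,2) bspec[OF 1(3)] fun_cong[OF 1(4)]
 define y where "y = (%x i. case i of None => 1 / g x | Some k => x k)"
 \<comment> \<open>After the substitution, a high power of \<open>g\<close> makes each coefficient
   polynomial; the claim for all large exponents permits a common one.\<close>
 have clear: "EX N. ALL n>=N. EX C:PF. ALL x. g x ~= 0 --> g x ^ n * F (y x) = C x" if "F : PF" for F
  using that
 proof (induction rule: PF.induct)
  case (PF_const r)
  have "EX C:PF. ALL x. g x ~= 0 --> g x ^ n * r = C x" for n
  proof
   show "(%x. g x ^ n * r) : PF" by (rule PF.PF_mult[OF PF_power[OF g] PF.PF_const])
  qed simp
  then show ?case by blast
 next
  case (PF_var i)
  show ?case
  proof (cases i)
   case None
   have "EX C:PF. ALL x. g x ~= 0 --> g x ^ n * y x i = C x" if "n >= 1" for n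
   proof
    show "(%x. g x ^ (n - 1)) : PF" by (rule PF_power[OF g])
   qed (use that in \<open>auto simp: y_def None power_eq_if\<close>)
   then show ?thesis by blast
  next
   case (Some k)
   have "EX C:PF. ALL x. g x ~= 0 --> g x ^ n * y x i = C x" for n
   proof
    show "(%x. g x ^ n * x k) : PF" by (rule PF.PF_mult[OF PF_power[OF g] PF.PF_var])
   qed (simp add: y_def Some)
   then show ?thesis by blast
  qed
 next
  case (PF_add F1 F2)
  then obtain N1 N2 where N: "!!n. n >= N1 ==> EX C:PF. ALL x. g x ~= 0 --> g x ^ n * F1 (y x) = C x"
   "!!n. n >= N2 ==> EX C:PF. ALL x. g x ~= 0 --> g x ^ n * F2 (y x) = C x" by metis
  have "EX C:PF. ALL x. g x ~= 0 --> g x ^ n * (F1 (y x) + F2 (y x)) = C x" if n: "n >= N1 + N2" for n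
  proof -
   obtain C1 where C1: "C1 : PF" "!!x. g x ~= 0 ==> g x ^ n * F1 (y x) = C1 x" using N(1)[of n] n by (metis le_add1 le_trans)
   obtain C2 where C2: "C2 : PF" "!!x. g x ~= 0 ==> g x ^ n * F2 (y x) = C2 x" using N(2)[of n] n by (metis le_add2 le_trans)
   show ?thesis by (intro bexI[of _ "%x. C1 x + C2 x"] PF.PF_add C1 C2) (auto simp: C1(2) C2(2) ring_distribs)
  qed
  then show ?case by blast
 next
  case (PF_mult F1 F2)
  then obtain N1 N2 where N: "!!n. n >= N1 ==> EX C:PF. ALL x. g x ~= 0 --> g x ^ n * F1 (y x) = C x"
   "!!n. n >= N2 ==> EX C:PF. ALL x. g x ~= 0 --> g x ^ n * F2 (y x) = C x" by metis
  have "EX C:PF. ALL x. g x ~= 0 --> g x ^ n * (F1 (y x) * F2 (y x)) = C x" if n: "n >= N1 + N2" for n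
  proof -
   obtain C1 where C1: "C1 : PF" "!!x. g x ~= 0 ==> g x ^ N1 * F1 (y x) = C1 x" using N(1)[of N1] by blast
   have "n - N1 >= N2" using n by simp
   from N(2)[OF this] obtain C2 where C2: "C2 : PF" "!!x. g x ~= 0 ==> g x ^ (n - N1) * F2 (y x) = C2 x" by blast
   have "g x ^ n = g x ^ N1 * g x ^ (n - N1)" for x using n by (simp flip: power_add)
   then show ?thesis
    by (intro bexI[of _ "%x. C1 x * C2 x"] PF.PF_mult C1 C2) (auto simp: C1(2)[symmetric] C2(2)[symmetric])
  qed
  then show ?case by blast
 qed
 have "EX N. ALL j:J. EX C:PF. ALL x. g x ~= 0 --> g x ^ N * c j (y x) = C x"
 proof -
  obtain N where N: "!!j n. j : J ==> n >= N j ==> EX C:PF. ALL x. g x ~= 0 --> g x ^ n * c j (y x) = C x"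
   using clear[OF J(3)] by metis
  have "N j <= (\<Sum>j\<in>J. N j)" if "j : J" for j using J(1) that by (intro member_le_sum) auto
  then show ?thesis using N by blast
 qed
 then obtain N C where C: "!!j. j : J ==> C j : PF" "!!j x. j : J ==> g x ~= 0 ==> g x ^ N * c j (y x) = C j x"
  by metis
 define J0 where "J0 = Some -` J"
 have J0: "finite J0" "J0 <= A" using J(1,2) by (auto simp: J0_def A'_def finite_vimageI)
 \<comment> \<open>The extra factor \<open>g x\<close> makes the identity true also on the zero set
   of \<open>g\<close>, where nothing can be substituted.\<close>
 have "g x ^ Suc N = (\<Sum>j\<in>J0. (g x * C (Some j) x) * G j x)" for x
 proof (cases "g x = 0")
  case False
  have "g x ^ N = g x ^ N * (\<Sum>j\<in>J. c j (y x) * G' j (y x))" by (simp flip: J(4))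
  also have "\<dots> = (\<Sum>j\<in>J. C j x * G' j (y x))"
   using C(2) False by (simp add: sum_distrib_left mult.assoc[symmetric])
  also have "\<dots> = (\<Sum>j\<in>Some ` J0. C j x * G' j (y x))"
  proof (rule sum.mono_neutral_right[OF J(1)])
   show "ALL j:J - Some ` J0. C j x * G' j (y x) = 0"
   proof
    fix j assume "j : J - Some ` J0"
    then have "j = None" by (cases j) (auto simp: J0_def)
    then show "C j x * G' j (y x) = 0" using False by (simp add: G'_def y_def)
   qed
  qed (auto simp: J0_def)
  also have "\<dots> = (\<Sum>j\<in>J0. C (Some j) x * G j x)"
   by (subst sum.reindex) (auto simp: G'_def y_def)
  finally show ?thesis by (simp add: sum_distrib_left mult.assoc)
 qed simp
 moreover have "C (Some j) : PF" if "j : J0" for j using that C(1) by (simp add: J0_def)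
 ultimately have "(%x. g x ^ Suc N) : gen_ideal A G"
  by (intro gen_idealI[OF J0, of "%j x. g x * C (Some j) x"] PF_mult g)
 then show ?thesis by blast
qed

text \<open>A partition of unity on \<open>g ~= 0\<close>. Squares of the local denominators are
  used because the local formula for \<open>ph\<close>, multiplied by one more factor
  \<open>G xi\<close>, holds also where \<open>G xi\<close> vanishes. The factor \<open>t\<close> is
  carried along unchanged; it will be a power of the exceptional equation.\<close>

lemma regular_fraction:
 assumes g: "g : PF" and loc: "!!xi. g xi ~= 0 ==> EX G:PF. EX F:PF. G xi ~= 0 &
   (ALL et. G et ~= 0 --> g et ~= 0 --> ph et * G et = t et * F et)"
 shows "EX k. EX F:PF. ALL et. g et ~= 0 --> ph et * g et ^ k = t et * F et"
proof -
 define A where "A = {xi. g xi ~= 0}"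
 obtain G F where GF: "!!xi. xi : A ==> G xi : PF" "!!xi. xi : A ==> F xi : PF" "!!xi. xi : A ==> G xi xi ~= 0"
  "!!xi et. xi : A ==> G xi et ~= 0 ==> g et ~= 0 ==> ph et * G xi et = t et * F xi et"
  using loc unfolding A_def mem_Collect_eq by metis
 have "EX N. (%x. g x ^ N) : gen_ideal A (%xi x. G xi x * G xi x)"
 proof (rule nullstellensatz[OF _ g])
  fix x assume "g x ~= 0"
  then show "EX xi:A. G xi x * G xi x ~= 0" using GF(3)[of x] by (auto simp: A_def)
 qed (intro PF_mult GF)
 then obtain N where N: "(%x. g x ^ N) : gen_ideal A (%xi x. G xi x * G xi x)" by blast
 obtain J c where 1: "finite J" "J <= A" "ALL j:J. c j : PF"
   "(%x. g x ^ N) = (%x. \<Sum>j\<in>J. c j x * (G j x * G j x))" using N by (rule gen_idealE)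
 note J = 1(1,2) bspec[OF 1(3)] fun_cong[OF 1(4)]
 have "ph et * g et ^ N = t et * (\<Sum>j\<in>J. c j et * (G j et * F j et))" if "g et ~= 0" for et
 proof -
  have "ph et * (G j et * G j et) = t et * (G j et * F j et)" if "j : J" for j
   using GF(4)[of j et] J(2) that \<open>g et ~= 0\<close> by (cases "G j et = 0") (auto simp: mult_ac)
  then have "(\<Sum>j\<in>J. c j et * (ph et * (G j et * G j et))) = (\<Sum>j\<in>J. c j et * (t et * (G j et * F j et)))"
   by (intro sum.cong refl) simp_all
  then show ?thesis by (simp add: J(4) sum_distrib_left mult_ac)
 qed
 moreover have "(%et. \<Sum>j\<in>J. c j et * (G j et * F j et)) : PF"
  using J(2,3) GF(1,2) by (intro PF_sum PF_mult) auto
 ultimately show ?thesis by (intro exI[of _ N] bexI) auto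
qed

section \<open>Cocycles of fractions\<close>

lemma PF_act: "F : PF ==> (%x. F (act w c x)) : PF"
proof -
 assume "F : PF"
 then show ?thesis
  unfolding act_def by (rule PF_compose[of F "%k x. c powi w k * x k"]) (rule PF_mult[OF PF_const PF_var])
qed

lemma hom_from_dense:
 assumes "F : PF" "G : PF" "G b ~= 0" "!!c x. c ~= 0 ==> G x ~= 0 ==> F (act w c x) = c powi de * F x"
 shows "hom w de F"
 unfolding hom_def
proof (intro allI impI)
 fix c :: complex and x assume c: "c ~= 0"
 show "F (act w c x) = c powi de * F x"
  by (rule PF_eq_dense[OF PF_act[OF assms(1)] PF_mult[OF PF_const assms(1)] assms(2,3) assms(4)[OF c]])
qed

lemma hom_cancel:
 assumes "F : PF" "g : PF" "g b ~= 0" "hom w ga g" "hom w (om + ga) (%x. F x * g x)"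
 shows "hom w om F"
proof (rule hom_from_dense[OF assms(1-3)])
 fix c :: complex and x assume c: "c ~= 0" and g: "g x ~= 0"
 have "F (act w c x) * (c powi ga * g x) = c powi om * c powi ga * (F x * g x)"
  using homD[OF assms(5) c, of x] homD[OF assms(4) c, of x] c by (simp add: power_int_add)
 then show "F (act w c x) = c powi om * F x" using c g by simp
qed

lemma uniform_denominator:
 assumes "finite A" "!!a. a : A ==> ga a : PF"
  "!!a. a : A ==> EX k. EX H:PF. ALL x. D x --> ph a x * ga a x ^ k = H x"
 shows "EX k0. ALL k>=k0. EX H. ALL a:A. H a : PF & (ALL x. D x --> ph a x * ga a x ^ k = H a x)"
proof -
 define P where "P = (%a k H. H : PF & (ALL x. D x --> ph a x * ga a x ^ k = H x))"
 have "ALL a:A. EX k H. P a k H" using assms(3) unfolding P_def by blast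
 then obtain k H where kH: "!!a. a : A ==> P a (k a) (H a)" by metis
 have "EX H. ALL a:A. H a : PF & (ALL x. D x --> ph a x * ga a x ^ K = H a x)" if K: "(\<Sum>a\<in>A. k a) <= K" for K
 proof (intro exI[of _ "%a x. H a x * ga a x ^ (K - k a)"] ballI conjI allI impI)
  fix a assume a: "a : A"
  then show "(%x. H a x * ga a x ^ (K - k a)) : PF"
   using kH[OF a] assms(2)[OF a] unfolding P_def by (intro PF_mult PF_power) auto
  fix x assume x: "D x"
  have "k a <= (\<Sum>a\<in>A. k a)" using assms(1) a by (intro member_le_sum) auto
  then have "ga a x ^ K = ga a x ^ k a * ga a x ^ (K - k a)" using K by (simp flip: power_add)
  moreover have "ph a x * ga a x ^ k a = H a x" using kH[OF a] x unfolding P_def by blast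
  ultimately show "ph a x * ga a x ^ K = H a x * ga a x ^ (K - k a)" by (metis mult.assoc)
 qed
 then show ?thesis by blast
qed

text \<open>The numerators of a cleared cocycle identity are projected to the weights that the
  identity forces, with one \<open>M\<close> for all \<open>j\<close>. The exponent sets
  \<open>B j\<close> are kept, so two gradings can be treated in succession.\<close>

lemma homogenize:
 assumes J: "finite J" and H: "!!j. j : J ==> H j : cfun.span (mon ` B j)"
  and g: "!!j. j : J ==> hom w (ga j) (g j)"
  and R: "!!i j. i : J ==> j : J ==> hom w (de + int K * ga j + int K * ga i) (R i j)"
  and eq: "!!i j x. i : J ==> j : J ==> R i j x = H j x * g i x ^ K - H i x * g j x ^ K"
 shows "EX H'. (ALL j:J. H' j : cfun.span (mon ` {al:B j. wt w al = de + int K * ga j})) &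
  (ALL i:J. ALL j:J. ALL x. R i j x = H' j x * g i x ^ K - H' i x * g j x ^ K)"
proof -
 define P where "P = (%j M. average M w (de + int K * ga j) (H j) : cfun.span (mon ` {al:B j. wt w al = de + int K * ga j}))"
 have "ALL j:J. EX M0. ALL M>=M0. P j M"
  unfolding P_def by (intro ballI average_span[OF H])
 then obtain M0 where "!!j M. j : J ==> M >= M0 j ==> P j M"
  by metis
 note M0 = this[unfolded P_def]
 define M where "M = Suc (\<Sum>j\<in>J. M0 j)"
 have MM: "M0 j <= M" if "j : J" for j
  using member_le_sum[of j J M0] J that by (simp add: M_def)
 have "R i j x = average M w (de + int K * ga j) (H j) x * g i x ^ K - average M w (de + int K * ga i) (H i) x * g j x ^ K"
  if ij: "i : J" "j : J" for i j x
 proof -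
  have Req: "R i j = (%x. H j x * g i x ^ K - H i x * g j x ^ K)" using eq[OF ij] by blast
  have "R i j = average M w (de + int K * ga j + int K * ga i) (R i j)"
   using average_hom[OF R[OF ij]] by (simp add: M_def)
  also have "\<dots> = average M w (de + int K * ga j + int K * ga i) (%x. H j x * g i x ^ K - H i x * g j x ^ K)"
   by (rule arg_cong[OF Req])
  also have "\<dots> =
    (%x. average M w (de + int K * ga j + int K * ga i) (%x. H j x * g i x ^ K) x
     - average M w (de + int K * ga i + int K * ga j) (%x. H i x * g j x ^ K) x)"
   by (simp add: average_diff add_ac)
  also have "\<dots> = (%x. average M w (de + int K * ga j) (H j) x * g i x ^ K - average M w (de + int K * ga i) (H i) x * g j x ^ K)"
   by (simp only: average_mult[OF hom_power[OF g[OF ij(1)]]] average_mult[OF hom_power[OF g[OF ij(2)]]])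
  finally show ?thesis by (rule fun_cong)
 qed
 then show ?thesis
  by (intro exI[of _ "%j. average M w (de + int K * ga j) (H j)"] conjI ballI allI M0 MM) auto
qed

text \<open>The open sets \<open>g j ~= 0\<close> cover the locus where \<open>u\<close> and some coordinate in \<open>S\<close> do not vanish.
 All identities between fractions are checked on the dense open set \<open>G ~= 0\<close>.\<close>

locale cover_setting =
 fixes J :: "'i set" and g :: "'i => ('k::finite => complex) => complex"
  and u G :: "('k => complex) => complex" and S :: "'k set"
 assumes J: "finite J" and gPF: "!!j. j : J ==> g j : PF" and uPF: "u : PF" and GPF: "G : PF"
  and Gnz: "EX x. G x ~= 0" and Gg: "!!x j. G x ~= 0 ==> j : J ==> g j x ~= 0"
  and Gu: "!!x. G x ~= 0 ==> u x ~= 0" and GS: "!!x a. G x ~= 0 ==> a : S ==> x a ~= 0"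
  and gu: "!!j. j : J ==> EX g':PF. ALL x. g j x = u x * g' x"
  and cover: "!!a x. a : S ==> u x ~= 0 ==> x a ~= 0 ==> EX j:J. g j x ~= 0"
begin

section \<open>Localised functions on a cover and Hartogs extension\<close>

lemma everywhere: "F : PF ==> F' : PF ==> (!!x. G x ~= 0 ==> F x = F' x) ==> F x = F' x"
 using PF_eq_dense[OF _ _ GPF] Gnz by blast

lemma everywhere_all: "F : PF ==> F' : PF ==> (!!x. G x ~= 0 ==> F x = F' x) ==> ALL x. F x = F' x"
 using everywhere by blast

lemma J_nonempty:
 assumes "a : S"
 obtains j where "j : J"
proof -
 obtain x where x: "G x ~= 0" using Gnz by blast
 show ?thesis using cover[OF assms Gu[OF x] GS[OF x assms]] that by blast
qed

text \<open>The localisation at \<open>g j\<close>. Only the values on the dense set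
  \<open>G ~= 0\<close> count, hence \<open>loc_cong\<close>.\<close>

definition loc :: "'i => (('k => complex) => complex) => bool" where
 "loc j ph \<longleftrightarrow> (EX k. EX H:PF. ALL x. G x ~= 0 --> ph x * g j x ^ k = H x)"

lemma locI: "H : PF ==> (!!x. G x ~= 0 ==> ph x * g j x ^ k = H x) ==> loc j ph"
 unfolding loc_def by blast

lemma loc_cong:
 assumes "loc j ph" "!!x. G x ~= 0 ==> ph x = ps x"
 shows "loc j ps"
proof -
 obtain k H where H: "H : PF" "!!x. G x ~= 0 ==> ph x * g j x ^ k = H x"
  using assms(1) unfolding loc_def by blast
 show ?thesis by (rule locI[OF H(1), of _ _ k]) (simp add: H(2) flip: assms(2))
qed

lemma loc_common:
 assumes j: "j : J" and "loc j ph" "loc j ps"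
 obtains k H1 H2 where "H1 : PF" "H2 : PF"
  "ALL x. G x ~= 0 --> ph x * g j x ^ k = H1 x" "ALL x. G x ~= 0 --> ps x * g j x ^ k = H2 x"
proof -
 have 1: "EX k. EX H:PF. ALL x. G x ~= 0 --> (if b then ph else ps) x * g j x ^ k = H x" for b
  using assms(2,3) unfolding loc_def by (cases b) simp_all
 have "EX k0. ALL k>=k0. EX H. ALL b:UNIV. H b : PF & (ALL x. G x ~= 0 --> (if b then ph else ps) x * g j x ^ k = H b x)"
  by (rule uniform_denominator[of "UNIV :: bool set" "%_. g j" "%x. G x ~= 0" "%b. if b then ph else ps"])
    (use 1 gPF[OF j] in simp_all)
 then obtain k H where H: "H b : PF & (ALL x. G x ~= 0 --> (if b then ph else ps) x * g j x ^ k = H b x)" for b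
  by blast
 show ?thesis
  by (rule that[of "H True" "H False" k]) (use H[of True] H[of False] in simp_all)
qed

lemma loc_diff:
 assumes j: "j : J" and "loc j ph" "loc j ps"
 shows "loc j (%x. ph x - ps x)"
proof -
 obtain k H1 H2 where H0: "H1 : PF" "H2 : PF"
   "ALL x. G x ~= 0 --> ph x * g j x ^ k = H1 x" "ALL x. G x ~= 0 --> ps x * g j x ^ k = H2 x" by (rule loc_common[OF assms])
  note H = H0(1,2) H0(3,4)[rule_format]
 show ?thesis
  by (rule locI[OF PF_diff[OF H(1,2)], of _ _ k]) (simp add: H(3,4) left_diff_distrib)
qed

lemma loc_PF_mult:
 assumes "F : PF" "loc j ph"
 shows "loc j (%x. F x * ph x)"
proof -
 obtain k H where H: "H : PF" "!!x. G x ~= 0 ==> ph x * g j x ^ k = H x"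
  using assms(2) unfolding loc_def by blast
 show ?thesis by (rule locI[OF PF_mult[OF assms(1) H(1)], of _ _ k]) (simp add: H(2) mult.assoc)
qed

text \<open>Division by \<open>u\<close> is possible in each localisation because \<open>u\<close>
  divides \<open>g j\<close>.\<close>

lemma loc_div_u:
 assumes j: "j : J" and "loc j ph"
 shows "loc j (%x. ph x / u x ^ m)"
proof -
 obtain k H where H: "H : PF" "!!x. G x ~= 0 ==> ph x * g j x ^ k = H x"
  using assms(2) unfolding loc_def by blast
 obtain g' where g': "g' : PF" "!!x. g j x = u x * g' x" using gu[OF j] by blast
 show ?thesis
 proof (rule locI[OF PF_mult[OF H(1) PF_power[OF g'(1)]], of _ _ "k + m" m])
  fix x assume x: "G x ~= 0"
  have "ph x / u x ^ m * g j x ^ (k + m) = ph x * g j x ^ k * (g j x ^ m / u x ^ m)"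
   by (simp add: power_add)
  also have "g j x ^ m / u x ^ m = g' x ^ m"
   using Gu[OF x] by (simp add: g'(2) power_mult_distrib)
  finally show "ph x / u x ^ m * g j x ^ (k + m) = H x * g' x ^ m" by (simp add: H(2)[OF x])
 qed
qed

text \<open>The sets \<open>g j ~= 0\<close> cover the locus where \<open>u x * x a\<close> does not
  vanish, so the Nullstellensatz puts a power of this product into the ideal of the
  \<open>k\<close>-th powers of the \<open>g j\<close>.\<close>

lemma power_combination:
 assumes a: "a : S"
 obtains N J' c where "finite J'" "J' <= J" "ALL j:J'. c j : PF"
  "ALL x. (u x * x a) ^ N = (\<Sum>j\<in>J'. c j x * g j x ^ k)"
proof -
 have "EX N. (%x. (u x * x a) ^ N) : gen_ideal J (%j x. g j x ^ k)"
 proof (rule nullstellensatz)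
  fix x assume "u x * x a ~= 0"
  then have "EX j:J. g j x ~= 0" using cover[OF a] by simp
  then show "EX j:J. g j x ^ k ~= 0" by auto
 qed (intro PF_mult PF_power PF_var uPF gPF, assumption?)+
 then obtain N where "(%x. (u x * x a) ^ N) : gen_ideal J (%j x. g j x ^ k)" by blast
 then obtain J' c where 1: "finite J'" "J' <= J" "ALL j:J'. c j : PF"
  "(%x. (u x * x a) ^ N) = (%x. \<Sum>j\<in>J'. c j x * g j x ^ k)" by (rule gen_idealE)
 show ?thesis by (rule that[OF 1(1-3) allI[OF fun_cong[OF 1(4)]]])
qed

lemma loc_clear:
 assumes a: "a : S" and ph: "!!j. j : J ==> loc j ph"
 shows "EX N. EX Ga:PF. ALL x. G x ~= 0 --> (u x * x a) ^ N * ph x = Ga x"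
proof -
 have "EX k0. ALL k>=k0. EX H. ALL j:J. H j : PF & (ALL x. G x ~= 0 --> ph x * g j x ^ k = H j x)"
  by (rule uniform_denominator[OF J gPF ph[unfolded loc_def]])
 then obtain k0 where "ALL k>=k0. EX H. ALL j:J. H j : PF & (ALL x. G x ~= 0 --> ph x * g j x ^ k = H j x)" by (elim exE)
 from this[rule_format, OF order_refl] obtain H where
  "ALL j:J. H j : PF & (ALL x. G x ~= 0 --> ph x * g j x ^ k0 = H j x)" by (elim exE)
 then have H: "j : J ==> H j : PF" "j : J ==> G x ~= 0 ==> ph x * g j x ^ k0 = H j x" for j x
  by simp_all
 obtain N J' c where c0: "finite J'" "J' <= J" "ALL j:J'. c j : PF"
  "ALL x. (u x * x a) ^ N = (\<Sum>j\<in>J'. c j x * g j x ^ k0)" by (rule power_combination[OF a])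
 note c = c0(1,2) bspec[OF c0(3)] spec[OF c0(4)]
 have "(u x * x a) ^ N * ph x = (\<Sum>j\<in>J'. c j x * H j x)" if x: "G x ~= 0" for x
  unfolding c(4) sum_distrib_right
 proof (rule sum.cong[OF refl])
  fix j assume "j : J'"
  then have "ph x * g j x ^ k0 = H j x" using H(2) c(2) x by blast
  then show "c j x * g j x ^ k0 * ph x = c j x * H j x" by (metis mult.assoc mult.commute)
 qed
 moreover have "(%x. \<Sum>j\<in>J'. c j x * H j x) : PF"
  by (intro PF_sum PF_mult c(3) H(1)) (use c(2) in auto)
 ultimately show ?thesis by (intro exI[of _ N] bexI) auto
qed

text \<open>The denominator of \<open>ph\<close> may be taken to be a power of
  \<open>u x * x a\<close>, and also a power of \<open>u x * x b\<close>. As \<open>x a\<close> and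
  \<open>x b\<close> are coprime, only a power of \<open>u\<close> remains.\<close>

lemma hartogs:
 assumes ab: "a : S" "b : S" "a ~= b" and ph: "!!j. j : J ==> loc j ph"
 shows "EX m. EX Ga:PF. ALL x. G x ~= 0 --> u x ^ m * ph x = Ga x"
proof -
 obtain Na A where A: "A : PF" "!!x. G x ~= 0 ==> (u x * x a) ^ Na * ph x = A x"
  using loc_clear[OF ab(1) ph] by blast
 obtain Nb B where B: "B : PF" "!!x. G x ~= 0 ==> (u x * x b) ^ Nb * ph x = B x"
  using loc_clear[OF ab(2) ph] by blast
 have 1: "(%x. u x ^ Nb * A x) : PF" "(%x. u x ^ Na * B x) : PF"
  by (intro PF_mult PF_power uPF A(1) B(1))+
 have ev: "ALL x. x b ^ Nb * (u x ^ Nb * A x) = x a ^ Na * (u x ^ Na * B x)"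
 proof (rule everywhere_all)
  fix x assume x: "G x ~= 0"
  show "x b ^ Nb * (u x ^ Nb * A x) = x a ^ Na * (u x ^ Na * B x)"
   unfolding A(2)[OF x, symmetric] B(2)[OF x, symmetric] by (simp add: power_mult_distrib)
 qed (intro PF_mult[OF PF_power[OF PF_var]] 1)+
 then obtain C where C: "C : PF" "!!x. u x ^ Nb * A x = x a ^ Na * C x"
  using PF_div_power[OF ab(3) 1 ev[rule_format]] by blast
 have "u x ^ (Na + Nb) * ph x = C x" if x: "G x ~= 0" for x
 proof -
  have "x a ^ Na * (u x ^ (Na + Nb) * ph x) = u x ^ Nb * A x"
   unfolding A(2)[OF x, symmetric] by (simp add: power_mult_distrib power_add)
  then show ?thesis using C(2)[of x] GS[OF x ab(1)] by simp
 qed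
 then show ?thesis by (intro exI[of _ "Na + Nb"] bexI[OF _ C(1)] allI impI)
qed

end

section \<open>Cocycles of fractions and the polynomials that annihilate their classes\<close>

locale cocycle_setting = cover_setting J g u G S
 for J :: "'i set" and g :: "'i => ('k::finite => complex) => complex" and u G S +
 fixes q :: "'i => 'i => ('k => complex) => complex"
 assumes qloc: "!!i j. i : J ==> j : J ==> EX k. EX F:PF. ALL x. G x ~= 0 --> q i j x * (g i x * g j x) ^ k = F x"
  and qcoc: "!!i j l x. i : J ==> j : J ==> l : J ==> G x ~= 0 ==> q i j x + q j l x = q i l x"
begin

text \<open>The \<open>r\<close> that annihilate the class of \<open>q\<close>; the goal is
  \<open>r = 1\<close>.\<close>

definition triv :: "(('k => complex) => complex) => bool" where
 "triv r \<longleftrightarrow> (EX h. (ALL j:J. loc j (h j)) & (ALL i:J. ALL j:J. ALL x. G x ~= 0 --> r x * q i j x = h j x - h i x))"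

lemma trivI:
 "(!!j. j : J ==> loc j (h j)) ==> (!!i j x. i : J ==> j : J ==> G x ~= 0 ==> r x * q i j x = h j x - h i x) ==> triv r"
 unfolding triv_def by blast

lemma trivE:
 assumes "triv r"
 obtains h where "ALL j:J. loc j (h j)" "ALL i:J. ALL j:J. ALL x. G x ~= 0 --> r x * q i j x = h j x - h i x"
 using assms unfolding triv_def by (elim exE conjE)

lemma q_uniform: "EX k0. ALL k>=k0. EX F. ALL i:J. ALL j:J. F i j : PF & (ALL x. G x ~= 0 --> q i j x * (g i x * g j x) ^ k = F i j x)"
proof -
 let ?P = "%k H a. H a : PF & (ALL x. G x ~= 0 --> q (fst a) (snd a) x * (g (fst a) x * g (snd a) x) ^ k = H a x)"
 have 1: "(%x. g (fst a) x * g (snd a) x) : PF" if "a : J \<times> J" for a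
  using that by (intro PF_mult gPF) (simp_all add: mem_Times_iff)
 have 2: "EX k. EX F:PF. ALL x. G x ~= 0 --> q (fst a) (snd a) x * (g (fst a) x * g (snd a) x) ^ k = F x" if "a : J \<times> J" for a
  using that by (intro qloc) (simp_all add: mem_Times_iff)
 have "EX k0. ALL k>=k0. EX H. ALL a:J \<times> J. ?P k H a"
  by (rule uniform_denominator[OF finite_cartesian_product[OF J J] 1 2])
 then obtain k0 where k0: "ALL k>=k0. EX H. ALL a:J \<times> J. ?P k H a" by (elim exE)
 show ?thesis
 proof (intro exI[of _ k0] allI impI)
  fix k assume "k0 <= k"
  from k0[THEN spec, THEN mp, OF this] obtain H where H: "ALL a:J \<times> J. ?P k H a" by (elim exE)
  show "EX F. ALL i:J. ALL j:J. F i j : PF & (ALL x. G x ~= 0 --> q i j x * (g i x * g j x) ^ k = F i j x)"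
  proof (rule exI[of _ "%i j. H (i, j)"], intro ballI)
   fix i j assume "i : J" "j : J"
   then have "(i, j) : J \<times> J" by simp
   from bspec[OF H this] show "H (i, j) : PF & (ALL x. G x ~= 0 --> q i j x * (g i x * g j x) ^ k = H (i, j) x)"
    unfolding fst_conv snd_conv .
  qed
 qed
qed

text \<open>The usual contraction with a partition of unity: if \<open>(u x * x a) ^ N\<close> is
  the sum of the \<open>c l * g l ^ k\<close>, the sums of the \<open>c l * g l ^ k * q l j\<close>
  have the required coboundary, and the factor \<open>g l ^ k\<close> removes the denominator of
  \<open>q l j\<close> at \<open>g l\<close>.\<close>

lemma triv_power:
 assumes a: "a : S"
 shows "EX m. triv (%x. (u x * x a) ^ m)"
proof -
 obtain k where "ALL k'>=k. EX F. ALL i:J. ALL j:J. F i j : PF & (ALL x. G x ~= 0 --> q i j x * (g i x * g j x) ^ k' = F i j x)"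
  using q_uniform by (elim exE)
 from this[rule_format, OF order_refl] obtain F where
  "ALL i:J. ALL j:J. F i j : PF & (ALL x. G x ~= 0 --> q i j x * (g i x * g j x) ^ k = F i j x)" by (elim exE)
 then have F: "i : J ==> j : J ==> F i j : PF"
  "i : J ==> j : J ==> G x ~= 0 ==> q i j x * (g i x * g j x) ^ k = F i j x" for i j x
  by simp_all
 obtain N J' c where c0: "finite J'" "J' <= J" "ALL j:J'. c j : PF"
  "ALL x. (u x * x a) ^ N = (\<Sum>j\<in>J'. c j x * g j x ^ k)" by (rule power_combination[OF a])
 note c = c0(1,2) bspec[OF c0(3)] spec[OF c0(4)]
 have "triv (%x. (u x * x a) ^ N)"
 proof (rule trivI[of "%j x. \<Sum>l\<in>J'. c l x * g l x ^ k * q l j x"])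
  fix j assume j: "j : J"
  show "loc j (%x. \<Sum>l\<in>J'. c l x * g l x ^ k * q l j x)"
  proof (rule locI[of "%x. \<Sum>l\<in>J'. c l x * F l j x"])
   show "(%x. \<Sum>l\<in>J'. c l x * F l j x) : PF"
    by (intro PF_sum PF_mult c(3) F(1) j) (use c(2) in auto)
   fix x assume x: "G x ~= 0"
   show "(\<Sum>l\<in>J'. c l x * g l x ^ k * q l j x) * g j x ^ k = (\<Sum>l\<in>J'. c l x * F l j x)"
    unfolding sum_distrib_right
   proof (rule sum.cong[OF refl])
    fix l assume "l : J'"
    then have "F l j x = q l j x * (g l x * g j x) ^ k" using F(2)[of l j x] c(2) j x by auto
    then show "c l x * g l x ^ k * q l j x * g j x ^ k = c l x * F l j x"
     by (simp add: power_mult_distrib)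
   qed
  qed
 next
  fix i j x assume ij: "i : J" "j : J" and x: "G x ~= 0"
  show "(u x * x a) ^ N * q i j x = (\<Sum>l\<in>J'. c l x * g l x ^ k * q l j x) - (\<Sum>l\<in>J'. c l x * g l x ^ k * q l i x)"
   unfolding c(4) sum_distrib_right sum_subtractf[symmetric]
  proof (rule sum.cong[OF refl])
   fix l assume "l : J'"
   then have "q l i x + q i j x = q l j x" using qcoc[of l i j x] c(2) ij x by auto
   then have "q i j x = q l j x - q l i x" by (simp add: eq_diff_eq add.commute)
   then show "c l x * g l x ^ k * q i j x = c l x * g l x ^ k * q l j x - c l x * g l x ^ k * q l i x"
    by (simp add: right_diff_distrib)
  qed
 qed
 then show ?thesis by blast
qed

lemma triv_mult:
 assumes "F : PF" "triv r"
 shows "triv (%x. F x * r x)"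
proof -
 obtain h where h0: "ALL j:J. loc j (h j)"
  "ALL i:J. ALL j:J. ALL x. G x ~= 0 --> r x * q i j x = h j x - h i x" by (rule trivE[OF assms(2)])
 have h: "j : J ==> loc j (h j)" "i : J ==> j : J ==> G x ~= 0 ==> r x * q i j x = h j x - h i x" for i j x
  using h0 by simp_all
 show ?thesis
  by (rule trivI[of "%j x. F x * h j x"])
    (use loc_PF_mult[OF assms(1) h(1)] h(2) in \<open>simp_all add: mult.assoc right_diff_distrib\<close>)
qed

lemma triv_div_u:
 assumes "triv (%x. u x ^ m * r x)"
 shows "triv r"
proof -
 obtain h where h0: "ALL j:J. loc j (h j)"
  "ALL i:J. ALL j:J. ALL x. G x ~= 0 --> u x ^ m * r x * q i j x = h j x - h i x" by (rule trivE[OF assms])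
 have h: "j : J ==> loc j (h j)" "i : J ==> j : J ==> G x ~= 0 ==> u x ^ m * r x * q i j x = h j x - h i x" for i j x
  using h0 by simp_all
 show ?thesis
 proof (rule trivI[of "%j x. h j x / u x ^ m"])
  fix i j x assume ij: "i : J" "j : J" "G x ~= 0"
  then have "u x ~= 0" using Gu by blast
  then show "r x * q i j x = h j x / u x ^ m - h i x / u x ^ m"
   using h(2)[OF ij] by (simp add: field_simps)
 qed (rule loc_div_u[OF _ h(1)])
qed

lemma triv_power':
 assumes a: "a : S"
 shows "EX m. triv (%x. x a ^ m)"
proof -
 obtain m where "triv (%x. (u x * x a) ^ m)" using triv_power[OF a] by blast
 then have "triv (%x. u x ^ m * x a ^ m)" by (simp add: power_mult_distrib)
 then have "triv (%x. x a ^ m)" by (rule triv_div_u)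
 then show ?thesis by blast
qed

text \<open>\<open>Ga\<close> measures the failure of \<open>x b * ha = x a * hb\<close>. If it lies
  in the ideal of \<open>x a\<close> and \<open>x b\<close>, subtracting suitable global functions
  from \<open>ha\<close> and \<open>hb\<close> restores this equation; then \<open>x a\<close>
  divides the corrected \<open>ha\<close>, and the quotients split \<open>r\<close> times the
  cocycle.\<close>

lemma triv_core:
 assumes ab: "a : S" "b : S" "a ~= b"
  and ha: "!!j. j : J ==> loc j (ha j)"
   "!!i j x. i : J ==> j : J ==> G x ~= 0 ==> x a * r x * q i j x = ha j x - ha i x"
  and hb: "!!j. j : J ==> loc j (hb j)"
  and Ga: "Ga : PF" "!!j x. j : J ==> G x ~= 0 ==> u x ^ m * (x b * ha j x - x a * hb j x) = Ga x"
   "!!x. x a = 0 ==> x b = 0 ==> Ga x = 0"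
 shows "triv r"
proof -
 \<comment> \<open>After division by \<open>x a\<close> and then by \<open>x b\<close>, the
   remainder is the restriction to \<open>x a = x b = 0\<close>, which vanishes.\<close>
 obtain B where B: "B : PF" "!!x. Ga x = Ga (x(a := 0)) + x a * B x" using PF_div[OF Ga(1)] by metis
 obtain A where A: "A : PF" "!!x. Ga (x(a := 0)) = Ga (x(b := 0, a := 0)) + x b * A x"
  using PF_div[OF PF_upd[OF Ga(1)]] by metis
 have AB: "Ga x = x b * A x + x a * B x" for x
 proof -
  have "Ga (x(b := 0, a := 0)) = 0" by (rule Ga(3)) (use ab in auto)
  then show ?thesis using B(2)[of x] A(2)[of x] by simp
 qed
 have locA: "loc j (%x. ha j x - A x / u x ^ m)" if j: "j : J" for j
  by (intro loc_diff[OF j] loc_div_u[OF j] ha(1)[OF j] locI[of A _ _ 0] A) simp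
 have locB: "loc j (%x. hb j x - (- B x) / u x ^ m)" if j: "j : J" for j
  by (intro loc_diff[OF j] loc_div_u[OF j] hb(1)[OF j] locI[of "%x. - B x" _ _ 0] PF_uminus B) simp
 have eq: "x b * (ha j x - A x / u x ^ m) = x a * (hb j x - (- B x) / u x ^ m)" if "j : J" "G x ~= 0" for j x
 proof -
  have "u x ^ m * (x b * ha j x - x a * hb j x) = x b * A x + x a * B x" using Ga(2)[OF that] AB by simp
  then have "x b * ha j x - x a * hb j x = (x b * A x + x a * B x) / u x ^ m"
   using Gu[OF that(2)] by (simp add: eq_divide_eq mult.commute)
  then show ?thesis by (simp add: algebra_simps add_divide_distrib)
 qed
 show ?thesis
 proof (rule trivI[of "%j x. (ha j x - A x / u x ^ m) / x a"])
  fix j assume j: "j : J"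
  obtain k H1 H2 where H0: "H1 : PF" "H2 : PF"
   "ALL x. G x ~= 0 --> (ha j x - A x / u x ^ m) * g j x ^ k = H1 x" "ALL x. G x ~= 0 --> (hb j x - (- B x) / u x ^ m) * g j x ^ k = H2 x" by (rule loc_common[OF j locA[OF j] locB[OF j]])
  note H = H0(1,2) H0(3,4)[rule_format]
  have ev: "ALL x. x b ^ 1 * H1 x = x a ^ 1 * H2 x"
  proof (rule everywhere_all)
   fix x assume x: "G x ~= 0"
   show "x b ^ 1 * H1 x = x a ^ 1 * H2 x"
    unfolding H(3)[OF x, symmetric] H(4)[OF x, symmetric] using eq[OF j x] by (simp add: mult.assoc[symmetric])
  qed (intro PF_mult[OF PF_power[OF PF_var]] H)+
  then obtain C where C: "C : PF" "!!x. H1 x = x a ^ 1 * C x" using PF_div_power[OF ab(3) H(1,2) ev[rule_format]] by blast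
  show "loc j (%x. (ha j x - A x / u x ^ m) / x a)"
  proof (rule locI[OF C(1)])
   fix x assume x: "G x ~= 0"
   then have "x a ~= 0" using GS ab(1) by blast
   then show "(ha j x - A x / u x ^ m) / x a * g j x ^ k = C x"
    using H(3)[OF x] C(2)[of x] by (simp add: field_simps)
  qed
 next
  fix i j x assume ij: "i : J" "j : J" "G x ~= 0"
  then have "x a ~= 0" using GS ab(1) by blast
  then show "r x * q i j x = (ha j x - A x / u x ^ m) / x a - (ha i x - A x / u x ^ m) / x a"
   using ha(2)[OF ij] by (simp add: field_simps)
 qed
qed

text \<open>In \<open>x b * ha j - x a * hb j\<close> the two multiples of \<open>q\<close> that
  express the dependence on \<open>j\<close> cancel, so this is one function for all
  \<open>j\<close>, and \<open>hartogs\<close> applies to it.\<close>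

lemma difference_glues:
 assumes ab: "a : S" "b : S" "a ~= b" and j0: "j0 : J"
  and ha: "!!j. j : J ==> loc j (ha j)"
   "!!i j x. i : J ==> j : J ==> G x ~= 0 ==> x a * r x * q i j x = ha j x - ha i x"
  and hb: "!!j. j : J ==> loc j (hb j)"
   "!!i j x. i : J ==> j : J ==> G x ~= 0 ==> x b * r x * q i j x = hb j x - hb i x"
 shows "EX m. EX Ga:PF. ALL j:J. ALL x. G x ~= 0 --> u x ^ m * (x b * ha j x - x a * hb j x) = Ga x"
proof -
 let ?ph = "%j x. x b * ha j x - x a * hb j x"
 have same: "?ph j x = ?ph j0 x" if "j : J" "G x ~= 0" for j x
 proof -
  have 1: "ha j x = ha j0 x + x a * r x * q j0 j x" "hb j x = hb j0 x + x b * r x * q j0 j x"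
   using ha(2)[OF j0 that] hb(2)[OF j0 that] by simp_all
  show ?thesis unfolding 1 by (simp add: algebra_simps)
 qed
 have "loc j (?ph j)" if j: "j : J" for j
  by (intro loc_diff[OF j] loc_PF_mult PF_var ha(1) hb(1) j)
 then have loc0: "loc j (?ph j0)" if "j : J" for j using same[OF that] that by (rule_tac loc_cong[of j "?ph j"])
 have "EX m. EX Ga:PF. ALL x. G x ~= 0 --> u x ^ m * ?ph j0 x = Ga x"
  by (rule hartogs[OF ab]) (rule loc0)
 then obtain m Ga where Ga0: "Ga : PF" "ALL x. G x ~= 0 --> u x ^ m * ?ph j0 x = Ga x"
  by (elim exE bexE)
 note Ga = Ga0(1) Ga0(2)[rule_format]
 show ?thesis
  by (intro exI[of _ m] bexI[OF _ Ga(1)] ballI allI impI) (simp add: same Ga(2))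
qed

text \<open>The third coordinate \<open>c\<close> provides members of the cover that meet
  \<open>x a = x b = 0\<close>. There \<open>ha\<close> and \<open>hb\<close> are regular, so
  \<open>Ga\<close> vanishes on a dense part of this locus; \<open>x0\<close> shows that
  \<open>u\<close> is not identically zero on it.\<close>

lemma triv_step_geometric:
 assumes ab: "a : S" "b : S" "a ~= b" and c: "c : S" "c ~= a" "c ~= b"
  and u0: "x0 a = 0" "x0 b = 0" "u x0 ~= 0"
  and ta: "triv (%x. x a * r x)" and tb: "triv (%x. x b * r x)"
 shows "triv r"
proof -
 obtain j0 where j0: "j0 : J" using J_nonempty[OF ab(1)] .
 obtain ha where ha0: "ALL j:J. loc j (ha j)"
  "ALL i:J. ALL j:J. ALL x. G x ~= 0 --> x a * r x * q i j x = ha j x - ha i x" by (rule trivE[OF ta])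
 have ha: "j : J ==> loc j (ha j)" "i : J ==> j : J ==> G x ~= 0 ==> x a * r x * q i j x = ha j x - ha i x" for i j x
  using ha0 by simp_all
 obtain hb where hb0: "ALL j:J. loc j (hb j)"
  "ALL i:J. ALL j:J. ALL x. G x ~= 0 --> x b * r x * q i j x = hb j x - hb i x" by (rule trivE[OF tb])
 have hb: "j : J ==> loc j (hb j)" "i : J ==> j : J ==> G x ~= 0 ==> x b * r x * q i j x = hb j x - hb i x" for i j x
  using hb0 by simp_all
 have "EX m. EX Ga:PF. ALL j:J. ALL x. G x ~= 0 --> u x ^ m * (x b * ha j x - x a * hb j x) = Ga x"
  by (rule difference_glues[OF ab j0, of ha r hb]) (fact ha hb)+
 then obtain m Ga where Ga0: "Ga : PF" "ALL j:J. ALL x. G x ~= 0 --> u x ^ m * (x b * ha j x - x a * hb j x) = Ga x"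
  by (elim exE bexE)
 note Ga = Ga0(1) Ga0(2)[rule_format]
 have van: "Ga x = 0" if x: "x a = 0" "x b = 0" "u x ~= 0" "x c ~= 0" for x
 proof -
  obtain j where j: "j : J" "g j x ~= 0" using cover[OF c(1) x(3,4)] by blast
  obtain k H1 H2 where H0: "H1 : PF" "H2 : PF"
   "ALL x. G x ~= 0 --> ha j x * g j x ^ k = H1 x" "ALL x. G x ~= 0 --> hb j x * g j x ^ k = H2 x" by (rule loc_common[OF j(1) ha(1)[OF j(1)] hb(1)[OF j(1)]])
  note H = H0(1,2) H0(3,4)[rule_format]
  have ev: "ALL x. Ga x * g j x ^ k = u x ^ m * (x b * H1 x - x a * H2 x)"
  proof (rule everywhere_all)
   fix x assume x: "G x ~= 0"
   show "Ga x * g j x ^ k = u x ^ m * (x b * H1 x - x a * H2 x)"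
    unfolding Ga(2)[OF j(1) x, symmetric] H(3)[OF x, symmetric] H(4)[OF x, symmetric] by (simp add: algebra_simps)
  qed (intro PF_mult PF_power PF_diff PF_var uPF gPF j(1) H Ga(1))+
  from ev[rule_format, of x] show ?thesis using x j(2) by simp
 qed
 let ?z = "%x. x(b := 0, a := 0)"
 have P1: "(%x. Ga (?z x)) : PF" and P2: "(%x. u (?z x)) : PF"
  by (intro PF_upd[OF PF_upd] Ga(1) uPF)+
 have "u (?z x0) ~= 0" using u0 by (metis fun_upd_triv)
 then obtain y where y: "u (?z y) ~= 0 & y c ~= 0"
  using PF_domain[OF P2 PF_var[of c], of x0 "%_. 1"] by auto
 have "Ga (?z x) = 0" for x
 proof (rule PF_dense[OF P1 PF_mult[OF P2 PF_var[of c]], of y])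
  show "u (?z y) * y c ~= 0" using y by simp
  fix x assume "u (?z x) * x c ~= 0"
  then show "Ga (?z x) = 0" using c ab(3) by (intro van) auto
 qed
 then have van0: "Ga x = 0" if "x a = 0" "x b = 0" for x using that by (metis fun_upd_triv)
 show ?thesis
  by (rule triv_core[OF ab, of ha r hb Ga m]) (fact ha hb Ga van0)+
qed

end

section \<open>Homogeneous cocycles\<close>

locale hom_cocycle_setting = cocycle_setting J g u G S q
 for J :: "'i set" and g :: "'i => ('k::finite => complex) => complex" and u G S q +
 fixes w :: "'k => int" and ga :: "'i => int" and de :: int
 assumes ghom: "!!j. j : J ==> hom w (ga j) (g j)"
  and Ghom: "!!c x. c ~= 0 ==> G x ~= 0 ==> G (act w c x) ~= 0"
  and qhom: "!!i j c x. i : J ==> j : J ==> c ~= 0 ==> G x ~= 0 ==> q i j (act w c x) = c powi de * q i j x"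
begin

lemma q_clear_hom:
 assumes "i : J" "j : J" "F : PF" "!!x. G x ~= 0 ==> q i j x * (g i x * g j x) ^ k = F x"
 shows "hom w (de + int k * ga j + int k * ga i) F"
proof -
 obtain b where b: "G b ~= 0" using Gnz by blast
 have h: "hom w (int k * (ga i + ga j)) (%x. (g i x * g j x) ^ k)"
  by (intro hom_power hom_mult ghom assms)
 show ?thesis
 proof (rule hom_from_dense[OF assms(3) GPF b])
  fix c :: complex and x assume c: "c ~= 0" "G x ~= 0"
  have "F (act w c x) = q i j (act w c x) * (g i (act w c x) * g j (act w c x)) ^ k"
   using assms(4)[OF Ghom[OF c]] by simp
  also have "\<dots> = c powi (de + int k * (ga i + ga j)) * (q i j x * (g i x * g j x) ^ k)"
   using qhom[OF assms(1,2) c] homD[OF h c(1), of x] c by (simp add: power_int_add)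
  finally show "F (act w c x) = c powi (de + int k * ga j + int k * ga i) * F x"
   using assms(4)[OF c(2)] by (simp add: algebra_simps)
 qed
qed

lemma triv_polynomial:
 assumes "triv r" "r : PF"
 shows "EX K F H. (ALL i:J. ALL j:J. F i j : PF & (ALL x. G x ~= 0 --> q i j x * (g i x * g j x) ^ K = F i j x)) &
  (ALL j:J. H j : PF) & (ALL i:J. ALL j:J. ALL x. r x * F i j x = H j x * g i x ^ K - H i x * g j x ^ K)"
proof -
 obtain h where h0: "ALL j:J. loc j (h j)"
  "ALL i:J. ALL j:J. ALL x. G x ~= 0 --> r x * q i j x = h j x - h i x" by (rule trivE[OF assms(1)])
 have h: "j : J ==> loc j (h j)" "i : J ==> j : J ==> G x ~= 0 ==> r x * q i j x = h j x - h i x" for i j x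
  using h0 by simp_all
 have "EX k0. ALL k>=k0. EX H. ALL j:J. H j : PF & (ALL x. G x ~= 0 --> h j x * g j x ^ k = H j x)"
  by (rule uniform_denominator[OF J gPF h(1)[unfolded loc_def]])
 then obtain k1 where k1: "ALL k>=k1. EX H. ALL j:J. H j : PF & (ALL x. G x ~= 0 --> h j x * g j x ^ k = H j x)"
  by (elim exE)
 obtain k2 where k2: "ALL k>=k2. EX F. ALL i:J. ALL j:J. F i j : PF & (ALL x. G x ~= 0 --> q i j x * (g i x * g j x) ^ k = F i j x)"
  using q_uniform by (elim exE)
 define K where "K = k1 + k2"
 have K: "k1 <= K" "k2 <= K" by (simp_all add: K_def)
 from k1[rule_format, OF K(1)] obtain H where "ALL j:J. H j : PF & (ALL x. G x ~= 0 --> h j x * g j x ^ K = H j x)"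
  by (elim exE)
 then have H: "j : J ==> H j : PF" "j : J ==> G x ~= 0 ==> h j x * g j x ^ K = H j x" for j x
  by simp_all
 from k2[rule_format, OF K(2)] obtain F where
  "ALL i:J. ALL j:J. F i j : PF & (ALL x. G x ~= 0 --> q i j x * (g i x * g j x) ^ K = F i j x)" by (elim exE)
 then have F: "i : J ==> j : J ==> F i j : PF"
  "i : J ==> j : J ==> G x ~= 0 ==> q i j x * (g i x * g j x) ^ K = F i j x" for i j x
  by simp_all
 have ev: "ALL x. r x * F i j x = H j x * g i x ^ K - H i x * g j x ^ K" if ij: "i : J" "j : J" for i j
 proof (rule everywhere_all)
  fix x assume x: "G x ~= 0"
  have "r x * F i j x = (r x * q i j x) * (g i x * g j x) ^ K" by (simp add: F(2)[OF ij x, symmetric])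
  then show "r x * F i j x = H j x * g i x ^ K - H i x * g j x ^ K"
   unfolding H(2)[OF ij(1) x, symmetric] H(2)[OF ij(2) x, symmetric] h(2)[OF ij x]
   by (simp add: power_mult_distrib algebra_simps)
 qed (intro PF_mult PF_diff PF_power gPF H F assms(2) ij)+
 then show ?thesis
  by (intro exI[of _ K] exI[of _ F] exI[of _ H] conjI ballI allI impI F H ev[THEN spec])
qed

lemma triv_homogeneous:
 assumes "triv r" "r : PF" "hom w rh r"
 shows "EX h K H. (ALL j:J. H j : PF & hom w (de + rh + int K * ga j) (H j) &
   (ALL x. G x ~= 0 --> h j x * g j x ^ K = H j x)) &
  (ALL i:J. ALL j:J. ALL x. G x ~= 0 --> r x * q i j x = h j x - h i x)"
proof -
 obtain K F H where 0: "ALL i:J. ALL j:J. F i j : PF & (ALL x. G x ~= 0 --> q i j x * (g i x * g j x) ^ K = F i j x)"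
   "ALL j:J. H j : PF" "ALL i:J. ALL j:J. ALL x. r x * F i j x = H j x * g i x ^ K - H i x * g j x ^ K"
  using triv_polynomial[OF assms(1,2)] by (elim exE conjE)
 have F: "F i j : PF" "G x ~= 0 ==> q i j x * (g i x * g j x) ^ K = F i j x" if "i : J" "j : J" for i j x
  using 0(1) that by simp_all
 have H: "j : J ==> H j : PF" "i : J ==> j : J ==> r x * F i j x = H j x * g i x ^ K - H i x * g j x ^ K" for i j x
  using 0(2,3) by simp_all
 have "EX H'. (ALL j:J. H' j : cfun.span (mon ` {al:UNIV. wt w al = (de + rh) + int K * ga j})) &
  (ALL i:J. ALL j:J. ALL x. r x * F i j x = H' j x * g i x ^ K - H' i x * g j x ^ K)"
 proof (rule homogenize[OF J _ ghom _ H(2)])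
  fix i j assume ij: "i : J" "j : J"
  have "hom w (rh + (de + int K * ga j + int K * ga i)) (%x. r x * F i j x)"
   by (rule hom_mult[OF assms(3) q_clear_hom[OF ij F(1)[OF ij] F(2)[OF ij]]])
  then show "hom w ((de + rh) + int K * ga j + int K * ga i) (%x. r x * F i j x)" by (simp add: add_ac)
 qed (use H(1) PF_eq_span in auto)
 then obtain H' where "ALL j:J. H' j : cfun.span (mon ` {al:UNIV. wt w al = (de + rh) + int K * ga j})"
  "ALL i:J. ALL j:J. ALL x. r x * F i j x = H' j x * g i x ^ K - H' i x * g j x ^ K" by (elim exE conjE)
 then have H': "j : J ==> H' j : cfun.span (mon ` {al. wt w al = (de + rh) + int K * ga j})"
  "i : J ==> j : J ==> r x * F i j x = H' j x * g i x ^ K - H' i x * g j x ^ K" for i j x by simp_all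
 show ?thesis
 proof (rule exI[of _ "%j x. H' j x / g j x ^ K"], rule exI[of _ K], rule exI[of _ H'], intro conjI ballI allI impI)
  fix j assume j: "j : J"
  show "H' j : PF" using H'(1)[OF j] span_mono_PF by blast
  show "hom w (de + rh + int K * ga j) (H' j)" by (rule hom_span[OF H'(1)[OF j]])
  fix x assume x: "G x ~= 0"
  show "H' j x / g j x ^ K * g j x ^ K = H' j x" using Gg[OF x j] by simp
 next
  fix i j x assume ij: "i : J" "j : J" and x: "G x ~= 0"
  have nz: "g i x ~= 0" "g j x ~= 0" using Gg[OF x] ij by auto
  have "r x * q i j x * (g i x * g j x) ^ K = H' j x * g i x ^ K - H' i x * g j x ^ K"
   using H'(2)[OF ij, of x] F(2)[OF ij x] by (simp add: mult.assoc)
  then show "r x * q i j x = H' j x / g j x ^ K - H' i x / g i x ^ K"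
   using nz by (simp add: field_simps power_mult_distrib)
 qed
qed

text \<open>Replaces the third coordinate: \<open>Ga\<close> has positive weight, while a monomial
  free of \<open>x a\<close> and \<open>x b\<close> has weight at most \<open>0\<close>, so each
  monomial of \<open>Ga\<close> contains one of them.\<close>

lemma triv_step_weight:
 assumes ab: "a : S" "b : S" "a ~= b" and u: "hom w 0 u"
  and r: "r : PF" "hom w rh r" and pos: "de + rh + w a + w b > 0" "!!k. k ~= a ==> k ~= b ==> w k <= 0"
  and ta: "triv (%x. x a * r x)" and tb: "triv (%x. x b * r x)"
 shows "triv r"
proof -
 obtain j0 where j0: "j0 : J" using J_nonempty[OF ab(1)] .
 obtain ha Ka Ha where 0: "ALL j:J. Ha j : PF & hom w (de + (w a + rh) + int Ka * ga j) (Ha j) &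
   (ALL x. G x ~= 0 --> ha j x * g j x ^ Ka = Ha j x)"
  "ALL i:J. ALL j:J. ALL x. G x ~= 0 --> x a * r x * q i j x = ha j x - ha i x"
  using triv_homogeneous[OF ta PF_mult[OF PF_var r(1)] hom_mult[OF hom_var r(2)]] by (elim exE conjE)
 have Ha: "j : J ==> Ha j : PF" "j : J ==> hom w (de + (w a + rh) + int Ka * ga j) (Ha j)"
  "j : J ==> G x ~= 0 ==> ha j x * g j x ^ Ka = Ha j x"
  "i : J ==> j : J ==> G x ~= 0 ==> x a * r x * q i j x = ha j x - ha i x" for i j x
  using 0 by simp_all
 obtain hb Kb Hb where 0: "ALL j:J. Hb j : PF & hom w (de + (w b + rh) + int Kb * ga j) (Hb j) &
   (ALL x. G x ~= 0 --> hb j x * g j x ^ Kb = Hb j x)"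
  "ALL i:J. ALL j:J. ALL x. G x ~= 0 --> x b * r x * q i j x = hb j x - hb i x"
  using triv_homogeneous[OF tb PF_mult[OF PF_var r(1)] hom_mult[OF hom_var r(2)]] by (elim exE conjE)
 have Hb: "j : J ==> Hb j : PF" "j : J ==> hom w (de + (w b + rh) + int Kb * ga j) (Hb j)"
  "j : J ==> G x ~= 0 ==> hb j x * g j x ^ Kb = Hb j x"
  "i : J ==> j : J ==> G x ~= 0 ==> x b * r x * q i j x = hb j x - hb i x" for i j x
  using 0 by simp_all
 have loca: "loc j (ha j)" if "j : J" for j by (rule locI[OF Ha(1)[OF that] Ha(3)[OF that]])
 have locb: "loc j (hb j)" if "j : J" for j by (rule locI[OF Hb(1)[OF that] Hb(3)[OF that]])
 have "EX m. EX Ga:PF. ALL j:J. ALL x. G x ~= 0 --> u x ^ m * (x b * ha j x - x a * hb j x) = Ga x"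
  by (rule difference_glues[OF ab j0, of ha r hb]) (fact loca locb Ha(4) Hb(4))+
 then obtain m Ga where Ga0: "Ga : PF" "ALL j:J. ALL x. G x ~= 0 --> u x ^ m * (x b * ha j x - x a * hb j x) = Ga x"
  by (elim exE bexE)
 note Ga = Ga0(1) Ga0(2)[rule_format]
 let ?om = "de + rh + w a + w b"
 let ?j = j0
 have eq: "(%x. Ga x * g ?j x ^ (Ka + Kb)) = (%x. u x ^ m * (x b * (Ha ?j x * g ?j x ^ Kb) - x a * (Hb ?j x * g ?j x ^ Ka)))"
 proof -
  have ev: "ALL x. Ga x * g ?j x ^ (Ka + Kb) = u x ^ m * (x b * (Ha ?j x * g ?j x ^ Kb) - x a * (Hb ?j x * g ?j x ^ Ka))"
  proof (rule everywhere_all)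
   fix x assume x: "G x ~= 0"
   show "Ga x * g ?j x ^ (Ka + Kb) = u x ^ m * (x b * (Ha ?j x * g ?j x ^ Kb) - x a * (Hb ?j x * g ?j x ^ Ka))"
    unfolding Ga(2)[OF j0 x, symmetric] Ha(3)[OF j0 x, symmetric] Hb(3)[OF j0 x, symmetric]
    by (simp add: algebra_simps power_add)
  qed (intro PF_mult PF_power PF_diff PF_var uPF gPF j0 Ha(1) Hb(1) Ga(1))+
  then show ?thesis by blast
 qed
 have h1: "hom w (w b + ((de + (w a + rh) + int Ka * ga ?j) + int Kb * ga ?j)) (%x. x b * (Ha ?j x * g ?j x ^ Kb))"
  by (intro hom_mult hom_var hom_power ghom Ha(2) j0)
 have h2: "hom w (w a + ((de + (w b + rh) + int Kb * ga ?j) + int Ka * ga ?j)) (%x. x a * (Hb ?j x * g ?j x ^ Ka))"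
  by (intro hom_mult hom_var hom_power ghom Hb(2) j0)
 have "hom w (?om + int (Ka + Kb) * ga ?j) (%x. x b * (Ha ?j x * g ?j x ^ Kb) - x a * (Hb ?j x * g ?j x ^ Ka))"
  by (rule hom_diff) (use h1 h2 in \<open>simp_all add: algebra_simps\<close>)
 then have "hom w (int m * 0 + (?om + int (Ka + Kb) * ga ?j)) (%x. Ga x * g ?j x ^ (Ka + Kb))"
  unfolding eq by (rule hom_mult[OF hom_power[OF u]])
 then have "hom w (?om + int (Ka + Kb) * ga ?j) (%x. Ga x * g ?j x ^ (Ka + Kb))" by simp
 moreover obtain b0 where "G b0 ~= 0" using Gnz by blast
 moreover from this have "g ?j b0 ^ (Ka + Kb) ~= 0" using Gg j0 by simp
 ultimately have homGa: "hom w ?om Ga"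
  using hom_cancel[OF Ga(1) PF_power[OF gPF[OF j0]] _ hom_power[OF ghom[OF j0]]] by blast
 have "Ga : cfun.span (mon ` UNIV)" using Ga(1) PF_eq_span by auto
 then have "Ga : cfun.span (mon ` {al:UNIV. wt w al = ?om})" by (rule span_mono_hom[OF _ homGa])
 then obtain A s where A: "finite A" "A <= {al:UNIV. wt w al = ?om}" "Ga = (%x. \<Sum>al\<in>A. s al * mon al x)"
  by (rule span_monoE)
 have van0: "Ga x = 0" if x: "x a = 0" "x b = 0" for x
  unfolding A(3)
 proof (rule sum.neutral, intro ballI)
  fix al assume "al : A"
  then have al: "wt w al > 0" using A(2) pos(1) by auto
  have "\<not> (al a = 0 & al b = 0)"
  proof
   assume z: "al a = 0 & al b = 0"
   have "w k * int (al k) <= 0" for k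
    using pos(2)[of k] z by (cases "k = a | k = b") (auto simp: mult_le_0_iff)
   then have "wt w al <= 0" unfolding wt_def by (intro sum_nonpos) auto
   then show False using al by simp
  qed
  then have "mon al x = 0" using x unfolding mon_def by auto
  then show "s al * mon al x = 0" by simp
 qed
 show ?thesis
  by (rule triv_core[OF ab, of ha r hb Ga m]) (fact loca Ha(4) locb Ga van0)+
qed

end

text \<open>Descending induction on \<open>i + j\<close>: once \<open>i + j >= 2 * m\<close>, one of
  the exponents is at least \<open>m\<close>.\<close>

lemma grid_descent:
 assumes ends: "!!i j. i >= m ==> P i j" "!!i j. j >= m ==> P i j"
  and step: "!!i j. P (Suc i) j ==> P i (Suc j) ==> P i j"
 shows "P (0::nat) (0::nat)"
proof -
 have "ALL i j. i + j + k >= 2 * m --> P i j" for k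
 proof (induction k)
  case 0
  show ?case
  proof (intro allI impI)
   fix i j assume "i + j + 0 >= 2 * m"
   then have "i >= m | j >= m" by linarith
   then show "P i j" using ends by blast
  qed
 next
  case (Suc k)
  show ?case
  proof (intro allI impI)
   fix i j assume "i + j + Suc k >= 2 * m"
   then have "P (Suc i) j" "P i (Suc j)" using Suc by auto
   then show "P i j" by (rule step)
  qed
 qed
 then show ?thesis by (metis add.left_neutral le_refl)
qed

context cocycle_setting begin

lemma triv_descent:
 assumes ab: "a : S" "b : S"
  and step: "!!i j. triv (%x. x a * (x a ^ i * x b ^ j)) ==> triv (%x. x b * (x a ^ i * x b ^ j)) ==> triv (%x. x a ^ i * x b ^ j)"
 shows "triv (%x. 1)"
proof -
 obtain ma mb where m: "triv (%x. x a ^ ma)" "triv (%x. x b ^ mb)"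
  using triv_power'[OF ab(1)] triv_power'[OF ab(2)] by blast
 let ?P = "%i j. triv (%x. x a ^ i * x b ^ j)"
 have "?P 0 0"
 proof (rule grid_descent[of "ma + mb" ?P])
  fix i j :: nat assume "ma + mb <= i"
  then have "x a ^ i * x b ^ j = x a ^ (i - ma) * x b ^ j * x a ^ ma" for x :: "'k => complex"
   by (simp add: mult.commute mult.left_commute flip: power_add)
  then show "?P i j" using triv_mult[OF PF_mult[OF PF_power[OF PF_var] PF_power[OF PF_var]] m(1)] by presburger
 next
  fix i j :: nat assume "ma + mb <= j"
  then have "x a ^ i * x b ^ j = x a ^ i * x b ^ (j - mb) * x b ^ mb" for x :: "'k => complex"
   by (simp add: mult.assoc flip: power_add)
  then show "?P i j" using triv_mult[OF PF_mult[OF PF_power[OF PF_var] PF_power[OF PF_var]] m(2)] by presburger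
 next
  fix i j assume "?P (Suc i) j" "?P i (Suc j)"
  then show "?P i j" using step by (simp add: mult.assoc mult.left_commute)
 qed
 then show ?thesis by simp
qed

lemma triv_one_geometric:
 assumes "a : S" "b : S" "a ~= b" "c : S" "c ~= a" "c ~= b" "x0 a = 0" "x0 b = 0" "u x0 ~= 0"
 shows "triv (%x. 1)"
 by (rule triv_descent[OF assms(1,2)]) (rule triv_step_geometric[OF assms])

end

lemma (in hom_cocycle_setting) triv_one_weight:
 assumes "a : S" "b : S" "a ~= b" "hom w 0 u" "de > 0" "w a >= 0" "w b >= 0" "!!k. k ~= a ==> k ~= b ==> w k <= 0"
 shows "triv (%x. 1)"
proof (rule triv_descent[OF assms(1,2)])
 fix i j assume t: "triv (%x. x a * (x a ^ i * x b ^ j))" "triv (%x. x b * (x a ^ i * x b ^ j))"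
 have h: "hom w (int i * w a + int j * w b) (%x. x a ^ i * x b ^ j)"
  by (intro hom_mult hom_power hom_var)
 have "de + (int i * w a + int j * w b) + w a + w b > 0" using assms(5-7) by (simp add: add_pos_nonneg)
 from triv_step_weight[OF assms(1-4) _ h this assms(8) t] show "triv (%x. x a ^ i * x b ^ j)"
  by (simp add: PF_mult PF_power PF_var)
qed

text \<open>\<open>homogenize\<close> is applied twice. The second projection stays within the
  exponents of the first weight, so the numerators become homogeneous for both actions.\<close>

lemma (in hom_cocycle_setting) homogeneous_splitting:
 assumes "triv (%x. 1)" and g': "!!j. j : J ==> hom w' (ga' j) (g j)"
  and G': "!!c x. c ~= 0 ==> G x ~= 0 ==> G (act w' c x) ~= 0"
  and q': "!!i j c x. i : J ==> j : J ==> c ~= 0 ==> G x ~= 0 ==> q i j (act w' c x) = c powi de' * q i j x"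
 obtains K H where
  "!!j. j : J ==> H j : cfun.span (mon ` {al. wt w al = de + int K * ga j & wt w' al = de' + int K * ga' j})"
  "!!i j x. i : J ==> j : J ==> G x ~= 0 ==> q i j x = H j x / g j x ^ K - H i x / g i x ^ K"
proof -
 interpret h': hom_cocycle_setting J g u G S q w' ga' de'
  by unfold_locales (use g' G' q' in auto)
 obtain K F H where 0: "ALL i:J. ALL j:J. F i j : PF & (ALL x. G x ~= 0 --> q i j x * (g i x * g j x) ^ K = F i j x)"
   "ALL j:J. H j : PF" "ALL i:J. ALL j:J. ALL x. 1 * F i j x = H j x * g i x ^ K - H i x * g j x ^ K"
  using triv_polynomial[OF assms(1) PF_const] by (elim exE conjE)
 have F: "F i j : PF" "G x ~= 0 ==> q i j x * (g i x * g j x) ^ K = F i j x" if "i : J" "j : J" for i j x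
  using 0(1) that by simp_all
 have H: "j : J ==> H j : PF" "i : J ==> j : J ==> 1 * F i j x = H j x * g i x ^ K - H i x * g j x ^ K" for i j x
  using 0(2,3) by simp_all
 have "EX H'. (ALL j:J. H' j : cfun.span (mon ` {al:UNIV. wt w al = de + int K * ga j})) &
  (ALL i:J. ALL j:J. ALL x. F i j x = H' j x * g i x ^ K - H' i x * g j x ^ K)"
  by (rule homogenize[OF J, of H])
    (use H ghom PF_eq_span q_clear_hom[OF _ _ F] in auto)
 then obtain H' where "ALL j:J. H' j : cfun.span (mon ` {al:UNIV. wt w al = de + int K * ga j})"
  "ALL i:J. ALL j:J. ALL x. F i j x = H' j x * g i x ^ K - H' i x * g j x ^ K" by (elim exE conjE)
 then have H': "j : J ==> H' j : cfun.span (mon ` {al:UNIV. wt w al = de + int K * ga j})"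
  "i : J ==> j : J ==> F i j x = H' j x * g i x ^ K - H' i x * g j x ^ K" for i j x by simp_all
 have "EX H''. (ALL j:J. H'' j : cfun.span (mon ` {al:{al:UNIV. wt w al = de + int K * ga j}. wt w' al = de' + int K * ga' j})) &
  (ALL i:J. ALL j:J. ALL x. F i j x = H'' j x * g i x ^ K - H'' i x * g j x ^ K)"
  by (rule homogenize[OF J H'(1) g' h'.q_clear_hom[OF _ _ F] H'(2)])
 then obtain H'' where "ALL j:J. H'' j : cfun.span (mon ` {al:{al:UNIV. wt w al = de + int K * ga j}. wt w' al = de' + int K * ga' j})"
  "ALL i:J. ALL j:J. ALL x. F i j x = H'' j x * g i x ^ K - H'' i x * g j x ^ K" by (elim exE conjE)
 then have H'': "j : J ==> H'' j : cfun.span (mon ` {al. wt w al = de + int K * ga j & wt w' al = de' + int K * ga' j})"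
  "i : J ==> j : J ==> F i j x = H'' j x * g i x ^ K - H'' i x * g j x ^ K" for i j x by simp_all
 show ?thesis
 proof (rule that[OF H''(1)])
  fix i j x assume ij: "i : J" "j : J" and x: "G x ~= 0"
  have nz: "g i x ~= 0" "g j x ~= 0" using Gg[OF x] ij by auto
  have "q i j x * (g i x * g j x) ^ K = H'' j x * g i x ^ K - H'' i x * g j x ^ K"
   using H''(2)[OF ij, of x] F(2)[OF ij x] by simp
  then show "q i j x = H'' j x / g j x ^ K - H'' i x / g i x ^ K"
   using nz by (simp add: field_simps power_mult_distrib)
 qed
qed

section \<open>The blow-up and its Zariski topology\<close>

lemma minors_nth: "minors q v $ (a, b) = q $ a * v $ b - q $ b * v $ a"
 by (simp add: minors_def)

lemma minors_smult: "minors q (c *s v) = c *s minors q v"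
 by (simp add: minors_def vec_eq_iff algebra_simps)

lemma minors_self: "minors q q = 0"
 by (simp add: minors_def vec_eq_iff)

lemma minors_eq_0_iff:
 assumes "q ~= 0"
 shows "minors q v = 0 \<longleftrightarrow> (EX c. v = c *s q)"
proof
 assume 0: "minors q v = 0"
 obtain a where a: "q $ a ~= 0" using assms by (auto simp: vec_eq_iff)
 have "q $ a * v $ b - q $ b * v $ a = 0" for b using 0 minors_nth[of q v a b] by simp
 then have "v = (v $ a / q $ a) *s q" using a by (auto simp: vec_eq_iff field_simps)
 then show "EX c. v = c *s q" by blast
next
 assume "EX c. v = c *s q"
 then show "minors q v = 0" by (auto simp: minors_smult minors_self)
qed

lemma proj_pt_eqD:
 assumes "proj_pt v = proj_pt q"
 obtains c where "c ~= 0" "v = c *s q"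
proof -
 have "v : proj_pt v" unfolding proj_pt_def by (simp, rule exI[of _ 1]) simp
 then have "v : proj_pt q" using assms by simp
 then show ?thesis using that by (auto simp: proj_pt_def)
qed

lemma proj_pt_smult:
 assumes "c ~= 0"
 shows "proj_pt (c *s q) = proj_pt q"
proof
 show "proj_pt (c *s q) <= proj_pt q"
  using assms by (auto simp: proj_pt_def vector_smult_assoc)
 show "proj_pt q <= proj_pt (c *s q)"
 proof
  fix x assume "x : proj_pt q"
  then obtain r where "x = r *s q" "r ~= 0" by (auto simp: proj_pt_def)
  then have "x = (r / c) *s (c *s q)" "r / c ~= 0" using assms by (simp_all add: vector_smult_assoc)
  then show "x : proj_pt (c *s q)" unfolding proj_pt_def by blast
 qed
qed

lemma rescale_rescale: "rescale c ga (rescale c' ga' e) = rescale (c * c') (%i. ga i * ga' i) e"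
 by (simp add: rescale_def vector_smult_assoc)

lemma rescale_one: "rescale 1 (%_. 1) e = e"
 by (simp add: rescale_def)

lemma fst_rescale [simp]: "fst (rescale c ga e) = c *s fst e"
 and snd_rescale [simp]: "snd (rescale c ga e) i = ga i *s snd e i"
 by (simp_all add: rescale_def)

lemma multiproj_ptI: "c ~= 0 ==> (!!i. ga i ~= 0) ==> rescale c ga e : multiproj_pt e"
 unfolding multiproj_pt_def by blast

lemma multiproj_ptE:
 assumes "e' : multiproj_pt e"
 obtains c ga where "c ~= 0" "ALL i. ga i ~= 0" "e' = rescale c ga e"
 using assms unfolding multiproj_pt_def mem_Collect_eq by (elim exE conjE)

lemma multiproj_pt_self: "e : multiproj_pt e"
 using multiproj_ptI[of 1 "%_. 1" e] by (simp add: rescale_one)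

lemma multiproj_pt_rescale:
 assumes "c ~= 0" "!!i. ga i ~= 0"
 shows "multiproj_pt (rescale c ga e) = multiproj_pt e"
proof
 show "multiproj_pt (rescale c ga e) <= multiproj_pt e"
 proof
  fix e' assume "e' : multiproj_pt (rescale c ga e)"
  then obtain c' ga' where "c' ~= 0" "ALL i. ga' i ~= 0" "e' = rescale c' ga' (rescale c ga e)" by (rule multiproj_ptE)
  then show "e' : multiproj_pt e" using assms by (simp add: rescale_rescale multiproj_ptI)
 qed
 show "multiproj_pt e <= multiproj_pt (rescale c ga e)"
 proof
  fix e' assume "e' : multiproj_pt e"
  then obtain c' ga' where *: "c' ~= 0" "ALL i. ga' i ~= 0" "e' = rescale c' ga' e" by (rule multiproj_ptE)
  have "e' = rescale (c' / c) (%i. ga' i / ga i) (rescale c ga e)"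
   using assms by (simp add: *(3) rescale_rescale)
  then show "e' : multiproj_pt (rescale c ga e)" using assms *(1,2) by (simp add: multiproj_ptI)
 qed
qed

lemma multiproj_pt_eq: "e' : multiproj_pt e ==> multiproj_pt e' = multiproj_pt e"
 using multiproj_pt_rescale by (metis multiproj_ptE)

lemma cone_rescale:
 assumes "e : blowup_cone p s" "c ~= 0" "!!i. ga i ~= 0"
 shows "rescale c ga e : blowup_cone p s"
proof -
 obtain v y where e: "e = (v, y)" by (cases e)
 have *: "v ~= 0" "!!i. i : {1..s} ==> y i ~= 0" "!!i. i : {1..s} ==> y i : range (minors (p i))"
  "!!i. i : {1..s} ==> EX r. minors (p i) v = r *s y i" "!!i. i ~: {1..s} ==> y i = 0"
  using assms(1) by (auto simp: e blowup_cone_def)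
 have "ga i *s y i : range (minors (p i))" if i: "i : {1..s}" for i
 proof -
  obtain w where "y i = minors (p i) w" using *(3)[OF i] by blast
  then have "ga i *s y i = minors (p i) (ga i *s w)" by (simp add: minors_smult)
  then show ?thesis by blast
 qed
 moreover have "EX r. minors (p i) (c *s v) = r *s (ga i *s y i)" if i: "i : {1..s}" for i
 proof -
  obtain r where "minors (p i) v = r *s y i" using *(4)[OF i] by blast
  then have "minors (p i) (c *s v) = (c * r / ga i) *s (ga i *s y i)"
   using assms(3) by (simp add: minors_smult vector_smult_assoc)
  then show ?thesis by blast
 qed
 ultimately show ?thesis
  using * assms(2,3) by (simp add: e blowup_cone_def rescale_def)
qed

lemma in_blowupD:
 assumes "x : blowup p s" "e : x"
 shows "e : blowup_cone p s" "x = multiproj_pt e"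
proof -
 obtain e0 where e0: "e0 : blowup_cone p s" "x = multiproj_pt e0" using assms(1) unfolding blowup_def by auto
 obtain c ga where "c ~= 0" "ALL i. ga i ~= 0" "e = rescale c ga e0"
  using assms(2) unfolding e0(2) by (rule multiproj_ptE)
 then show "e : blowup_cone p s" using cone_rescale[OF e0(1)] by blast
 show "x = multiproj_pt e" using multiproj_pt_eq assms(2) e0(2) by metis
qed

lemma multiproj_in_blowup: "e : blowup_cone p s ==> multiproj_pt e : blowup p s"
 by (simp add: blowup_def)

lemma blowup_point:
 assumes "x : blowup p s"
 obtains e where "e : x" "e : blowup_cone p s" "x = multiproj_pt e"
 using assms multiproj_pt_self unfolding blowup_def by blast

lemma in_Union_iff:
 assumes "U <= blowup p s"
 shows "e : \<Union>U \<longleftrightarrow> e : blowup_cone p s & multiproj_pt e : U"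
proof
 assume "e : \<Union>U"
 then obtain x where x: "x : U" "e : x" by blast
 then have "x : blowup p s" using assms by blast
 with x show "e : blowup_cone p s & multiproj_pt e : U" using in_blowupD[of x p s e] by simp
next
 assume "e : blowup_cone p s & multiproj_pt e : U"
 then show "e : \<Union>U" using multiproj_pt_self[of e] by blast
qed

lemma Union_blowup: "\<Union>(blowup p s) = blowup_cone p s"
 using in_Union_iff[of "blowup p s" p s] multiproj_in_blowup by blast

section \<open>Multihomogeneous polynomials and basic open sets\<close>

lemma multihomD: "F : multihom s k b ==> F (rescale c ga e) = c ^ k * (\<Prod>i\<in>{1..s}. ga i ^ b i) * F e"
 unfolding multihom_def by blast

lemma multihomI: "F : poly_funs s ==> (!!c ga e. F (rescale c ga e) = c ^ k * (\<Prod>i\<in>{1..s}. ga i ^ b i) * F e) ==> F : multihom s k b"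
 unfolding multihom_def by blast

lemma multihom_poly: "F : multihom s k b ==> F : poly_funs s"
 unfolding multihom_def by blast

lemma multihom_const: "(%e. c) : multihom s 0 (%_. 0)"
 by (rule multihomI) (auto intro: poly_funs.intros)

lemma multihom_zero: "(%e. 0) : multihom s k b"
 by (rule multihomI) (auto intro: poly_funs.intros)

lemma multihom_mult: "F : multihom s k b ==> G : multihom s l b' ==> (%e. F e * G e) : multihom s (k + l) (%i. b i + b' i)"
 by (rule multihomI) (auto simp: multihomD power_add prod.distrib multihom_poly intro: poly_funs.intros)

lemma multihom_cmult: "F : multihom s k b ==> (%e. c * F e) : multihom s k b"
 using multihom_mult[OF multihom_const] by fastforce

lemma multihom_add: "F : multihom s k b ==> G : multihom s k b ==> (%e. F e + G e) : multihom s k b"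
 by (rule multihomI) (auto simp: multihomD ring_distribs multihom_poly intro: poly_funs.intros)

lemma multihom_diff: "F : multihom s k b ==> G : multihom s k b ==> (%e. F e - G e) : multihom s k b"
 using multihom_add[OF _ multihom_cmult[of G s k b "-1"]] by simp

lemma multihom_sum: "(!!i. i : I ==> F i : multihom s k b) ==> (%e. \<Sum>i\<in>I. F i e) : multihom s k b"
 by (induction I rule: infinite_finite_induct) (auto intro: multihom_add multihom_zero)

lemma multihom_power: "F : multihom s k b ==> (%e. F e ^ n) : multihom s (n * k) (%i. n * b i)"
proof (induction n)
 case 0 show ?case using multihom_const[of 1] by simp
next
 case (Suc n)
 then show ?case using multihom_mult[of F s k b "%e. F e ^ n" "n * k" "%i. n * b i"] by simp
qed

lemma multihom_prod:
 "(!!i. i : I ==> F i : multihom s (k i) (b i)) ==> (%e. \<Prod>i\<in>I. F i e) : multihom s (\<Sum>i\<in>I. k i) (%j. \<Sum>i\<in>I. b i j)"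
proof (induction I rule: infinite_finite_induct)
 case (insert i I)
 then show ?case
  using multihom_mult[of "F i" s "k i" "b i" "%e. \<Prod>i\<in>I. F i e" "\<Sum>i\<in>I. k i" "%j. \<Sum>i\<in>I. b i j"] by simp
qed (use multihom_const[of 1] in simp_all)

lemma multihom_fst: "(%e. fst e $ a) : multihom s 1 (%_. 0)"
 by (rule multihomI) (auto intro: poly_funs.intros)

lemma multihom_snd:
 assumes "i : {1..s}"
 shows "(%e. snd e i $ ab) : multihom s 0 (%j. if j = i then 1 else 0)"
proof (rule multihomI)
 fix c ga e
 have "(\<Prod>j\<in>{1..s}. ga j ^ (if j = i then 1 else 0)) = (\<Prod>j\<in>{1..s}. if j = i then ga j else (1::complex))"
  by (intro prod.cong) auto
 also have "\<dots> = ga i" using assms by simp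
 finally show "snd (rescale c ga e) i $ ab = c ^ 0 * (\<Prod>j\<in>{1..s}. ga j ^ (if j = i then 1 else 0)) * snd e i $ ab"
  by simp
qed (use assms in \<open>auto intro: poly_funs.intros\<close>)

lemma multihom_form:
 assumes "G : cfun.span (mon ` {al. wt (%_. 1) al = int k})"
 shows "(%e. G (($) (fst e))) : multihom s k (%_. 0)"
proof -
 obtain A r where A: "finite A" "A <= {al. wt (%_. 1) al = int k}" "G = (%x. \<Sum>al\<in>A. r al * mon al x)"
  using assms by (rule span_monoE)
 have "(%e. mon al (($) (fst e))) : multihom s k (%_. 0)" if "al : A" for al
 proof -
  have "(%e. \<Prod>a\<in>UNIV. (fst e $ a) ^ al a) : multihom s (\<Sum>a\<in>UNIV. al a * 1) (%j. \<Sum>a\<in>UNIV. al a * 0)"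
   by (intro multihom_prod multihom_power multihom_fst)
  moreover have "(\<Sum>a\<in>UNIV. al a) = k"
  proof -
   have "int (\<Sum>a\<in>UNIV. al a) = int k" using A(2) that by (auto simp: wt_def)
   then show ?thesis by linarith
  qed
  ultimately show ?thesis by (simp add: mon_def)
 qed
 then show ?thesis unfolding A(3) by (intro multihom_sum multihom_cmult)
qed

definition basic_open :: "(nat => complex ^ 'm::finite) => nat => ('m coords => complex) => 'm coords set set" where
 "basic_open p s F = {x : blowup p s. ALL e:x. F e ~= 0}"

lemma basic_open_subset: "basic_open p s F <= blowup p s"
 by (auto simp: basic_open_def)

lemma in_basic_open:
 assumes "F : multihom s k b" "e : blowup_cone p s"
 shows "multiproj_pt e : basic_open p s F \<longleftrightarrow> F e ~= 0"
proof
 assume "multiproj_pt e : basic_open p s F"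
 then show "F e ~= 0" using multiproj_pt_self[of e] unfolding basic_open_def by blast
next
 assume F: "F e ~= 0"
 have "F e' ~= 0" if "e' : multiproj_pt e" for e'
 proof -
  from that obtain c ga where c: "c ~= 0" "ALL i. ga i ~= 0" "e' = rescale c ga e" by (rule multiproj_ptE)
  then show ?thesis using F by (simp add: multihomD[OF assms(1)])
 qed
 then show "multiproj_pt e : basic_open p s F"
  using assms(2) by (simp add: basic_open_def multiproj_in_blowup)
qed

lemma openin_basic: "F : multihom s k b ==> openin (zariski p s) (basic_open p s F)"
 unfolding zariski_def openin_topology_generated_by_iff basic_open_def
 by (rule generate_topology_on.Basis) blast

lemma topspace_zariski: "topspace (zariski p s) = blowup p s"
proof
 show "topspace (zariski p s) <= blowup p s"
  unfolding zariski_def topology_generated_by_topspace by blast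
 have "openin (zariski p s) (basic_open p s (%e. 1))" by (rule openin_basic[OF multihom_const])
 then have "basic_open p s (%e. 1) <= topspace (zariski p s)" by (rule openin_subset)
 then show "blowup p s <= topspace (zariski p s)" by (simp add: basic_open_def)
qed

lemma open_subset_blowup: "openin (zariski p s) W ==> W <= blowup p s"
 using openin_subset topspace_zariski by metis

text \<open>The generating sets are closed under intersection, since a product of multihomogeneous
  polynomials is multihomogeneous; hence they form a base.\<close>

lemma basic_open_nbhd:
 assumes "openin (zariski p s) W" "x : W"
 shows "EX F k b. F : multihom s k b & x : basic_open p s F & basic_open p s F <= W"
proof -
 have "generate_topology_on {{x : blowup p s. ALL e:x. F e ~= 0} | F. EX k b. F : multihom s k b} W"
  using assms(1) unfolding zariski_def openin_topology_generated_by_iff .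
 then show ?thesis using assms(2)
 proof (induction arbitrary: x rule: generate_topology_on.induct)
  case Empty then show ?case by simp
 next
  case (Int A B)
  obtain F k b where F: "F : multihom s k b" "x : basic_open p s F" "basic_open p s F <= A"
   using Int.IH(1)[of x] Int.prems by auto
  obtain G l c where G: "G : multihom s l c" "x : basic_open p s G" "basic_open p s G <= B"
   using Int.IH(2)[of x] Int.prems by auto
  have "basic_open p s (%e. F e * G e) = basic_open p s F \<inter> basic_open p s G"
   by (auto simp: basic_open_def)
  with F(2,3) G(2,3) show ?case
   by (intro exI[of _ "%e. F e * G e"] exI[of _ "k + l"] exI[of _ "%i. b i + c i"] conjI multihom_mult F(1) G(1)) auto
 next
  case (UN K)
  then obtain A where A: "A : K" "x : A" by blast
  then show ?case using UN.IH[OF A] by (meson Union_upper order_trans)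
 next
  case (Basis S)
  then obtain F k b where F: "S = basic_open p s F" "F : multihom s k b" unfolding basic_open_def by auto
  then show ?case using Basis by (intro exI[of _ F]) auto
 qed
qed

section \<open>Sections of the line bundles\<close>

lemma sec_H_pointE:
 assumes "sec_H p s d U ph" "x : U"
 obtains w kw bw F G k l b where "w : multihom s kw bw" "x : basic_open p s w" "basic_open p s w <= U"
  "F : multihom s k b" "G : multihom s l b" "int k - int l = d"
  "ALL e:\<Union>(basic_open p s w). G e ~= 0 & ph e = F e / G e"
proof -
 obtain W k l b F G where W: "openin (zariski p s) W" "x : W" "W <= U"
  "F : multihom s k b" "G : multihom s l b" "int k - int l = d" "ALL e:\<Union>W. G e ~= 0 & ph e = F e / G e"
  using assms unfolding sec_H_def by meson
 obtain w kw bw where w: "w : multihom s kw bw" "x : basic_open p s w" "basic_open p s w <= W"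
  using basic_open_nbhd[OF W(1,2)] by (elim exE conjE)
 have "ALL e:\<Union>(basic_open p s w). G e ~= 0 & ph e = F e / G e" using W(7) w(3) by blast
 then show ?thesis using that[OF w(1,2) order_trans[OF w(3) W(3)] W(4-6)] by blast
qed

lemma sec_H_fraction:
 assumes "openin (zariski p s) W" "F : multihom s k b" "G : multihom s l b" "int k - int l = d"
  "!!e. e : \<Union>W ==> G e ~= 0 & ph e = F e / G e"
 shows "sec_H p s d W ph"
 unfolding sec_H_def
proof
 fix x assume "x : W"
 then show "EX W'. openin (zariski p s) W' & x : W' & W' <= W &
   (EX k l b. EX F:multihom s k b. EX G:multihom s l b. int k - int l = d & (ALL e:\<Union>W'. G e ~= 0 & ph e = F e / G e))"
  using assms(1,4,5) by (intro exI[of _ W] conjI exI[of _ k] exI[of _ l] exI[of _ b] bexI[OF _ assms(2)] bexI[OF _ assms(3)]) auto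
qed

lemma sec_H_local:
 assumes "!!x. x : U ==> EX W. x : W & W <= U & sec_H p s d W ph"
 shows "sec_H p s d U ph"
proof -
 define Q where "Q = (%W. EX k l b. EX F:multihom s k b. EX G:multihom s l b. int k - int l = d &
   (ALL e:\<Union>W. G e ~= 0 & ph e = F e / G e))"
 have iff: "sec_H p s d U ph \<longleftrightarrow> (ALL x:U. EX W. openin (zariski p s) W & x : W & W <= U & Q W)" for U
  unfolding sec_H_def Q_def ..
 show ?thesis
  using assms unfolding iff by (meson order_trans)
qed

lemma sec_H_mono:
 assumes "sec_H p s d U ph" "openin (zariski p s) U'" "U' <= U" "!!e. e : \<Union>U' ==> ps e = ph e"
 shows "sec_H p s d U' ps"
proof (rule sec_H_local)
 fix x assume x: "x : U'"
 obtain w kw bw F G k l b where w: "w : multihom s kw bw" "x : basic_open p s w" "basic_open p s w <= U"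
  "F : multihom s k b" "G : multihom s l b" "int k - int l = d"
  "ALL e:\<Union>(basic_open p s w). G e ~= 0 & ph e = F e / G e"
  using assms(3) x by (rule_tac sec_H_pointE[OF assms(1), of x]) auto
 have "sec_H p s d (basic_open p s w \<inter> U') ps"
 proof (rule sec_H_fraction[OF openin_Int[OF openin_basic[OF w(1)] assms(2)] w(4-6)])
  fix e assume "e : \<Union>(basic_open p s w \<inter> U')"
  then have e: "e : \<Union>(basic_open p s w)" "e : \<Union>U'" by auto
  show "G e ~= 0 & ps e = F e / G e" unfolding assms(4)[OF e(2)] by (rule w(7)[THEN bspec, OF e(1)])
 qed
 then show "EX W. x : W & W <= U' & sec_H p s d W ps"
  using x w(2) by (intro exI[of _ "basic_open p s w \<inter> U'"]) auto
qed

lemma sec_H_two: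
 assumes "sec_H p s d U ph" "sec_H p s d' U ps" "x : U"
 obtains W F G k l b F' G' k' l' b' where "openin (zariski p s) W" "x : W" "W <= U"
  "F : multihom s k b" "G : multihom s l b" "int k - int l = d"
  "F' : multihom s k' b'" "G' : multihom s l' b'" "int k' - int l' = d'"
  "ALL e:\<Union>W. G e ~= 0 & ph e = F e / G e & G' e ~= 0 & ps e = F' e / G' e"
proof -
 obtain w kw bw F G k l b where w: "w : multihom s kw bw" "x : basic_open p s w" "basic_open p s w <= U"
  "F : multihom s k b" "G : multihom s l b" "int k - int l = d"
  "ALL e:\<Union>(basic_open p s w). G e ~= 0 & ph e = F e / G e"
  by (rule sec_H_pointE[OF assms(1,3)])
 obtain w' kw' bw' F' G' k' l' b' where w': "w' : multihom s kw' bw'" "x : basic_open p s w'" "basic_open p s w' <= U"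
  "F' : multihom s k' b'" "G' : multihom s l' b'" "int k' - int l' = d'"
  "ALL e:\<Union>(basic_open p s w'). G' e ~= 0 & ps e = F' e / G' e"
  by (rule sec_H_pointE[OF assms(2,3)])
 show ?thesis
 proof (rule that[of "basic_open p s w \<inter> basic_open p s w'"])
  show "openin (zariski p s) (basic_open p s w \<inter> basic_open p s w')"
   by (intro openin_Int openin_basic[OF w(1)] openin_basic[OF w'(1)])
  show "ALL e:\<Union>(basic_open p s w \<inter> basic_open p s w'). G e ~= 0 & ph e = F e / G e & G' e ~= 0 & ps e = F' e / G' e"
   using w(7) w'(7) by auto
 qed (use w(2,3) w'(2) w(4-6) w'(4-6) in auto)
qed

lemma sec_H_mult:
 assumes "sec_H p s d U ph" "sec_H p s d' U ps"
 shows "sec_H p s (d + d') U (%e. ph e * ps e)"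
proof (rule sec_H_local)
 fix x assume x: "x : U"
 obtain W F G k l b F' G' k' l' b' where W: "openin (zariski p s) W" "x : W" "W <= U"
  "F : multihom s k b" "G : multihom s l b" "int k - int l = d"
  "F' : multihom s k' b'" "G' : multihom s l' b'" "int k' - int l' = d'"
  "ALL e:\<Union>W. G e ~= 0 & ph e = F e / G e & G' e ~= 0 & ps e = F' e / G' e"
  by (rule sec_H_two[OF assms x])
 have "sec_H p s (d + d') W (%e. ph e * ps e)"
  by (rule sec_H_fraction[OF W(1) multihom_mult[OF W(4,7)] multihom_mult[OF W(5,8)]]) (use W(6,9,10) in auto)
 then show "EX W. x : W & W <= U & sec_H p s (d + d') W (%e. ph e * ps e)" using W by blast
qed

lemma sec_H_add:
 assumes "sec_H p s d U ph" "sec_H p s d U ps"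
 shows "sec_H p s d U (%e. ph e + ps e)"
proof (rule sec_H_local)
 fix x assume x: "x : U"
 obtain W F G k l b F' G' k' l' b' where W: "openin (zariski p s) W" "x : W" "W <= U"
  "F : multihom s k b" "G : multihom s l b" "int k - int l = d"
  "F' : multihom s k' b'" "G' : multihom s l' b'" "int k' - int l' = d"
  "ALL e:\<Union>W. G e ~= 0 & ph e = F e / G e & G' e ~= 0 & ps e = F' e / G' e"
  by (rule sec_H_two[OF assms x])
 have 1: "(%e. F e * G' e) : multihom s (k + l') (%i. b i + b' i)" by (rule multihom_mult[OF W(4,8)])
 have "(%e. F' e * G e) : multihom s (k' + l) (%i. b' i + b i)" by (rule multihom_mult[OF W(7,5)])
 moreover have "k' + l = k + l'" using W(6,9) by linarith
 ultimately have 2: "(%e. F' e * G e) : multihom s (k + l') (%i. b i + b' i)" by (simp add: add.commute)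
 have "sec_H p s d W (%e. ph e + ps e)"
  by (rule sec_H_fraction[OF W(1) multihom_add[OF 1 2] multihom_mult[OF W(5,8)]])
    (use W(6,9,10) in \<open>auto simp: field_simps\<close>)
 then show "EX W. x : W & W <= U & sec_H p s d W (%e. ph e + ps e)" using W by blast
qed

lemma sec_H_const:
 assumes "openin (zariski p s) U"
 shows "sec_H p s 0 U (%e. c)"
 by (rule sec_H_fraction[OF assms multihom_const[of c] multihom_const[of 1]]) auto

lemma sec_H_cmult:
 assumes "openin (zariski p s) U" "sec_H p s d U ph"
 shows "sec_H p s d U (%e. c * ph e)"
 using sec_H_mult[OF sec_H_const[OF assms(1)] assms(2)] by simp

text \<open>A negative \<open>d\<close> has to come from the denominator: a power of a coordinate
  that does not vanish near the point supplies the degree.\<close>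

lemma sec_H_zero:
 assumes "openin (zariski p s) U"
 shows "sec_H p s d U (%e. 0)"
proof (rule sec_H_local)
 fix x assume x: "x : U"
 then have "x : blowup p s" using open_subset_blowup[OF assms] by blast
 then obtain e where e: "e : blowup_cone p s" "x = multiproj_pt e" by (rule blowup_point)
 then obtain a where a: "fst e $ a ~= 0" by (auto simp: blowup_cone_def vec_eq_iff)
 let ?W = "basic_open p s (%e. fst e $ a) \<inter> U"
 have op: "openin (zariski p s) ?W" by (intro openin_Int openin_basic[OF multihom_fst] assms)
 have xW: "x : ?W" using x e a in_basic_open[OF multihom_fst, of e p s a] by simp
 have sec: "sec_H p s d ?W (%e. 0)"
 proof (rule sec_H_fraction[OF op multihom_zero[of s "nat d"], of "%e. (fst e $ a) ^ nat (- d)"])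
  show "(%e. (fst e $ a) ^ nat (- d)) : multihom s (nat (- d)) (%i. nat (- d) * 0)"
   using multihom_power[OF multihom_fst[of a s], of "nat (- d)"] by simp
 qed (auto simp: basic_open_def)
 show "EX W. x : W & W <= U & sec_H p s d W (%e. 0)"
  by (rule exI[of _ ?W], intro conjI xW sec Int_lower2)
qed

lemma sec_H_sum:
 assumes "openin (zariski p s) U" "!!k. k : I ==> sec_H p s d U (ph k)"
 shows "sec_H p s d U (%e. \<Sum>k\<in>I. ph k e)"
 using assms(2)
 by (induction I rule: infinite_finite_induct) (auto intro: sec_H_add sec_H_zero[OF assms(1)])

lemma sec_H_prod:
 assumes "openin (zariski p s) U" "!!k. k : I ==> sec_H p s 0 U (ph k)"
 shows "sec_H p s 0 U (%e. \<Prod>k\<in>I. ph k e)"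
 using assms(2)
proof (induction I rule: infinite_finite_induct)
 case (insert k I)
 then show ?case using sec_H_mult[of p s 0 U "ph k" 0 "%e. \<Prod>k\<in>I. ph k e"] by simp
qed (use sec_H_const[OF assms(1)] in simp_all)

text \<open>Numerator and denominator have the same degrees in the \<open>y i\<close>, so the
  factors \<open>ga\<close> cancel, and of the degrees in \<open>v\<close> only the difference
  \<open>d\<close> is left.\<close>

lemma sec_H_homogeneous:
 assumes "sec_H p s d U ph" "U <= blowup p s" "e : \<Union>U" "c ~= 0" "!!i. ga i ~= 0"
 shows "ph (rescale c ga e) = c powi d * ph e"
proof -
 have e: "e : blowup_cone p s" "multiproj_pt e : U" using in_Union_iff[OF assms(2)] assms(3) by auto
 obtain w kw bw F G k l b where w: "w : multihom s kw bw" "multiproj_pt e : basic_open p s w" "basic_open p s w <= U"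
  "F : multihom s k b" "G : multihom s l b" "int k - int l = d"
  "ALL e:\<Union>(basic_open p s w). G e ~= 0 & ph e = F e / G e"
  by (rule sec_H_pointE[OF assms(1) e(2)])
 have "e : \<Union>(basic_open p s w)" using w(2) multiproj_pt_self by blast
 moreover have "rescale c ga e : \<Union>(basic_open p s w)" using w(2) multiproj_ptI[OF assms(4), of ga e, OF assms(5)] by blast
 ultimately have ph: "ph e = F e / G e" "ph (rescale c ga e) = F (rescale c ga e) / G (rescale c ga e)" using w(7) by blast+
 define Ga where "Ga = (\<Prod>i\<in>{1..s}. ga i ^ b i)"
 have "Ga ~= 0" unfolding Ga_def using assms(5) by simp
 moreover have "c powi d = c ^ k / c ^ l" using assms(4) w(6) by (metis power_int_diff power_int_of_nat)
 moreover have "F (rescale c ga e) = c ^ k * Ga * F e" "G (rescale c ga e) = c ^ l * Ga * G e"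
  unfolding Ga_def by (rule multihomD[OF w(4)], rule multihomD[OF w(5)])
 ultimately show ?thesis unfolding ph by simp
qed

section \<open>Sections vanishing doubly along the exceptional divisors\<close>

abbreviation sec_2 :: "(nat => complex ^ 'm::finite) => nat => int => 'm coords set set => ('m coords => complex) => bool" where
 "sec_2 p s d \<equiv> sec_D p s d (%i. 2)"

definition sec_2_on :: "(nat => complex ^ 'm::finite) => nat => int => 'm coords set set => ('m coords => complex) => bool" where
 "sec_2_on p s d W ph \<longleftrightarrow> (EX (N::nat) ps tht. (ALL k<N. sec_H p s d W (ps k)) &
    (ALL k<N. ALL i:{1..s}. ALL j<(2::nat). sec_ideal p s i W (tht k i j)) &
    (ALL e:\<Union>W. ph e = (\<Sum>k<N. ps k e * (\<Prod>i\<in>{1..s}. \<Prod>j<(2::nat). tht k i j e))))"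

lemma sec_2_iff: "sec_2 p s d U ph \<longleftrightarrow> (ALL x:U. EX W. openin (zariski p s) W & x : W & W <= U & sec_2_on p s d W ph)"
 unfolding sec_D_def sec_2_on_def ..

lemma sec_2_pointE:
 assumes "sec_2 p s d U ph" "x : U"
 obtains W where "openin (zariski p s) W" "x : W" "W <= U" "sec_2_on p s d W ph"
 using assms unfolding sec_2_iff by blast

lemma sec_2_local:
 assumes "!!x. x : U ==> EX W. x : W & W <= U & sec_2 p s d W ph"
 shows "sec_2 p s d U ph"
 unfolding sec_2_iff
proof
 fix x assume "x : U"
 then obtain W where W: "x : W" "W <= U" "sec_2 p s d W ph" using assms by blast
 obtain W' where "openin (zariski p s) W'" "x : W'" "W' <= W" "sec_2_on p s d W' ph"
  by (rule sec_2_pointE[OF W(3,1)])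
 then show "EX W. openin (zariski p s) W & x : W & W <= U & sec_2_on p s d W ph"
  using W(2) by (intro exI[of _ W']) auto
qed

lemma sec_ideal_mono:
 assumes "sec_ideal p s i U tht" "openin (zariski p s) U'" "U' <= U"
 shows "sec_ideal p s i U' tht"
 using assms sec_H_mono[of p s 0 U tht U' tht] unfolding sec_ideal_def by blast

lemma sec_2_on_mono:
 assumes "sec_2_on p s d W ph" "openin (zariski p s) W'" "W' <= W" "!!e. e : \<Union>W' ==> ps e = ph e"
 shows "sec_2_on p s d W' ps"
proof -
 obtain N :: nat and ps' tht where *: "ALL k<N. sec_H p s d W (ps' k)"
    "ALL k<N. ALL i:{1..s}. ALL j<(2::nat). sec_ideal p s i W (tht k i j)"
    "ALL e:\<Union>W. ph e = (\<Sum>k<N. ps' k e * (\<Prod>i\<in>{1..s}. \<Prod>j<(2::nat). tht k i j e))"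
  using assms(1) unfolding sec_2_on_def by (elim exE conjE)
 show ?thesis
  unfolding sec_2_on_def
 proof (rule exI[of _ N], rule exI[of _ ps'], rule exI[of _ tht], intro conjI)
  show "ALL k<N. sec_H p s d W' (ps' k)"
   using *(1) sec_H_mono[OF _ assms(2,3)] by blast
  show "ALL k<N. ALL i:{1..s}. ALL j<(2::nat). sec_ideal p s i W' (tht k i j)"
   using *(2) sec_ideal_mono[OF _ assms(2,3)] by blast
  show "ALL e:\<Union>W'. ps e = (\<Sum>k<N. ps' k e * (\<Prod>i\<in>{1..s}. \<Prod>j<(2::nat). tht k i j e))"
   using *(3) assms(3,4) by auto
 qed
qed

lemma sec_2_of_on: "openin (zariski p s) W ==> sec_2_on p s d W ph ==> sec_2 p s d W ph"
 unfolding sec_2_iff by blast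

lemma sec_2_mono:
 assumes "sec_2 p s d U ph" "openin (zariski p s) U'" "U' <= U" "!!e. e : \<Union>U' ==> ps e = ph e"
 shows "sec_2 p s d U' ps"
proof (rule sec_2_local)
 fix x assume x: "x : U'"
 obtain W where W: "openin (zariski p s) W" "x : W" "W <= U" "sec_2_on p s d W ph"
  using x assms(3) by (rule_tac sec_2_pointE[OF assms(1), of x]) auto
 have op: "openin (zariski p s) (W \<inter> U')" by (intro openin_Int W(1) assms(2))
 have "sec_2_on p s d (W \<inter> U') ps"
  by (rule sec_2_on_mono[OF W(4) op]) (use assms(4) in auto)
 then show "EX W. x : W & W <= U' & sec_2 p s d W ps"
  using x W(2) sec_2_of_on[OF op] by (intro exI[of _ "W \<inter> U'"]) auto
qed

lemma sec_2_zero: "openin (zariski p s) U ==> sec_2 p s d U (%e. 0)"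
 by (rule sec_2_of_on) (auto simp: sec_2_on_def intro!: exI[of _ 0])

lemma sec_2_on_add:
 assumes "sec_2_on p s d W ph" "sec_2_on p s d W ps"
 shows "sec_2_on p s d W (%e. ph e + ps e)"
proof -
 obtain N :: nat and f tht where 1: "ALL k<N. sec_H p s d W (f k)"
    "ALL k<N. ALL i:{1..s}. ALL j<(2::nat). sec_ideal p s i W (tht k i j)"
    "ALL e:\<Union>W. ph e = (\<Sum>k<N. f k e * (\<Prod>i\<in>{1..s}. \<Prod>j<(2::nat). tht k i j e))"
  using assms(1) unfolding sec_2_on_def by (elim exE conjE)
 obtain N' :: nat and f' tht' where 2: "ALL k<N'. sec_H p s d W (f' k)"
    "ALL k<N'. ALL i:{1..s}. ALL j<(2::nat). sec_ideal p s i W (tht' k i j)"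
    "ALL e:\<Union>W. ps e = (\<Sum>k<N'. f' k e * (\<Prod>i\<in>{1..s}. \<Prod>j<(2::nat). tht' k i j e))"
  using assms(2) unfolding sec_2_on_def by (elim exE conjE)
 let ?f = "%k. if k < N then f k else f' (k - N)"
 let ?tht = "%k. if k < N then tht k else tht' (k - N)"
 show ?thesis
  unfolding sec_2_on_def
 proof (rule exI[of _ "N + N'"], rule exI[of _ ?f], rule exI[of _ ?tht], intro conjI)
  show "ALL k<N + N'. sec_H p s d W (?f k)" using 1(1) 2(1) by auto
  show "ALL k<N + N'. ALL i:{1..s}. ALL j<(2::nat). sec_ideal p s i W (?tht k i j)" using 1(2) 2(2) by auto
  show "ALL e:\<Union>W. ph e + ps e = (\<Sum>k<N + N'. ?f k e * (\<Prod>i\<in>{1..s}. \<Prod>j<(2::nat). ?tht k i j e))"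
  proof
   fix e assume e: "e : \<Union>W"
   let ?t = "%k. ?f k e * (\<Prod>i\<in>{1..s}. \<Prod>j<(2::nat). ?tht k i j e)"
   have "(\<Sum>k<N + N'. ?t k) = (\<Sum>k<N. ?t k) + (\<Sum>k<N'. ?t (N + k))"
    by (induction N') (simp_all add: add.assoc)
   also have "\<dots> = ph e + ps e"
    unfolding 1(3)[THEN bspec, OF e] 2(3)[THEN bspec, OF e] by simp
   finally show "ph e + ps e = (\<Sum>k<N + N'. ?t k)" by simp
  qed
 qed
qed

lemma sec_2_add:
 assumes "sec_2 p s d U ph" "sec_2 p s d U ps"
 shows "sec_2 p s d U (%e. ph e + ps e)"
proof (rule sec_2_local)
 fix x assume x: "x : U"
 obtain W where W: "openin (zariski p s) W" "x : W" "W <= U" "sec_2_on p s d W ph"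
  by (rule sec_2_pointE[OF assms(1) x])
 obtain W' where W': "openin (zariski p s) W'" "x : W'" "W' <= U" "sec_2_on p s d W' ps"
  by (rule sec_2_pointE[OF assms(2) x])
 have op: "openin (zariski p s) (W \<inter> W')" by (intro openin_Int W(1) W'(1))
 have "sec_2_on p s d (W \<inter> W') (%e. ph e + ps e)"
  by (rule sec_2_on_add[OF sec_2_on_mono[OF W(4) op] sec_2_on_mono[OF W'(4) op]]) auto
 then show "EX W. x : W & W <= U & sec_2 p s d W (%e. ph e + ps e)"
  using W W' sec_2_of_on[OF op] by (intro exI[of _ "W \<inter> W'"]) auto
qed

lemma sec_2_cmult:
 assumes "sec_2 p s d U ph"
 shows "sec_2 p s d U (%e. c * ph e)"
 unfolding sec_2_iff
proof
 fix x assume x: "x : U"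
 obtain W where W: "openin (zariski p s) W" "x : W" "W <= U" "sec_2_on p s d W ph"
  by (rule sec_2_pointE[OF assms(1) x])
 obtain N :: nat and f tht where 1: "ALL k<N. sec_H p s d W (f k)"
    "ALL k<N. ALL i:{1..s}. ALL j<(2::nat). sec_ideal p s i W (tht k i j)"
    "ALL e:\<Union>W. ph e = (\<Sum>k<N. f k e * (\<Prod>i\<in>{1..s}. \<Prod>j<(2::nat). tht k i j e))"
  using W(4) unfolding sec_2_on_def by (elim exE conjE)
 have "sec_2_on p s d W (%e. c * ph e)"
  unfolding sec_2_on_def
  by (rule exI[of _ N], rule exI[of _ "%k e. c * f k e"], rule exI[of _ tht])
    (use 1 sec_H_cmult[OF W(1)] in \<open>simp add: sum_distrib_left mult.assoc\<close>)
 then show "EX W. openin (zariski p s) W & x : W & W <= U & sec_2_on p s d W (%e. c * ph e)"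
  by (intro exI[of _ W] conjI W(1-3))
qed

lemma sec_2_diff:
 assumes "sec_2 p s d U ph" "sec_2 p s d U ps"
 shows "sec_2 p s d U (%e. ph e - ps e)"
 using sec_2_add[OF assms(1) sec_2_cmult[OF assms(2), of "-1"]] by simp

lemma sec_H_diff:
 assumes "openin (zariski p s) U" "sec_H p s d U ph" "sec_H p s d U ps"
 shows "sec_H p s d U (%e. ph e - ps e)"
 using sec_H_add[OF assms(2) sec_H_cmult[OF assms(1,3), of "-1"]] by simp

lemma sec_2_imp_sec_H:
 assumes "sec_2 p s d U ph"
 shows "sec_H p s d U ph"
proof (rule sec_H_local)
 fix x assume x: "x : U"
 obtain W where W: "openin (zariski p s) W" "x : W" "W <= U" "sec_2_on p s d W ph"
  by (rule sec_2_pointE[OF assms(1) x])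
 obtain N :: nat and f tht where 1: "ALL k<N. sec_H p s d W (f k)"
    "ALL k<N. ALL i:{1..s}. ALL j<(2::nat). sec_ideal p s i W (tht k i j)"
    "ALL e:\<Union>W. ph e = (\<Sum>k<N. f k e * (\<Prod>i\<in>{1..s}. \<Prod>j<(2::nat). tht k i j e))"
  using W(4) unfolding sec_2_on_def by (elim exE conjE)
 have "sec_H p s (d + 0) W (%e. f k e * (\<Prod>i\<in>{1..s}. \<Prod>j<(2::nat). tht k i j e))" if "k < N" for k
 proof (intro sec_H_mult sec_H_prod[OF W(1)])
  show "sec_H p s d W (f k)" using 1(1) that by simp
  fix i and j :: nat assume "i : {1..s}" "j : {..<2}"
  then show "sec_H p s 0 W (tht k i j)" using 1(2) that by (simp add: sec_ideal_def)
 qed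
 then have "sec_H p s d W (%e. \<Sum>k<N. f k e * (\<Prod>i\<in>{1..s}. \<Prod>j<(2::nat). tht k i j e))"
  by (intro sec_H_sum[OF W(1)]) simp
 then have "sec_H p s d W ph"
  by (rule sec_H_mono[OF _ W(1) order_refl 1(3)[THEN bspec]])
 then show "EX W. x : W & W <= U & sec_H p s d W ph" by (intro exI[of _ W] conjI W(2,3))
qed

text \<open>Off the exceptional divisors the constant \<open>1\<close> is a section of every ideal
  sheaf, so the product of the ideals imposes no condition.\<close>

lemma sec_2_off_exceptional:
 assumes "openin (zariski p s) U" "sec_H p s d U ph"
  "!!e i. e : \<Union>U ==> i : {1..s} ==> proj_pt (fst e) ~= proj_pt (p i)"
 shows "sec_2 p s d U ph"
proof (rule sec_2_of_on[OF assms(1)])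
 have "sec_ideal p s i U (%e. 1)" if "i : {1..s}" for i
  unfolding sec_ideal_def using assms(3)[OF _ that] by (intro conjI sec_H_const[OF assms(1)] ballI impI) simp
 then show "sec_2_on p s d U ph"
  unfolding sec_2_on_def using assms(2)
  by (intro exI[of _ 1] exI[of _ "%k. ph"] exI[of _ "%k i j e. 1"]) simp
qed

text \<open>On a set that meets no exceptional divisor other than the \<open>i\<close>-th, the
  ideals of the others contain \<open>1\<close>.\<close>

lemma sec_2_square:
 assumes "openin (zariski p s) U" "i : {1..s}" "sec_H p s d U ps" "sec_ideal p s i U tht"
  "!!e j. e : \<Union>U ==> j : {1..s} ==> j ~= i ==> proj_pt (fst e) ~= proj_pt (p j)"
  "!!e. e : \<Union>U ==> ph e = ps e * tht e ^ 2"
 shows "sec_2 p s d U ph"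
proof (rule sec_2_of_on[OF assms(1)])
 let ?tht = "%k l j e. if l = i then tht e else 1"
 have 1: "sec_ideal p s l U (%e. if l = i then tht e else 1)" if "l : {1..s}" for l
 proof (cases "l = i")
  case False
  then show ?thesis
   unfolding sec_ideal_def using assms(5)[OF _ that False]
   by (simp add: sec_H_const[OF assms(1)] del: Union_iff)
 qed (use assms(4) in simp)
 have 2: "(\<Prod>l\<in>{1..s}. \<Prod>j<(2::nat). if l = i then tht e else 1) = tht e ^ 2" for e
 proof -
  have "(\<Prod>l\<in>{1..s}. \<Prod>j<(2::nat). if l = i then tht e else 1) = (\<Prod>l\<in>{1..s}. if l = i then tht e ^ 2 else 1)"
   by (intro prod.cong) auto
  then show ?thesis using assms(2) by simp
 qed
 show "sec_2_on p s d U ph"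
  unfolding sec_2_on_def
 proof (rule exI[of _ 1], rule exI[of _ "%k. ps"], rule exI[of _ ?tht], intro conjI)
  show "ALL e:\<Union>U. ph e = (\<Sum>k<(1::nat). ps e * (\<Prod>l\<in>{1..s}. \<Prod>j<(2::nat). if l = i then tht e else 1))"
   using assms(6) 2 by simp
 qed (use assms(3) 1 in auto)
qed

section \<open>Gradients of polynomial functions\<close>

lemma PF_grad_ex:
 assumes "F : PF"
 shows "EX g. ALL w. ((%z. F (%k. x k + z * w k)) has_field_derivative (\<Sum>k\<in>UNIV. g k * w k)) (at 0)"
 using assms
proof (induction rule: PF.induct)
 case (PF_const c)
 show ?case by (rule exI[of _ "%_. 0"]) simp
next
 case (PF_var k)
 show ?case
 proof (rule exI[of _ "%j. if j = k then 1 else 0"], rule allI)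
  fix w :: "'a => complex"
  have "(\<Sum>j\<in>UNIV. (if j = k then 1 else 0) * w j) = (\<Sum>j\<in>UNIV. if j = k then w j else 0)"
   by (intro sum.cong) auto
  then have "(\<Sum>j\<in>UNIV. (if j = k then 1 else 0) * w j) = w k" by simp
  then show "((%z. x k + z * w k) has_field_derivative (\<Sum>j\<in>UNIV. (if j = k then 1 else 0) * w j)) (at 0)"
   by (auto intro!: derivative_eq_intros)
 qed
next
 case (PF_add F G)
 then obtain f g where fg: "ALL w. ((%z. F (%k. x k + z * w k)) has_field_derivative (\<Sum>k\<in>UNIV. f k * w k)) (at 0)"
  "ALL w. ((%z. G (%k. x k + z * w k)) has_field_derivative (\<Sum>k\<in>UNIV. g k * w k)) (at 0)" by (elim exE)
 show ?case
  by (rule exI[of _ "%k. f k + g k"])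
    (auto simp: ring_distribs sum.distrib intro!: DERIV_add fg[rule_format])
next
 case (PF_mult F G)
 then obtain f g where fg: "ALL w. ((%z. F (%k. x k + z * w k)) has_field_derivative (\<Sum>k\<in>UNIV. f k * w k)) (at 0)"
  "ALL w. ((%z. G (%k. x k + z * w k)) has_field_derivative (\<Sum>k\<in>UNIV. g k * w k)) (at 0)" by (elim exE)
 show ?case
 proof (rule exI[of _ "%k. f k * G x + g k * F x"], rule allI)
  fix w
  have "((%z. F (%k. x k + z * w k) * G (%k. x k + z * w k)) has_field_derivative
    (\<Sum>k\<in>UNIV. f k * w k) * G (%k. x k + 0 * w k) + (\<Sum>k\<in>UNIV. g k * w k) * F (%k. x k + 0 * w k)) (at 0)"
   by (rule DERIV_mult'[THEN DERIV_cong, OF fg(1)[rule_format] fg(2)[rule_format]]) simp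
  then show "((%z. F (%k. x k + z * w k) * G (%k. x k + z * w k)) has_field_derivative
    (\<Sum>k\<in>UNIV. (f k * G x + g k * F x) * w k)) (at 0)"
   by (simp add: ring_distribs sum.distrib sum_distrib_left sum_distrib_right mult_ac)
 qed
qed

text \<open>Characterised by all directional derivatives at once; the unit directions make it
  unique.\<close>

definition grad :: "(('k::finite => complex) => complex) => ('k => complex) => 'k => complex" where
 "grad F x = (SOME g. ALL w. ((%z. F (%k. x k + z * w k)) has_field_derivative (\<Sum>k\<in>UNIV. g k * w k)) (at 0))"

lemma grad_deriv:
 assumes "F : PF"
 shows "((%z. F (%k. x k + z * w k)) has_field_derivative (\<Sum>k\<in>UNIV. grad F x k * w k)) (at 0)"
 using someI_ex[OF PF_grad_ex[OF assms, of x]] unfolding grad_def by blast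

lemma sum_unit: "(\<Sum>j\<in>UNIV. f j * (if j = k then 1 else 0)) = (f k :: complex)" for k :: "'k::finite"
proof -
 have "(\<Sum>j\<in>UNIV. f j * (if j = k then 1 else 0)) = (\<Sum>j\<in>UNIV. if j = k then f j else 0)"
  by (intro sum.cong) auto
 then show ?thesis by simp
qed

lemma grad_unique:
 assumes "F : PF" "!!w. ((%z. F (%k. x k + z * w k)) has_field_derivative (\<Sum>k\<in>UNIV. g k * w k)) (at 0)"
 shows "grad F x = g"
proof
 fix k
 show "grad F x k = g k"
  using DERIV_unique[OF grad_deriv[OF assms(1), of x "%j. if j = k then 1 else 0"] assms(2)[of "%j. if j = k then 1 else 0"]]
  by (simp only: sum_unit)
qed

lemma grad_add:
 assumes "F : PF" "G : PF"
 shows "grad (%x. F x + G x) x = (%k. grad F x k + grad G x k)"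
proof (rule grad_unique[OF PF_add[OF assms]])
 fix w
 show "((%z. F (%k. x k + z * w k) + G (%k. x k + z * w k)) has_field_derivative (\<Sum>k\<in>UNIV. (grad F x k + grad G x k) * w k)) (at 0)"
  unfolding ring_distribs sum.distrib by (intro DERIV_add grad_deriv assms)
qed

lemma grad_cmult:
 assumes "F : PF"
 shows "grad (%x. c * F x) x = (%k. c * grad F x k)"
proof (rule grad_unique[OF PF_mult[OF PF_const assms]])
 fix w
 show "((%z. c * F (%k. x k + z * w k)) has_field_derivative (\<Sum>k\<in>UNIV. (c * grad F x k) * w k)) (at 0)"
  unfolding mult.assoc sum_distrib_left[symmetric] by (intro DERIV_cmult grad_deriv assms)
qed

lemma grad_mult:
 assumes "F : PF" "G : PF"
 shows "grad (%x. F x * G x) x = (%k. grad F x k * G x + F x * grad G x k)"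
proof (rule grad_unique[OF PF_mult[OF assms]])
 fix w
 have "((%z. F (%k. x k + z * w k) * G (%k. x k + z * w k)) has_field_derivative
   (\<Sum>k\<in>UNIV. grad F x k * w k) * G (%k. x k + 0 * w k) + (\<Sum>k\<in>UNIV. grad G x k * w k) * F (%k. x k + 0 * w k)) (at 0)"
  by (rule DERIV_mult'[THEN DERIV_cong, OF grad_deriv[OF assms(1)] grad_deriv[OF assms(2)]]) simp
 then show "((%z. F (%k. x k + z * w k) * G (%k. x k + z * w k)) has_field_derivative
   (\<Sum>k\<in>UNIV. (grad F x k * G x + F x * grad G x k) * w k)) (at 0)"
  by (simp add: ring_distribs sum.distrib sum_distrib_left sum_distrib_right mult_ac)
qed

lemma grad_const: "grad (%x. c) x = (%k. 0)"
 by (rule grad_unique[OF PF_const]) simp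

lemma grad_zero_deriv:
 assumes "F : PF" "grad F x = (%_. 0)"
 shows "((%z. F (%k. x k + z * w k)) has_field_derivative 0) (at 0)"
 using grad_deriv[OF assms(1), of x w] by (simp add: assms(2))

text \<open>Both sides are the derivative at \<open>z = 0\<close> of \<open>F\<close> at
  \<open>(1 + z) x\<close>; near \<open>0\<close> the scalar \<open>1 + z\<close> is invertible, as
  \<open>hom\<close> requires.\<close>

lemma euler:
 assumes "F : PF" "hom (%_. 1) (int d) F"
 shows "(\<Sum>k\<in>UNIV. grad F x k * x k) = of_nat d * F x"
proof -
 have 1: "((%z. F (%k. x k + z * x k)) has_field_derivative (\<Sum>k\<in>UNIV. grad F x k * x k)) (at 0)"
  by (rule grad_deriv[OF assms(1)])
 have 2: "((%z. (1 + z) ^ d * F x) has_field_derivative of_nat d * F x) (at 0)"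
  by (auto intro!: derivative_eq_intros)
 have "((%z. F (%k. x k + z * x k)) has_field_derivative of_nat d * F x) (at 0)"
 proof (rule has_field_derivative_transform_within_open[OF 2, of "ball 0 1"])
  fix z :: complex assume "z : ball 0 1"
  then have "1 + z ~= 0" by (metis add_eq_0_iff2 dist_0_norm less_irrefl mem_ball norm_minus_cancel norm_one)
  then have "F (act (%_. 1) (1 + z) x) = (1 + z) powi int d * F x" by (rule homD[OF assms(2)])
  then show "(1 + z) ^ d * F x = F (%k. x k + z * x k)" by (simp add: act_def ring_distribs)
 qed auto
 from DERIV_unique[OF 1 this] show ?thesis .
qed

section \<open>Cox coordinates at an exceptional divisor\<close>

lemma sum_option: "(\<Sum>k\<in>UNIV. f k) = f None + (\<Sum>a\<in>UNIV. f (Some a))"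
 for f :: "('m::finite) option => 'b::comm_monoid_add"
 by (simp add: UNIV_option_conv sum.reindex)

lemma prod_option: "(\<Prod>k\<in>UNIV. f k) = f None * (\<Prod>a\<in>UNIV. f (Some a))"
 for f :: "('m::finite) option => 'b::comm_monoid_mult"
 by (simp add: UNIV_option_conv prod.reindex)

lemma minors_add: "minors q (v + w) = minors q v + minors q w"
 by (simp add: minors_def vec_eq_iff algebra_simps)

lemma coneD:
 assumes "e : blowup_cone p s"
 shows "fst e ~= 0" "j : {1..s} ==> snd e j ~= 0" "j : {1..s} ==> EX w. snd e j = minors (p j) w"
  "j : {1..s} ==> EX r. minors (p j) (fst e) = r *s snd e j" "j ~: {1..s} ==> snd e j = 0"
proof -
 obtain v y where e: "e = (v, y)" by (cases e)
 have *: "v ~= 0" "ALL i:{1..s}. y i ~= 0 & y i : range (minors (p i)) & (EX c. minors (p i) v = c *s y i)"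
  "ALL i. i ~: {1..s} --> y i = 0"
  using assms unfolding e blowup_cone_def mem_Collect_eq prod.case by blast+
 show "fst e ~= 0" using * e by simp
 show "j : {1..s} ==> snd e j ~= 0" using bspec[OF *(2), of j] e by simp
 show "j : {1..s} ==> EX w. snd e j = minors (p j) w" using bspec[OF *(2), of j] e by auto
 show "j : {1..s} ==> EX r. minors (p j) (fst e) = r *s snd e j" using bspec[OF *(2), of j] e by simp
 show "j ~: {1..s} ==> snd e j = 0" using * e by simp
qed

lemma PF_div_ex:
 assumes "F : PF"
 shows "EX G:PF. ALL x. F x = F (x(a := 0)) + x a * G x"
proof -
 obtain G where G: "G : PF" "!!x. F x = F (x(a := 0)) + x a * G x"
  by (rule PF_div[OF assms, of a]) (rule that)
 show ?thesis by (rule bexI[OF _ G(1)], rule allI, rule G(2))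
qed

lemma PF_vec: "F : PF ==> (!!a. (%x. V x $ a) : PF) ==> (%x. F (($) (V x))) : PF"
 using PF_compose[of F "%k x. V x $ k"] by simp

text \<open>Near the exceptional divisor over \<open>p i\<close> the points of the blow-up are \<open>v = x\<^sub>c p\<^sub>i + t x'\<close>
 with \<open>y\<^sub>i\<close> the class of \<open>x'\<close>, where \<open>x'\<close> has no \<open>c\<close>-component. The index \<open>None\<close> stands for \<open>t\<close>, an
 equation of the exceptional divisor.\<close>

locale chart =
 fixes p :: "nat => complex ^ 'm::finite" and s i :: nat and c :: 'm
  and u :: "('m => complex) => complex" and du :: nat
 assumes i: "i : {1..s}" and c: "p i $ c ~= 0" and p_nz: "!!j. j : {1..s} ==> p j ~= 0"
  and uPF: "u : PF" and uhom: "hom (%_. 1) (int du) u" and u0: "u (%_. 0) = 0"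
  and ui: "u (($) (p i)) ~= 0" and uj: "!!j. j : {1..s} ==> j ~= i ==> u (($) (p j)) = 0"
begin

definition vmod :: "('m option => complex) => complex ^ 'm" where
 "vmod xi = (\<chi> a. xi (Some c) * p i $ a + (if a = c then 0 else xi None * xi (Some a)))"

definition xpr :: "('m option => complex) => complex ^ 'm" where
 "xpr xi = (\<chi> a. if a = c then 0 else xi (Some a))"

definition sigma :: "('m option => complex) => 'm coords" where
 "sigma xi = (vmod xi, %j. if j = i then minors (p i) (xpr xi) else if j : {1..s} then minors (p j) (vmod xi) else 0)"

definition good :: "('m option => complex) => bool" where
 "good xi \<longleftrightarrow> u (($) (vmod xi)) ~= 0 & xpr xi ~= 0"

definition tt :: "'m coords => complex" where
 "tt e = (SOME r. minors (p i) (fst e) = r *s snd e i)"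

text \<open>Inverse to \<open>sigma\<close> up to scaling of the \<open>y j\<close>: since
  \<open>x'\<close> has no \<open>c\<close>-component, row \<open>c\<close> of
  \<open>y i = minors (p i) x'\<close> is \<open>p i $ c\<close> times \<open>x'\<close>. The entry
  at \<open>Some c\<close> is the coefficient of \<open>p i\<close>.\<close>

definition tau :: "'m coords => 'm option => complex" where
 "tau e k = (case k of None => tt e | Some a => if a = c then fst e $ c / p i $ c else snd e i $ (c, a) / p i $ c)"

lemma vmod_eq: "vmod xi = xi (Some c) *s p i + xi None *s xpr xi"
 by (simp add: vmod_def xpr_def vec_eq_iff)

lemma u_smult: "r ~= 0 ==> u (($) (r *s v)) = r ^ du * u (($) v)"
 using homD[OF uhom, of r "($) v"] by (simp add: act_def vector_smult_component[abs_def])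

text \<open>\<open>u\<close> vanishes at the other centres, so the chart \<open>u ~= 0\<close> meets
  no other exceptional divisor.\<close>

lemma u_zero_at:
 assumes "u (($) v) ~= 0"
 shows "v ~= 0" and "!!j. j : {1..s} ==> j ~= i ==> minors (p j) v ~= 0"
  and "!!j. j : {1..s} ==> j ~= i ==> proj_pt v ~= proj_pt (p j)"
proof -
 show v: "v ~= 0"
 proof
  assume "v = 0"
  then have "($) v = (%_. 0)" by auto
  then show False using assms u0 by simp
 qed
 have *: False if j: "j : {1..s}" "j ~= i" "v = r *s p j" for j r
 proof -
  have "r ~= 0" using v j(3) by auto
  then show False using assms uj[OF j(1,2)] by (simp add: j(3) u_smult)
 qed
 show "minors (p j) v ~= 0" if "j : {1..s}" "j ~= i" for j
  using * that minors_eq_0_iff[OF p_nz[OF that(1)]] by blast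
 show "proj_pt v ~= proj_pt (p j)" if "j : {1..s}" "j ~= i" for j
 proof
  assume "proj_pt v = proj_pt (p j)"
  then obtain r where "v = r *s p j" by (rule proj_pt_eqD)
  then show False using * that by blast
 qed
qed

lemma minors_xpr: "minors (p i) (xpr xi) $ (c, a) = p i $ c * xpr xi $ a"
 by (simp add: minors_nth xpr_def)

lemma sigma_cone:
 assumes "good xi"
 shows "sigma xi : blowup_cone p s"
proof -
 have u: "u (($) (vmod xi)) ~= 0" and x: "xpr xi ~= 0" using assms by (auto simp: good_def)
 obtain a where a: "xpr xi $ a ~= 0" using x by (auto simp: vec_eq_iff)
 have 1: "minors (p i) (xpr xi) ~= 0" using minors_xpr[of xi a] a c by auto
 have 2: "minors (p i) (vmod xi) = xi None *s minors (p i) (xpr xi)"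
  by (simp add: vmod_eq minors_add minors_smult minors_self)
 have 3: "EX r. minors (p j) (vmod xi) = r *s minors (p j) (vmod xi)" for j
  by (rule exI[of _ 1]) simp
 show ?thesis
  unfolding blowup_cone_def sigma_def using u_zero_at[OF u] 1 2 3 i by auto
qed

lemma tt_eq:
 assumes "e : blowup_cone p s"
 shows "minors (p i) (fst e) = tt e *s snd e i"
proof -
 have "EX r. minors (p i) (fst e) = r *s snd e i" by (rule coneD(4)[OF assms i])
 then show ?thesis unfolding tt_def by (rule someI_ex)
qed

lemma cone_snd:
 assumes "e : blowup_cone p s"
 shows "minors (p i) (xpr (tau e)) = snd e i" "snd e i ~= 0" "snd e i $ (c, c) = 0"
proof -
 obtain w where w: "snd e i = minors (p i) w" using coneD(3)[OF assms i] by (elim exE)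
 show c0: "snd e i $ (c, c) = 0" by (simp add: w minors_nth)
 have "xpr (tau e) = w + (- (w $ c / p i $ c)) *s p i"
  using c by (simp add: xpr_def tau_def w minors_nth vec_eq_iff field_simps)
 then have "minors (p i) (xpr (tau e)) = minors (p i) (w + (- (w $ c / p i $ c)) *s p i)"
  by (rule arg_cong)
 then show "minors (p i) (xpr (tau e)) = snd e i"
  by (simp only: minors_add minors_smult minors_self w) simp
 show "snd e i ~= 0" by (rule coneD(2)[OF assms i])
qed

lemma xpr_tau_nz:
 assumes "e : blowup_cone p s"
 shows "xpr (tau e) ~= 0"
proof
 assume "xpr (tau e) = 0"
 then have "minors (p i) (xpr (tau e)) = 0" by (simp add: minors_def vec_eq_iff)
 then show False using cone_snd[OF assms] by simp
qed

lemma vmod_tau: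
 assumes "e : blowup_cone p s"
 shows "vmod (tau e) = fst e"
proof -
 have "tt e * (snd e i $ (c, a)) = p i $ c * fst e $ a - p i $ a * fst e $ c" for a
  using arg_cong[OF tt_eq[OF assms], of "%m. m $ (c, a)"] by (simp add: minors_nth)
 then show ?thesis
  using c by (simp add: vmod_def tau_def vec_eq_iff field_simps)
qed

lemma sigma_tau:
 assumes e: "e : blowup_cone p s" and u: "u (($) (fst e)) ~= 0"
 obtains ga where "ALL j. ga j ~= 0" "e = rescale 1 ga (sigma (tau e))"
proof -
 have "EX r. r ~= 0 & snd e j = r *s snd (sigma (tau e)) j" for j
 proof (cases "j : {1..s} & j ~= i")
  case True
  then obtain r where r: "minors (p j) (fst e) = r *s snd e j" using coneD(4)[OF e, of j] by (elim conjE) auto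
  have "minors (p j) (fst e) ~= 0" using u_zero_at(2)[OF u] True by blast
  then have "r ~= 0" using r by auto
  then have "snd e j = (1 / r) *s snd (sigma (tau e)) j"
   using True r by (simp add: sigma_def vmod_tau[OF e] vector_smult_assoc)
  then show ?thesis using \<open>r ~= 0\<close> by (intro exI[of _ "1 / r"]) simp
 next
  case False
  have "snd (sigma (tau e)) j = snd e j"
  proof (cases "j = i")
   case True
   then show ?thesis by (simp add: sigma_def cone_snd(1)[OF e])
  next
   case j: False
   then have jn: "j ~: {1..s}" using False by blast
   show ?thesis unfolding sigma_def snd_conv coneD(5)[OF e jn] using j jn by (simp only: if_False)
  qed
  then show ?thesis by (intro exI[of _ 1]) simp
 qed
 then have "ALL j. EX r. r ~= 0 & snd e j = r *s snd (sigma (tau e)) j" by (intro allI)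
 from choice[OF this] obtain ga where ga: "ALL j. ga j ~= 0 & snd e j = ga j *s snd (sigma (tau e)) j" by (elim exE)
 have ga0: "ALL j. ga j ~= 0" using ga by blast
 have "snd e = (%j. ga j *s snd (sigma (tau e)) j)" using ga by (intro ext) blast
 moreover have "fst e = 1 *s fst (sigma (tau e))" by (simp add: sigma_def vmod_tau[OF e])
 ultimately have "e = rescale 1 ga (sigma (tau e))"
  unfolding rescale_def by (metis prod.collapse)
 then show ?thesis by (rule that[OF ga0])
qed

lemma multiproj_sigma_tau:
 assumes e: "e : blowup_cone p s" and u: "u (($) (fst e)) ~= 0"
 shows "multiproj_pt (sigma (tau e)) = multiproj_pt e"
proof -
 obtain ga where ga: "ALL j. ga j ~= 0" "e = rescale 1 ga (sigma (tau e))" by (rule sigma_tau[OF assms])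
 have "multiproj_pt (rescale 1 ga (sigma (tau e))) = multiproj_pt (sigma (tau e))"
  by (rule multiproj_pt_rescale) (use ga(1) in auto)
 then show ?thesis using ga(2) by simp
qed

lemma vmod_PF: "(%xi. vmod xi $ a) : PF"
 unfolding vmod_def by (cases "a = c") (auto intro!: PF_add PF_mult PF_var PF_const)

lemma xpr_PF: "(%xi. xpr xi $ a) : PF"
 unfolding xpr_def by (cases "a = c") (auto intro!: PF_var PF_const)

lemma minors_PF: "(!!a. (%xi. V xi $ a) : PF) ==> (%xi. minors q (V xi) $ ab) : PF"
 unfolding minors_def by (simp add: PF_diff PF_mult PF_const)

lemma poly_sigma: "F : poly_funs s ==> (%xi. F (sigma xi)) : PF"
proof (induction rule: poly_funs.induct)
 case (2 a)
 show ?case by (simp add: sigma_def vmod_PF)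
next
 case (3 j ab)
 then show ?case by (cases "j = i") (simp_all add: sigma_def minors_PF xpr_PF vmod_PF)
qed (simp_all add: PF_const PF_add PF_mult)

text \<open>The weights of two one-parameter groups acting on the Cox coordinates: \<open>wl\<close>
  rescales \<open>y i\<close> and fixes \<open>v\<close>, while \<open>wm\<close> rescales
  \<open>v\<close> and fixes \<open>y i\<close>.\<close>

definition wl :: "'m option => int" where
 "wl k = (case k of None => -1 | Some a => if a = c then 0 else 1)"

definition wm :: "'m option => int" where
 "wm k = (case k of None => 1 | Some a => if a = c then 1 else 0)"

lemma vmod_act:
 assumes "r ~= 0"
 shows "vmod (act wl r xi) = vmod xi" "xpr (act wl r xi) = r *s xpr xi"
  "vmod (act wm r xi) = r *s vmod xi" "xpr (act wm r xi) = xpr xi"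
 using assms by (simp_all add: vmod_def xpr_def act_def wl_def wm_def vec_eq_iff power_int_minus algebra_simps)

lemma sigma_act:
 assumes "r ~= 0"
 shows "sigma (act wl r xi) = rescale 1 (%j. if j = i then r else 1) (sigma xi)"
  "sigma (act wm r xi) = rescale r (%j. if j = i then 1 else r) (sigma xi)"
 using assms by (auto simp: sigma_def rescale_def vmod_act minors_smult fun_eq_iff)

lemma multihom_sigma:
 assumes "F : multihom s k b"
 shows "hom wl (int (b i)) (%xi. F (sigma xi))"
  "hom wm (int k + (\<Sum>j\<in>{1..s} - {i}. int (b j))) (%xi. F (sigma xi))"
proof -
 show "hom wl (int (b i)) (%xi. F (sigma xi))"
  unfolding hom_def
 proof (intro allI impI)
  fix r :: complex and xi assume r: "r ~= 0"
  have "(\<Prod>j\<in>{1..s}. (if j = i then r else 1) ^ b j) = r ^ b i"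
   using i by (subst prod.remove[of _ i]) auto
  then show "F (sigma (act wl r xi)) = r powi int (b i) * F (sigma xi)"
   by (simp add: sigma_act[OF r] multihomD[OF assms])
 qed
 show "hom wm (int k + (\<Sum>j\<in>{1..s} - {i}. int (b j))) (%xi. F (sigma xi))"
  unfolding hom_def
 proof (intro allI impI)
  fix r :: complex and xi assume r: "r ~= 0"
  have "(\<Prod>j\<in>{1..s}. (if j = i then 1 else r) ^ b j) = (\<Prod>j\<in>{1..s} - {i}. r ^ b j)"
   using i by (subst prod.remove[of _ i]) auto
  also have "\<dots> = r powi (\<Sum>j\<in>{1..s} - {i}. int (b j))"
   using r by (simp add: power_int_sum)
  finally show "F (sigma (act wm r xi)) = r powi (int k + (\<Sum>j\<in>{1..s} - {i}. int (b j))) * F (sigma xi)"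
   using r by (simp add: sigma_act[OF r] multihomD[OF assms] power_int_add)
 qed
qed

abbreviation U :: "('m option => complex) => complex" where "U xi \<equiv> u (($) (vmod xi))"

lemma U_PF: "U : PF"
 by (rule PF_vec[OF uPF vmod_PF])

lemma U_hom: "hom wl 0 U" "hom wm (int du) U"
 unfolding hom_def by (simp_all add: vmod_act u_smult)

text \<open>Passes from neighbourhoods in the blow-up to principal open sets of the Cox space. The
  factor \<open>xi (Some a)\<close> keeps \<open>x'\<close>, and with it \<open>y i\<close>, away
  from zero.\<close>

lemma nbhd_function:
 assumes W: "openin (zariski p s) W" "multiproj_pt (sigma xi) : W" and xi: "good xi"
 obtains a F k b where "a ~= c" "F : multihom s k b" "U xi * xi (Some a) * F (sigma xi) ~= 0"
  "ALL et. U et * et (Some a) * F (sigma et) ~= 0 --> good et & multiproj_pt (sigma et) : W"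
proof -
 obtain F k b where F: "F : multihom s k b" "multiproj_pt (sigma xi) : basic_open p s F" "basic_open p s F <= W"
  using basic_open_nbhd[OF W] by (elim exE conjE)
 have u: "U xi ~= 0" and x: "xpr xi ~= 0" using xi by (auto simp: good_def)
 obtain a where a: "xpr xi $ a ~= 0" using x by (auto simp: vec_eq_iff)
 then have ac: "a ~= c" "xi (Some a) ~= 0" by (auto simp: xpr_def split: if_splits)
 have Fxi: "F (sigma xi) ~= 0" using F(2) in_basic_open[OF F(1) sigma_cone[OF xi]] by simp
 have "good et & multiproj_pt (sigma et) : W" if et: "U et * et (Some a) * F (sigma et) ~= 0" for et
 proof -
  have "xpr et $ a ~= 0" using et ac(1) by (simp add: xpr_def)
  then have g: "good et" using et by (auto simp: good_def)
  then show ?thesis using in_basic_open[OF F(1) sigma_cone[OF g]] F(3) et by auto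
 qed
 then show ?thesis using u ac Fxi by (intro that[of a F k b] F(1)) auto
qed

subsection \<open>Pulling sections back to the chart\<close>

text \<open>The pullback of \<open>ph\<close> is regular near \<open>xi\<close> and divisible by
  \<open>t ^ r\<close>, so its order of vanishing along the exceptional divisor is at least
  \<open>r\<close>.\<close>

definition reg :: "nat => ('m option => complex) => ('m coords => complex) => bool" where
 "reg r xi ph \<longleftrightarrow> (EX G:PF. EX F:PF. G xi ~= 0 & (ALL et. G et ~= 0 --> ph (sigma et) * G et = et None ^ r * F et))"

lemma regI:
 "G : PF ==> F : PF ==> G xi ~= 0 ==> (!!et. G et ~= 0 ==> ph (sigma et) * G et = et None ^ r * F et) ==> reg r xi ph"
 unfolding reg_def by (intro bexI[of _ G] bexI[of _ F] conjI allI impI)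

lemma regE:
 assumes "reg r xi ph"
 obtains G F where "G : PF" "F : PF" "G xi ~= 0" "ALL et. G et ~= 0 --> ph (sigma et) * G et = et None ^ r * F et"
 using assms unfolding reg_def by (elim bexE conjE)

lemma reg_mult:
 assumes "reg r xi ph" "reg r' xi ps"
 shows "reg (r + r') xi (%e. ph e * ps e)"
proof -
 obtain G F where 1: "G : PF" "F : PF" "G xi ~= 0" "ALL et. G et ~= 0 --> ph (sigma et) * G et = et None ^ r * F et"
  using assms(1) by (rule regE)
 obtain G' F' where 2: "G' : PF" "F' : PF" "G' xi ~= 0" "ALL et. G' et ~= 0 --> ps (sigma et) * G' et = et None ^ r' * F' et"
  using assms(2) by (rule regE)
 show ?thesis
 proof (rule regI[OF PF_mult[OF 1(1) 2(1)] PF_mult[OF 1(2) 2(2)]])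
  fix et assume et: "G et * G' et ~= 0"
  have "ph (sigma et) * ps (sigma et) * (G et * G' et) = (ph (sigma et) * G et) * (ps (sigma et) * G' et)" by simp
  also have "\<dots> = (et None ^ r * F et) * (et None ^ r' * F' et)" using 1(4) 2(4) et by simp
  finally show "ph (sigma et) * ps (sigma et) * (G et * G' et) = et None ^ (r + r') * (F et * F' et)"
   by (simp add: power_add mult_ac)
 qed (use 1(3) 2(3) in simp)
qed

lemma reg_add:
 assumes "reg r xi ph" "reg r xi ps"
 shows "reg r xi (%e. ph e + ps e)"
proof -
 obtain G F where 1: "G : PF" "F : PF" "G xi ~= 0" "ALL et. G et ~= 0 --> ph (sigma et) * G et = et None ^ r * F et"
  using assms(1) by (rule regE)
 obtain G' F' where 2: "G' : PF" "F' : PF" "G' xi ~= 0" "ALL et. G' et ~= 0 --> ps (sigma et) * G' et = et None ^ r * F' et"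
  using assms(2) by (rule regE)
 show ?thesis
 proof (rule regI[OF PF_mult[OF 1(1) 2(1)] PF_add[OF PF_mult[OF 1(2) 2(1)] PF_mult[OF 2(2) 1(1)]]])
  fix et assume et: "G et * G' et ~= 0"
  have "(ph (sigma et) + ps (sigma et)) * (G et * G' et) = (ph (sigma et) * G et) * G' et + (ps (sigma et) * G' et) * G et"
   by (simp add: algebra_simps)
  also have "\<dots> = (et None ^ r * F et) * G' et + (et None ^ r * F' et) * G et" using 1(4) 2(4) et by simp
  finally show "(ph (sigma et) + ps (sigma et)) * (G et * G' et) = et None ^ r * (F et * G' et + F' et * G et)"
   by (simp add: algebra_simps)
 qed (use 1(3) 2(3) in simp)
qed

lemma reg_const: "reg 0 xi (%e. r)"
 by (rule regI[OF PF_const[of 1] PF_const[of r]]) simp_all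

lemma reg_zero: "reg r xi (%e. 0)"
 by (rule regI[OF PF_const[of 1] PF_const[of 0]]) simp_all

lemma reg_sum: "(!!k. k : I ==> reg r xi (ph k)) ==> reg r xi (%e. \<Sum>k\<in>I. ph k e)"
 by (induction I rule: infinite_finite_induct) (simp_all add: reg_zero reg_add)

lemma reg_prod: "(!!k. k : I ==> reg (r k) xi (ph k)) ==> finite I ==> reg (\<Sum>k\<in>I. r k) xi (%e. \<Prod>k\<in>I. ph k e)"
proof (induction I rule: infinite_finite_induct)
 case (insert k I)
 then show ?case using reg_mult[of "r k" xi "ph k" "\<Sum>k\<in>I. r k" "%e. \<Prod>k\<in>I. ph k e"] by simp
qed (simp_all add: reg_const)

lemma reg_sec_H:
 assumes "sec_H p s d W ph" "multiproj_pt (sigma xi) : W" "good xi"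
 shows "reg 0 xi ph"
proof -
 obtain w kw bw F G k l b where w: "w : multihom s kw bw" "multiproj_pt (sigma xi) : basic_open p s w" "basic_open p s w <= W"
  "F : multihom s k b" "G : multihom s l b" "int k - int l = d"
  "ALL e:\<Union>(basic_open p s w). G e ~= 0 & ph e = F e / G e"
  by (rule sec_H_pointE[OF assms(1,2)])
 obtain a f kf bf where f: "a ~= c" "f : multihom s kf bf" "U xi * xi (Some a) * f (sigma xi) ~= 0"
  "ALL et. U et * et (Some a) * f (sigma et) ~= 0 --> good et & multiproj_pt (sigma et) : basic_open p s w"
  by (rule nbhd_function[OF openin_basic[OF w(1)] w(2) assms(3)])
 let ?N = "%et. U et * et (Some a) * f (sigma et)"
 have N: "?N : PF" by (intro PF_mult U_PF PF_var poly_sigma multihom_poly[OF f(2)])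
 have GF: "G (sigma et) ~= 0 & ph (sigma et) = F (sigma et) / G (sigma et)" if "?N et ~= 0" for et
 proof -
  have "multiproj_pt (sigma et) : basic_open p s w" using f(4) that by blast
  then have "sigma et : \<Union>(basic_open p s w)" using multiproj_pt_self by blast
  then show ?thesis by (rule w(7)[THEN bspec])
 qed
 show ?thesis
 proof (rule regI[of "%et. ?N et * G (sigma et)" "%et. ?N et * F (sigma et)"])
  show "(%et. ?N et * G (sigma et)) : PF" "(%et. ?N et * F (sigma et)) : PF"
   by (intro PF_mult[OF N] poly_sigma multihom_poly[OF w(4)] multihom_poly[OF w(5)])+
  show "?N xi * G (sigma xi) ~= 0" using f(3) GF[OF f(3)] by simp
  fix et assume "?N et * G (sigma et) ~= 0"
  then have "?N et ~= 0" by auto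
  from GF[OF this] show "ph (sigma et) * (?N et * G (sigma et)) = et None ^ 0 * (?N et * F (sigma et))" by simp
 qed
qed

text \<open>The pullback of \<open>tht\<close> is regular and vanishes for \<open>t = 0\<close>, so
  \<open>t\<close> divides its numerator. The numerator is first multiplied by the functions that
  cut out the neighbourhood, so that it vanishes on the whole hyperplane
  \<open>t = 0\<close>.\<close>

lemma reg_ideal:
 assumes tht: "sec_ideal p s i W tht" and W: "openin (zariski p s) W" "multiproj_pt (sigma xi) : W" and xi: "good xi"
 shows "reg 1 xi tht"
proof -
 have "reg 0 xi tht" using tht W(2) xi by (intro reg_sec_H[of 0 W]) (auto simp: sec_ideal_def)
 then obtain G F where 1: "G : PF" "F : PF" "G xi ~= 0" "ALL et. G et ~= 0 --> tht (sigma et) * G et = et None ^ 0 * F et"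
  by (rule regE)
 obtain a f kf bf where f: "a ~= c" "f : multihom s kf bf" "U xi * xi (Some a) * f (sigma xi) ~= 0"
  "ALL et. U et * et (Some a) * f (sigma et) ~= 0 --> good et & multiproj_pt (sigma et) : W"
  by (rule nbhd_function[OF W xi])
 let ?N = "%et. U et * et (Some a) * f (sigma et)"
 have N: "?N : PF" by (intro PF_mult U_PF PF_var poly_sigma multihom_poly[OF f(2)])
 let ?F = "%et. F et * (?N et * G et)"
 have FPF: "?F : PF" by (intro PF_mult[OF 1(2)] PF_mult[OF N] 1(1))
 obtain F3 where F3': "F3 : PF" "ALL et. ?F et = ?F (et(None := 0)) + et None * F3 et"
  using PF_div_ex[OF FPF, of None] by (elim bexE)
 note F3 = F3'(1) F3'(2)[THEN spec]
 have zero: "?F ze = 0" if "ze None = 0" for ze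
 proof (cases "?N ze * G ze = 0")
  case False
  then have Nze: "?N ze ~= 0" "G ze ~= 0" by auto
  have g: "good ze" "multiproj_pt (sigma ze) : W" using f(4)[THEN spec, THEN mp, OF Nze(1)] by simp_all
  have v: "vmod ze = ze (Some c) *s p i" using that by (simp add: vmod_eq)
  have "ze (Some c) ~= 0" using u_zero_at(1)[of "vmod ze"] g(1) v by (auto simp: good_def)
  then have "proj_pt (fst (sigma ze)) = proj_pt (p i)" by (simp add: sigma_def v proj_pt_smult)
  moreover have "sigma ze : \<Union>W" using g(2) multiproj_pt_self by blast
  ultimately have "tht (sigma ze) = 0" using tht unfolding sec_ideal_def by blast
  then have "F ze = 0" using 1(4)[THEN spec, THEN mp, OF Nze(2)] by simp
  then show ?thesis by simp
 qed simp
 have z0: "?F (et(None := 0)) = 0" for et by (rule zero) simp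
 show ?thesis
 proof (rule regI[of "%et. G et * (?N et * G et)" F3])
  show "(%et. G et * (?N et * G et)) : PF" by (intro PF_mult[OF 1(1)] PF_mult[OF N] 1(1))
  fix et assume "G et * (?N et * G et) ~= 0"
  then have "tht (sigma et) * G et = F et" using 1(4) by simp
  then have "tht (sigma et) * (G et * (?N et * G et)) = ?F et" by (metis mult.assoc)
  also have "\<dots> = et None ^ 1 * F3 et" unfolding F3(2)[of et] z0 by simp
  finally show "tht (sigma et) * (G et * (?N et * G et)) = et None ^ 1 * F3 et" .
 qed (use F3(1) 1(3) f(3) in simp_all)
qed

lemma reg_cong_nbhd:
 assumes "reg r xi ph" and W: "openin (zariski p s) W" "multiproj_pt (sigma xi) : W" and xi: "good xi"
  and eq: "!!e. e : \<Union>W ==> ps e = ph e"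
 shows "reg r xi ps"
proof -
 obtain G F where 1: "G : PF" "F : PF" "G xi ~= 0" "ALL et. G et ~= 0 --> ph (sigma et) * G et = et None ^ r * F et"
  using assms(1) by (rule regE)
 obtain a f kf bf where f: "a ~= c" "f : multihom s kf bf" "U xi * xi (Some a) * f (sigma xi) ~= 0"
  "ALL et. U et * et (Some a) * f (sigma et) ~= 0 --> good et & multiproj_pt (sigma et) : W"
  by (rule nbhd_function[OF W xi])
 let ?N = "%et. U et * et (Some a) * f (sigma et)"
 have N: "?N : PF" by (intro PF_mult U_PF PF_var poly_sigma multihom_poly[OF f(2)])
 show ?thesis
 proof (rule regI[of "%et. G et * ?N et" "%et. F et * ?N et"])
  show "(%et. G et * ?N et) : PF" "(%et. F et * ?N et) : PF" by (intro PF_mult[OF _ N] 1)+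
  fix et assume et: "G et * ?N et ~= 0"
  then have "?N et ~= 0" by auto
  then have "multiproj_pt (sigma et) : W" using f(4)[THEN spec, THEN mp] by blast
  then have "sigma et : \<Union>W" using multiproj_pt_self by blast
  moreover have "ph (sigma et) * G et = et None ^ r * F et" using 1(4) et by auto
  ultimately show "ps (sigma et) * (G et * ?N et) = et None ^ r * (F et * ?N et)"
   using eq by (metis mult.assoc)
 qed (use 1(3) f(3) in simp)
qed

text \<open>In each summand exactly two factors are sections of the \<open>i\<close>-th ideal and
  contribute one \<open>t\<close> each; the other factors are merely regular.\<close>

lemma reg_sec_2:
 assumes "sec_2 p s d W0 ph" "multiproj_pt (sigma xi) : W0" and xi: "good xi"
 shows "reg 2 xi ph"
proof -
 obtain W where W: "openin (zariski p s) W" "multiproj_pt (sigma xi) : W" "W <= W0" "sec_2_on p s d W ph"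
  by (rule sec_2_pointE[OF assms(1,2)])
 obtain N :: nat and f tht where 1: "ALL k<N. sec_H p s d W (f k)"
    "ALL k<N. ALL i:{1..s}. ALL j<(2::nat). sec_ideal p s i W (tht k i j)"
    "ALL e:\<Union>W. ph e = (\<Sum>k<N. f k e * (\<Prod>i\<in>{1..s}. \<Prod>j<(2::nat). tht k i j e))"
  using W(4) unfolding sec_2_on_def by (elim exE conjE)
 have "reg (0 + (\<Sum>l\<in>{1..s}. \<Sum>j<(2::nat). if l = i then 1 else 0)) xi (%e. f k e * (\<Prod>i\<in>{1..s}. \<Prod>j<(2::nat). tht k i j e))" if k: "k < N" for k
 proof (intro reg_mult reg_prod finite_atLeastAtMost finite_lessThan)
  show "reg 0 xi (f k)" using 1(1) k by (intro reg_sec_H[OF _ W(2) xi]) auto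
  fix l and j :: nat assume l: "l : {1..s}" "j : {..<2}"
  have tht: "sec_ideal p s l W (tht k l j)" using 1(2) k l by simp
  show "reg (if l = i then 1 else 0) xi (tht k l j)"
  proof (cases "l = i")
   case True then show ?thesis using reg_ideal[OF _ W(1,2) xi] tht by simp
  next
   case False then show ?thesis using reg_sec_H[of 0 W, OF _ W(2) xi] tht by (simp add: sec_ideal_def)
  qed
 qed
 moreover have "(\<Sum>l\<in>{1..s}. \<Sum>j<(2::nat). if l = i then 1 else 0) = (2::nat)"
 proof -
  have "(\<Sum>l\<in>{1..s}. \<Sum>j<(2::nat). if l = i then 1 else 0) = (\<Sum>l\<in>{1..s}. if l = i then (2::nat) else 0)"
   by (intro sum.cong) auto
  then show ?thesis using i by simp
 qed
 ultimately have "reg 2 xi (%e. \<Sum>k<N. f k e * (\<Prod>i\<in>{1..s}. \<Prod>j<(2::nat). tht k i j e))"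
  by (intro reg_sum) simp
 then show ?thesis
  by (rule reg_cong_nbhd[OF _ W(1,2) xi 1(3)[THEN bspec]])
qed

subsection \<open>Sections defined on the chart\<close>

lemma tau_None: "e : blowup_cone p s ==> tau e None * (snd e i $ (c, b)) = minors (p i) (fst e) $ (c, b)"
 using arg_cong[OF tt_eq, of e "%m. m $ (c, b)"] by (simp add: tau_def)

text \<open>\<open>t\<close> is not a polynomial in the multihomogeneous coordinates, but
  \<open>t * y\<close> with \<open>y = snd e i $ (c, b)\<close> is a minor of \<open>p i\<close> and
  \<open>v\<close>. Multiplication by \<open>y ^ A\<close>, with \<open>A\<close> at least the
  exponent of \<open>t\<close>, makes the monomial polynomial, of degree \<open>A + ka\<close> in
  \<open>y i\<close>.\<close>

lemma mon_multihom:
 assumes "al None <= A" "wt wl al = ka" "wt wm al = int de"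
 shows "EX F:multihom s de (%j. if j = i then nat (int A + ka) else 0).
  ALL e:blowup_cone p s. F e = (snd e i $ (c, b)) ^ A * mon al (tau e)"
proof -
 let ?y = "%b (e :: 'm coords). snd e i $ (c, b)"
 define F where "F = (%e :: 'm coords. (p i $ c * fst e $ b - p i $ b * fst e $ c) ^ al None * (?y b e) ^ (A - al None) *
   ((1 / p i $ c * fst e $ c) ^ al (Some c) * (\<Prod>a\<in>UNIV - {c}. (1 / p i $ c * ?y a e) ^ al (Some a))))"
 have wl: "wt wl al = - int (al None) + (\<Sum>a\<in>UNIV - {c}. int (al (Some a)))"
 proof -
  have "(\<Sum>a\<in>UNIV. wl (Some a) * int (al (Some a))) = (\<Sum>a\<in>UNIV - {c}. wl (Some a) * int (al (Some a)))"
   by (rule sum.mono_neutral_right) (auto simp: wl_def)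
  also have "\<dots> = (\<Sum>a\<in>UNIV - {c}. int (al (Some a)))" by (intro sum.cong) (auto simp: wl_def)
  finally show ?thesis by (simp add: wt_def sum_option) (simp add: wl_def)
 qed
 have wm: "wt wm al = int (al None + al (Some c))"
 proof -
  have "(\<Sum>a\<in>UNIV. wm (Some a) * int (al (Some a))) = (\<Sum>a\<in>UNIV. if a = c then int (al (Some a)) else 0)"
   by (intro sum.cong) (auto simp: wm_def)
  then show ?thesis by (simp add: wt_def sum_option) (simp add: wm_def)
 qed
 have "F : multihom s ((al None * 1 + (A - al None) * 0) + (al (Some c) * 1 + (\<Sum>a\<in>UNIV - {c}. al (Some a) * 0)))
   (%j. (al None * 0 + (A - al None) * (if j = i then 1 else 0)) + (al (Some c) * 0 + (\<Sum>a\<in>UNIV - {c}. al (Some a) * (if j = i then 1 else 0))))"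
  unfolding F_def
  by (intro multihom_mult multihom_power multihom_prod multihom_diff multihom_cmult multihom_fst multihom_snd i)
 moreover have "(al None * 1 + (A - al None) * 0) + (al (Some c) * 1 + (\<Sum>a\<in>UNIV - {c}. al (Some a) * 0)) = de"
  using wm assms(3) by simp
 moreover have "(%j. (al None * 0 + (A - al None) * (if j = i then 1 else 0)) + (al (Some c) * 0 + (\<Sum>a\<in>UNIV - {c}. al (Some a) * (if j = i then 1 else 0))))
   = (%j. if j = i then nat (int A + ka) else 0)"
 proof
  fix j
  have "int A + ka = int ((A - al None) + (\<Sum>a\<in>UNIV - {c}. al (Some a)))"
   using wl assms(1,2) by simp
  then show "(al None * 0 + (A - al None) * (if j = i then 1 else 0)) + (al (Some c) * 0 + (\<Sum>a\<in>UNIV - {c}. al (Some a) * (if j = i then 1 else 0)))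
   = (if j = i then nat (int A + ka) else 0)" by (simp del: of_nat_add)
 qed
 moreover have "F e = (?y b e) ^ A * mon al (tau e)" if e: "e : blowup_cone p s" for e
 proof -
  have A: "(?y b e) ^ A = (?y b e) ^ al None * (?y b e) ^ (A - al None)"
   using assms(1) by (simp flip: power_add)
  have t: "tau e None * ?y b e = p i $ c * fst e $ b - p i $ b * fst e $ c"
   using tau_None[OF e, of b] by (simp add: minors_nth)
  have pr: "(\<Prod>a\<in>UNIV. tau e (Some a) ^ al (Some a)) = (1 / p i $ c * fst e $ c) ^ al (Some c) * (\<Prod>a\<in>UNIV - {c}. (1 / p i $ c * ?y a e) ^ al (Some a))"
   by (subst prod.remove[of _ c]) (auto simp: tau_def intro!: prod.cong)
  have m: "mon al (tau e) = tau e None ^ al None * (\<Prod>a\<in>UNIV. tau e (Some a) ^ al (Some a))"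
   by (simp add: mon_def prod_option)
  show ?thesis unfolding F_def m A pr t[symmetric] power_mult_distrib by (simp only: mult_ac)
 qed
 ultimately show ?thesis by (intro bexI[of _ F]) auto
qed

lemma model_multihom:
 assumes "H : PF" "hom wl ka H" "hom wm (int de) H"
 shows "EX A0. ALL A>=A0. EX F:multihom s de (%j. if j = i then nat (int A + ka) else 0).
  ALL e:blowup_cone p s. F e = (snd e i $ (c, b)) ^ A * H (tau e)"
proof -
 have "H : cfun.span (mon ` UNIV)" using assms(1) PF_eq_span by auto
 from span_mono_hom[OF span_mono_hom[OF this assms(2)] assms(3)]
 have "H : cfun.span (mon ` {al : {al : UNIV. wt wl al = ka}. wt wm al = int de})" .
 then obtain S r where S: "finite S" "S <= {al : {al : UNIV. wt wl al = ka}. wt wm al = int de}"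
  "H = (%x. \<Sum>al\<in>S. r al * mon al x)" by (rule span_monoE)
 have "EX F:multihom s de (%j. if j = i then nat (int A + ka) else 0).
  ALL e:blowup_cone p s. F e = (snd e i $ (c, b)) ^ A * H (tau e)" if A: "A >= (\<Sum>al\<in>S. al None)" for A
 proof -
  have "ALL al:S. EX F. F : multihom s de (%j. if j = i then nat (int A + ka) else 0) &
   (ALL e:blowup_cone p s. F e = (snd e i $ (c, b)) ^ A * mon al (tau e))"
  proof
   fix al assume al: "al : S"
   have "al None <= (\<Sum>al\<in>S. al None)" using S(1) al by (intro member_le_sum) auto
   then have "al None <= A" using A by simp
   with mon_multihom[of al A ka de b] S(2) al
   show "EX F. F : multihom s de (%j. if j = i then nat (int A + ka) else 0) &
    (ALL e:blowup_cone p s. F e = (snd e i $ (c, b)) ^ A * mon al (tau e))" by auto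
  qed
  then obtain F where F: "ALL al:S. F al : multihom s de (%j. if j = i then nat (int A + ka) else 0) &
   (ALL e:blowup_cone p s. F al e = (snd e i $ (c, b)) ^ A * mon al (tau e))"
   unfolding bchoice_iff by (elim exE)
  show ?thesis
  proof (rule bexI[of _ "%e. \<Sum>al\<in>S. r al * F al e"])
   show "(%e. \<Sum>al\<in>S. r al * F al e) : multihom s de (%j. if j = i then nat (int A + ka) else 0)"
    using F by (intro multihom_sum multihom_cmult) auto
   show "ALL e:blowup_cone p s. (\<Sum>al\<in>S. r al * F al e) = (snd e i $ (c, b)) ^ A * H (tau e)"
    using F by (auto simp: S(3) sum_distrib_left mult_ac intro!: sum.cong)
  qed
 qed
 then show ?thesis by (intro exI[of _ "\<Sum>al\<in>S. al None"] allI impI)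
qed

lemma hom_weight_nonneg:
 assumes "F : PF" "hom w de F" "!!k. w k >= 0" "F x ~= 0"
 shows "de >= 0"
proof (rule ccontr)
 assume "\<not> de >= 0"
 have "F : cfun.span (mon ` UNIV)" using assms(1) PF_eq_span by auto
 from span_mono_hom[OF this assms(2)] have "F : cfun.span (mon ` {al : UNIV. wt w al = de})" .
 moreover have "wt w al >= 0" for al unfolding wt_def using assms(3) by (intro sum_nonneg) simp
 then have "{al : UNIV. wt w al = de} = {}" using \<open>\<not> de >= 0\<close> by auto
 ultimately show False using assms(4) by (simp add: fun_eq_iff)
qed

lemma wm_nonneg: "wm k >= 0"
 by (auto simp: wm_def split: option.splits)

lemma u_multihom: "(%e. u (($) (fst e))) : multihom s du (%_. 0)"
proof (rule multihom_form)
 have "u : cfun.span (mon ` UNIV)" using uPF PF_eq_span by auto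
 from span_mono_hom[OF this uhom] show "u : cfun.span (mon ` {al. wt (%_. 1) al = int du})" by simp
qed

text \<open>Leads back from Cox coordinates to sections: \<open>t ^ 2 * H / g\<close> is written as
  \<open>ps * tht ^ 2\<close>, where \<open>tht = t * y / v\<close> has degree zero and vanishes on
  the exceptional divisor. Powers of \<open>y\<close> turn \<open>H\<close> and \<open>g\<close>
  into multihomogeneous polynomials.\<close>

lemma section_from_model:
 assumes e0: "e0 : blowup_cone p s" "u (($) (fst e0)) ~= 0"
  and H: "H : PF" "hom wl (ka + 2) H" "hom wm (de + d - 2) H"
  and g: "g : PF" "hom wl ka g" "hom wm de g" "g (tau e0) ~= 0"
 shows "EX W. openin (zariski p s) W & multiproj_pt e0 : W & (ALL e:\<Union>W. u (($) (fst e)) ~= 0 & g (tau e) ~= 0) &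
  sec_2 p s d W (%e. tau e None ^ 2 * H (tau e) / g (tau e))"
proof -
 have "de >= 0" by (rule hom_weight_nonneg[OF g(1,3) wm_nonneg g(4)])
 define de2 where "de2 = nat de"
 have de2: "int de2 = de" using \<open>de >= 0\<close> by (simp add: de2_def)
 obtain b where b: "snd e0 i $ (c, b) ~= 0"
 proof -
  obtain a where a: "xpr (tau e0) $ a ~= 0" using xpr_tau_nz[OF e0(1)] by (auto simp: vec_eq_iff)
  have "snd e0 i $ (c, a) = p i $ c * xpr (tau e0) $ a"
   using minors_xpr[of "tau e0" a] unfolding cone_snd(1)[OF e0(1)] .
  then show ?thesis using a c by (intro that[of a]) simp
 qed
 obtain k where k: "fst e0 $ k ~= 0" using e0(1) by (auto simp: blowup_cone_def vec_eq_iff)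
 let ?y = "%e :: 'm coords. snd e i $ (c, b)" and ?v = "%e :: 'm coords. fst e $ k"
 let ?ph = "%e. tau e None ^ 2 * H (tau e) / g (tau e)"
 obtain A2 where A2: "ALL A>=A2. EX F:multihom s de2 (%j. if j = i then nat (int A + ka) else 0).
  ALL e:blowup_cone p s. F e = ?y e ^ A * g (tau e)"
  using model_multihom[OF g(1,2), of de2 b] g(3) de2 by auto
 show ?thesis
 proof (cases "de + d - 2 >= 0")
  case True
  define de1 where "de1 = nat (de + d - 2)"
  have de1: "int de1 = de + d - 2" using True by (simp add: de1_def)
  obtain A1 where A1: "ALL A>=A1. EX F:multihom s de1 (%j. if j = i then nat (int A + (ka + 2)) else 0).
   ALL e:blowup_cone p s. F e = ?y e ^ A * H (tau e)"
   using model_multihom[OF H(1,2), of de1 b] H(3) de1 by auto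
  define A where "A = A1 + A2 + nat \<bar>ka\<bar>"
  have A: "A1 <= A" "A2 <= A" "int A + ka >= 0" by (simp_all add: A_def)
  obtain FH where FH: "FH : multihom s de1 (%j. if j = i then nat (int A + (ka + 2)) else 0)"
   "ALL e:blowup_cone p s. FH e = ?y e ^ A * H (tau e)"
   using A1[THEN spec, THEN mp, OF A(1)] by (elim bexE)
  obtain Fg where Fg: "Fg : multihom s de2 (%j. if j = i then nat (int A + ka) else 0)"
   "ALL e:blowup_cone p s. Fg e = ?y e ^ A * g (tau e)"
   using A2[THEN spec, THEN mp, OF A(2)] by (elim bexE)
  let ?w = "%e :: 'm coords. u (($) (fst e)) * (?v e * (?y e * Fg e))"
  have w: "?w : multihom s (du + (1 + (0 + de2))) (%j. 0 + (0 + ((if j = i then 1 else 0) + (if j = i then nat (int A + ka) else 0))))"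
   by (intro multihom_mult u_multihom multihom_fst multihom_snd i Fg(1))
  let ?W = "basic_open p s ?w"
  have op: "openin (zariski p s) ?W" by (rule openin_basic[OF w])
  have W: "e : blowup_cone p s & u (($) (fst e)) ~= 0 & ?v e ~= 0 & ?y e ~= 0 & g (tau e) ~= 0" if "e : \<Union>?W" for e
  proof -
   have e: "e : blowup_cone p s" "multiproj_pt e : ?W" using in_Union_iff[OF basic_open_subset] that by blast+
   then have "?w e ~= 0" using in_basic_open[OF w] by blast
   then show ?thesis using e(1) Fg(2) by auto
  qed
  have e0W: "multiproj_pt e0 : ?W"
   using in_basic_open[OF w e0(1)] e0 k b g(4) Fg(2) by simp
  let ?ps = "%e. (?v e ^ 2 * FH e) / (?y e ^ 2 * Fg e)"
  let ?tht = "%e. (p i $ c * fst e $ b - p i $ b * fst e $ c) / ?v e"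
  have "(%e. ?y e ^ 2 * Fg e) : multihom s (2 * 0 + de2) (%j. 2 * (if j = i then 1 else 0) + (if j = i then nat (int A + ka) else 0))"
   by (intro multihom_mult multihom_power multihom_snd i Fg(1))
  moreover have "(%j. 2 * (if j = i then 1 else 0) + (if j = i then nat (int A + ka) else 0))
    = (%j. 2 * 0 + (if j = i then nat (int A + (ka + 2)) else 0))"
   using A(3) by (auto simp: fun_eq_iff nat_add_distrib)
  ultimately have den: "(%e. ?y e ^ 2 * Fg e) : multihom s (2 * 0 + de2) (%j. 2 * 0 + (if j = i then nat (int A + (ka + 2)) else 0))"
   by simp
  have num: "(%e. ?v e ^ 2 * FH e) : multihom s (2 * 1 + de1) (%j. 2 * 0 + (if j = i then nat (int A + (ka + 2)) else 0))"
   by (intro multihom_mult multihom_power multihom_fst FH(1))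
  have "sec_H p s d ?W ?ps"
  proof (rule sec_H_fraction[OF op num den])
   fix e assume "e : \<Union>?W"
   from W[OF this] show "?y e ^ 2 * Fg e ~= 0 & ?ps e = (?v e ^ 2 * FH e) / (?y e ^ 2 * Fg e)"
    using Fg(2) by simp
  qed (use de1 de2 in simp)
  moreover have "sec_ideal p s i ?W ?tht"
   unfolding sec_ideal_def
  proof (intro conjI ballI impI)
   show "sec_H p s 0 ?W ?tht"
   proof (rule sec_H_fraction[OF op multihom_diff[OF multihom_cmult[OF multihom_fst] multihom_cmult[OF multihom_fst]] multihom_fst[of k]])
    fix e assume "e : \<Union>?W"
    from W[OF this] show "?v e ~= 0 & ?tht e = (p i $ c * fst e $ b - p i $ b * fst e $ c) / ?v e" by simp
   qed simp
   fix e :: "'m coords" assume "proj_pt (fst e) = proj_pt (p i)"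
   then obtain r where "fst e = r *s p i" by (rule proj_pt_eqD)
   then show "?tht e = 0" by simp
  qed
  ultimately have "sec_2 p s d ?W ?ph"
  proof (rule sec_2_square[OF op i])
   fix e j assume "e : \<Union>?W" "j : {1..s}" "j ~= i"
   then show "proj_pt (fst e) ~= proj_pt (p j)" using u_zero_at(3) W by blast
  next
   fix e assume "e : \<Union>?W"
   from W[OF this] have e: "e : blowup_cone p s" "?v e ~= 0" "?y e ~= 0" "g (tau e) ~= 0" by blast+
   have t: "p i $ c * fst e $ b - p i $ b * fst e $ c = tau e None * ?y e"
    using tau_None[OF e(1), of b] by (simp add: minors_nth)
   show "?ph e = ?ps e * ?tht e ^ 2"
    unfolding t FH(2)[THEN bspec, OF e(1)] Fg(2)[THEN bspec, OF e(1)] using e(2-4) by (simp add: field_simps)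
  qed
  then show ?thesis using op e0W W by (intro exI[of _ ?W]) blast
 next
  case False
  \<comment> \<open>A negative degree in \<open>v\<close> leaves only \<open>H = 0\<close>, that is,
    the zero section.\<close>
  have H0: "H x = 0" for x using hom_weight_nonneg[OF H(1,3) wm_nonneg, of x] False by blast
  obtain Fg where Fg: "Fg : multihom s de2 (%j. if j = i then nat (int A2 + ka) else 0)"
   "ALL e:blowup_cone p s. Fg e = ?y e ^ A2 * g (tau e)"
   using A2[THEN spec, THEN mp, OF order_refl] by (elim bexE)
  let ?w = "%e :: 'm coords. u (($) (fst e)) * (?y e * Fg e)"
  have w: "?w : multihom s (du + (0 + de2)) (%j. 0 + ((if j = i then 1 else 0) + (if j = i then nat (int A2 + ka) else 0)))"
   by (intro multihom_mult u_multihom multihom_snd i Fg(1))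
  let ?W = "basic_open p s ?w"
  have op: "openin (zariski p s) ?W" by (rule openin_basic[OF w])
  have W: "u (($) (fst e)) ~= 0 & g (tau e) ~= 0" if "e : \<Union>?W" for e
  proof -
   have e: "e : blowup_cone p s" "multiproj_pt e : ?W" using in_Union_iff[OF basic_open_subset] that by blast+
   then have "?w e ~= 0" using in_basic_open[OF w] by blast
   then show ?thesis using e(1) Fg(2) by auto
  qed
  have e0W: "multiproj_pt e0 : ?W"
   using in_basic_open[OF w e0(1)] e0 b g(4) Fg(2) by simp
  have "sec_2 p s d ?W ?ph"
   using sec_2_zero[OF op, of d] by (simp add: H0)
  then show ?thesis using op e0W W by (intro exI[of _ ?W]) blast
 qed
qed

text \<open>The pullback of \<open>Q\<close> and its derivative in \<open>t\<close> vanish at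
  \<open>t = 0\<close>, first where the coefficient of \<open>p i\<close> is invertible and then
  everywhere by density; so \<open>t\<close> divides the pullback twice.\<close>

lemma double_zero_factor:
 assumes Q: "Q : PF" "hom (%_. 1) de Q" "Q (($) (p i)) = 0" "grad Q (($) (p i)) = (%_. 0)"
 obtains H where "H : PF" "ALL xi. Q (($) (vmod xi)) = xi None ^ 2 * H xi" "hom wl 2 H" "hom wm (de - 2) H"
proof -
 let ?R = "%xi. Q (($) (vmod xi))"
 have R: "?R : PF" by (rule PF_vec[OF Q(1) vmod_PF])
 obtain R1 where R1': "R1 : PF" "ALL xi. ?R xi = ?R (xi(None := 0)) + xi None * R1 xi"
  using PF_div_ex[OF R, of None] by (elim bexE)
 note R1 = R1'(1) R1'(2)[THEN spec]
 obtain H where H': "H : PF" "ALL xi. R1 xi = R1 (xi(None := 0)) + xi None * H xi"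
  using PF_div_ex[OF R1(1), of None] by (elim bexE)
 note H = H'(1) H'(2)[THEN spec]
 have scale: "Q (%k. r * x k) = r powi de * Q x" if "r ~= 0" for r x
  using homD[OF Q(2) that, of x] by (simp add: act_def)
 have van: "?R (xi(None := 0)) = 0" for xi
 proof (rule PF_dense[OF PF_upd[OF R] PF_var[of "Some c"], of "%_. 1"])
  fix xi :: "'m option => complex" assume "xi (Some c) ~= 0"
  moreover have "($) (vmod (xi(None := 0))) = (%k. xi (Some c) * p i $ k)" by (auto simp: vmod_eq)
  ultimately show "?R (xi(None := 0)) = 0" using Q(3) by (simp add: scale)
 qed simp
 have van1: "R1 (xi(None := 0)) = 0" for xi
 proof (rule PF_dense[OF PF_upd[OF R1(1)] PF_var[of "Some c"], of "%_. 1"])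
  fix xi :: "'m option => complex" assume x: "xi (Some c) ~= 0"
  let ?x = "xi (Some c)"
  let ?w = "%k. xpr xi $ k / ?x"
  have "((%z. ?x powi de * Q (%k. p i $ k + z * ?w k)) has_field_derivative ?x powi de * 0) (at 0)"
   by (intro DERIV_cmult grad_zero_deriv Q(1,4))
  moreover have "?x powi de * Q (%k. p i $ k + z * ?w k) = z * R1 (xi(None := z))" for z
  proof -
   have "?x powi de * Q (%k. p i $ k + z * ?w k) = Q (%k. ?x * (p i $ k + z * ?w k))"
    using scale[OF x] by simp
   also have "(%k. ?x * (p i $ k + z * ?w k)) = ($) (vmod (xi(None := z)))"
    using x by (auto simp: vmod_def xpr_def fun_eq_iff field_simps)
   also have "Q (($) (vmod (xi(None := z)))) = z * R1 (xi(None := z))"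
    using R1(2)[of "xi(None := z)"] van by simp
   finally show ?thesis .
  qed
  ultimately have d1: "((%z. z * R1 (xi(None := z))) has_field_derivative 0) (at 0)" by simp
  have line: "(%k. (xi(None := 0)) k + z * (if k = None then 1 else 0)) = xi(None := z)" for z by auto
  obtain D where D: "((%z. R1 (xi(None := z))) has_field_derivative D) (at 0)"
   using grad_deriv[OF R1(1), of "xi(None := 0)" "%k. if k = None then 1 else 0"] unfolding line by blast
  have "((%z. z * R1 (xi(None := z))) has_field_derivative (1 * R1 (xi(None := 0)) + D * 0)) (at 0)"
   by (rule DERIV_mult'[THEN DERIV_cong, OF DERIV_ident D]) simp
  from DERIV_unique[OF this d1] show "R1 (xi(None := 0)) = 0" by simp
 qed simp
 have eq: "?R xi = xi None ^ 2 * H xi" for xi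
  using R1(2)[of xi] H(2)[of xi] van[of xi] van1[of xi] by (simp add: power2_eq_square)
 have Hl: "hom wl 2 H" and Hm: "hom wm (de - 2) H"
 proof -
  have t: "(%xi. xi None ^ 2) : PF" by (rule PF_power[OF PF_var])
  have t1: "(%_. 1 :: complex) None ^ 2 ~= 0" by simp
  have e: "(%xi. H xi * xi None ^ 2) = ?R" using eq by (simp add: mult.commute)
  have "hom wl (2 + int 2 * wl None) (%xi. H xi * xi None ^ 2)"
   unfolding e by (simp add: hom_def vmod_act wl_def)
  then show "hom wl 2 H" by (rule hom_cancel[OF H(1) t t1 hom_power[OF hom_var]])
  have "hom wm ((de - 2) + int 2 * wm None) (%xi. H xi * xi None ^ 2)"
   unfolding e by (simp add: hom_def vmod_act wm_def vector_smult_component[abs_def] scale)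
  then show "hom wm (de - 2) H" by (rule hom_cancel[OF H(1) t t1 hom_power[OF hom_var]])
 qed
 show ?thesis by (rule that[OF H(1) _ Hl Hm]) (use eq in blast)
qed

lemma double_zero_section:
 assumes Q: "Q : PF" "hom (%_. 1) (d + int k * int du) Q" "Q (($) (p i)) = 0" "grad Q (($) (p i)) = (%_. 0)"
  and e0: "e0 : blowup_cone p s" "u (($) (fst e0)) ~= 0"
 shows "EX W. openin (zariski p s) W & multiproj_pt e0 : W & (ALL e:\<Union>W. u (($) (fst e)) ~= 0) &
  sec_2 p s d W (%e. Q (($) (fst e)) / u (($) (fst e)) ^ k)"
proof -
 obtain H where H: "H : PF" "ALL xi. Q (($) (vmod xi)) = xi None ^ 2 * H xi" "hom wl 2 H" "hom wm ((d + int k * int du) - 2) H"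
  by (rule double_zero_factor[OF Q])
 let ?g = "%xi. U xi ^ k"
 have g: "?g : PF" by (rule PF_power[OF U_PF])
 have gl: "hom wl 0 ?g" using hom_power[OF U_hom(1), of k] by simp
 have gm: "hom wm (int k * int du) ?g" by (rule hom_power[OF U_hom(2)])
 have H1: "hom wl (0 + 2) H" "hom wm (int k * int du + d - 2) H" using H(3,4) by (simp_all add: add.commute)
 have g0: "?g (tau e0) ~= 0" using e0 by (simp add: vmod_tau)
 obtain W where W: "openin (zariski p s) W" "multiproj_pt e0 : W"
  "ALL e:\<Union>W. u (($) (fst e)) ~= 0 & ?g (tau e) ~= 0" "sec_2 p s d W (%e. tau e None ^ 2 * H (tau e) / ?g (tau e))"
  using section_from_model[OF e0 H(1) H1 g gl gm g0] by (elim exE conjE)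
 have "sec_2 p s d W (%e. Q (($) (fst e)) / u (($) (fst e)) ^ k)"
 proof (rule sec_2_mono[OF W(4,1) order_refl])
  fix e assume "e : \<Union>W"
  then have "e : blowup_cone p s" using in_Union_iff[OF open_subset_blowup[OF W(1)]] by blast
  from vmod_tau[OF this] show "Q (($) (fst e)) / u (($) (fst e)) ^ k = tau e None ^ 2 * H (tau e) / ?g (tau e)"
   using H(2)[THEN spec, of "tau e"] by simp
 qed
 then show ?thesis using W by (intro exI[of _ W]) blast
qed

text \<open>Conversely, a section of this form has a double zero: differentiate along the lines through \<open>p i\<close>.\<close>

lemma double_zero_of_section:
 assumes P: "P : PF" "hom (%_. 1) de P"
  and sec: "!!e. e : blowup_cone p s ==> proj_pt (fst e) = proj_pt (p i) ==>
   EX W. multiproj_pt e : W & sec_2 p s d W (%e. P (($) (fst e)))"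
  and ab: "a ~= c"
 shows "P (($) (p i)) = 0" "grad P (($) (p i)) = (%_. 0)"
proof -
 have key: "P (($) (p i)) = 0 & ((%z. P (%k. p i $ k + z * w $ k)) has_field_derivative 0) (at 0)"
  if w: "w $ c = 0" "w ~= 0" for w
 proof -
  \<comment> \<open>Cox coordinates of the point of the exceptional divisor in direction
    \<open>w\<close>; setting the entry \<open>None\<close> to \<open>z\<close> moves along the line
    \<open>p i + z w\<close>.\<close>
  define xi where "xi = (%k. case k of None => 0 | Some b => if b = c then 1 else w $ b)"
  have x: "xpr (xi(None := z)) = w" for z using w(1) by (auto simp: xpr_def xi_def vec_eq_iff)
  have v: "vmod (xi(None := z)) = p i + z *s w" for z
   unfolding vmod_eq x by (simp add: xi_def)
  have xi0: "xi(None := 0) = xi" by (auto simp: xi_def)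
  have g: "good xi" using v[of 0] x[of 0] w(2) ui by (simp add: good_def xi0)
  have E: "proj_pt (fst (sigma xi)) = proj_pt (p i)" using v[of 0] by (simp add: sigma_def xi0)
  obtain W where W: "multiproj_pt (sigma xi) : W" "sec_2 p s d W (%e. P (($) (fst e)))"
   using sec[OF sigma_cone[OF g] E] by (elim exE conjE)
  have "reg 2 xi (%e. P (($) (fst e)))" by (rule reg_sec_2[OF W(2,1) g])
  then obtain G F where GF: "G : PF" "F : PF" "G xi ~= 0"
   "ALL et. G et ~= 0 --> P (($) (fst (sigma et))) * G et = et None ^ 2 * F et" by (rule regE)
  have line: "(%k. xi k + z * (if k = None then 1 else 0)) = xi(None := z)" for z
   by (auto simp: xi_def)
  obtain D where D: "((%z. G (xi(None := z))) has_field_derivative D) (at 0)"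
   using grad_deriv[OF GF(1), of xi "%k. if k = None then 1 else 0"] unfolding line by blast
  obtain E where E: "((%z. F (xi(None := z))) has_field_derivative E) (at 0)"
   using grad_deriv[OF GF(2), of xi "%k. if k = None then 1 else 0"] unfolding line by blast
  have G0: "G (xi(None := 0)) ~= 0" using GF(3) by (simp add: xi0)
  have q: "((%z. z ^ 2 * (F (xi(None := z)) / G (xi(None := z)))) has_field_derivative 0) (at 0)"
   using G0 by (auto intro!: derivative_eq_intros D E)
  have "isCont (%z. G (xi(None := z))) 0" by (rule DERIV_isCont[OF D])
  then have ev: "\<forall>\<^sub>F z in at 0. G (xi(None := z)) ~= 0"
   using G0 by (intro tendsto_imp_eventually_ne[of "%z. G (xi(None := z))"]) (auto simp: isCont_def)
  have ev': "\<forall>\<^sub>F z in nhds 0. G (xi(None := z)) ~= 0"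
   using ev G0 by (simp add: eventually_nhds_conv_at)
  have Pz: "z ^ 2 * (F (xi(None := z)) / G (xi(None := z))) = P (%k. p i $ k + z * w $ k)" if "G (xi(None := z)) ~= 0" for z
  proof -
   have "($) (fst (sigma (xi(None := z)))) = (%k. p i $ k + z * w $ k)" using v[of z] by (auto simp: sigma_def)
   then have "P (%k. p i $ k + z * w $ k) * G (xi(None := z)) = z ^ 2 * F (xi(None := z))"
    using GF(4)[THEN spec, of "xi(None := z)"] that by simp
   then show ?thesis using that by (simp add: field_simps)
  qed
  have evq: "\<forall>\<^sub>F z in nhds 0. z ^ 2 * (F (xi(None := z)) / G (xi(None := z))) = P (%k. p i $ k + z * w $ k)"
   by (rule eventually_mono[OF ev' Pz])
  have "((%z. P (%k. p i $ k + z * w $ k)) has_field_derivative 0) (at 0)"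
   by (rule iffD1[OF DERIV_cong_ev[OF refl evq refl] q])
  moreover have "P (($) (p i)) = 0" using Pz[OF G0] by simp
  ultimately show ?thesis by simp
 qed
 define w0 :: "complex ^ 'm" where "w0 = (\<chi> b. if b = a then 1 else 0)"
 have "w0 $ c = 0" "w0 $ a = 1" using ab by (simp_all add: w0_def)
 then have "w0 $ c = 0" "w0 ~= 0" by auto
 then show P0: "P (($) (p i)) = 0" using key by blast
 have scale: "P (%k. r * x k) = r powi de * P x" if "r ~= 0" for r x
  using homD[OF P(2) that, of x] by (simp add: act_def)
 \<comment> \<open>The directions with \<open>w $ c = 0\<close> leave out only that of
   \<open>p i\<close>, in which a form vanishing at \<open>p i\<close> has derivative zero by
   homogeneity.\<close>
 have dp: "(\<Sum>k\<in>UNIV. grad P (($) (p i)) k * p i $ k) = 0"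
 proof -
  have 1: "((%z. P (%k. p i $ k + z * p i $ k)) has_field_derivative (\<Sum>k\<in>UNIV. grad P (($) (p i)) k * p i $ k)) (at 0)"
   by (rule grad_deriv[OF P(1)])
  have 2: "((%z. 0) has_field_derivative (0::complex)) (at 0)" by simp
  have "((%z. P (%k. p i $ k + z * p i $ k)) has_field_derivative 0) (at 0)"
  proof (rule has_field_derivative_transform_within_open[OF 2, of "ball 0 1"])
   fix z :: complex assume "z : ball 0 1"
   then have "1 + z ~= 0" by (metis add_eq_0_iff2 dist_0_norm less_irrefl mem_ball norm_minus_cancel norm_one)
   from scale[OF this, of "($) (p i)"] show "0 = P (%k. p i $ k + z * p i $ k)"
    using P0 by (simp add: ring_distribs)
  qed auto
  from DERIV_unique[OF 1 this] show ?thesis .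
 qed
 have gk: "grad P (($) (p i)) k = 0" if "k ~= c" for k
 proof -
  define w :: "complex ^ 'm" where "w = (\<chi> b. if b = k then 1 else 0)"
  have "w $ c = 0" "w $ k = 1" using that by (simp_all add: w_def)
  then have "w $ c = 0" "w ~= 0" by auto
  then have 1: "((%z. P (%j. p i $ j + z * w $ j)) has_field_derivative 0) (at 0)" using key by blast
  have "((%z. P (%j. p i $ j + z * w $ j)) has_field_derivative (\<Sum>j\<in>UNIV. grad P (($) (p i)) j * w $ j)) (at 0)"
   by (rule grad_deriv[OF P(1)])
  from DERIV_unique[OF this 1] show ?thesis by (simp add: w_def sum_unit)
 qed
 have "(\<Sum>k\<in>UNIV. grad P (($) (p i)) k * p i $ k) = grad P (($) (p i)) c * p i $ c"
  by (subst sum.remove[of _ c]) (use gk in simp_all)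
 then have "grad P (($) (p i)) c = 0" using dp c by simp
 then show "grad P (($) (p i)) = (%_. 0)" using gk by (metis ext)
qed

end

text \<open>Quasi-compactness from the Nullstellensatz: only finitely many \<open>g i\<close> occur
  in an expression for a power of \<open>u x * x a\<close>, and these already cover.\<close>

lemma finite_subcover:
 fixes S :: "'k::finite set"
 assumes "!!i. i : A ==> g i : PF" "u : PF"
  and cov: "!!a x. a : S ==> u x ~= 0 ==> x a ~= 0 ==> EX i:A. g i x ~= 0"
 shows "EX J. finite J & J <= A & (ALL a:S. ALL x. u x ~= 0 --> x a ~= 0 --> (EX i:J. g i x ~= 0))"
proof -
 have "ALL a:S. EX J. finite J & J <= A & (ALL x. u x ~= 0 --> x a ~= 0 --> (EX i:J. g i x ~= 0))"
 proof
  fix a assume a: "a : S"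
  have "EX N. (%x. (u x * x a) ^ N) : gen_ideal A g"
   by (rule nullstellensatz[OF assms(1) PF_mult[OF assms(2) PF_var]]) (use cov[OF a] in auto)
  then obtain N where "(%x. (u x * x a) ^ N) : gen_ideal A g" by (elim exE)
  then obtain J c where J: "finite J" "J <= A" "ALL j:J. c j : PF" "(%x. (u x * x a) ^ N) = (%x. \<Sum>j\<in>J. c j x * g j x)"
   by (rule gen_idealE)
  have "EX i:J. g i x ~= 0" if "u x ~= 0" "x a ~= 0" for x
  proof (rule ccontr)
   assume "\<not> (EX i:J. g i x ~= 0)"
   then have "(\<Sum>j\<in>J. c j x * g j x) = 0" by simp
   then have "(u x * x a) ^ N = 0" using fun_cong[OF J(4), of x] by simp
   then show False using that by simp
  qed
  then show "EX J. finite J & J <= A & (ALL x. u x ~= 0 --> x a ~= 0 --> (EX i:J. g i x ~= 0))"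
   using J(1,2) by (intro exI[of _ J]) simp
 qed
 then obtain J where J: "ALL a:S. finite (J a) & J a <= A & (ALL x. u x ~= 0 --> x a ~= 0 --> (EX i:J a. g i x ~= 0))"
  unfolding bchoice_iff by (elim exE)
 show ?thesis
 proof (rule exI[of _ "\<Union>a\<in>S. J a"], intro conjI ballI allI impI)
  show "finite (\<Union>a\<in>S. J a)" using J finite[of S] by auto
  show "(\<Union>a\<in>S. J a) <= A" using J by auto
  fix a x assume a: "a : S" and x: "u x ~= 0" "x a ~= 0"
  have "EX i:J a. g i x ~= 0" using bspec[OF J a] x by simp
  then show "EX i:(\<Union>a\<in>S. J a). g i x ~= 0" using a by blast
 qed
qed

text \<open>Since covers are indexed by points, \<open>f (x, multiproj_pt e, e)\<close> is a
  function of \<open>e\<close> for each \<open>x\<close>. By the cocycle rule the cochain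
  \<open>ka e - f (x, multiproj_pt e, e)\<close> has coboundary \<open>f\<close>; the condition on
  \<open>ka\<close> makes its members sections near each \<open>x\<close>.\<close>

definition splits :: "('m::finite coords set set => ('m coords => complex) => bool) => 'm coords set topology =>
  ('m coords set \<times> 'm coords set \<times> 'm coords => complex) => 'm coords set set => ('m coords => complex) => bool" where
 "splits sec T f V ka \<longleftrightarrow> (ALL x:V. EX W. openin T W & x : W & sec W (%e. ka e - f (x, multiproj_pt e, e)))"

lemma regular_quotient_extend:
 assumes F: "F : PF" "H : PF" "H' : PF" and g: "g : PF" "g' : PF" and G: "G : PF" "G b ~= 0"
  and eq: "!!x. G x ~= 0 ==> g x ~= 0 & g' x ~= 0 & F x / (g x * g' x) ^ k = H' x / g' x ^ K - H x / g x ^ K"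
  and x: "g x ~= 0" "g' x ~= 0"
 shows "F x / (g x * g' x) ^ k = H' x / g' x ^ K - H x / g x ^ K"
proof -
 have 1: "(%x. F x * (g x * g' x) ^ K) : PF" by (intro PF_mult PF_power F g)
 have 2: "(%x. (H' x * g x ^ K - H x * g' x ^ K) * (g x * g' x) ^ k) : PF" by (intro PF_mult PF_diff PF_power F g)
 have "F x * (g x * g' x) ^ K = (H' x * g x ^ K - H x * g' x ^ K) * (g x * g' x) ^ k"
 proof (rule PF_eq_dense[OF 1 2 G])
  fix x assume "G x ~= 0"
  from eq[OF this] have nz: "g x ~= 0" "g' x ~= 0" and e: "F x / (g x * g' x) ^ k = H' x / g' x ^ K - H x / g x ^ K" by auto
  have "F x = (H' x / g' x ^ K - H x / g x ^ K) * (g x * g' x) ^ k"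
   using e nz by (simp add: divide_eq_eq)
  then show "F x * (g x * g' x) ^ K = (H' x * g x ^ K - H x * g' x ^ K) * (g x * g' x) ^ k"
   using nz by (simp add: power_mult_distrib field_simps)
 qed
 then show ?thesis using x by (simp add: power_mult_distrib field_simps)
qed

section \<open>Cocycles and sections on a chart\<close>

lemma cocycleE:
 assumes "f : cech_cocycles T sec"
 obtains N where "ALL x:topspace T. openin T (N x) & x : N x"
  "ALL x:topspace T. ALL y:topspace T. sec (N x \<inter> N y) (%e. f (x, y, e))"
  "ALL x:topspace T. ALL y:topspace T. ALL z:topspace T. ALL e:\<Union>(N x \<inter> N y \<inter> N z). f (x, y, e) + f (y, z, e) = f (x, z, e)"
 using assms unfolding cech_cocycles_def pointed_cover_def mem_Collect_eq by (elim exE conjE)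

lemma two_others:
 fixes c :: "'m::finite"
 assumes "CARD('m) >= 3"
 obtains a b where "a ~= c" "b ~= c" "b ~= a"
proof -
 have "card (UNIV - {c} :: 'm set) >= 2" using assms by (simp add: card_Diff_singleton)
 then have "\<not> card (UNIV - {c} :: 'm set) <= Suc 0" by linarith
 then have "\<not> (ALL a:UNIV - {c}. ALL b:UNIV - {c}. a = b)" unfolding card_le_Suc0_iff_eq[OF finite] .
 then obtain a b where "a ~= c" "b ~= c" "a ~= b" by auto
 then show ?thesis using that by metis
qed

context chart begin

lemma reg_weaken:
 assumes "reg r ze ph"
 shows "EX G:PF. EX F:PF. G ze ~= 0 & (ALL et. G et ~= 0 --> Q et --> ph (sigma et) * G et = et None ^ r * F et)"
proof -
 obtain G F where *: "G : PF" "F : PF" "G ze ~= 0" "ALL et. G et ~= 0 --> ph (sigma et) * G et = et None ^ r * F et"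
  using assms by (rule regE)
 show ?thesis
  by (rule bexI[OF _ *(1)], rule bexI[OF _ *(2)], intro conjI allI impI, rule *(3), rule *(4)[THEN spec, THEN mp])
qed

text \<open>The blow-up of an affine neighbourhood of \<open>p i\<close> has no first cohomology with coefficients in
 the sections vanishing twice along the exceptional divisor.\<close>

lemma chart_splitting:
 assumes card: "CARD('m) >= 3" and f: "f : cech_cocycles (zariski p s) (sec_2 p s d)"
 shows "EX ka. splits (sec_2 p s d) (zariski p s) f (basic_open p s (%e. u (($) (fst e)))) ka"
proof -
 obtain N where N0: "ALL x:topspace (zariski p s). openin (zariski p s) (N x) & x : N x"
  "ALL x:topspace (zariski p s). ALL y:topspace (zariski p s). sec_2 p s d (N x \<inter> N y) (%e. f (x, y, e))"
  "ALL x:topspace (zariski p s). ALL y:topspace (zariski p s). ALL z:topspace (zariski p s).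
    ALL e:\<Union>(N x \<inter> N y \<inter> N z). f (x, y, e) + f (y, z, e) = f (x, z, e)"
  using f by (rule cocycleE)
 let ?X = "blowup p s"
 have N: "openin (zariski p s) (N x)" "x : N x" if "x : ?X" for x
  using N0(1) that by (simp_all add: topspace_zariski)
 have fsec: "sec_2 p s d (N x \<inter> N y) (%e. f (x, y, e))" if "x : ?X" "y : ?X" for x y
  using N0(2) that by (simp add: topspace_zariski)
 have fcoc: "f (x, y, e) + f (y, z, e) = f (x, z, e)"
  if "x : ?X" "y : ?X" "z : ?X" "e : \<Union>(N x \<inter> N y \<inter> N z)" for x y z e
  using N0(3)[unfolded topspace_zariski, THEN bspec, OF that(1), THEN bspec, OF that(2), THEN bspec, OF that(3), THEN bspec, OF that(4)] .
 define pt where "pt = (%xi. multiproj_pt (sigma xi))"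
 have ptX: "pt xi : ?X" if "good xi" for xi using multiproj_in_blowup[OF sigma_cone[OF that]] by (simp add: pt_def)
 define A where "A = {xi. good xi}"
 \<comment> \<open>At each good point a function homogeneous for both actions is chosen whose
   nonvanishing stays inside the given cover; its factor \<open>U\<close> is recorded because
   \<open>cover_setting\<close> asks for divisibility by \<open>u\<close>.\<close>
 define Pr where "Pr = (%xi (g, a, b, g'). g : PF & hom wl a g & hom wm b g & g xi ~= 0 &
  (ALL et. g et ~= 0 --> good et & pt et : N (pt xi)) & g' : PF & (ALL et. g et = U et * g' et))"
 have "ALL xi:A. EX t. Pr xi t"
 proof
  fix xi assume "xi : A"
  then have xi: "good xi" by (simp add: A_def)
  have W: "multiproj_pt (sigma xi) : N (pt xi)" using N(2)[OF ptX[OF xi]] by (simp add: pt_def)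
  obtain a F k b where F: "a ~= c" "F : multihom s k b" "U xi * xi (Some a) * F (sigma xi) ~= 0"
   "ALL et. U et * et (Some a) * F (sigma et) ~= 0 --> good et & multiproj_pt (sigma et) : N (pt xi)"
   by (rule nbhd_function[OF N(1)[OF ptX[OF xi]] W xi])
  have 1: "(%et. U et * et (Some a) * F (sigma et)) : PF" "(%et. et (Some a) * F (sigma et)) : PF"
   by (intro PF_mult U_PF PF_var poly_sigma multihom_poly[OF F(2)])+
  have 2: "hom wl (0 + wl (Some a) + int (b i)) (%et. U et * et (Some a) * F (sigma et))"
   by (intro hom_mult U_hom hom_var multihom_sigma[OF F(2)])
  have 3: "hom wm (int du + wm (Some a) + (int k + (\<Sum>j\<in>{1..s} - {i}. int (b j)))) (%et. U et * et (Some a) * F (sigma et))"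
   by (intro hom_mult U_hom hom_var multihom_sigma[OF F(2)])
  have 4: "ALL et. U et * et (Some a) * F (sigma et) = U et * (et (Some a) * F (sigma et))" by (simp add: mult.assoc)
  show "EX t. Pr xi t"
   by (rule exI[of _ "(%et. U et * et (Some a) * F (sigma et), 0 + wl (Some a) + int (b i),
     int du + wm (Some a) + (int k + (\<Sum>j\<in>{1..s} - {i}. int (b j))), %et. et (Some a) * F (sigma et))"])
     (unfold Pr_def prod.case, intro conjI 1 2 3 4 F(3), unfold pt_def, rule F(4)[unfolded pt_def])
 qed
 then obtain T where T: "ALL xi:A. Pr xi (T xi)" unfolding bchoice_iff by (elim exE)
 define g where "g = (%xi. fst (T xi))"
 define gal where "gal = (%xi. fst (snd (T xi)))"
 define gam where "gam = (%xi. fst (snd (snd (T xi))))"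
 define g' where "g' = (%xi. snd (snd (snd (T xi))))"
 have Tg: "Pr xi (g xi, gal xi, gam xi, g' xi)" if "xi : A" for xi
  using bspec[OF T that] by (simp add: g_def gal_def gam_def g'_def)
 have g: "g xi : PF" "hom wl (gal xi) (g xi)" "hom wm (gam xi) (g xi)" "g xi xi ~= 0"
  "g' xi : PF" and gU: "ALL et. g xi et = U et * g' xi et"
  and gN': "ALL et. g xi et ~= 0 --> good et & pt et : N (pt xi)" if "xi : A" for xi
 proof -
  note * = Tg[OF that, unfolded Pr_def prod.case]
  show "g xi : PF" by (rule *[THEN conjunct1])
  note * = *[THEN conjunct2]
  show "hom wl (gal xi) (g xi)" by (rule *[THEN conjunct1])
  note * = *[THEN conjunct2]
  show "hom wm (gam xi) (g xi)" by (rule *[THEN conjunct1])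
  note * = *[THEN conjunct2]
  show "g xi xi ~= 0" by (rule *[THEN conjunct1])
  note * = *[THEN conjunct2]
  show "ALL et. g xi et ~= 0 --> good et & pt et : N (pt xi)" by (rule *[THEN conjunct1])
  note * = *[THEN conjunct2]
  show "g' xi : PF" by (rule *[THEN conjunct1])
  show "ALL et. g xi et = U et * g' xi et" by (rule *[THEN conjunct2])
 qed
 have gN: "good et & pt et : N (pt xi)" if "xi : A" "g xi et ~= 0" for xi et
  by (rule gN'[OF that(1), THEN spec, THEN mp, OF that(2)])
 define S where "S = Some ` (UNIV - {c})"
 have SA: "et : A" if aS: "a : S" and et: "U et ~= 0" "et a ~= 0" for a et
 proof -
  obtain b where b: "a = Some b" "b ~= c" using aS by (auto simp: S_def)
  then have "xpr et $ b ~= 0" using et(2) by (simp add: xpr_def)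
  then have "xpr et ~= 0" by auto
  then show ?thesis using et(1) by (simp add: A_def good_def)
 qed
 have "EX J. finite J & J <= A & (ALL a:S. ALL x. U x ~= 0 --> x a ~= 0 --> (EX i:J. g i x ~= 0))"
  by (rule finite_subcover[OF g(1) U_PF]) (use SA g(4) in blast)+
 then obtain J where J: "finite J" "J <= A" "ALL a:S. ALL x. U x ~= 0 --> x a ~= 0 --> (EX i:J. g i x ~= 0)"
  by (elim exE conjE)
 have JA: "j : A" "good j" "pt j : ?X" if "j : J" for j
  using J(2) that ptX by (auto simp: A_def)
 have tN: "(%et. et None ^ 2) : PF" for et :: "'m option => complex" by (rule PF_power[OF PF_var])
 have fr: "EX k. EX F:PF. ALL et. g j et * g l et ~= 0 --> f (pt j, pt l, sigma et) * (g j et * g l et) ^ k = et None ^ 2 * F et"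
  if jl: "j : J" "l : J" for j l
 proof (rule regular_fraction)
  show "(%et. g j et * g l et) : PF" by (intro PF_mult g(1) JA jl)
  fix ze assume "g j ze * g l ze ~= 0"
  then have nz: "g j ze ~= 0" "g l ze ~= 0" by auto
  have ze: "good ze" "multiproj_pt (sigma ze) : N (pt j) \<inter> N (pt l)"
   using gN[OF JA(1)[OF jl(1)] nz(1)] gN[OF JA(1)[OF jl(2)] nz(2)] by (simp_all add: pt_def)
  have "reg 2 ze (%e. f (pt j, pt l, e))"
   by (rule reg_sec_2[OF fsec[OF JA(3)[OF jl(1)] JA(3)[OF jl(2)]] ze(2,1)])
  then show "EX G:PF. EX F:PF. G ze ~= 0 & (ALL et. G et ~= 0 --> g j et * g l et ~= 0 -->
    f (pt j, pt l, sigma et) * G et = et None ^ 2 * F et)"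
   by (rule reg_weaken)
 qed
 \<comment> \<open>Division by \<open>t ^ 2\<close> turns the cocycle into one of regular functions,
   of weight \<open>2\<close> for \<open>wl\<close> and \<open>d - 2\<close> for
   \<open>wm\<close>.\<close>
 define q where "q = (%j l et. f (pt j, pt l, sigma et) / et None ^ 2)"
 define G where "G = (%et. et None * (\<Prod>a\<in>S. et a) * U et * (\<Prod>j\<in>J. g j et))"
 have GPF: "G : PF" unfolding G_def by (intro PF_mult PF_prod PF_var U_PF g(1) JA)
 have G0: "et None ~= 0" "a : S ==> et a ~= 0" "U et ~= 0" "j : J ==> g j et ~= 0" if "G et ~= 0" for et a j
  using that J(1) by (auto simp: G_def)
 \<comment> \<open>Cox coordinates of \<open>p i\<close> itself with \<open>x' = 0\<close>: here
   \<open>U\<close> does not vanish although all coordinates in \<open>S\<close> do.\<close>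
 define x0 where "x0 = (%k. if k = Some c then 1 else (0::complex))"
 have Ux0: "U x0 ~= 0"
 proof -
  have "vmod x0 = p i" by (simp add: vmod_def x0_def vec_eq_iff)
  then show ?thesis using ui by simp
 qed
 have Gnz: "EX x. G x ~= 0"
 proof -
  have a: "(%_. 1 :: complex) None * (\<Prod>a\<in>S. (%_. 1) a) ~= 0" by simp
  have b: "EX x. (\<Prod>j\<in>J. g j x) ~= 0"
   by (rule PF_prod_nonzero[OF J(1)]) (use g(1,4) JA(1) in blast)+
  have 1: "(%et. et None * (\<Prod>a\<in>S. et a)) : PF" by (intro PF_mult PF_prod PF_var)
  have 2: "EX x. x None * (\<Prod>a\<in>S. x a) ~= 0 & U x ~= 0" by (rule PF_domain[OF 1 U_PF a Ux0])
  have 3: "(%et. et None * (\<Prod>a\<in>S. et a) * U et) : PF" by (intro PF_mult PF_prod PF_var U_PF)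
  have 4: "(%x. \<Prod>j\<in>J. g j x) : PF" by (intro PF_prod g(1) JA)
  obtain y where y: "y None * (\<Prod>a\<in>S. y a) * U y ~= 0" using 2 by auto
  obtain z where z: "(\<Prod>j\<in>J. g j z) ~= 0" using b by auto
  have "EX x. x None * (\<Prod>a\<in>S. x a) * U x ~= 0 & (\<Prod>j\<in>J. g j x) ~= 0" by (rule PF_domain[OF 3 4 y z])
  then obtain x where "x None * (\<Prod>a\<in>S. x a) * U x ~= 0" "(\<Prod>j\<in>J. g j x) ~= 0" by (elim exE conjE)
  then show ?thesis unfolding G_def by (intro exI[of _ x]) simp
 qed
 have pts: "sigma et : \<Union>(N (pt j) \<inter> N (pt l))" if "G et ~= 0" "j : J" "l : J" for et j l
 proof -
  have "pt et : N (pt j) \<inter> N (pt l)" using gN[OF JA(1)] G0(4)[OF that(1)] that(2,3) by simp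
  then show ?thesis using multiproj_pt_self[of "sigma et"] unfolding pt_def by blast
 qed
 have fhom: "f (pt j, pt l, rescale r ga e) = r powi d * f (pt j, pt l, e)"
  if "j : J" "l : J" "e : \<Union>(N (pt j) \<inter> N (pt l))" "r ~= 0" "!!i. ga i ~= 0" for j l e r ga
 proof (rule sec_H_homogeneous[OF sec_2_imp_sec_H[OF fsec]])
  show "N (pt j) \<inter> N (pt l) <= blowup p s" using open_subset_blowup[OF N(1)[OF JA(3)[OF that(1)]]] by blast
 qed (use that JA in auto)
 have cov: "EX j:J. g j x ~= 0" if "a : S" "U x ~= 0" "x a ~= 0" for a x using J(3) that by blast
 interpret hom_cocycle_setting J g U G S q wl gal 2
 proof unfold_locales
  fix i j assume ij: "i : J" "j : J"
  obtain k F where F: "F : PF" "ALL et. g i et * g j et ~= 0 --> f (pt i, pt j, sigma et) * (g i et * g j et) ^ k = et None ^ 2 * F et"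
   using fr[OF ij] by (elim exE bexE)
  show "EX k. EX F:PF. ALL x. G x ~= 0 --> q i j x * (g i x * g j x) ^ k = F x"
  proof (rule exI[of _ k], rule bexI[OF _ F(1)], intro allI impI)
   fix x assume x: "G x ~= 0"
   have "f (pt i, pt j, sigma x) * (g i x * g j x) ^ k = x None ^ 2 * F x"
    using F(2)[THEN spec, of x] G0(4)[OF x] ij by simp
   then show "q i j x * (g i x * g j x) ^ k = F x" using G0(1)[OF x] by (simp add: q_def field_simps)
  qed
 next
  fix i j l x assume ij: "i : J" "j : J" "l : J" and x: "G x ~= 0"
  have "pt x : N (pt i) \<inter> N (pt j) \<inter> N (pt l)" using gN[OF JA(1)] G0(4)[OF x] ij by simp
  then have "sigma x : \<Union>(N (pt i) \<inter> N (pt j) \<inter> N (pt l))" using multiproj_pt_self[of "sigma x"] unfolding pt_def by blast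
  from fcoc[OF JA(3)[OF ij(1)] JA(3)[OF ij(2)] JA(3)[OF ij(3)] this]
  show "q i j x + q j l x = q i l x" by (simp add: q_def flip: add_divide_distrib)
 next
  fix c :: complex and x assume c: "c ~= 0" and x: "G x ~= 0"
  have "hom wl (wl None + (\<Sum>a\<in>S. wl a) + 0 + (\<Sum>j\<in>J. gal j)) G"
   unfolding G_def by (intro hom_mult hom_prod hom_var U_hom g(2) JA)
  from homD[OF this c, of x] show "G (act wl c x) ~= 0" using x c by simp
 next
  fix i j and r :: complex and x assume ij: "i : J" "j : J" and r: "r ~= 0" and x: "G x ~= 0"
  have "f (pt i, pt j, sigma (act wl r x)) = 1 powi d * f (pt i, pt j, sigma x)"
   unfolding sigma_act(1)[OF r] by (rule fhom[OF ij pts[OF x ij]]) (use r in auto)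
  moreover have "act wl r x None = x None / r" by (simp add: act_def wl_def power_int_minus field_simps)
  ultimately show "q i j (act wl r x) = r powi 2 * q i j x"
   using r by (simp add: q_def power_divide)
 next
  fix j assume "j : J"
  then have jA: "j : A" by (rule JA(1))
  have "ALL x. g j x = U x * g' j x" by (rule gU[OF jA])
  then show "EX g':PF. ALL x. g j x = U x * g' x" by (rule bexI[OF _ g(5)[OF jA]])
 next
  fix a x assume "a : S" "U x ~= 0" "x a ~= 0"
  then show "EX j:J. g j x ~= 0" by (rule cov)
 next
  show "EX x. G x ~= 0" by (rule Gnz)
 qed (use J(1) g(1,2) JA U_PF GPF G0 in \<open>auto\<close>)
 have hm: "q i j (act wm r x) = r powi (d - 2) * q i j x" if ij: "i : J" "j : J" and r: "r ~= 0" and x: "G x ~= 0" for i j r x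
 proof -
  have "f (pt i, pt j, sigma (act wm r x)) = r powi d * f (pt i, pt j, sigma x)"
   unfolding sigma_act(2)[OF r] by (rule fhom[OF ij pts[OF x ij]]) (use r in auto)
  moreover have "act wm r x None = r * x None" by (simp add: act_def wm_def)
  ultimately show ?thesis using r by (simp add: q_def power_mult_distrib power_int_diff)
 qed
 have Gm: "G (act wm r x) ~= 0" if r: "r ~= 0" and x: "G x ~= 0" for r x
 proof -
  have "hom wm (wm None + (\<Sum>a\<in>S. wm a) + int du + (\<Sum>j\<in>J. gam j)) G"
   unfolding G_def by (intro hom_mult hom_prod hom_var U_hom g(3) JA)
  from homD[OF this r, of x] show ?thesis using x r by simp
 qed
 have triv1: "triv (%x. 1)"
 proof -
  obtain a b where a: "a ~= c" and b: "b ~= c" "b ~= a" by (rule two_others[OF card])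
  show ?thesis
  \<comment> \<open>In dimension at least 3 a third coordinate is available. In the plane
    \<open>S\<close> has only two elements, and the positive weight of \<open>q\<close> for
    \<open>wl\<close> takes over.\<close>
  proof (cases "EX c'. c' ~= c & c' ~= a & c' ~= b")
   case True
   then obtain c' where "c' ~= c" "c' ~= a" "c' ~= b" by blast
   then show ?thesis using a b Ux0
    by (intro triv_one_geometric[of "Some a" "Some b" "Some c'" x0]) (auto simp: S_def x0_def)
  next
   case False
   show ?thesis
   proof (rule triv_one_weight[of "Some a" "Some b"])
    fix k assume k: "k ~= Some a" "k ~= Some b"
    show "wl k <= 0"
    proof (cases k)
     case (Some e) then have "e = c" using k False by auto
     then show ?thesis using Some by (simp add: wl_def)
    qed (simp add: wl_def)
   qed (use a b U_hom in \<open>auto simp: S_def wl_def\<close>)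
  qed
 qed
 obtain K H where H: "!!j. j : J ==> H j : cfun.span (mon ` {al. wt wl al = 2 + int K * gal j & wt wm al = (d - 2) + int K * gam j})"
  and Hq: "!!i j x. i : J ==> j : J ==> G x ~= 0 ==> q i j x = H j x / g j x ^ K - H i x / g i x ^ K"
  by (rule homogeneous_splitting[OF triv1 g(3)[OF JA(1)] Gm hm]) (assumption | rule that)+
 have HPF: "H j : PF" if "j : J" for j using H[OF that] span_mono_PF by blast
 have Hl: "hom wl (int K * gal j + 2) (H j)" if "j : J" for j
  using hom_span[of "H j" wl "2 + int K * gal j"] H[OF that] cfun.span_mono[of "mon ` {al. wt wl al = 2 + int K * gal j & wt wm al = (d - 2) + int K * gam j}" "mon ` {al. wt wl al = 2 + int K * gal j}"]
  by (auto simp: add.commute)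
 have Hm: "hom wm (int K * gam j + d - 2) (H j)" if "j : J" for j
  using hom_span[of "H j" wm "(d - 2) + int K * gam j"] H[OF that] cfun.span_mono[of "mon ` {al. wt wl al = 2 + int K * gal j & wt wm al = (d - 2) + int K * gam j}" "mon ` {al. wt wm al = (d - 2) + int K * gam j}"]
  by (auto simp: algebra_simps)
 define ps where "ps = (%j e. tau e None ^ 2 * H j (tau e) / g j (tau e) ^ K)"
 have split: "ps l e - ps j e = f (pt j, pt l, e)"
  if jl: "j : J" "l : J" and e: "e : blowup_cone p s" "g j (tau e) ~= 0" "g l (tau e) ~= 0" "u (($) (fst e)) ~= 0" for j l e
 proof -
  obtain k F where F: "F : PF" "ALL et. g j et * g l et ~= 0 --> f (pt j, pt l, sigma et) * (g j et * g l et) ^ k = et None ^ 2 * F et"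
   using fr[OF jl] by (elim exE bexE)
  obtain b where b: "G b ~= 0" using Gnz by (elim exE)
  have quo: "F (tau e) / (g j (tau e) * g l (tau e)) ^ k = H l (tau e) / g l (tau e) ^ K - H j (tau e) / g j (tau e) ^ K"
  proof (rule regular_quotient_extend[OF F(1) HPF[OF jl(1)] HPF[OF jl(2)] g(1)[OF JA(1)[OF jl(1)]] g(1)[OF JA(1)[OF jl(2)]] GPF b _ e(2,3)])
   fix x assume x: "G x ~= 0"
   have nz: "g j x ~= 0" "g l x ~= 0" using G0(4)[OF x] jl by auto
   have "f (pt j, pt l, sigma x) * (g j x * g l x) ^ k = x None ^ 2 * F x"
    using F(2)[THEN spec, of x] nz by simp
   then have "q j l x = F x / (g j x * g l x) ^ k" using G0(1)[OF x] nz by (simp add: q_def field_simps)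
   then show "g j x ~= 0 & g l x ~= 0 & F x / (g j x * g l x) ^ k = H l x / g l x ^ K - H j x / g j x ^ K"
    using Hq[OF jl x] nz by simp
  qed
  have "f (pt j, pt l, sigma (tau e)) * (g j (tau e) * g l (tau e)) ^ k = tau e None ^ 2 * F (tau e)"
   using F(2)[THEN spec, of "tau e"] e(2,3) by simp
  then have "f (pt j, pt l, sigma (tau e)) = tau e None ^ 2 * (F (tau e) / (g j (tau e) * g l (tau e)) ^ k)"
   using e(2,3) by (simp add: field_simps)
  also have "\<dots> = ps l e - ps j e" unfolding quo ps_def by (simp add: right_diff_distrib)
  finally have 1: "f (pt j, pt l, sigma (tau e)) = ps l e - ps j e" .
  obtain ga where ga: "ALL j. ga j ~= 0" "e = rescale 1 ga (sigma (tau e))" by (rule sigma_tau[OF e(1,4)])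
  have "pt (tau e) : N (pt j) \<inter> N (pt l)" using gN[OF JA(1)[OF jl(1)] e(2)] gN[OF JA(1)[OF jl(2)] e(3)] by simp
  then have "sigma (tau e) : \<Union>(N (pt j) \<inter> N (pt l))" using multiproj_pt_self[of "sigma (tau e)"] unfolding pt_def by blast
  then have "f (pt j, pt l, rescale 1 ga (sigma (tau e))) = 1 powi d * f (pt j, pt l, sigma (tau e))"
   using ga(1) by (intro fhom jl) auto
  then have "f (pt j, pt l, e) = f (pt j, pt l, sigma (tau e))" using ga(2) by simp
  then show ?thesis using 1 by simp
 qed
 \<comment> \<open>The function \<open>ps j e + f (pt j, multiproj_pt e, e)\<close> is the same for
   all \<open>j\<close> with \<open>g j (tau e)\<close> nonzero; \<open>sel\<close> picks one such
   \<open>j\<close>.\<close>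
 define sel where "sel = (%e. SOME j. j : J & g j (tau e) ~= 0)"
 define ka where "ka = (%e. ps (sel e) e + f (pt (sel e), multiproj_pt e, e))"
 have inN: "multiproj_pt e : N (pt j)" if "j : J" "e : blowup_cone p s" "g j (tau e) ~= 0" "u (($) (fst e)) ~= 0" for j e
  using gN[OF JA(1)[OF that(1)] that(3)] multiproj_sigma_tau[OF that(2,4)] by (simp add: pt_def)
 have ka: "ka e = ps j e + f (pt j, multiproj_pt e, e)"
  if j: "j : J" and e: "e : blowup_cone p s" "g j (tau e) ~= 0" "u (($) (fst e)) ~= 0" for j e
 proof -
  let ?l = "sel e"
  have l: "?l : J & g ?l (tau e) ~= 0" unfolding sel_def by (rule someI[of _ j]) (use j e in simp)
  have X: "multiproj_pt e : ?X" by (rule multiproj_in_blowup[OF e(1)])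
  have "multiproj_pt e : N (pt j) \<inter> N (pt ?l) \<inter> N (multiproj_pt e)"
   using inN[OF j e] inN[of ?l e] l e N(2)[OF X] by simp
  then have "e : \<Union>(N (pt j) \<inter> N (pt ?l) \<inter> N (multiproj_pt e))" using multiproj_pt_self[of e] by blast
  from fcoc[OF JA(3)[OF j] JA(3) X this] l
  have "f (pt j, pt ?l, e) + f (pt ?l, multiproj_pt e, e) = f (pt j, multiproj_pt e, e)" by simp
  moreover have "ps ?l e - ps j e = f (pt j, pt ?l, e)" using split[OF j, of ?l e] l e by simp
  ultimately show ?thesis unfolding ka_def by (simp add: algebra_simps)
 qed
 have "splits (sec_2 p s d) (zariski p s) f (basic_open p s (%e. u (($) (fst e)))) ka"
  unfolding splits_def
 proof
  fix x assume x: "x : basic_open p s (%e. u (($) (fst e)))"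
  then have "x : ?X" by (simp add: basic_open_def)
  then obtain e0 where e0: "e0 : x" "e0 : blowup_cone p s" "x = multiproj_pt e0" by (rule blowup_point)
  have u0: "u (($) (fst e0)) ~= 0" using x e0(1) by (simp add: basic_open_def)
  obtain a where a: "xpr (tau e0) $ a ~= 0" using xpr_tau_nz[OF e0(2)] by (auto simp: vec_eq_iff)
  then have "a ~= c" "tau e0 (Some a) ~= 0" by (auto simp: xpr_def split: if_splits)
  then have "EX j:J. g j (tau e0) ~= 0" using u0 by (intro cov[of "Some a"]) (auto simp: S_def vmod_tau[OF e0(2)])
  then obtain j where j: "j : J" "g j (tau e0) ~= 0" by (elim bexE)
  \<comment> \<open>The exponent \<open>Suc K\<close> instead of \<open>K\<close> lets nonvanishing
    of the denominator imply that of \<open>g j\<close> also for \<open>K = 0\<close>.\<close>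
  have gK: "(%et. g j et ^ Suc K) : PF" "hom wl (int (Suc K) * gal j) (%et. g j et ^ Suc K)"
    "hom wm (int (Suc K) * gam j) (%et. g j et ^ Suc K)"
   by (intro PF_power hom_power g(1-3) JA j(1))+
  have gK0: "g j (tau e0) ^ Suc K ~= 0" using j(2) by simp
  have HK: "(%et. H j et * g j et) : PF" by (intro PF_mult HPF g(1) JA j(1))
  have HKl: "hom wl (int (Suc K) * gal j + 2) (%et. H j et * g j et)"
   using hom_mult[OF Hl[OF j(1)] g(2)[OF JA(1)[OF j(1)]]] by (simp add: algebra_simps)
  have HKm: "hom wm (int (Suc K) * gam j + d - 2) (%et. H j et * g j et)"
   using hom_mult[OF Hm[OF j(1)] g(3)[OF JA(1)[OF j(1)]]] by (simp add: algebra_simps)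
  obtain W where W: "openin (zariski p s) W" "multiproj_pt e0 : W" "ALL e:\<Union>W. u (($) (fst e)) ~= 0 & g j (tau e) ^ Suc K ~= 0"
   "sec_2 p s d W (%e. tau e None ^ 2 * (H j (tau e) * g j (tau e)) / g j (tau e) ^ Suc K)"
   using section_from_model[OF e0(2) u0 HK HKl HKm gK gK0] by (elim exE conjE)
  let ?W = "W \<inter> (N (pt j) \<inter> N x)"
  have op: "openin (zariski p s) ?W" by (intro openin_Int W(1) N JA j \<open>x : ?X\<close>)
  have xW: "x : ?W" using W(2) e0(3) inN[OF j(1) e0(2) j(2) u0] N(2)[OF \<open>x : ?X\<close>] by simp
  have nz: "u (($) (fst e)) ~= 0" "g j (tau e) ~= 0" if "e : \<Union>?W" for e
  proof -
   have "e : \<Union>W" using that by blast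
   then have "u (($) (fst e)) ~= 0 & g j (tau e) ^ Suc K ~= 0" using W(3) by (rule bspec[rotated])
   then show "u (($) (fst e)) ~= 0" "g j (tau e) ~= 0" by auto
  qed
  have s1: "sec_2 p s d ?W (ps j)"
   by (rule sec_2_mono[OF W(4) op]) (use nz in \<open>auto simp: ps_def\<close>)
  have s2: "sec_2 p s d ?W (%e. f (pt j, x, e))"
   by (rule sec_2_mono[OF fsec[OF JA(3)[OF j(1)] \<open>x : ?X\<close>] op]) auto
  have "sec_2 p s d ?W (%e. ka e - f (x, multiproj_pt e, e))"
  proof (rule sec_2_mono[OF sec_2_add[OF s1 s2] op order_refl])
   fix e assume eW: "e : \<Union>?W"
   then have e: "e : blowup_cone p s" "multiproj_pt e : ?W"
    using in_Union_iff[OF open_subset_blowup[OF op]] by auto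
   have X: "multiproj_pt e : ?X" by (rule multiproj_in_blowup[OF e(1)])
   have "e : \<Union>(N (pt j) \<inter> N x \<inter> N (multiproj_pt e))"
    using e(2) N(2)[OF X] multiproj_pt_self[of e] by blast
   from fcoc[OF JA(3)[OF j(1)] \<open>x : ?X\<close> X this] ka[OF j(1) e(1) nz(2,1)[OF eW]]
   show "ka e - f (x, multiproj_pt e, e) = ps j e + f (pt j, x, e)" by (simp add: algebra_simps)
  qed
  then show "EX W. openin (zariski p s) W & x : W & sec_2 p s d W (%e. ka e - f (x, multiproj_pt e, e))"
   using op xW by (intro exI[of _ ?W] conjI)
 qed
 then show ?thesis by blast
qed

text \<open>Sections of \<open>\<O>(d H)\<close> do not see the exceptional divisor: in the Cox coordinates they
 are polynomials of weight \<open>0\<close>, hence polynomials in \<open>v\<close>.\<close>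

lemma chart_sections:
 assumes card: "CARD('m) >= 3" and w: "w : PF" "hom (%_. 1) (int dw) w" "EX x. w x ~= 0"
  and wmult: "(%e. w (($) (fst e))) : multihom s dw (%_. 0)"
  and wu: "!!x. w x ~= 0 ==> u x ~= 0"
  and ph: "sec_H p s d (basic_open p s (%e. w (($) (fst e)))) ph"
 shows "EX m Ga. Ga : PF & hom (%_. 1) (d + int m * int dw) Ga &
  (ALL e:blowup_cone p s. w (($) (fst e)) ~= 0 --> ph e * w (($) (fst e)) ^ m = Ga (($) (fst e)))"
proof -
 let ?O = "basic_open p s (%e. w (($) (fst e)))"
 let ?W = "%xi. w (($) (vmod xi))"
 have WPF: "?W : PF" by (rule PF_vec[OF w(1) vmod_PF])
 define g where "g = (%a xi. ?W xi * xi (Some a))"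
 define J where "J = UNIV - {c}"
 define S where "S = Some ` J"
 have gPF: "g a : PF" for a unfolding g_def by (intro PF_mult WPF PF_var)
 have good_g: "good xi & multiproj_pt (sigma xi) : ?O" if "a : J" "g a xi ~= 0" for a xi
 proof -
  have nz: "?W xi ~= 0" "xi (Some a) ~= 0" using that(2) by (auto simp: g_def)
  have "xpr xi $ a ~= 0" using nz(2) that(1) by (simp add: xpr_def J_def)
  then have gd: "good xi" using wu[OF nz(1)] by (auto simp: good_def)
  have "w (($) (fst (sigma xi))) ~= 0" using nz(1) by (simp add: sigma_def)
  then show ?thesis using gd in_basic_open[OF wmult sigma_cone[OF gd]] by simp
 qed
 have fr: "EX k. EX F:PF. ALL et. g a et ~= 0 --> ph (sigma et) * g a et ^ k = et None ^ 0 * F et" if a: "a : J" for a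
 proof (rule regular_fraction[OF gPF])
  fix ze assume "g a ze ~= 0"
  then have "good ze" "multiproj_pt (sigma ze) : ?O" using good_g[OF a] by auto
  then have "reg 0 ze ph" by (intro reg_sec_H[OF ph])
  then show "EX G:PF. EX F:PF. G ze ~= 0 & (ALL et. G et ~= 0 --> g a et ~= 0 --> ph (sigma et) * G et = et None ^ 0 * F et)"
   by (rule reg_weaken)
 qed
 define G where "G = (%xi. ?W xi * (\<Prod>a\<in>J. xi (Some a)))"
 have GPF: "G : PF" unfolding G_def by (intro PF_mult WPF PF_prod PF_var)
 have G0: "?W xi ~= 0" "a : J ==> xi (Some a) ~= 0" if "G xi ~= 0" for xi a
  using that by (auto simp: G_def)
 \<comment> \<open>The Cox coordinates of a vector with \<open>t = 1\<close>.\<close>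
 define lift where "lift = (%x k. case k of None => 1 | Some a => if a = c then x c / p i $ c else x a - x c / p i $ c * p i $ a)"
 have vl: "($) (vmod (lift x)) = x" for x
  using c by (auto simp: vmod_def lift_def fun_eq_iff field_simps)
 have Gnz: "EX x. G x ~= 0"
 proof -
  obtain x where "w x ~= 0" using w(3) by blast
  then have 1: "?W (lift x) ~= 0" by (simp add: vl)
  have 2: "(%xi. \<Prod>a\<in>J. xi (Some a)) : PF" by (intro PF_prod PF_var)
  have 3: "(\<Prod>a\<in>J. (%_. 1 :: complex) (Some a)) ~= 0" by simp
  have "EX x. ?W x ~= 0 & (\<Prod>a\<in>J. x (Some a)) ~= 0" by (rule PF_domain[OF WPF 2 1 3])
  then show ?thesis unfolding G_def by simp
 qed
 interpret cover_setting J g ?W G S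
 proof unfold_locales
  fix j assume "j : J"
  show "EX g':PF. ALL x. g j x = ?W x * g' x" by (rule bexI[OF _ PF_var[of "Some j"]]) (simp add: g_def)
 qed (use gPF WPF GPF Gnz G0 in \<open>auto simp: J_def S_def g_def\<close>)
 obtain a b where a: "a ~= c" and b: "b ~= c" "b ~= a" by (rule two_others[OF card])
 have lc: "loc j (%et. ph (sigma et))" if j: "j : J" for j
 proof -
  obtain k F where F: "F : PF" "ALL et. g j et ~= 0 --> ph (sigma et) * g j et ^ k = et None ^ 0 * F et"
   using fr[OF j] by (elim exE bexE)
  show ?thesis by (rule locI[where k = k, OF F(1)]) (use F(2) Gg[OF _ j] in simp)
 qed
 have abS: "Some a : S" "Some b : S" "Some a ~= Some b" using a b by (auto simp: S_def J_def)
 have "EX m. EX Ga:PF. ALL x. G x ~= 0 --> ?W x ^ m * ph (sigma x) = Ga x"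
  by (rule hartogs[OF abS]) (rule lc)
 then obtain m Ga0 where Ga0: "Ga0 : PF" "ALL x. G x ~= 0 --> ?W x ^ m * ph (sigma x) = Ga0 x" by (elim exE bexE)
 have ext: "?W et ^ m * ph (sigma et) = Ga0 et" if j: "j : J" and et: "g j et ~= 0" for j et
 proof -
  obtain k F where F: "F : PF" "ALL et. g j et ~= 0 --> ph (sigma et) * g j et ^ k = et None ^ 0 * F et"
   using fr[OF j] by (elim exE bexE)
  have "ALL x. ?W x ^ m * F x = Ga0 x * g j x ^ k"
  proof (rule everywhere_all)
   fix x assume x: "G x ~= 0"
   have "F x = ph (sigma x) * g j x ^ k" using F(2) Gg[OF x j] by simp
   moreover have "?W x ^ m * ph (sigma x) = Ga0 x" using Ga0(2) x by simp
   ultimately show "?W x ^ m * F x = Ga0 x * g j x ^ k" by (simp flip: mult.assoc)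
  qed (intro PF_mult PF_power WPF F(1) Ga0(1) gPF j)+
  then have "?W et ^ m * F et = Ga0 et * g j et ^ k" by simp
  moreover have "F et = ph (sigma et) * g j et ^ k" using F(2) et by simp
  ultimately show ?thesis using et by simp
 qed
 have phhom: "ph (rescale r ga (sigma x)) = r powi d * ph (sigma x)" if "G x ~= 0" "r ~= 0" "!!j. ga j ~= 0" for r ga x
 proof (rule sec_H_homogeneous[OF ph basic_open_subset _ that(2,3)])
  have "a : J" using a by (simp add: J_def)
  then have "multiproj_pt (sigma x) : ?O" using good_g Gg[OF that(1)] by blast
  then show "sigma x : \<Union>?O" using multiproj_pt_self by blast
 qed
 have wsm: "w (%k. r * x k) = r ^ dw * w x" if "r ~= 0" for r x using homD[OF w(2) that, of x] by (simp add: act_def)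
 obtain b0 where b0: "G b0 ~= 0" using Gnz by (elim exE)
 have Wl: "?W (act wl r x) = ?W x" and Wm: "?W (act wm r x) = r ^ dw * ?W x" if "r ~= 0" for r x
  using that by (simp_all add: vmod_act vector_smult_component[abs_def] wsm)
 have GA: "G (act wl r x) ~= 0" "G (act wm r x) ~= 0" if "r ~= 0" "G x ~= 0" for r x
 proof -
  show "G (act wl r x) ~= 0" using G0[OF that(2)] that(1) Wl[OF that(1)] by (simp add: G_def) (simp add: act_def)
  show "G (act wm r x) ~= 0" using G0[OF that(2)] that(1) Wm[OF that(1)] by (simp add: G_def) (simp add: act_def)
 qed
 have hl: "hom wl 0 Ga0"
 proof (rule hom_from_dense[OF Ga0(1) GPF b0])
  fix r :: complex and x assume r: "r ~= 0" and x: "G x ~= 0"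
  have "ph (sigma (act wl r x)) = 1 powi d * ph (sigma x)"
   unfolding sigma_act(1)[OF r] by (rule phhom[OF x]) (use r in auto)
  moreover have "?W (act wl r x) ^ m * ph (sigma (act wl r x)) = Ga0 (act wl r x)" using Ga0(2) GA(1)[OF r x] by blast
  moreover have "?W x ^ m * ph (sigma x) = Ga0 x" using Ga0(2) x by blast
  ultimately show "Ga0 (act wl r x) = r powi 0 * Ga0 x" using Wl[OF r, of x] by simp
 qed
 have hm: "hom wm (d + int m * int dw) Ga0"
 proof (rule hom_from_dense[OF Ga0(1) GPF b0])
  fix r :: complex and x assume r: "r ~= 0" and x: "G x ~= 0"
  have 1: "ph (sigma (act wm r x)) = r powi d * ph (sigma x)"
   unfolding sigma_act(2)[OF r] by (rule phhom[OF x]) (use r in auto)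
  have 2: "?W (act wm r x) ^ m * ph (sigma (act wm r x)) = Ga0 (act wm r x)" using Ga0(2) GA(2)[OF r x] by blast
  have 3: "?W x ^ m * ph (sigma x) = Ga0 x" using Ga0(2) x by blast
  have "Ga0 (act wm r x) = (r ^ dw) ^ m * r powi d * Ga0 x"
   unfolding 2[symmetric] 3[symmetric] 1 Wm[OF r] by (simp add: power_mult_distrib)
  also have "(r ^ dw) ^ m = r powi (int m * int dw)"
   by (simp add: power_int_mult mult.commute flip: power_mult of_nat_mult)
  finally show "Ga0 (act wm r x) = r powi (d + int m * int dw) * Ga0 x" using r by (simp add: power_int_add)
 qed
 define Ga where "Ga = (%x. Ga0 (lift x))"
 have GaPF: "Ga : PF"
  unfolding Ga_def
 proof (rule PF_compose[OF Ga0(1)])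
  fix k
  show "(%x. lift x k) : PF"
  proof (cases k)
   case None then show ?thesis by (simp add: lift_def PF_const)
  next
   case (Some b)
   have "(%x :: 'm => complex. x c * (1 / p i $ c)) : PF" "(%x. x b - x c * (p i $ b / p i $ c)) : PF"
    by (intro PF_mult PF_diff PF_var PF_const)+
   then show ?thesis by (cases "b = c") (simp_all add: lift_def Some)
  qed
 qed
 \<comment> \<open>Invariance under \<open>wl\<close> normalises \<open>t\<close> to
   \<open>1\<close>, so \<open>Ga0\<close> factors through \<open>vmod\<close>; density covers
   \<open>t = 0\<close>.\<close>
 have Gav: "Ga0 xi = Ga (($) (vmod xi))" for xi
 proof (rule PF_eq_dense[OF Ga0(1) PF_vec[OF GaPF vmod_PF] PF_var[of None], of "%_. 1"])
  fix xi :: "'m option => complex" assume t: "xi None ~= 0"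
  have "lift (($) (vmod xi)) = act wl (xi None) xi"
  proof
   fix k show "lift (($) (vmod xi)) k = act wl (xi None) xi k"
    using t c by (cases k) (simp_all add: lift_def vmod_def act_def wl_def power_int_minus)
  qed
  then show "Ga0 xi = Ga (($) (vmod xi))" using homD[OF hl t, of xi] by (simp add: Ga_def)
 qed simp
 have "hom (%_. 1) (d + int m * int dw) Ga"
  unfolding hom_def
 proof (intro allI impI)
  fix r :: complex and x assume r: "r ~= 0"
  have "($) (vmod (act wm r (lift x))) = (%k. r * x k)"
   unfolding vmod_act(3)[OF r] using fun_cong[OF vl[of x]] by (simp add: fun_eq_iff)
  then have "act (%_. 1) r x = ($) (vmod (act wm r (lift x)))" by (simp add: act_def)
  then have "Ga (act (%_. 1) r x) = Ga0 (act wm r (lift x))" by (simp add: Gav)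
  then show "Ga (act (%_. 1) r x) = r powi (d + int m * int dw) * Ga x" using homD[OF hm r] by (simp add: Ga_def)
 qed
 moreover have "ph e * w (($) (fst e)) ^ m = Ga (($) (fst e))" if e: "e : blowup_cone p s" "w (($) (fst e)) ~= 0" for e
 proof -
  have ue: "u (($) (fst e)) ~= 0" by (rule wu[OF e(2)])
  obtain k where k: "xpr (tau e) $ k ~= 0" using xpr_tau_nz[OF e(1)] by (auto simp: vec_eq_iff)
  then have kJ: "k : J" "tau e (Some k) ~= 0" by (auto simp: xpr_def J_def split: if_splits)
  have gk: "g k (tau e) ~= 0" using kJ e by (simp add: g_def vmod_tau)
  have 1: "w (($) (fst e)) ^ m * ph (sigma (tau e)) = Ga (($) (fst e))"
   using ext[OF kJ(1) gk] by (simp add: Gav vmod_tau[OF e(1)])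
  obtain ga where ga: "ALL j. ga j ~= 0" "e = rescale 1 ga (sigma (tau e))" by (rule sigma_tau[OF e(1) ue])
  have "multiproj_pt (sigma (tau e)) : ?O" using good_g[OF kJ(1) gk] by blast
  then have "sigma (tau e) : \<Union>?O" using multiproj_pt_self by blast
  then have "ph (rescale 1 ga (sigma (tau e))) = 1 powi d * ph (sigma (tau e))"
   using ga(1) by (intro sec_H_homogeneous[OF ph basic_open_subset]) auto
  then have "ph e = ph (sigma (tau e))" using ga(2) by simp
  then show ?thesis using 1 by (simp add: mult.commute)
 qed
 ultimately show ?thesis using GaPF by (intro exI[of _ m] exI[of _ Ga] conjI ballI impI)
qed

end

section \<open>Gluing the charts\<close>

locale points =
 fixes p :: "nat => complex ^ 'm::finite" and s :: nat
 assumes p_nz: "!!j. j : {1..s} ==> p j ~= 0"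
  and p_inj: "inj_on (%i. proj_pt (p i)) {1..s}"
  and card3: "CARD('m) >= 3" and s2: "s >= 2"
begin

lemma p_distinct:
 assumes "i : {1..s}" "j : {1..s}" "i ~= j"
 shows "minors (p j) (p i) ~= 0"
proof
 assume "minors (p j) (p i) = 0"
 then obtain r where r: "p i = r *s p j" using minors_eq_0_iff[OF p_nz[OF assms(2)]] by blast
 then have "r ~= 0" using p_nz[OF assms(1)] by auto
 then have "proj_pt (p i) = proj_pt (p j)" using r proj_pt_smult by metis
 then show False using inj_onD[OF p_inj _ assms(1,2)] assms(3) by blast
qed

text \<open>One minor of \<open>q\<close> does not vanish at \<open>v\<close>, another not at
  \<open>v'\<close>; if neither avoids both points, their sum does.\<close>

lemma linear_form_between:
 fixes q v v' :: "complex ^ 'm"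
 assumes "minors q v ~= 0" "minors q v' ~= 0"
 shows "EX l:PF. hom (%_. 1) 1 l & l (%_. 0) = 0 & l (($) q) = 0 & l (($) v) ~= 0 & l (($) v') ~= 0"
proof -
 define m where "m = (%ab x. q $ fst ab * x (snd ab) - q $ snd ab * x (fst ab) :: complex)"
 have mm: "m ab (($) w) = minors q w $ ab" for ab w by (simp add: m_def minors_def)
 have mPF: "m ab : PF" for ab unfolding m_def by (intro PF_diff PF_mult PF_const PF_var)
 have mh: "hom (%_. 1) 1 (m ab)" for ab by (simp add: hom_def m_def act_def algebra_simps)
 have m0: "m ab (%_. 0) = 0" "m ab (($) q) = 0" for ab by (simp_all add: m_def)
 obtain ab where ab: "m ab (($) v) ~= 0" using assms(1) by (auto simp: vec_eq_iff mm)
 obtain ab' where ab': "m ab' (($) v') ~= 0" using assms(2) by (auto simp: vec_eq_iff mm)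
 show ?thesis
 proof (cases "m ab (($) v') ~= 0 | m ab' (($) v) ~= 0")
  case True
  then show ?thesis using ab ab' mPF mh m0 by (elim disjE) (intro bexI[OF _ mPF] conjI; assumption | simp)+
 next
  case False
  then show ?thesis using ab ab' by (intro bexI[OF _ PF_add[OF mPF[of ab] mPF[of ab']]] conjI hom_add mh) (simp_all add: m0)
 qed
qed

text \<open>\<open>i\<close> is the centre proportional to \<open>v\<close>, or \<open>1\<close> if
  there is none. \<open>u\<close> is a product of linear forms, one through each other centre, hence
  of degree \<open>s - 1\<close>; as \<open>s >= 2\<close>, it vanishes at the origin.\<close>

lemma chart_at:
 assumes v: "v ~= 0"
 shows "EX i c u. chart p s i c u (s - 1) & u (($) v) ~= 0"
proof -
 define i where "i = (if EX i:{1..s}. minors (p i) v = 0 then SOME i. i : {1..s} & minors (p i) v = 0 else 1)"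
 have i: "i : {1..s}" "j : {1..s} ==> j ~= i ==> minors (p j) v ~= 0" for j
 proof -
  have *: "i : {1..s} & (j : {1..s} --> j ~= i --> minors (p j) v ~= 0)"
  proof (cases "EX i:{1..s}. minors (p i) v = 0")
   case True
   have i: "i : {1..s} & minors (p i) v = 0"
    unfolding i_def using True by (simp only: if_True) (rule someI_ex, blast)
   then obtain r where r: "v = r *s p i" using minors_eq_0_iff[OF p_nz] by blast
   then have r0: "r ~= 0" using v by auto
   have "minors (p j) v ~= 0" if "j : {1..s}" "j ~= i" for j
    using p_distinct[of i j] that i r0 unfolding r minors_smult by simp
   then show ?thesis using i by blast
  next
   case False
   then show ?thesis using s2 by (auto simp: i_def)
  qed
  then show "i : {1..s}" "j : {1..s} ==> j ~= i ==> minors (p j) v ~= 0" by blast+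
 qed
 have "ALL j:{1..s} - {i}. EX l. l : PF & hom (%_. 1) 1 l & l (%_. 0) = 0 & l (($) (p j)) = 0 & l (($) (p i)) ~= 0 & l (($) v) ~= 0"
  using linear_form_between[OF p_distinct[OF i(1)] i(2)] by blast
 then obtain l where l: "ALL j:{1..s} - {i}. l j : PF & hom (%_. 1) 1 (l j) & l j (%_. 0) = 0 & l j (($) (p j)) = 0 & l j (($) (p i)) ~= 0 & l j (($) v) ~= 0"
  unfolding bchoice_iff by (elim exE)
 define u where "u = (%x. \<Prod>j\<in>{1..s} - {i}. l j x)"
 have l1: "l j : PF" "hom (%_. 1) 1 (l j)" "l j (%_. 0) = 0" "l j (($) (p j)) = 0" "l j (($) (p i)) ~= 0" "l j (($) v) ~= 0"
  if "j : {1..s} - {i}" for j using bspec[OF l that] by simp_all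
 have cd: "card ({1..s} - {i}) = s - 1" using i(1) by simp
 obtain c where c: "p i $ c ~= 0" using p_nz[OF i(1)] by (auto simp: vec_eq_iff)
 have "chart p s i c u (s - 1)"
 proof
  show "u : PF" unfolding u_def by (intro PF_prod l1)
  have "hom (%_. 1) (\<Sum>j\<in>{1..s} - {i}. 1) u" unfolding u_def by (intro hom_prod l1)
  then show "hom (%_. 1) (int (s - 1)) u" by (simp only: sum_constant cd mult_1_right)
  define j where "j = (if i = 1 then 2 else 1::nat)"
  have "j : {1..s} - {i}" using s2 by (simp add: j_def)
  then show "u (%_. 0) = 0" unfolding u_def using l1(3) by (intro prod_zero) auto
  show "u (($) (p i)) ~= 0" unfolding u_def using l1(5) by simp
  show "u (($) (p j)) = 0" if "j : {1..s}" "j ~= i" for j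
   unfolding u_def using l1(4)[of j] that by (intro prod_zero) auto
 qed (use i c p_nz in auto)
 moreover have "u (($) v) ~= 0" unfolding u_def using l1(6) by simp
 ultimately show ?thesis by (intro exI conjI)
qed

lemma minors_nonzero:
 assumes "q ~= 0"
 shows "EX w :: complex ^ 'm. minors q w ~= 0"
proof -
 obtain c where c: "q $ c ~= 0" using assms by (auto simp: vec_eq_iff)
 obtain a b where a: "a ~= c" "b ~= c" "b ~= a" by (rule two_others[OF card3])
 have "minors q (axis a 1) $ (c, a) ~= 0" using a c by (simp add: minors_nth axis_def)
 then show ?thesis by (intro exI[of _ "axis a 1"]) auto
qed

text \<open>Over a centre any nonzero value in the range of the minors is allowed for
  \<open>y j\<close>; elsewhere the minor itself is taken.\<close>

lemma cone_over:
 assumes v: "v ~= 0"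
 shows "EX e:blowup_cone p s. fst e = v"
proof -
 have "ALL j:{1..s}. EX w. minors (p j) w ~= 0" using minors_nonzero p_nz by blast
 then obtain w where w: "ALL j:{1..s}. minors (p j) (w j) ~= 0" unfolding bchoice_iff by (elim exE)
 define y where "y = (%j. if j ~: {1..s} then 0 else if minors (p j) v = 0 then minors (p j) (w j) else minors (p j) v)"
 have "y j ~= 0 & y j : range (minors (p j)) & (EX c. minors (p j) v = c *s y j)" if "j : {1..s}" for j
 proof (cases "minors (p j) v = 0")
  case True then show ?thesis using w that by (auto simp: y_def intro!: exI[of _ 0])
 next
  case False then show ?thesis using that by (auto simp: y_def intro!: exI[of _ 1])
 qed
 then have "(v, y) : blowup_cone p s" using v by (auto simp: blowup_cone_def y_def)
 then show ?thesis by force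
qed

definition charts :: "(nat \<times> 'm \<times> (('m => complex) => complex)) set" where
 "charts = {t. chart p s (fst t) (fst (snd t)) (snd (snd t)) (s - 1)}"

lemma finite_charts:
 obtains J where "finite J" "J <= charts" "!!v. v ~= 0 ==> EX t:J. snd (snd t) (($) v) ~= 0"
proof -
 have "EX J. finite J & J <= charts & (ALL a:UNIV. ALL x. (1::complex) ~= 0 --> x a ~= 0 --> (EX t:J. snd (snd t) x ~= 0))"
 proof (rule finite_subcover[of charts "%t. snd (snd t)" "%_. 1", OF _ PF_const])
  fix t assume "t : charts"
  then show "snd (snd t) : PF" unfolding charts_def by (auto dest: chart.uPF)
 next
  fix a :: 'm and x assume "x a ~= (0::complex)"
  then have "vec_lambda x ~= 0" by (auto simp: vec_eq_iff)
  then obtain i c u where "chart p s i c u (s - 1)" "u (($) (vec_lambda x)) ~= 0" using chart_at by blast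
  moreover have "($) (vec_lambda x) = x" by auto
  ultimately have "(i, c, u) : charts & snd (snd (i, c, u)) x ~= 0" by (simp add: charts_def)
  then show "EX t:charts. snd (snd t) x ~= 0" by blast
 qed
 then obtain J where J: "finite J" "J <= charts" "ALL a:UNIV. ALL x. (1::complex) ~= 0 --> x a ~= 0 --> (EX t:J. snd (snd t) x ~= 0)"
  by (elim exE conjE)
 show ?thesis
 proof (rule that[OF J(1,2)])
  fix v :: "complex ^ 'm" assume "v ~= 0"
  then obtain a where "v $ a ~= 0" by (auto simp: vec_eq_iff)
  then show "EX t:J. snd (snd t) (($) v) ~= 0" using J(3) by simp
 qed
qed

text \<open>Transports functions on the cone of the blow-up to functions of \<open>v\<close>. On the
  charts sections of O(d H) depend on \<open>fst e\<close> only, so the choice over a centre is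
  harmless.\<close>

definition lift_cone :: "('m => complex) => 'm coords" where
 "lift_cone x = (SOME e. e : blowup_cone p s & fst e = vec_lambda x)"

lemma lift_cone:
 assumes "x a ~= 0"
 shows "lift_cone x : blowup_cone p s" "($) (fst (lift_cone x)) = x"
proof -
 have "vec_lambda x ~= 0" using assms by (auto simp: vec_eq_iff)
 then have "EX e. e : blowup_cone p s & fst e = vec_lambda x" using cone_over by blast
 from someI_ex[OF this] show "lift_cone x : blowup_cone p s" "($) (fst (lift_cone x)) = x"
  unfolding lift_cone_def[symmetric] by auto
qed

end

text \<open>A finite atlas: index \<open>t = (i, c, u)\<close>, and \<open>uu t = u\<close>.\<close>

locale atlas = points +
 fixes J :: "(nat \<times> 'a \<times> (('a => complex) => complex)) set"
 assumes finJ: "finite J" and Jch: "J <= charts"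
  and Jcov: "!!v. v ~= 0 ==> EX t:J. snd (snd t) (($) v) ~= 0"
begin

abbreviation uu :: "nat \<times> 'a \<times> (('a => complex) => complex) => ('a => complex) => complex" where
 "uu t \<equiv> snd (snd t)"

lemma ch: "t : J ==> chart p s (fst t) (fst (snd t)) (uu t) (s - 1)"
 using Jch by (auto simp: charts_def)

lemma uuPF: "t : J ==> uu t : PF" by (rule chart.uPF[OF ch])

lemma uuhom: "t : J ==> hom (%_. 1) (int (s - 1)) (uu t)" by (rule chart.uhom[OF ch])

lemma uunz: "t : J ==> uu t (($) (p (fst t))) ~= 0" by (rule chart.ui[OF ch])

section \<open>Projective space covered by the charts\<close>

definition GG :: "('a => complex) => complex" where
 "GG x = (\<Prod>a\<in>UNIV. x a) * (\<Prod>t\<in>J. uu t x)"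

lemma GG: "GG : PF" "GG x ~= 0 ==> x a ~= 0" "GG x ~= 0 ==> t : J ==> uu t x ~= 0"
 using finJ unfolding GG_def[abs_def] by (auto intro!: PF_mult PF_prod PF_var uuPF)

lemma GGnz: "EX x. GG x ~= 0"
proof -
 have 1: "(%x :: 'a => complex. \<Prod>a\<in>UNIV. x a) : PF" by (intro PF_prod PF_var)
 have 2: "(%x. \<Prod>t\<in>J. uu t x) : PF" by (intro PF_prod uuPF)
 have 3: "(\<Prod>a\<in>UNIV. (%_ :: 'a. 1 :: complex) a) ~= 0" by simp
 have "EX x. (\<Prod>t\<in>J. uu t x) ~= 0" by (rule PF_prod_nonzero[OF finJ uuPF]) (use uunz in blast)+
 then obtain x where "(\<Prod>t\<in>J. uu t x) ~= 0" by (elim exE)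
 from PF_domain[OF 1 2 3 this] show ?thesis unfolding GG_def by simp
qed

lemma GG_act: "GG x ~= 0 ==> r ~= 0 ==> GG (act (%_. 1) r x) ~= 0"
proof -
 assume x: "GG x ~= 0" and r: "r ~= 0"
 have "uu t (act (%_. 1) r x) ~= 0" if "t : J" for t
  using homD[OF uuhom[OF that] r, of x] GG(3)[OF x that] r by simp
 then show "GG (act (%_. 1) r x) ~= 0" using GG(2)[OF x] r finJ by (simp add: GG_def act_def)
qed

text \<open>The case of projective space: \<open>u\<close> is \<open>1\<close> and all coordinates
  belong to \<open>S\<close>.\<close>

lemma cover: "cover_setting J uu (%_. 1) GG UNIV"
proof
 show "EX x. GG x ~= 0" by (rule GGnz)
 fix j assume "j : J"
 show "EX g':PF. ALL x. uu j x = 1 * g' x" by (rule bexI[OF _ uuPF[OF \<open>j : J\<close>]]) simp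
next
 fix a :: 'a and x assume "x a ~= (0::complex)"
 then have "vec_lambda x ~= 0" by (auto simp: vec_eq_iff)
 from Jcov[OF this] show "EX j:J. uu j x ~= 0" by (simp add: vec_lambda_inverse)
qed (use finJ uuPF GG PF_const in auto)

text \<open>Each chart gives a quotient of a form by a power of \<open>uu t\<close>, and Hartogs
  extension on the cone over projective space makes a single form of these quotients.\<close>

lemma global_sec_H:
 assumes ph: "sec_H p s d (blowup p s) ph"
 obtains F where "F : PF" "hom (%_. 1) d F" "ALL e:blowup_cone p s. ph e = F (($) (fst e))"
proof -
 interpret cover_setting J uu "%_. 1" GG UNIV by (rule cover)
 have loc_ex: "EX m Ga. Ga : PF & hom (%_. 1) (d + int m * int (s - 1)) Ga &
  (ALL e:blowup_cone p s. uu t (($) (fst e)) ~= 0 --> ph e * uu t (($) (fst e)) ^ m = Ga (($) (fst e)))" if t: "t : J" for t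
 proof (rule chart.chart_sections[OF ch[OF t] card3 uuPF[OF t] uuhom[OF t]])
  show "EX x. uu t x ~= 0" using uunz[OF t] by blast
  show um: "(%e. uu t (($) (fst e))) : multihom s (s - 1) (%_. 0)" by (rule chart.u_multihom[OF ch[OF t]])
  show "sec_H p s d (basic_open p s (%e. uu t (($) (fst e)))) ph"
   by (rule sec_H_mono[OF ph openin_basic[OF um] basic_open_subset refl])
 qed
 let ?ph = "%x. ph (lift_cone x)"
 have lc: "loc t ?ph" if t: "t : J" for t
 proof -
  obtain m Ga where Ga: "Ga : PF" "hom (%_. 1) (d + int m * int (s - 1)) Ga"
   "ALL e:blowup_cone p s. uu t (($) (fst e)) ~= 0 --> ph e * uu t (($) (fst e)) ^ m = Ga (($) (fst e))"
   using loc_ex[OF t] by (elim exE conjE)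
  show ?thesis
  proof (rule locI[where k = m, OF Ga(1)])
   fix x assume x: "GG x ~= 0"
   note l = lift_cone[of x undefined, OF GG(2)[OF x]]
   show "ph (lift_cone x) * uu t x ^ m = Ga x" using bspec[OF Ga(3) l(1)] GG(3)[OF x t] unfolding l(2) by simp
  qed
 qed
 obtain b c :: 'a where bc: "b ~= undefined" "c ~= undefined" "c ~= b" by (rule two_others[OF card3])
 have "EX m. EX Ga:PF. ALL x. GG x ~= 0 --> 1 ^ m * ?ph x = Ga x"
  by (rule hartogs[OF UNIV_I UNIV_I bc(3)]) (rule lc)
 then obtain m F where F: "F : PF" "ALL x. GG x ~= 0 --> 1 ^ m * ?ph x = F x" by (elim exE bexE)
 have key: "EX m Ga. hom (%_. 1) (d + int m * int (s - 1)) Ga & (ALL x. F x * uu t x ^ m = Ga x) &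
   (ALL e:blowup_cone p s. uu t (($) (fst e)) ~= 0 --> ph e * uu t (($) (fst e)) ^ m = Ga (($) (fst e)))" if t: "t : J" for t
 proof -
  obtain m Ga where Ga: "Ga : PF" "hom (%_. 1) (d + int m * int (s - 1)) Ga"
   "ALL e:blowup_cone p s. uu t (($) (fst e)) ~= 0 --> ph e * uu t (($) (fst e)) ^ m = Ga (($) (fst e))"
   using loc_ex[OF t] by (elim exE conjE)
  have "ALL x. F x * uu t x ^ m = Ga x"
  proof (rule everywhere_all)
   fix x assume x: "GG x ~= 0"
   note l = lift_cone[of x undefined, OF GG(2)[OF x]]
   have "ph (lift_cone x) = F x" using F(2) x by simp
   then show "F x * uu t x ^ m = Ga x" using bspec[OF Ga(3) l(1)] GG(3)[OF x t] unfolding l(2) by simp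
  qed (intro PF_mult PF_power uuPF t F(1) Ga(1))+
  then show ?thesis using Ga(2,3) by (intro exI[of _ m] exI[of _ Ga] conjI)
 qed
 show ?thesis
 proof (rule that[OF F(1)])
  obtain v :: "complex ^ 'a" where "v ~= 0" using p_nz[of 1] s2 by auto
  from Jcov[OF this] obtain t where t: "t : J" by blast
  obtain m Ga where Ga: "hom (%_. 1) (d + int m * int (s - 1)) Ga" "ALL x. F x * uu t x ^ m = Ga x"
   using key[OF t] by (elim exE conjE)
  have "(%x. F x * uu t x ^ m) = Ga" by (rule ext) (rule Ga(2)[THEN spec])
  then have "hom (%_. 1) (d + int m * int (s - 1)) (%x. F x * uu t x ^ m)" using Ga(1) by (simp only:)
  then show "hom (%_. 1) d F"
   using uunz[OF t] by (intro hom_cancel[OF F(1) PF_power[OF uuPF[OF t]] _ hom_power[OF uuhom[OF t]], of "($) (p (fst t))" m]) simp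
  show "ALL e:blowup_cone p s. ph e = F (($) (fst e))"
  proof
   fix e assume e: "e : blowup_cone p s"
   obtain t where t: "t : J" "uu t (($) (fst e)) ~= 0" using Jcov[OF coneD(1)[OF e]] by (elim bexE)
   obtain m Ga where Ga: "ALL x. F x * uu t x ^ m = Ga x"
    "ALL e:blowup_cone p s. uu t (($) (fst e)) ~= 0 --> ph e * uu t (($) (fst e)) ^ m = Ga (($) (fst e))"
    using key[OF t(1)] by (elim exE conjE)
   have "ph e * uu t (($) (fst e)) ^ m = Ga (($) (fst e))" using bspec[OF Ga(2) e] t(2) by blast
   also have "\<dots> = F (($) (fst e)) * uu t (($) (fst e)) ^ m" using Ga(1) by simp
   finally show "ph e = F (($) (fst e))" using t(2) by simp
  qed
 qed
qed

text \<open>Two splittings of the same cocycle differ by a section of O(d H) on the overlap, and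
  such sections are fractions of forms by \<open>chart_sections\<close>.\<close>

lemma chart_difference:
 assumes t: "t : J" "t' : J"
  and ka: "splits (sec_2 p s d) (zariski p s) f (basic_open p s (%e. uu t (($) (fst e)))) ka"
  and ka': "splits (sec_2 p s d) (zariski p s) f (basic_open p s (%e. uu t' (($) (fst e)))) ka'"
 shows "EX m Ga. Ga : PF & hom (%_. 1) (d + int m * int (s - 1 + (s - 1))) Ga &
  (ALL e:blowup_cone p s. uu t (($) (fst e)) * uu t' (($) (fst e)) ~= 0 -->
   (ka' e - ka e) * (uu t (($) (fst e)) * uu t' (($) (fst e))) ^ m = Ga (($) (fst e)))"
proof (rule chart.chart_sections[OF ch[OF t(1)] card3, where w = "%x. uu t x * uu t' x"])
 show "(%x. uu t x * uu t' x) : PF" by (intro PF_mult uuPF t)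
 show "hom (%_. 1) (int (s - 1 + (s - 1))) (%x. uu t x * uu t' x)"
  using hom_mult[OF uuhom[OF t(1)] uuhom[OF t(2)]] by simp
 obtain x where "GG x ~= 0" using GGnz by (elim exE)
 then show "EX x. uu t x * uu t' x ~= 0" using GG(3) t by (intro exI[of _ x]) simp
 have um: "(%e. uu t (($) (fst e))) : multihom s (s - 1) (%_. 0)" if "t : J" for t by (rule chart.u_multihom[OF ch[OF that]])
 show um2: "(%e. uu t (($) (fst e)) * uu t' (($) (fst e))) : multihom s (s - 1 + (s - 1)) (%_. 0)"
  using multihom_mult[OF um[OF t(1)] um[OF t(2)]] by simp
 let ?O = "basic_open p s (%e. uu t (($) (fst e)) * uu t' (($) (fst e)))"
 show "sec_H p s d ?O (%e. ka' e - ka e)"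
 proof (rule sec_H_local)
  fix x assume x: "x : ?O"
  then have x1: "x : basic_open p s (%e. uu t (($) (fst e)))" and x2: "x : basic_open p s (%e. uu t' (($) (fst e)))"
   by (auto simp: basic_open_def)
  obtain W where W: "openin (zariski p s) W" "x : W" "sec_2 p s d W (%e. ka e - f (x, multiproj_pt e, e))"
   using bspec[OF ka[unfolded splits_def] x1] by (elim exE conjE)
  obtain W' where W': "openin (zariski p s) W'" "x : W'" "sec_2 p s d W' (%e. ka' e - f (x, multiproj_pt e, e))"
   using bspec[OF ka'[unfolded splits_def] x2] by (elim exE conjE)
  let ?W = "W \<inter> W' \<inter> ?O"
  have op: "openin (zariski p s) ?W" by (intro openin_Int W W' openin_basic[OF um2])
  have "sec_2 p s d ?W (%e. ka' e - f (x, multiproj_pt e, e))" "sec_2 p s d ?W (%e. ka e - f (x, multiproj_pt e, e))"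
   by (rule sec_2_mono[OF W'(3) op _ refl], blast, rule sec_2_mono[OF W(3) op _ refl], blast)
  from sec_2_imp_sec_H[OF sec_2_diff[OF this]] have "sec_H p s d ?W (%e. ka' e - ka e)" by simp
  then show "EX W. x : W & W <= ?O & sec_H p s d W (%e. ka' e - ka e)"
   using W(2) W'(2) x by (intro exI[of _ ?W] conjI) auto
 qed
qed simp

text \<open>The differences of the splittings on the charts form a cocycle of O(d H) on projective
  space, which splits because there are at least three coordinates. The corrections
  \<open>H t / uu t ^ K\<close> belong to O(d H) but may fail to vanish doubly at the centres; this
  defect is what survives as cohomology.\<close>

lemma global_splitting:
 assumes f: "f : cech_cocycles (zariski p s) (sec_2 p s d)"
 shows "EX ka K H. (ALL t:J. H t : PF & hom (%_. 1) (d + int K * int (s - 1)) (H t) &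
  splits (sec_2 p s d) (zariski p s) f (basic_open p s (%e. uu t (($) (fst e))))
   (%e. ka e - H t (($) (fst e)) / uu t (($) (fst e)) ^ K))"
proof -
 have "ALL t:J. EX ka. splits (sec_2 p s d) (zariski p s) f (basic_open p s (%e. uu t (($) (fst e)))) ka"
  using chart.chart_splitting[OF ch card3 f] by blast
 then obtain ka where ka: "ALL t:J. splits (sec_2 p s d) (zariski p s) f (basic_open p s (%e. uu t (($) (fst e)))) (ka t)"
  unfolding bchoice_iff by (elim exE)
 define q where "q = (%t t' x. ka t' (lift_cone x) - ka t (lift_cone x))"
 have diff: "EX m Ga. Ga : PF & hom (%_. 1) (d + int m * int (s - 1 + (s - 1))) Ga &
  (ALL e:blowup_cone p s. uu t (($) (fst e)) * uu t' (($) (fst e)) ~= 0 -->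
   (ka t' e - ka t e) * (uu t (($) (fst e)) * uu t' (($) (fst e))) ^ m = Ga (($) (fst e)))"
  if "t : J" "t' : J" for t t'
  by (rule chart_difference[OF that bspec[OF ka that(1)] bspec[OF ka that(2)]])
 have diffE: "EX m Ga. Ga : PF & hom (%_. 1) (d + int m * int (s - 1 + (s - 1))) Ga &
   (ALL x. GG x ~= 0 --> q t t' x * (uu t x * uu t' x) ^ m = Ga x) &
   (ALL e:blowup_cone p s. uu t (($) (fst e)) * uu t' (($) (fst e)) ~= 0 -->
   (ka t' e - ka t e) * (uu t (($) (fst e)) * uu t' (($) (fst e))) ^ m = Ga (($) (fst e)))"
  if t: "t : J" "t' : J" for t t'
 proof -
  obtain m Ga where Ga: "Ga : PF" "hom (%_. 1) (d + int m * int (s - 1 + (s - 1))) Ga"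
   "ALL e:blowup_cone p s. uu t (($) (fst e)) * uu t' (($) (fst e)) ~= 0 -->
   (ka t' e - ka t e) * (uu t (($) (fst e)) * uu t' (($) (fst e))) ^ m = Ga (($) (fst e))"
   using diff[OF t] by (elim exE conjE)
  have "ALL x. GG x ~= 0 --> q t t' x * (uu t x * uu t' x) ^ m = Ga x"
  proof (intro allI impI)
   fix x assume x: "GG x ~= 0"
   note l = lift_cone[of x undefined, OF GG(2)[OF x]]
   show "q t t' x * (uu t x * uu t' x) ^ m = Ga x"
    using bspec[OF Ga(3) l(1)] GG(3)[OF x t(1)] GG(3)[OF x t(2)] unfolding l(2) q_def by simp
  qed
  then show ?thesis using Ga by (intro exI[of _ m] exI[of _ Ga] conjI)
 qed
 have qh: "q i j (act (%_. 1) r x) = r powi d * q i j x" if ij: "i : J" "j : J" and r: "r ~= 0" and x: "GG x ~= 0" for i j r x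
 proof -
  obtain m Ga where Ga: "hom (%_. 1) (d + int m * int (s - 1 + (s - 1))) Ga"
   "ALL x. GG x ~= 0 --> q i j x * (uu i x * uu j x) ^ m = Ga x"
   using diffE[OF ij] by (elim exE conjE)
  let ?y = "act (%_. 1) r x"
  have y: "GG ?y ~= 0" by (rule GG_act[OF x r])
  have "hom (%_. 1) (int m * (int (s - 1) + int (s - 1))) (%x. (uu i x * uu j x) ^ m)"
   by (intro hom_power hom_mult uuhom ij)
  from homD[OF this r, of x] have 1: "(uu i ?y * uu j ?y) ^ m = r powi (int m * (int (s - 1) + int (s - 1))) * (uu i x * uu j x) ^ m" .
  have "q i j ?y * (uu i ?y * uu j ?y) ^ m = Ga ?y" using Ga(2) y by blast
  also have "\<dots> = r powi (d + int m * int (s - 1 + (s - 1))) * (q i j x * (uu i x * uu j x) ^ m)"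
   using homD[OF Ga(1) r, of x] Ga(2)[THEN spec, THEN mp, OF x] by simp
  finally have "q i j ?y * (uu i ?y * uu j ?y) ^ m = r powi d * q i j x * (uu i ?y * uu j ?y) ^ m"
   unfolding 1 using r by (simp add: power_int_add)
  then show ?thesis using GG(3)[OF y] ij by simp
 qed
 have cs: "cocycle_setting J uu (%_. 1) GG UNIV q"
  unfolding cocycle_setting_def cocycle_setting_axioms_def
 proof (intro conjI cover allI impI)
  fix i j assume ij: "i : J" "j : J"
  obtain m Ga where Ga: "Ga : PF" "ALL x. GG x ~= 0 --> q i j x * (uu i x * uu j x) ^ m = Ga x"
   using diffE[OF ij] by (elim exE conjE)
  show "EX k. EX F:PF. ALL x. GG x ~= 0 --> q i j x * (uu i x * uu j x) ^ k = F x"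
   by (rule exI[of _ m], rule bexI[OF _ Ga(1)], rule Ga(2))
 qed (simp add: q_def)
 interpret hom_cocycle_setting J uu "%_. 1" GG UNIV q "%_. 1" "%_. int (s - 1)" d
  unfolding hom_cocycle_setting_def hom_cocycle_setting_axioms_def
  by (intro conjI cs allI impI uuhom GG_act qh)
 obtain a b :: 'a where ab: "a ~= undefined" "b ~= undefined" "b ~= a" by (rule two_others[OF card3])
 \<comment> \<open>With \<open>u = 1\<close>, any vector with two vanishing coordinates serves as
   \<open>x0\<close>.\<close>
 have tr: "triv (%x. 1)"
  by (rule triv_one_geometric[of a b undefined "%_. 0"]) (use ab in auto)
 obtain K H where H: "!!j. j : J ==> H j : cfun.span (mon ` {al. wt (%_. 1) al = d + int K * int (s - 1) & wt (%_. 1) al = d + int K * int (s - 1)})"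
  and Hq: "!!i j x. i : J ==> j : J ==> GG x ~= 0 ==> q i j x = H j x / uu j x ^ K - H i x / uu i x ^ K"
  by (rule homogeneous_splitting[OF tr uuhom GG_act qh]) (assumption | rule that)+
 have HPF: "H j : PF" "hom (%_. 1) (d + int K * int (s - 1)) (H j)" if "j : J" for j
  using H[OF that] span_mono_PF hom_span[of "H j" "%_. 1" "d + int K * int (s - 1)"] by auto
 define ka' where "ka' = (%t (e :: 'a coords). ka t e - H t (($) (fst e)) / uu t (($) (fst e)) ^ K)"
 have glue: "ka' t' e = ka' t e"
  if t: "t : J" "t' : J" and e: "e : blowup_cone p s" "uu t (($) (fst e)) ~= 0" "uu t' (($) (fst e)) ~= 0" for t t' e
 proof -
  obtain m Ga where Ga: "Ga : PF" "ALL x. GG x ~= 0 --> q t t' x * (uu t x * uu t' x) ^ m = Ga x"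
   "ALL e:blowup_cone p s. uu t (($) (fst e)) * uu t' (($) (fst e)) ~= 0 -->
    (ka t' e - ka t e) * (uu t (($) (fst e)) * uu t' (($) (fst e))) ^ m = Ga (($) (fst e))"
   using diffE[OF t] by (elim exE conjE)
  obtain b where b: "GG b ~= 0" using GGnz by (elim exE)
  let ?v = "($) (fst e)"
  have quo: "Ga ?v / (uu t ?v * uu t' ?v) ^ m = H t' ?v / uu t' ?v ^ K - H t ?v / uu t ?v ^ K"
  proof (rule regular_quotient_extend[OF Ga(1) HPF(1)[OF t(1)] HPF(1)[OF t(2)] uuPF[OF t(1)] uuPF[OF t(2)] GG(1) b _ e(2,3)])
   fix x assume x: "GG x ~= 0"
   have nz: "uu t x ~= 0" "uu t' x ~= 0" using GG(3)[OF x] t by auto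
   have "q t t' x * (uu t x * uu t' x) ^ m = Ga x" using Ga(2) x by blast
   then have "q t t' x = Ga x / (uu t x * uu t' x) ^ m" using nz by (simp add: field_simps)
   then show "uu t x ~= 0 & uu t' x ~= 0 & Ga x / (uu t x * uu t' x) ^ m = H t' x / uu t' x ^ K - H t x / uu t x ^ K"
    using Hq[OF t x] nz by simp
  qed
  have "(ka t' e - ka t e) * (uu t ?v * uu t' ?v) ^ m = Ga ?v" using bspec[OF Ga(3) e(1)] e(2,3) by simp
  then have "ka t' e - ka t e = Ga ?v / (uu t ?v * uu t' ?v) ^ m" using e(2,3) by (simp add: field_simps)
  then show ?thesis unfolding quo ka'_def by (simp add: algebra_simps)
 qed
 define sel where "sel = (%e :: 'a coords. SOME t. t : J & uu t (($) (fst e)) ~= 0)"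
 define ka0 where "ka0 = (%e. ka' (sel e) e)"
 have ka0: "ka0 e = ka' t e" if t: "t : J" and e: "e : blowup_cone p s" "uu t (($) (fst e)) ~= 0" for t e
 proof -
  have "sel e : J & uu (sel e) (($) (fst e)) ~= 0" unfolding sel_def by (rule someI[of _ t]) (use t e in blast)
  then show ?thesis unfolding ka0_def using glue[OF t _ e] by blast
 qed
 have "splits (sec_2 p s d) (zariski p s) f (basic_open p s (%e. uu t (($) (fst e))))
   (%e. ka0 e - (- H t (($) (fst e))) / uu t (($) (fst e)) ^ K)" if t: "t : J" for t
  unfolding splits_def
 proof
  let ?O = "basic_open p s (%e. uu t (($) (fst e)))"
  have um: "(%e. uu t (($) (fst e))) : multihom s (s - 1) (%_. 0)" by (rule chart.u_multihom[OF ch[OF t]])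
  fix x assume x: "x : ?O"
  obtain W where W: "openin (zariski p s) W" "x : W" "sec_2 p s d W (%e. ka t e - f (x, multiproj_pt e, e))"
   using bspec[OF bspec[OF ka t, unfolded splits_def] x] by (elim exE conjE)
  have op: "openin (zariski p s) (W \<inter> ?O)" by (intro openin_Int W openin_basic[OF um])
  have "sec_2 p s d (W \<inter> ?O) (%e. ka0 e - (- H t (($) (fst e))) / uu t (($) (fst e)) ^ K - f (x, multiproj_pt e, e))"
  proof (rule sec_2_mono[OF W(3) op])
   fix e assume "e : \<Union>(W \<inter> ?O)"
   then have e: "e : blowup_cone p s" "multiproj_pt e : W \<inter> ?O" using in_Union_iff[OF open_subset_blowup[OF op]] by auto
   have "uu t (($) (fst e)) ~= 0" using e in_basic_open[OF um e(1)] by simp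
   from ka0[OF t e(1) this]
   show "ka0 e - (- H t (($) (fst e))) / uu t (($) (fst e)) ^ K - f (x, multiproj_pt e, e) = ka t e - f (x, multiproj_pt e, e)"
    by (simp add: ka'_def)
  qed blast
  then show "EX W. openin (zariski p s) W & x : W & sec_2 p s d W
    (%e. ka0 e - (- H t (($) (fst e))) / uu t (($) (fst e)) ^ K - f (x, multiproj_pt e, e))"
   using op W(2) x by (intro exI[of _ "W \<inter> ?O"] conjI) auto
 qed
 then show ?thesis
  by (intro exI[of _ ka0] exI[of _ K] exI[of _ "%t x. - H t x"] ballI conjI PF_uminus HPF(1))
    (use HPF(2) in \<open>auto simp: hom_def\<close>)
qed

end

section \<open>Cohomology and gradients\<close>

lemma grad_diff:
 assumes "F : PF" "G : PF"
 shows "grad (%x. F x - G x) x = (%k. grad F x k - grad G x k)"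
proof -
 have "grad (%x. F x + (-1) * G x) x = (%k. grad F x k + (-1) * grad G x k)"
  by (simp only: grad_add[OF assms(1) PF_mult[OF PF_const assms(2)]] grad_cmult[OF assms(2)])
 then show ?thesis by simp
qed

text \<open>\<open>ga\<close> is read off from the product rule for \<open>H = P * w\<close> at
  \<open>x\<close>. The value of \<open>P\<close> is then correct by Euler's relation, where
  \<open>d >= 1\<close> is used.\<close>

lemma fit_gradient:
 assumes H: "H : PF" "hom (%_. 1) (int d + int m) H" and w: "w : PF" "hom (%_. 1) (int m) w"
  and wx: "w x ~= 0" and d: "d >= 1"
 shows "EX ga. ALL P. P : PF --> hom (%_. 1) (int d) P --> grad P x = ga -->
  H x - P x * w x = 0 & grad (%x. H x - P x * w x) x = (%_. 0)"
proof -
 define P0 where "P0 = H x / w x"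
 define ga where "ga = (%a. (grad H x a - P0 * grad w x a) / w x)"
 have eH: "(\<Sum>k\<in>UNIV. grad H x k * x k) = of_nat (d + m) * H x"
  by (rule euler[OF H(1)]) (use H(2) in simp)
 have ew: "(\<Sum>k\<in>UNIV. grad w x k * x k) = of_nat m * w x" by (rule euler[OF w])
 have "(\<Sum>k\<in>UNIV. ga k * x k) * w x = (\<Sum>k\<in>UNIV. grad H x k * x k) - P0 * (\<Sum>k\<in>UNIV. grad w x k * x k)"
 proof -
  have "ga k * w x = grad H x k - P0 * grad w x k" for k using wx by (simp add: ga_def)
  then have "ga k * x k * w x = grad H x k * x k - P0 * (grad w x k * x k)" for k
   by (metis (no_types, opaque_lifting) left_diff_distrib mult.assoc mult.commute)
  then show ?thesis by (simp only: sum_distrib_left sum_distrib_right sum_subtractf)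
 qed
 also have "\<dots> = of_nat d * H x" using wx unfolding eH ew P0_def by (simp add: algebra_simps)
 finally have sg: "(\<Sum>k\<in>UNIV. ga k * x k) = of_nat d * P0" using wx by (simp add: P0_def field_simps)
 have "H x - P x * w x = 0 & grad (%x. H x - P x * w x) x = (%_. 0)"
  if P: "P : PF" "hom (%_. 1) (int d) P" "grad P x = ga" for P
 proof -
  have "of_nat d * P x = of_nat d * P0" using euler[OF P(1,2), of x] unfolding P(3) sg by (rule sym)
  then have Px: "P x = P0" using d by simp
  have "grad (%x. H x - P x * w x) x = (%k. grad H x k - (grad P x k * w x + P x * grad w x k))"
   by (simp only: grad_diff[OF H(1) PF_mult[OF P(1) w(1)]] grad_mult[OF P(1) w(1)])
  then show ?thesis using wx by (simp add: Px P(3) ga_def P0_def)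
 qed
 then show ?thesis by (intro exI[of _ ga] allI impI)
qed

text \<open>With \<open>l = x c / q $ c\<close>, so that \<open>l = 1\<close> at \<open>q\<close>,
  the pairing of \<open>ga\<close> with \<open>x\<close> times \<open>l ^ (d - 1)\<close> has
  gradient \<open>ga\<close> up to a multiple of the gradient of \<open>l\<close>; the term with
  \<open>l ^ d\<close> cancels this multiple.\<close>

definition grad_form :: "nat => complex ^ 'm::finite => 'm => ('m => complex) => ('m => complex) => complex" where
 "grad_form d q c ga x = (\<Sum>a\<in>UNIV. ga a * x a) * (x c / q $ c) ^ (d - 1)
   - of_nat (d - 1) / of_nat d * (\<Sum>a\<in>UNIV. ga a * q $ a) * (x c / q $ c) ^ d"

lemma grad_form:
 assumes q: "q $ c ~= 0" and d: "d >= 1"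
 shows "grad_form d q c ga : PF" "hom (%_. 1) (int d) (grad_form d q c ga)"
  "grad (grad_form d q c ga) (($) q) = ga"
proof -
 have cd: "(%x :: 'a => complex. x c / q $ c) : PF"
  using PF_mult[OF PF_var PF_const, of c "1 / q $ c"] by simp
 show PF: "grad_form d q c ga : PF"
  unfolding grad_form_def[abs_def] by (intro PF_diff PF_mult PF_sum PF_power PF_const PF_var cd)
 obtain e where e: "d = Suc e" using d by (cases d) auto
 show "hom (%_. 1) (int d) (grad_form d q c ga)"
  unfolding hom_def
 proof (intro allI impI)
  fix r :: complex and x :: "'a => complex" assume r: "r ~= 0"
  have 1: "(\<Sum>a\<in>UNIV. ga a * (r * x a)) = r * (\<Sum>a\<in>UNIV. ga a * x a)"
   by (simp add: sum_distrib_left mult.left_commute)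
  have 2: "r * x c / q $ c = r * (x c / q $ c)" by simp
  have 3: "r powi int d = r * r ^ e" using r by (simp add: e power_int_add)
  show "grad_form d q c ga (act (%_. 1) r x) = r powi int d * grad_form d q c ga x"
   unfolding grad_form_def act_def power_int_1_right 1 2 power_mult_distrib 3 by (simp add: e algebra_simps)
 qed
 show "grad (grad_form d q c ga) (($) q) = ga"
 proof (rule grad_unique[OF PF])
  fix w :: "'a => complex"
  define A where "A = (\<Sum>a\<in>UNIV. ga a * q $ a)"
  define B where "B = (\<Sum>a\<in>UNIV. ga a * w a)"
  define l where "l = w c / q $ c"
  have 1: "(\<Sum>a\<in>UNIV. ga a * (q $ a + z * w a)) = A + z * B" for z
   by (simp add: A_def B_def ring_distribs sum.distrib sum_distrib_left mult.left_commute)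
  have 2: "(q $ c + z * w c) / q $ c = 1 + z * l" for z using q by (simp add: l_def field_simps)
  have ne: "(1 :: complex) + of_nat e ~= 0" by (metis of_nat_Suc of_nat_neq_0)
  have "((%z. (A + z * B) * (1 + z * l) ^ (d - 1) - of_nat (d - 1) / of_nat d * A * (1 + z * l) ^ d) has_field_derivative B) (at 0)"
   by (rule derivative_eq_intros refl | simp add: e)+ (simp add: algebra_simps e ne)
  then show "((%z. grad_form d q c ga (%k. q $ k + z * w k)) has_field_derivative (\<Sum>k\<in>UNIV. ga k * w k)) (at 0)"
   unfolding grad_form_def 1 2 A_def[symmetric] B_def[symmetric] .
 qed
qed

lemma grad_form_linear:
 "grad_form d q c (%a. ga a + ga' a) x = grad_form d q c ga x + grad_form d q c ga' x"
 "grad_form d q c (%a. r * ga a) x = r * grad_form d q c ga x"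
 by (simp_all add: grad_form_def ring_distribs sum.distrib mult.assoc sum_distrib_left[symmetric] right_diff_distrib) (simp_all add: algebra_simps)?

lemma form_in_span: "F : PF ==> hom w de F ==> F : cfun.span (mon ` {al. wt w al = de})"
 using span_mono_hom[of F UNIV w de] by (simp add: PF_eq_span[symmetric])

section \<open>Coboundaries, and forms as coefficient vectors\<close>

lemma cech_coboundariesI:
 assumes "!!x. x : topspace T ==> openin T (U x) & x : U x & sec (U x) (h x)"
  "!!x y e. x : topspace T ==> y : topspace T ==> e : \<Union>(U x \<inter> U y) ==> f (x, y, e) = h y e - h x e"
 shows "f : cech_coboundaries T sec"
 unfolding cech_coboundaries_def pointed_cover_def mem_Collect_eq
 using assms by (intro exI[of _ U] exI[of _ h] conjI ballI) simp_all

lemma cech_coboundariesE: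
 assumes "f : cech_coboundaries T sec"
 obtains U h where "ALL x:topspace T. openin T (U x) & x : U x" "ALL x:topspace T. sec (U x) (h x)"
  "ALL x:topspace T. ALL y:topspace T. ALL e:\<Union>(U x \<inter> U y). f (x, y, e) = h y e - h x e"
 using assms unfolding cech_coboundaries_def pointed_cover_def mem_Collect_eq by (elim exE conjE)

lemma subspace_coboundaries: "cfun.subspace (cech_coboundaries (zariski p s) (sec_2 p s d))"
proof (rule cfun_subspaceI)
 let ?T = "zariski p s"
 show "(%x. 0) : cech_coboundaries ?T (sec_2 p s d)"
  by (rule cech_coboundariesI[of _ "%_. topspace ?T" _ "%x e. 0"]) (auto intro: sec_2_zero)
 fix f assume "f : cech_coboundaries ?T (sec_2 p s d)"
 then obtain U h where U: "ALL x:topspace ?T. openin ?T (U x) & x : U x" "ALL x:topspace ?T. sec_2 p s d (U x) (h x)"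
  "ALL x:topspace ?T. ALL y:topspace ?T. ALL e:\<Union>(U x \<inter> U y). f (x, y, e) = h y e - h x e" by (rule cech_coboundariesE)
 show "(%x. r * f x) : cech_coboundaries ?T (sec_2 p s d)" for r
 proof (rule cech_coboundariesI[of _ U _ "%x e. r * h x e"])
  fix x y e assume x: "x : topspace ?T" "y : topspace ?T" "e : \<Union>(U x \<inter> U y)"
  show "r * f (x, y, e) = r * h y e - r * h x e"
   using U(3)[THEN bspec, OF x(1), THEN bspec, OF x(2), THEN bspec, OF x(3)] by (simp add: right_diff_distrib)
 qed (use U(1,2) sec_2_cmult in blast)
 fix g assume "g : cech_coboundaries ?T (sec_2 p s d)"
 then obtain U' h' where U': "ALL x:topspace ?T. openin ?T (U' x) & x : U' x" "ALL x:topspace ?T. sec_2 p s d (U' x) (h' x)"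
  "ALL x:topspace ?T. ALL y:topspace ?T. ALL e:\<Union>(U' x \<inter> U' y). g (x, y, e) = h' y e - h' x e" by (rule cech_coboundariesE)
 show "(%x. f x + g x) : cech_coboundaries ?T (sec_2 p s d)"
 proof (rule cech_coboundariesI[of _ "%x. U x \<inter> U' x" _ "%x e. h x e + h' x e"])
  fix x assume x: "x : topspace ?T"
  have op: "openin ?T (U x \<inter> U' x)" using U(1) U'(1) x by auto
  have "sec_2 p s d (U x \<inter> U' x) (h x)" by (rule sec_2_mono[OF bspec[OF U(2) x] op _ refl]) blast
  moreover have "sec_2 p s d (U x \<inter> U' x) (h' x)" by (rule sec_2_mono[OF bspec[OF U'(2) x] op _ refl]) blast
  ultimately show "openin ?T (U x \<inter> U' x) & x : U x \<inter> U' x & sec_2 p s d (U x \<inter> U' x) (%e. h x e + h' x e)"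
   using op U(1) U'(1) x by (intro conjI sec_2_add) blast+
 next
  fix x y e assume x: "x : topspace ?T" "y : topspace ?T" and e: "e : \<Union>((U x \<inter> U' x) \<inter> (U y \<inter> U' y))"
  have "f (x, y, e) = h y e - h x e" using U(3)[THEN bspec, OF x(1), THEN bspec, OF x(2)] e by blast
  moreover have "g (x, y, e) = h' y e - h' x e" using U'(3)[THEN bspec, OF x(1), THEN bspec, OF x(2)] e by blast
  ultimately show "f (x, y, e) + g (x, y, e) = h y e + h' y e - (h x e + h' x e)" by simp
 qed
qed

definition exps :: "nat => ('m::finite => nat) set" where "exps d = {al. (\<Sum>k\<in>UNIV. al k) = d}"

definition poly_of :: "nat => (('m::finite => nat) => complex) => ('m => complex) => complex" where
 "poly_of d c x = (\<Sum>al\<in>exps d. c al * mon al x)"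

lemma wt_one: "wt (%_. 1) al = int (\<Sum>k\<in>UNIV. al k)" by (simp add: wt_def)

lemma finite_exps: "finite (exps d :: ('m::finite => nat) set)"
proof (rule finite_subset)
 show "exps d <= (\<Pi>\<^sub>E k\<in>UNIV. {..d})"
 proof
  fix al assume "al : exps d"
  then have "al k <= d" for k using member_le_sum[of k UNIV al] by (simp add: exps_def)
  then show "al : (\<Pi>\<^sub>E k\<in>UNIV. {..d})" by (simp add: PiE_iff)
 qed
 show "finite (\<Pi>\<^sub>E k\<in>(UNIV :: 'm set). {..d})" by (intro finite_PiE) auto
qed

lemma poly_of: "poly_of d c : PF" "hom (%_. 1) (int d) (poly_of d c)"
proof -
 show "poly_of d c : PF" unfolding poly_of_def[abs_def] by (intro PF_sum PF_mult PF_const PF_mono)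
 have "poly_of d c : cfun.span (mon ` {al. wt (%_. 1) al = int d})"
  unfolding poly_of_def[abs_def] by (intro cfun_span_sum cfun.span_base imageI) (simp add: exps_def wt_one del: of_nat_sum)
 then show "hom (%_. 1) (int d) (poly_of d c)" by (rule hom_span)
qed

lemma poly_of_ex:
 assumes "F : PF" "hom (%_. 1) (int d) F"
 obtains c where "c : supp_in (exps d)" "F = poly_of d c"
proof -
 obtain A r where A: "finite A" "A <= {al. wt (%_. 1) al = int d}" "F = (%x. \<Sum>al\<in>A. r al * mon al x)"
  using form_in_span[OF assms] by (rule span_monoE)
 have AE: "A <= exps d" using A(2) unfolding exps_def wt_one by (auto simp del: of_nat_sum)
 show ?thesis
 proof (rule that[of "%al. if al : A then r al else 0"])
  show "(%al. if al : A then r al else 0) : supp_in (exps d)" using AE by (auto simp: supp_in_def)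
  show "F = poly_of d (%al. if al : A then r al else 0)"
  proof
   fix x
   show "F x = poly_of d (%al. if al : A then r al else 0) x"
    unfolding A(3) poly_of_def by (intro sum.mono_neutral_cong_left finite_exps AE) auto
  qed
 qed
qed

lemma poly_of_linear:
 "poly_of d (%al. c al + c' al) = (%x. poly_of d c x + poly_of d c' x)"
 "poly_of d (%al. r * c al) = (%x. r * poly_of d c x)"
 by (simp_all add: poly_of_def fun_eq_iff ring_distribs sum.distrib sum_distrib_left mult.assoc)

section \<open>From prescribed gradients to cohomology classes\<close>

context points begin

definition over :: "nat => 'm coords set => bool" where
 "over i x \<longleftrightarrow> (EX e:x. proj_pt (fst e) = proj_pt (p i))"

lemma over_iff: "over i (multiproj_pt e) \<longleftrightarrow> proj_pt (fst e) = proj_pt (p i)"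
proof
 assume "over i (multiproj_pt e)"
 then obtain e' where e': "e' : multiproj_pt e" "proj_pt (fst e') = proj_pt (p i)" unfolding over_def by blast
 obtain c ga where "c ~= 0" "e' = rescale c ga e" using e'(1) by (rule multiproj_ptE)
 then show "proj_pt (fst e) = proj_pt (p i)" using e'(2) proj_pt_smult[of c "fst e"] by simp
qed (use multiproj_pt_self over_def in blast)

lemma over_unique: "x : blowup p s ==> over i x ==> over j x ==> i : {1..s} ==> j : {1..s} ==> i = j"
 by (metis blowup_point over_iff inj_onD[OF p_inj])

text \<open>For each centre not below \<open>x\<close> some minor does not vanish at
  \<open>x\<close>; the product of these minors cuts out the neighbourhood.\<close>

lemma nbhd_over:
 assumes "x : blowup p s"
 shows "EX N. openin (zariski p s) N & x : N & (ALL e:\<Union>N. ALL j:{1..s}. proj_pt (fst e) = proj_pt (p j) --> over j x)"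
proof -
 obtain e0 where e0: "e0 : blowup_cone p s" "x = multiproj_pt e0" using assms by (rule blowup_point)
 define A where "A = {j : {1..s}. \<not> over j x}"
 have "ALL j:A. EX ab. minors (p j) (fst e0) $ ab ~= 0"
 proof
  fix j assume j: "j : A"
  have "minors (p j) (fst e0) ~= 0"
  proof
   assume "minors (p j) (fst e0) = 0"
   then obtain r where r: "fst e0 = r *s p j" using minors_eq_0_iff[OF p_nz] j by (auto simp: A_def)
   then have "r ~= 0" using coneD(1)[OF e0(1)] by auto
   then show False using j e0(2) over_iff proj_pt_smult r by (metis (mono_tags, lifting) A_def mem_Collect_eq)
  qed
  then show "EX ab. minors (p j) (fst e0) $ ab ~= 0" by (auto simp: vec_eq_iff)
 qed
 then obtain ab where ab: "ALL j:A. minors (p j) (fst e0) $ ab j ~= 0" unfolding bchoice_iff by (elim exE)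
 define F where "F = (%e :: 'm coords. \<Prod>j\<in>A. minors (p j) (fst e) $ ab j)"
 have fA: "finite A" by (simp add: A_def)
 have F: "F : multihom s (\<Sum>j\<in>A. 1) (%i. \<Sum>j\<in>A. 0)"
  unfolding F_def
 proof (rule multihom_prod)
  fix j
  show "(%e. minors (p j) (fst e) $ ab j) : multihom s 1 (%_. 0)"
   unfolding minors_def vec_lambda_beta by (intro multihom_diff multihom_cmult multihom_fst)
 qed
 have "over j x" if e: "e : \<Union>(basic_open p s F)" and j: "j : {1..s}" "proj_pt (fst e) = proj_pt (p j)" for e j
 proof (rule ccontr)
  assume "\<not> over j x"
  then have jA: "j : A" using j(1) by (simp add: A_def)
  have "F e ~= 0" using e by (auto simp: basic_open_def)
  then have "minors (p j) (fst e) $ ab j ~= 0" using jA fA by (simp add: F_def)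
  moreover obtain r where "fst e = r *s p j" using j(2) by (rule proj_pt_eqD)
  ultimately show False by (simp add: minors_smult minors_self)
 qed
 moreover have "x : basic_open p s F"
  unfolding e0(2) using in_basic_open[OF F e0(1)] ab fA by (simp add: F_def)
 ultimately show ?thesis using openin_basic[OF F] by (intro exI[of _ "basic_open p s F"] conjI ballI impI)
qed

lemma form_sec_H:
 assumes "openin (zariski p s) U" "F : PF" "hom (%_. 1) (int d) F"
 shows "sec_H p s (int d) U (%e. F (($) (fst e)))"
 by (rule sec_H_fraction[OF assms(1) multihom_form[OF form_in_span[OF assms(2,3)]] multihom_const[of 1]]) auto

lemma exceptional_nbhd:
 assumes Q: "Q : PF" "hom (%_. 1) d Q" "Q (($) (p i)) = 0" "grad Q (($) (p i)) = (%_. 0)"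
  and x: "x : blowup p s" "over i x" "i : {1..s}"
 shows "EX W. openin (zariski p s) W & x : W & sec_2 p s d W (%e. Q (($) (fst e)))"
proof -
 obtain e0 where e0: "e0 : blowup_cone p s" "x = multiproj_pt e0" using x(1) by (rule blowup_point)
 obtain j c u where u: "chart p s j c u (s - 1)" "u (($) (fst e0)) ~= 0" using chart_at[OF coneD(1)[OF e0(1)]] by (elim exE conjE)
 have "j = i" using chart.u_zero_at(3)[OF u x(3)] over_iff e0(2) x(2) by blast
 then have Q': "Q (($) (p j)) = 0" "grad Q (($) (p j)) = (%_. 0)" "hom (%_. 1) (d + int 0 * int (s - 1)) Q" using Q by simp_all
 show ?thesis
  using chart.double_zero_section[OF u(1) Q(1) Q'(3,1,2) e0(1) u(2)] e0(2) by simp blast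
qed

lemma ordinary_nbhd:
 assumes x: "x : blowup p s" "!!i. i : {1..s} ==> \<not> over i x" and W: "openin (zariski p s) W" "x : W" and ph: "sec_H p s d W ph"
 shows "EX W'. openin (zariski p s) W' & x : W' & sec_2 p s d W' ph"
proof -
 obtain N where N: "openin (zariski p s) N" "x : N" "ALL e:\<Union>N. ALL j:{1..s}. proj_pt (fst e) = proj_pt (p j) --> over j x"
  using nbhd_over[OF x(1)] by (elim exE conjE)
 have op: "openin (zariski p s) (N \<inter> W)" by (intro openin_Int N W)
 have "sec_2 p s d (N \<inter> W) ph"
  by (rule sec_2_off_exceptional[OF op sec_H_mono[OF ph op _ refl]]) (use N(3) x(2) in blast)+
 then show ?thesis using op N(2) W(2) by blast
qed

definition coord :: "nat => 'm" where "coord i = (SOME c. p i $ c ~= 0)"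

lemma coord: "i : {1..s} ==> p i $ coord i ~= 0"
proof -
 assume "i : {1..s}"
 then have "EX c. p i $ c ~= 0" using p_nz by (auto simp: vec_eq_iff)
 then show ?thesis unfolding coord_def by (rule someI_ex)
qed

abbreviation PP :: "nat => (nat \<times> 'm => complex) => nat => ('m => complex) => complex" where
 "PP d g i \<equiv> grad_form d (p i) (coord i) (%a. g (i, a))"

text \<open>A cochain of forms: at points over the centre \<open>i\<close> the form with gradient
  \<open>g (i, _)\<close>, and \<open>0\<close> elsewhere. At most one summand is present because
  the centres are distinct.\<close>

definition kk :: "nat => (nat \<times> 'm => complex) => 'm coords set => 'm coords => complex" where
 "kk d g x e = (\<Sum>i\<in>{1..s}. if over i x then PP d g i (($) (fst e)) else 0)"

lemma kk_over:
 assumes "x : blowup p s" "over i x" "i : {1..s}"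
 shows "kk d g x e = PP d g i (($) (fst e))"
proof -
 have "kk d g x e = (\<Sum>j\<in>{1..s}. if j = i then PP d g i (($) (fst e)) else 0)"
  unfolding kk_def by (intro sum.cong refl) (use over_unique assms in auto)
 then show ?thesis using assms(3) by simp
qed

lemma kk_none: "(!!i. i : {1..s} ==> \<not> over i x) ==> kk d g x e = 0"
 unfolding kk_def by (intro sum.neutral) simp

lemma kk_sec_H:
 assumes "openin (zariski p s) U" "d >= 1"
 shows "sec_H p s (int d) U (kk d g x)"
 unfolding kk_def[abs_def]
proof (rule sec_H_sum[OF assms(1)])
 fix i assume i: "i : {1..s}"
 show "sec_H p s (int d) U (%e. if over i x then PP d g i (($) (fst e)) else 0)"
  using form_sec_H[OF assms(1) grad_form(1,2)[OF coord[OF i] assms(2)]] sec_H_zero[OF assms(1)]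
  by (cases "over i x") simp_all
qed

text \<open>The connecting map for the quotient of O(d H) by O(D): the coboundary of a cochain of
  O(d H) that lifts prescribed first-order jets at the centres.\<close>

definition delta :: "nat => (nat \<times> 'm => complex) => 'm coords set \<times> 'm coords set \<times> 'm coords => complex" where
 "delta d g = (%(x, y, e). kk d g y e - kk d g x e)"

lemma clinear_delta: "clinear (delta d)"
proof (rule clinearI)
 have 1: "kk d (%x. f x + g x) x e = kk d f x e + kk d g x e" for f g x e
  unfolding kk_def sum.distrib[symmetric] by (intro sum.cong refl) (simp add: grad_form_linear)
 have 2: "kk d (%x. c * f x) x e = c * kk d f x e" for f c x e
  unfolding kk_def sum_distrib_left by (intro sum.cong refl) (simp add: grad_form_linear)
 show "delta d (%x. f x + g x) = (%x. delta d f x + delta d g x)" for f g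
  by (auto simp: delta_def fun_eq_iff 1)
 show "delta d (%x. c * f x) = (%x. c * delta d f x)" for f c
  by (auto simp: delta_def fun_eq_iff 2 right_diff_distrib)
qed

abbreviation ZZ where "ZZ d \<equiv> cech_cocycles (zariski p s) (sec_2 p s (int d))"
abbreviation BB where "BB d \<equiv> cech_coboundaries (zariski p s) (sec_2 p s (int d))"

lemma cocycle_if:
 assumes d: "d >= 1" and B: "f - delta d g : BB d"
 shows "f : ZZ d"
proof -
 obtain U h where U0: "ALL x:topspace (zariski p s). openin (zariski p s) (U x) & x : U x" "ALL x:topspace (zariski p s). sec_2 p s d (U x) (h x)"
  "ALL x:topspace (zariski p s). ALL y:topspace (zariski p s). ALL e:\<Union>(U x \<inter> U y). (f - delta d g) (x, y, e) = h y e - h x e"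
  using B by (rule cech_coboundariesE)
 note U = U0[unfolded topspace_zariski]
 have "ALL x:blowup p s. EX N. openin (zariski p s) N & x : N & (ALL e:\<Union>N. ALL j:{1..s}. proj_pt (fst e) = proj_pt (p j) --> over j x)"
  using nbhd_over by blast
 then obtain N where N: "ALL x:blowup p s. openin (zariski p s) (N x) & x : N x & (ALL e:\<Union>(N x). ALL j:{1..s}. proj_pt (fst e) = proj_pt (p j) --> over j x)"
  unfolding bchoice_iff by (elim exE)
 define W where "W = (%x. U x \<inter> N x)"
 have op: "openin (zariski p s) (W x)" "x : W x" if "x : blowup p s" for x
  using U(1) N that by (auto simp: W_def)
 have eq: "f (x, y, e) = (h y e + kk d g y e) - (h x e + kk d g x e)" if x: "x : blowup p s" "y : blowup p s" "e : \<Union>(W x \<inter> W y)" for x y e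
 proof -
  have "e : \<Union>(U x \<inter> U y)" using x(3) by (auto simp: W_def)
  then have "(f - delta d g) (x, y, e) = h y e - h x e" using U(3)[THEN bspec, OF x(1), THEN bspec, OF x(2)] by blast
  then show ?thesis by (simp add: delta_def algebra_simps)
 qed
 have "sec_2 p s d (W x \<inter> W y) (%e. f (x, y, e))" if x: "x : blowup p s" "y : blowup p s" for x y
 proof -
  have o: "openin (zariski p s) (W x \<inter> W y)" by (intro openin_Int op x)
  have h: "sec_2 p s d (W x \<inter> W y) (h z)" if "z = x | z = y" for z
  proof -
   have "sec_2 p s d (U z) (h z)" using U(2) that x by blast
   then show ?thesis by (rule sec_2_mono[OF _ o _ refl]) (use that in \<open>auto simp: W_def\<close>)
  qed
  have k: "sec_2 p s d (W x \<inter> W y) (%e. kk d g y e - kk d g x e)"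
  proof (cases "EX i:{1..s}. over i x & over i y")
   case True
   then obtain i where i: "i : {1..s}" "over i x" "over i y" by blast
   have "(%e. kk d g y e - kk d g x e) = (%e. 0)"
    using kk_over[OF x(1) i(2,1)] kk_over[OF x(2) i(3,1)] by simp
   then show ?thesis using sec_2_zero[OF o] by simp
  next
   case False
   show ?thesis
   proof (rule sec_2_off_exceptional[OF o sec_H_diff[OF o kk_sec_H[OF o d] kk_sec_H[OF o d]]])
    fix e i assume e: "e : \<Union>(W x \<inter> W y)" and i: "i : {1..s}"
    have "e : \<Union>(N x)" "e : \<Union>(N y)" using e by (auto simp: W_def)
    then show "proj_pt (fst e) ~= proj_pt (p i)" using N x i False by blast
   qed
  qed
  show ?thesis
   by (rule sec_2_mono[OF sec_2_add[OF sec_2_diff[OF h h] k] o order_refl, of y x])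
     (auto simp: eq[OF x])
 qed
 moreover have "f (x, y, e) + f (y, z, e) = f (x, z, e)"
  if x: "x : blowup p s" "y : blowup p s" "z : blowup p s" and e: "e : \<Union>(W x \<inter> W y \<inter> W z)" for x y z e
 proof -
  have "e : \<Union>(W x \<inter> W y)" "e : \<Union>(W y \<inter> W z)" "e : \<Union>(W x \<inter> W z)" using e by blast+
  then show ?thesis using eq[OF x(1,2)] eq[OF x(2,3)] eq[OF x(1,3)] by simp
 qed
 ultimately show ?thesis
  unfolding cech_cocycles_def pointed_cover_def topspace_zariski mem_Collect_eq
  using op by (intro exI[of _ W] conjI ballI) auto
qed

text \<open>\<open>global_splitting\<close> leaves the corrections \<open>H t / uu t ^ K\<close>.
  Near the centre \<open>i\<close> the correction is matched up to a double zero by a form with the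
  gradient from \<open>fit_gradient\<close>, and \<open>g\<close> collects these gradients.\<close>

lemma cocycle_imp:
 assumes d: "d >= 1" and f: "f : ZZ d"
 shows "EX g:supp_in ({1..s} \<times> UNIV). f - delta d g : BB d"
proof -
 obtain J where J: "finite J" "J <= charts" "!!v. v ~= 0 ==> EX t:J. snd (snd t) (($) v) ~= 0"
  by (rule finite_charts) (rule that)
 interpret atlas p s J by unfold_locales (rule J)+
 obtain ka K H where H: "ALL t:J. H t : PF & hom (%_. 1) (int d + int K * int (s - 1)) (H t) &
  splits (sec_2 p s d) (zariski p s) f (basic_open p s (%e. uu t (($) (fst e))))
   (%e. ka e - H t (($) (fst e)) / uu t (($) (fst e)) ^ K)"
  using global_splitting[OF f] by (elim exE)
 have um: "(%e. uu t (($) (fst e))) : multihom s (s - 1) (%_. 0)" if "t : J" for t by (rule chart.u_multihom[OF ch[OF that]])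
 have "ALL i:{1..s}. EX t. t : J & uu t (($) (p i)) ~= 0" using Jcov p_nz by blast
 then obtain T where T: "ALL i:{1..s}. T i : J & uu (T i) (($) (p i)) ~= 0" unfolding bchoice_iff by (elim exE)
 \<comment> \<open>\<open>uu t\<close> vanishes at every centre but its own.\<close>
 have Ti: "fst (T i) = i" if i: "i : {1..s}" for i
 proof (rule ccontr)
  assume "fst (T i) ~= i"
  then have "uu (T i) (($) (p i)) = 0" using chart.uj[OF ch[of "T i"] i] T i by metis
  then show False using T i by blast
 qed
 have "ALL i:{1..s}. EX ga. ALL P. P : PF --> hom (%_. 1) (int d) P --> grad P (($) (p i)) = ga -->
  H (T i) (($) (p i)) - P (($) (p i)) * uu (T i) (($) (p i)) ^ K = 0 &
  grad (%x. H (T i) x - P x * uu (T i) x ^ K) (($) (p i)) = (%_. 0)"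
 proof
  fix i assume i: "i : {1..s}"
  have t: "T i : J" "uu (T i) (($) (p i)) ~= 0" using T i by blast+
  have h: "H (T i) : PF" "hom (%_. 1) (int d + int (K * (s - 1))) (H (T i))" using bspec[OF H t(1)] by simp_all
  have w: "hom (%_. 1) (int (K * (s - 1))) (%x. uu (T i) x ^ K)" using hom_power[OF uuhom[OF t(1)]] by simp
  show "EX ga. ALL P. P : PF --> hom (%_. 1) (int d) P --> grad P (($) (p i)) = ga -->
   H (T i) (($) (p i)) - P (($) (p i)) * uu (T i) (($) (p i)) ^ K = 0 &
   grad (%x. H (T i) x - P x * uu (T i) x ^ K) (($) (p i)) = (%_. 0)"
   by (rule fit_gradient[OF h PF_power[OF uuPF[OF t(1)]] w _ d]) (use t(2) in simp)
 qed
 then obtain ga where ga: "ALL i:{1..s}. ALL P. P : PF --> hom (%_. 1) (int d) P --> grad P (($) (p i)) = ga i -->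
  H (T i) (($) (p i)) - P (($) (p i)) * uu (T i) (($) (p i)) ^ K = 0 &
  grad (%x. H (T i) x - P x * uu (T i) x ^ K) (($) (p i)) = (%_. 0)"
  unfolding bchoice_iff by (elim exE)
 define g where "g = (%(i, a). if i : {1..s} then ga i a else 0)"
 have g: "g : supp_in ({1..s} \<times> UNIV)" by (auto simp: supp_in_def g_def)
 have gi: "(%a. g (i, a)) = ga i" if "i : {1..s}" for i using that by (simp add: g_def)
 obtain N where N0: "ALL x:topspace (zariski p s). openin (zariski p s) (N x) & x : N x"
  "ALL x:topspace (zariski p s). ALL y:topspace (zariski p s). sec_2 p s d (N x \<inter> N y) (%e. f (x, y, e))"
  "ALL x:topspace (zariski p s). ALL y:topspace (zariski p s). ALL z:topspace (zariski p s).
    ALL e:\<Union>(N x \<inter> N y \<inter> N z). f (x, y, e) + f (y, z, e) = f (x, z, e)"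
  using f by (rule cocycleE)
 note N = N0[unfolded topspace_zariski]
 have "EX W. openin (zariski p s) W & x : W & sec_2 p s d W (%e. ka e - kk d g x e - f (x, multiproj_pt e, e))"
  if x: "x : blowup p s" for x
 proof -
  obtain e0 where e0: "e0 : blowup_cone p s" "x = multiproj_pt e0" using x by (rule blowup_point)
  have glue: "EX W. openin (zariski p s) W & x : W & sec_2 p s d W (%e. ka e - kk d g x e - f (x, multiproj_pt e, e))"
   if t: "t : J" "uu t (($) (fst e0)) ~= 0" and W2: "openin (zariski p s) W2" "x : W2"
    and s2: "sec_2 p s d W2 (%e. H t (($) (fst e)) / uu t (($) (fst e)) ^ K - kk d g x e)" for t W2
  proof -
   have "x : basic_open p s (%e. uu t (($) (fst e)))" unfolding e0(2) in_basic_open[OF um[OF t(1)] e0(1)] by (rule t(2))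
   then obtain W1 where W1: "openin (zariski p s) W1" "x : W1"
    "sec_2 p s d W1 (%e. ka e - H t (($) (fst e)) / uu t (($) (fst e)) ^ K - f (x, multiproj_pt e, e))"
    using bspec[OF H t(1)] unfolding splits_def by blast
   have o: "openin (zariski p s) (W1 \<inter> W2)" by (intro openin_Int W1 W2)
   have a: "sec_2 p s d (W1 \<inter> W2) (%e. ka e - H t (($) (fst e)) / uu t (($) (fst e)) ^ K - f (x, multiproj_pt e, e))"
    by (rule sec_2_mono[OF W1(3) o _ refl]) blast
   have b: "sec_2 p s d (W1 \<inter> W2) (%e. H t (($) (fst e)) / uu t (($) (fst e)) ^ K - kk d g x e)"
    by (rule sec_2_mono[OF s2 o _ refl]) blast
   have "sec_2 p s d (W1 \<inter> W2) (%e. ka e - kk d g x e - f (x, multiproj_pt e, e))"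
    by (rule sec_2_mono[OF sec_2_add[OF a b] o order_refl]) simp
   then show ?thesis using o W1(2) W2(2) by blast
  qed
  show ?thesis
  proof (cases "EX i:{1..s}. over i x")
   case True
   then obtain i where i: "i : {1..s}" "over i x" by blast
   have t: "T i : J" "uu (T i) (($) (p i)) ~= 0" using T i(1) by blast+
   have "proj_pt (fst e0) = proj_pt (p i)" using i(2) unfolding e0(2) over_iff .
   then obtain r where r: "r ~= 0" "fst e0 = r *s p i" by (rule proj_pt_eqD)
   have u0: "uu (T i) (($) (fst e0)) ~= 0"
    unfolding r(2) chart.u_smult[OF ch[OF t(1)] r(1)] using r(1) t(2) by simp
   let ?P = "PP d g i"
   have P: "?P : PF" "hom (%_. 1) (int d) ?P" "grad ?P (($) (p i)) = ga i"
    using grad_form[OF coord[OF i(1)] d] by (simp_all only: gi[OF i(1)])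
   define Q where "Q = (%x. H (T i) x - ?P x * uu (T i) x ^ K)"
   have Q: "Q (($) (p (fst (T i)))) = 0" "grad Q (($) (p (fst (T i)))) = (%_. 0)"
   proof -
    note * = ga[THEN bspec, OF i(1), THEN spec, THEN mp, OF P(1), THEN mp, OF P(2), THEN mp, OF P(3)]
    show "Q (($) (p (fst (T i)))) = 0" unfolding Q_def Ti[OF i(1)] by (rule *[THEN conjunct1])
    show "grad Q (($) (p (fst (T i)))) = (%_. 0)" unfolding Q_def Ti[OF i(1)] by (rule *[THEN conjunct2])
   qed
   have h: "H (T i) : PF" "hom (%_. 1) (int d + int K * int (s - 1)) (H (T i))" using bspec[OF H t(1)] by simp_all
   have QPF: "Q : PF" unfolding Q_def by (intro PF_diff PF_mult PF_power h P uuPF t)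
   have Qh: "hom (%_. 1) (int d + int K * int (s - 1)) Q"
    unfolding Q_def by (intro hom_diff h hom_mult P hom_power uuhom t)
   obtain W where W: "openin (zariski p s) W" "multiproj_pt e0 : W" "ALL e:\<Union>W. uu (T i) (($) (fst e)) ~= 0"
    "sec_2 p s d W (%e. Q (($) (fst e)) / uu (T i) (($) (fst e)) ^ K)"
    using chart.double_zero_section[OF ch[OF t(1)] QPF Qh Q e0(1) u0] by (elim exE conjE)
   show ?thesis
   proof (rule glue[OF t(1) u0 W(1)])
    show "x : W" using W(2) e0(2) by simp
    show "sec_2 p s d W (%e. H (T i) (($) (fst e)) / uu (T i) (($) (fst e)) ^ K - kk d g x e)"
    proof (rule sec_2_mono[OF W(4,1) order_refl])
     fix e assume "e : \<Union>W"
     then have "uu (T i) (($) (fst e)) ~= 0" by (rule bspec[OF W(3)])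
     then show "H (T i) (($) (fst e)) / uu (T i) (($) (fst e)) ^ K - kk d g x e = Q (($) (fst e)) / uu (T i) (($) (fst e)) ^ K"
      by (simp add: Q_def kk_over[OF x i(2,1)] diff_divide_distrib)
    qed
   qed
  next
   case False
   obtain t where t: "t : J" "uu t (($) (fst e0)) ~= 0" using Jcov[OF coneD(1)[OF e0(1)]] by (elim bexE)
   let ?O = "basic_open p s (%e. uu t (($) (fst e)))"
   have xO: "x : ?O" unfolding e0(2) in_basic_open[OF um[OF t(1)] e0(1)] by (rule t(2))
   have h: "H t : PF" "hom (%_. 1) (int (d + K * (s - 1))) (H t)" using bspec[OF H t(1)] by simp_all
   have oO: "openin (zariski p s) ?O" by (rule openin_basic[OF um[OF t(1)]])
   have kn: "kk d g x e = 0" for e by (rule kk_none) (use False in blast)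
   have "sec_H p s d ?O (%e. H t (($) (fst e)) / uu t (($) (fst e)) ^ K)"
   proof (rule sec_H_fraction[OF oO multihom_form[OF form_in_span[OF h]]])
    show "(%e. uu t (($) (fst e)) ^ K) : multihom s (K * (s - 1)) (%_. 0)"
     using multihom_power[OF um[OF t(1)], of K] by simp
   qed (auto simp: basic_open_def)
   then have "sec_H p s d ?O (%e. H t (($) (fst e)) / uu t (($) (fst e)) ^ K - kk d g x e)"
    using kn by simp
   then obtain W where "openin (zariski p s) W" "x : W" "sec_2 p s d W (%e. H t (($) (fst e)) / uu t (($) (fst e)) ^ K - kk d g x e)"
    using ordinary_nbhd[OF x _ oO xO] False by blast
   then show ?thesis by (rule glue[OF t])
  qed
 qed
 then have "ALL x:blowup p s. EX W. openin (zariski p s) W & x : W & sec_2 p s d W (%e. ka e - kk d g x e - f (x, multiproj_pt e, e))"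
  by (intro ballI)
 then obtain W where W: "ALL x:blowup p s. openin (zariski p s) (W x) & x : W x & sec_2 p s d (W x) (%e. ka e - kk d g x e - f (x, multiproj_pt e, e))"
  unfolding bchoice_iff by (elim exE)
 have "f - delta d g : BB d"
 proof (rule cech_coboundariesI[of _ "%x. W x \<inter> N x" _ "%x e. ka e - kk d g x e - f (x, multiproj_pt e, e)"], unfold topspace_zariski)
  fix x assume x: "x : blowup p s"
  have o: "openin (zariski p s) (W x \<inter> N x)" using W N(1) x by (intro openin_Int) blast+
  have "sec_2 p s d (W x) (%e. ka e - kk d g x e - f (x, multiproj_pt e, e))" using W x by blast
  from sec_2_mono[OF this o _ refl]
  show "openin (zariski p s) (W x \<inter> N x) & x : W x \<inter> N x & sec_2 p s d (W x \<inter> N x) (%e. ka e - kk d g x e - f (x, multiproj_pt e, e))"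
   using o W N(1) x by blast
 next
  fix x y e assume x: "x : blowup p s" "y : blowup p s" and e: "e : \<Union>(W x \<inter> N x \<inter> (W y \<inter> N y))"
  have "W x \<inter> N x \<inter> (W y \<inter> N y) <= blowup p s" using N(1) x(1) open_subset_blowup by blast
  from in_Union_iff[OF this] e have e': "e : blowup_cone p s" "multiproj_pt e : N x \<inter> N y" by auto
  have X: "multiproj_pt e : blowup p s" by (rule multiproj_in_blowup[OF e'(1)])
  have "multiproj_pt e : N x \<inter> N y \<inter> N (multiproj_pt e)" using e'(2) N(1) X by blast
  then have "e : \<Union>(N x \<inter> N y \<inter> N (multiproj_pt e))" using multiproj_pt_self by blast
  from N(3)[THEN bspec, OF x(1), THEN bspec, OF x(2), THEN bspec, OF X, THEN bspec, OF this]
  show "(f - delta d g) (x, y, e) = ka e - kk d g y e - f (y, multiproj_pt e, e) - (ka e - kk d g x e - f (x, multiproj_pt e, e))"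
   by (simp add: delta_def algebra_simps)
 qed
 then show ?thesis using g by blast
qed

definition grads :: "nat => (nat \<times> 'm => complex) set" where
 "grads d = {g : supp_in ({1..s} \<times> UNIV). EX F:PF. hom (%_. 1) (int d) F & (ALL i:{1..s}. ALL a. g (i, a) = grad F (($) (p i)) a)}"

lemma value_zero:
 assumes "F : PF" "hom (%_. 1) (int d) F" "d >= 1" "grad F x = (%_. 0)"
 shows "F x = 0"
 using euler[OF assms(1,2), of x] assms(3,4) by simp

lemma double_zero_at:
 assumes P: "P : PF" "hom (%_. 1) de P" and i: "i : {1..s}"
  and sec: "!!e. e : blowup_cone p s ==> proj_pt (fst e) = proj_pt (p i) ==>
   EX W. multiproj_pt e : W & sec_2 p s d W (%e. P (($) (fst e)))"
 shows "P (($) (p i)) = 0" "grad P (($) (p i)) = (%_. 0)"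
proof -
 obtain j c u where u: "chart p s j c u (s - 1)" "u (($) (p i)) ~= 0" using chart_at[OF p_nz[OF i]] by (elim exE conjE)
 have "j = i" using chart.u_zero_at(3)[OF u i] by blast
 then have ch: "chart p s i c u (s - 1)" using u(1) by simp
 obtain a b where "a ~= c" "b ~= c" "b ~= a" by (rule two_others[OF card3])
 from chart.double_zero_of_section[OF ch P sec this(1)]
 show "P (($) (p i)) = 0" "grad P (($) (p i)) = (%_. 0)" by blast+
qed

text \<open>If \<open>delta d g\<close> is the coboundary of \<open>h\<close>, the functions
  \<open>kk - h\<close> glue to a global section of O(d H), a form whose gradients at the centres
  are \<open>g\<close>. Conversely, subtracting a form with these gradients from \<open>kk\<close>
  gives sections with double zeros.\<close>

lemma delta_coboundary:
 assumes d: "d >= 1" and g: "g : supp_in ({1..s} \<times> UNIV)"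
 shows "delta d g : BB d \<longleftrightarrow> g : grads d"
proof
 assume "delta d g : BB d"
 then obtain U h where U0: "ALL x:topspace (zariski p s). openin (zariski p s) (U x) & x : U x" "ALL x:topspace (zariski p s). sec_2 p s d (U x) (h x)"
  "ALL x:topspace (zariski p s). ALL y:topspace (zariski p s). ALL e:\<Union>(U x \<inter> U y). delta d g (x, y, e) = h y e - h x e"
  by (rule cech_coboundariesE)
 note U = U0[unfolded topspace_zariski]
 define ph where "ph = (%e. kk d g (multiproj_pt e) e - h (multiproj_pt e) e)"
 have ph: "ph e = kk d g x e - h x e" if x: "x : blowup p s" and e: "e : \<Union>(U x)" for x e
 proof -
  have "U x <= blowup p s" using U(1) x open_subset_blowup by blast
  from in_Union_iff[OF this] e have e': "e : blowup_cone p s" "multiproj_pt e : U x" by auto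
  have X: "multiproj_pt e : blowup p s" by (rule multiproj_in_blowup[OF e'(1)])
  have "multiproj_pt e : U x \<inter> U (multiproj_pt e)" using e'(2) U(1) X by blast
  then have "e : \<Union>(U x \<inter> U (multiproj_pt e))" using multiproj_pt_self by blast
  from U(3)[THEN bspec, OF x, THEN bspec, OF X, THEN bspec, OF this] show ?thesis by (simp add: delta_def ph_def algebra_simps)
 qed
 have phH: "sec_H p s d (blowup p s) ph"
 proof (rule sec_H_local)
  fix x assume x: "x : blowup p s"
  have o: "openin (zariski p s) (U x)" "sec_2 p s d (U x) (h x)" using U x by blast+
  have "sec_H p s d (U x) (%e. kk d g x e - h x e)"
   by (rule sec_H_diff[OF o(1) kk_sec_H[OF o(1) d] sec_2_imp_sec_H[OF o(2)]])
  then have "sec_H p s d (U x) ph" by (rule sec_H_mono[OF _ o(1) order_refl]) (rule ph[OF x])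
  moreover have "x : U x" using U(1) x by blast
  ultimately show "EX W. x : W & W <= blowup p s & sec_H p s d W ph"
   using open_subset_blowup[OF o(1)] by (intro exI[of _ "U x"] conjI)
 qed
 obtain J where J: "finite J" "J <= charts" "!!v. v ~= 0 ==> EX t:J. snd (snd t) (($) v) ~= 0"
  by (rule finite_charts) (rule that)
 interpret atlas p s J by unfold_locales (rule J)+
 obtain F where F: "F : PF" "hom (%_. 1) (int d) F" "ALL e:blowup_cone p s. ph e = F (($) (fst e))"
  using phH by (rule global_sec_H)
 have "grad F (($) (p i)) = (%a. g (i, a))" if i: "i : {1..s}" for i
 proof -
  let ?P = "PP d g i"
  have P: "?P : PF" "hom (%_. 1) (int d) ?P" "grad ?P (($) (p i)) = (%a. g (i, a))"
   using grad_form[OF coord[OF i] d] by blast+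
  have "grad (%x. F x - ?P x) (($) (p i)) = (%_. 0)"
  proof (rule double_zero_at(2)[OF PF_diff[OF F(1) P(1)] hom_diff[OF F(2) P(2)] i])
   fix e assume e: "e : blowup_cone p s" "proj_pt (fst e) = proj_pt (p i)"
   let ?x = "multiproj_pt e"
   have x: "?x : blowup p s" "over i ?x" using e multiproj_in_blowup over_iff by blast+
   have o: "openin (zariski p s) (U ?x)" "sec_2 p s d (U ?x) (h ?x)" "?x : U ?x" using U x by blast+
   have "sec_2 p s d (U ?x) (%e. F (($) (fst e)) - ?P (($) (fst e)))"
   proof (rule sec_2_mono[OF sec_2_cmult[OF o(2), of "-1"] o(1) order_refl])
    fix e' assume e': "e' : \<Union>(U ?x)"
    then have "e' : blowup_cone p s" using in_Union_iff[OF open_subset_blowup[OF o(1)]] by blast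
    then show "F (($) (fst e')) - ?P (($) (fst e')) = - 1 * h ?x e'"
     using F(3) ph[OF x(1) e'] kk_over[OF x i] by simp
   qed
   then show "EX W. ?x : W & sec_2 p s d W (%e. F (($) (fst e)) - ?P (($) (fst e)))" using o(3) by blast
  qed
  then have "(%k. grad F (($) (p i)) k - g (i, k)) = (%_. 0)" unfolding grad_diff[OF F(1) P(1)] P(3) .
  then show ?thesis by (simp add: fun_eq_iff)
 qed
 then show "g : grads d" unfolding grads_def using g F(1,2) by (intro CollectI conjI bexI[OF _ F(1)]) simp_all
next
 assume "g : grads d"
 then obtain F where F: "F : PF" "hom (%_. 1) (int d) F" "ALL i:{1..s}. ALL a. g (i, a) = grad F (($) (p i)) a"
  unfolding grads_def by blast
 have "EX W. openin (zariski p s) W & x : W & sec_2 p s d W (%e. kk d g x e - F (($) (fst e)))" if x: "x : blowup p s" for x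
 proof (cases "EX i:{1..s}. over i x")
  case True
  then obtain i where i: "i : {1..s}" "over i x" by blast
  let ?P = "PP d g i"
  have P: "?P : PF" "hom (%_. 1) (int d) ?P" "grad ?P (($) (p i)) = (%a. g (i, a))"
   using grad_form[OF coord[OF i(1)] d] by blast+
  have g0: "grad (%x. ?P x - F x) (($) (p i)) = (%_. 0)"
   unfolding grad_diff[OF P(1) F(1)] P(3) using F(3) i(1) by simp
  have v0: "?P (($) (p i)) - F (($) (p i)) = 0"
   by (rule value_zero[OF PF_diff[OF P(1) F(1)] hom_diff[OF P(2) F(2)] d g0])
  show ?thesis
   using exceptional_nbhd[OF PF_diff[OF P(1) F(1)] hom_diff[OF P(2) F(2)] v0 g0 x i(2,1)]
   by (simp add: kk_over[OF x i(2,1)])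
 next
  case False
  have o: "openin (zariski p s) (blowup p s)" using openin_topspace topspace_zariski by metis
  show ?thesis
   by (rule ordinary_nbhd[OF x _ o x sec_H_diff[OF o kk_sec_H[OF o d] form_sec_H[OF o F(1,2)]]]) (use False in blast)
 qed
 then have "ALL x:blowup p s. EX W. openin (zariski p s) W & x : W & sec_2 p s d W (%e. kk d g x e - F (($) (fst e)))"
  by (intro ballI)
 then obtain W where W: "ALL x:blowup p s. openin (zariski p s) (W x) & x : W x & sec_2 p s d (W x) (%e. kk d g x e - F (($) (fst e)))"
  unfolding bchoice_iff by (elim exE)
 show "delta d g : BB d"
  by (rule cech_coboundariesI[of _ W _ "%x e. kk d g x e - F (($) (fst e))"], unfold topspace_zariski)
    (use W in \<open>simp_all add: delta_def\<close>)
qed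

text \<open>All classes come from prescribed gradients by \<open>cocycle_imp\<close>, and those
  prescriptions that come from forms are exactly the trivial ones.\<close>

theorem h1_eq:
 assumes d: "d >= 1"
 shows "h1 p s (int d) (%i. 2) + cfun.dim (grads d) = s * CARD('m)"
proof -
 let ?V = "supp_in ({1..s} \<times> (UNIV :: 'm set))"
 have fin: "finite ({1..s} \<times> (UNIV :: 'm set))" by simp
 have 1: "quot_dim (ZZ d) (BB d) + cfun.dim {v : ?V. delta d v : BB d} = cfun.dim ?V"
 proof (rule quot_dim_linear[OF clinear_delta supp_in_dim(2)[OF fin] subspace_coboundaries])
  show "z : ZZ d \<longleftrightarrow> (EX v:?V. z - delta d v : BB d)" for z
   using cocycle_if[OF d] cocycle_imp[OF d] by blast
 qed
 have 2: "{v : ?V. delta d v : BB d} = grads d"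
  using delta_coboundary[OF d] unfolding grads_def by blast
 have 3: "cfun.dim ?V = s * CARD('m)" unfolding supp_in_dim(1)[OF fin] by (simp add: card_cartesian_product)
 show ?thesis using 1 unfolding 2 3 h1_def dim_H1_def .
qed

section \<open>Global sections\<close>

lemma global_section_form:
 assumes "ph : global_sections (zariski p s) (sec_2 p s d)"
 obtains F where "F : PF" "hom (%_. 1) d F" "ALL i:{1..s}. F (($) (p i)) = 0 & grad F (($) (p i)) = (%_. 0)"
  "ALL e. ph e = (if e : blowup_cone p s then F (($) (fst e)) else 0)"
proof -
 have ph: "sec_2 p s d (blowup p s) ph" "!!e. e ~: blowup_cone p s ==> ph e = 0"
  using assms by (auto simp: global_sections_def topspace_zariski Union_blowup)
 obtain J where J: "finite J" "J <= charts" "!!v. v ~= 0 ==> EX t:J. snd (snd t) (($) v) ~= 0"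
  by (rule finite_charts) (rule that)
 interpret atlas p s J by unfold_locales (rule J)+
 obtain F where F: "F : PF" "hom (%_. 1) d F" "ALL e:blowup_cone p s. ph e = F (($) (fst e))"
  using sec_2_imp_sec_H[OF ph(1)] by (rule global_sec_H)
 have o: "openin (zariski p s) (blowup p s)" using openin_topspace topspace_zariski by metis
 have s: "sec_2 p s d (blowup p s) (%e. F (($) (fst e)))"
  by (rule sec_2_mono[OF ph(1) o order_refl]) (use F(3) in \<open>simp add: Union_blowup\<close>)
 show ?thesis
 proof (rule that[OF F(1,2)])
  show "ALL i:{1..s}. F (($) (p i)) = 0 & grad F (($) (p i)) = (%_. 0)"
  proof
   fix i assume i: "i : {1..s}"
   have "EX W. multiproj_pt e : W & sec_2 p s d W (%e. F (($) (fst e)))" if "e : blowup_cone p s" for e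
    using s multiproj_in_blowup[OF that] by blast
   from double_zero_at[OF F(1,2) i this] show "F (($) (p i)) = 0 & grad F (($) (p i)) = (%_. 0)" by blast
  qed
  show "ALL e. ph e = (if e : blowup_cone p s then F (($) (fst e)) else 0)" using F(3) ph(2) by simp
 qed
qed

definition grad_map :: "nat => (('m => nat) => complex) => nat \<times> 'm => complex" where
 "grad_map d c = (%(i, a). if i : {1..s} then grad (poly_of d c) (($) (p i)) a else 0)"

lemma clinear_grad_map: "clinear (grad_map d)"
proof (rule clinearI)
 show "grad_map d (%x. f x + g x) = (%x. grad_map d f x + grad_map d g x)" for f g
  by (auto simp: grad_map_def poly_of_linear grad_add[OF poly_of(1) poly_of(1)])
 show "grad_map d (%x. c * f x) = (%x. c * grad_map d f x)" for c f
  by (auto simp: grad_map_def poly_of_linear grad_cmult[OF poly_of(1)])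
qed

lemma grads_eq: "grads d = grad_map d ` supp_in (exps d)"
proof
 show "grads d <= grad_map d ` supp_in (exps d)"
 proof
  fix g assume "g : grads d"
  then obtain F where g: "g : supp_in ({1..s} \<times> UNIV)" and F: "F : PF" "hom (%_. 1) (int d) F" "ALL i:{1..s}. ALL a. g (i, a) = grad F (($) (p i)) a"
   unfolding grads_def by blast
  obtain c where c: "c : supp_in (exps d)" "F = poly_of d c" using F(1,2) by (rule poly_of_ex)
  have "g = grad_map d c" using g F(3) c(2) by (auto simp: grad_map_def supp_in_def fun_eq_iff)
  then show "g : grad_map d ` supp_in (exps d)" using c(1) by blast
 qed
 show "grad_map d ` supp_in (exps d) <= grads d"
  unfolding grads_def using poly_of by (force simp: grad_map_def supp_in_def)
qed

lemma subspace_grads: "cfun.subspace (grads d)"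
 unfolding grads_eq using rank_nullity(2)[OF clinear_grad_map supp_in_dim(2)[OF finite_exps]] fin_dim_subspace by blast

text \<open>Sections are the forms in the kernel of \<open>grad_map\<close>; vanishing gradients
  imply vanishing values by Euler's relation. A form is recovered from its section because the
  blow-up maps onto projective space.\<close>

theorem h0_eq:
 assumes d: "d >= 1"
 shows "h0 p s (int d) (%i. 2) + cfun.dim (grads d) = card (exps d :: ('m => nat) set)"
proof -
 let ?A = "supp_in (exps d)"
 define T where "T = (%c e. if e : blowup_cone p s then poly_of d c (($) (fst e)) else 0)"
 have T: "clinear T" by (rule clinearI) (auto simp: T_def poly_of_linear)
 define C0 where "C0 = {c : ?A. grad_map d c = 0}"
 have C0: "c : C0 \<longleftrightarrow> c : ?A & (ALL i:{1..s}. grad (poly_of d c) (($) (p i)) = (%_. 0))" for c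
  unfolding C0_def grad_map_def by (auto simp: fun_eq_iff)
 have sub: "cfun.subspace C0"
  unfolding C0_def
  using cfun.subspace_inter[OF subspace_supp_in[of "exps d"] cpair.linear_subspace_kernel[OF clinear_grad_map[of d]]]
  by (simp add: Int_def)
 have fd: "fin_dim C0" by (rule supp_in_fin_dim[OF finite_exps _ sub]) (auto simp: C0_def)
 have "global_sections (zariski p s) (sec_2 p s (int d)) = T ` C0"
 proof (intro set_eqI iffI)
  fix ph assume "ph : global_sections (zariski p s) (sec_2 p s (int d))"
  then obtain F where F: "F : PF" "hom (%_. 1) (int d) F" "ALL i:{1..s}. F (($) (p i)) = 0 & grad F (($) (p i)) = (%_. 0)"
   "ALL e. ph e = (if e : blowup_cone p s then F (($) (fst e)) else 0)" by (rule global_section_form)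
  obtain c where c: "c : supp_in (exps d)" "F = poly_of d c" using F(1,2) by (rule poly_of_ex)
  have "c : C0" unfolding C0 using c F(3) by simp
  moreover have "ph = T c" using F(4) c(2) by (simp add: T_def fun_eq_iff)
  ultimately show "ph : T ` C0" by blast
 next
  fix ph assume "ph : T ` C0"
  then obtain c where c: "c : C0" "ph = T c" by blast
  let ?F = "poly_of d c"
  have g0: "grad ?F (($) (p i)) = (%_. 0)" if "i : {1..s}" for i using c(1) that unfolding C0 by blast
  have v0: "?F (($) (p i)) = 0" if "i : {1..s}" for i by (rule value_zero[OF poly_of d g0[OF that]])
  have o: "openin (zariski p s) (blowup p s)" using openin_topspace topspace_zariski by metis
  have "sec_2 p s d (blowup p s) (%e. ?F (($) (fst e)))"
  proof (rule sec_2_local)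
   fix x assume x: "x : blowup p s"
   have ex: "EX W. openin (zariski p s) W & x : W & sec_2 p s d W (%e. ?F (($) (fst e)))"
   proof (cases "EX i:{1..s}. over i x")
    case True
    then obtain i where i: "i : {1..s}" "over i x" by blast
    show ?thesis by (rule exceptional_nbhd[OF poly_of v0[OF i(1)] g0[OF i(1)] x i(2,1)])
   next
    case False
    show ?thesis by (rule ordinary_nbhd[OF x _ o x form_sec_H[OF o poly_of]]) (use False in blast)
   qed
   obtain W where W: "openin (zariski p s) W" "x : W" "sec_2 p s d W (%e. ?F (($) (fst e)))" using ex by (elim exE conjE)
   show "EX W. x : W & W <= blowup p s & sec_2 p s d W (%e. ?F (($) (fst e)))"
    using W(2,3) open_subset_blowup[OF W(1)] by (intro exI[of _ W] conjI)
  qed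
  then have "sec_2 p s d (blowup p s) ph"
   by (rule sec_2_mono[OF _ o order_refl]) (use c(2) in \<open>simp add: T_def Union_blowup\<close>)
  then show "ph : global_sections (zariski p s) (sec_2 p s (int d))"
   by (simp add: global_sections_def topspace_zariski Union_blowup c(2) T_def)
 qed
 moreover have "cfun.dim (T ` C0) = cfun.dim C0"
 proof (rule dim_image_inj[OF T fd])
  fix c assume c: "c : C0" "T c = 0"
  have z: "poly_of d c x = 0" if "x undefined ~= 0" for x
  proof -
   have "vec_lambda x ~= 0" using that by (auto simp: vec_eq_iff)
   then obtain e where e: "e : blowup_cone p s" "fst e = vec_lambda x" using cone_over by blast
   have "T c e = 0" using c(2) by simp
   then show ?thesis using e by (simp add: T_def vec_lambda_inverse)
  qed
  have "poly_of d c x = 0" for x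
   by (rule PF_dense[OF poly_of(1) PF_var[of undefined], of "%_. 1"]) (use z in auto)
  then have "c al = 0" if "al : exps d" for al
   using mono_lin_indep[OF finite_exps _ that] unfolding poly_of_def by blast
  then show "c = 0" using c(1) unfolding C0_def by (auto simp: supp_in_def fun_eq_iff)
 qed
 moreover have "card (exps d :: ('m => nat) set) = cfun.dim C0 + cfun.dim (grads d)"
  using rank_nullity(1)[OF clinear_grad_map[of d] supp_in_dim(2)[OF finite_exps[of d]]]
  unfolding supp_in_dim(1)[OF finite_exps] C0_def grads_eq .
 ultimately show ?thesis by (simp add: h0_def dim_H0_def)
qed

text \<open>A form of degree zero is constant and vanishes at \<open>p 1\<close>, and in negative
  degree there are no monomials, so a nonzero section forces \<open>d >= 1\<close>.\<close>

lemma effective_form: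
 assumes "effective p s d (%i. 2)"
 obtains F x where "F : PF" "hom (%_. 1) d F" "F x ~= 0" "d >= 1"
  "ALL i:{1..s}. F (($) (p i)) = 0 & grad F (($) (p i)) = (%_. 0)"
proof -
 let ?S = "global_sections (zariski p s) (sec_2 p s d)"
 have "\<not> ?S <= {0}"
 proof
  assume "?S <= {0}"
  then have "cfun.dim ?S <= card ({} :: ('m coords => complex) set)" by (intro cfun.dim_le_card) auto
  then show False using assms by (simp add: effective_def h0_def dim_H0_def)
 qed
 then obtain ph where ph: "ph : ?S" "ph ~= 0" by blast
 obtain F where F: "F : PF" "hom (%_. 1) d F" "ALL i:{1..s}. F (($) (p i)) = 0 & grad F (($) (p i)) = (%_. 0)"
  "ALL e. ph e = (if e : blowup_cone p s then F (($) (fst e)) else 0)" using ph(1) by (rule global_section_form)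
 obtain e where "ph e ~= 0" using ph(2) by (auto simp: fun_eq_iff)
 then have Fx: "F (($) (fst e)) ~= 0" using F(4) by (auto split: if_splits)
 obtain A r where A: "finite A" "A <= {al. wt (%_. 1) al = d}" "F = (%x. \<Sum>al\<in>A. r al * mon al x)"
  using form_in_span[OF F(1,2)] by (rule span_monoE)
 have "d >= 1"
 proof (rule ccontr)
  assume "\<not> d >= 1"
  have "al = (%_. 0)" if "al : A" for al
  proof -
   have "int (\<Sum>k\<in>UNIV. al k) = d" using A(2) that unfolding wt_one by blast
   then have "(\<Sum>k\<in>UNIV. al k) = 0" using \<open>\<not> d >= 1\<close> by linarith
   then show ?thesis by (auto simp: fun_eq_iff)
  qed
  then have "mon al x = 1" if "al : A" for al x using that mono_0 by metis
  then have "F x = (\<Sum>al\<in>A. r al)" for x unfolding A(3) by (intro sum.cong) simp_all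
  then have "F (($) (fst e)) = F (($) (p 1))" by simp
  moreover have "F (($) (p 1)) = 0" using F(3) s2 by simp
  ultimately show False using Fx by simp
 qed
 then show ?thesis by (rule that[OF F(1,2) Fx _ F(3)])
qed

end

section \<open>Interpolation conditions on binary forms\<close>

text \<open>A homogeneous Vandermonde argument: testing on multiples of the linear form that
  vanishes at the point \<open>k\<close> removes this point and lowers the degree by one.\<close>

lemma moments_zero:
 fixes c u w :: "nat => complex"
 assumes "finite I" "card I <= Suc D" "!!i. i : I ==> u i ~= 0 | w i ~= 0"
  "!!i j. i : I ==> j : I ==> i ~= j ==> u i * w j ~= u j * w i"
  "!!m. m <= D ==> (\<Sum>i\<in>I. c i * u i ^ (D - m) * w i ^ m) = 0"
 shows "ALL i:I. c i = 0"
 using assms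
proof (induction I arbitrary: c D rule: finite_induct)
 case (insert k I)
 have I0: "ALL i:I. c i = 0"
 proof (cases D)
  case 0
  then have "I = {}" using insert.prems(1) insert.hyps by simp
  then show ?thesis by simp
 next
  case (Suc E)
  let ?l = "%i. w k * u i - u k * w i"
  have "ALL i:I. c i * ?l i = 0"
  proof (rule insert.IH[where D = E])
   fix m assume m: "m <= E"
   have "(\<Sum>i\<in>insert k I. c i * ?l i * u i ^ (E - m) * w i ^ m) =
     w k * (\<Sum>i\<in>insert k I. c i * u i ^ (D - m) * w i ^ m) - u k * (\<Sum>i\<in>insert k I. c i * u i ^ (D - Suc m) * w i ^ Suc m)"
    unfolding sum_distrib_left sum_subtractf[symmetric] using m Suc
    by (intro sum.cong refl) (simp add: Suc_diff_le algebra_simps)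
   also have "\<dots> = 0" using insert.prems(4)[of m] insert.prems(4)[of "Suc m"] m Suc by simp
   finally show "(\<Sum>i\<in>I. c i * ?l i * u i ^ (E - m) * w i ^ m) = 0" using insert.hyps by (simp add: mult.commute)
  qed (use insert.prems insert.hyps Suc in auto)
  moreover have "?l i ~= 0" if "i : I" for i
   using insert.prems(3)[of i k] insert.hyps that by (auto simp: mult.commute)
  ultimately show ?thesis by auto
 qed
 \<comment> \<open>Only \<open>k\<close> is left; the exponents \<open>m = 0\<close> and
   \<open>m = D\<close> treat the cases \<open>u k ~= 0\<close> and \<open>w k ~= 0\<close>.\<close>
 have "c k * u k ^ (D - m) * w k ^ m = 0" if "m <= D" for m
  using insert.prems(4)[OF that] insert.hyps I0 by simp
 from this[of 0] this[of D] have "c k = 0" using insert.prems(2)[of k] by auto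
 then show ?case using I0 by simp
qed simp

text \<open>The derivative of \<open>a\<^bsup>N-k\<^esup> b\<^sup>k\<close> in the direction \<open>(x, y)\<close>.\<close>

definition hterm :: "nat => complex => complex => complex => complex => nat => complex" where
 "hterm N x y a b k = x * of_nat (N - k) * a ^ (N - k - 1) * b ^ k + y * of_nat k * a ^ (N - k) * b ^ (k - 1)"

section \<open>Hermite interpolation\<close>

lemma hterm_mult:
 assumes "k <= E"
 shows "hterm (Suc E) x y a b k = x * a ^ (E - k) * b ^ k + a * hterm E x y a b k"
  "hterm (Suc E) x y a b (Suc k) = y * a ^ (E - k) * b ^ k + b * hterm E x y a b k"
proof -
 obtain e where E: "E = k + e" using assms le_iff_add by blast
 show "hterm (Suc E) x y a b k = x * a ^ (E - k) * b ^ k + a * hterm E x y a b k"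
  unfolding hterm_def E by (cases e) (simp_all add: algebra_simps)
 show "hterm (Suc E) x y a b (Suc k) = y * a ^ (E - k) * b ^ k + b * hterm E x y a b k"
  unfolding hterm_def E by (cases k) (simp_all add: algebra_simps)
qed

lemma hterm_euler: "k <= E ==> hterm E a b a b k = of_nat E * (a ^ (E - k) * b ^ k)"
proof -
 assume "k <= E"
 then obtain e where E: "E = k + e" using le_iff_add by blast
 show ?thesis unfolding hterm_def E by (cases k; cases e) (simp_all add: algebra_simps)
qed

lemma hterm_add: "hterm N (x + x') (y + y') a b k = hterm N x y a b k + hterm N x' y' a b k"
 and hterm_cmult: "hterm N (r * x) (r * y) a b k = r * hterm N x y a b k"
 by (simp_all add: hterm_def algebra_simps)

text \<open>By the product rule, testing on multiples of a linear form yields a derivative plus a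
  point value. Euler's formula rewrites the value as a derivative in the direction
  \<open>(a, b)\<close> divided by \<open>E\<close>, so the shape of the functional is
  preserved.\<close>

lemma hterm_step:
 assumes "k <= E" "E >= 1"
 shows "bet * hterm (Suc E) x y a b k - al * hterm (Suc E) x y a b (Suc k) =
  hterm E ((bet * a - al * b) * x + (x * bet - y * al) / of_nat E * a) ((bet * a - al * b) * y + (x * bet - y * al) / of_nat E * b) a b k"
proof -
 have "(x * bet - y * al) / of_nat E * hterm E a b a b k = (x * bet - y * al) * (a ^ (E - k) * b ^ k)"
  using assms by (simp add: hterm_euler)
 then show ?thesis unfolding hterm_add hterm_cmult hterm_mult[OF assms(1)] by (simp add: algebra_simps)
qed

lemma hterm_zero:
 assumes "a ~= 0 | b ~= 0" "N >= 1" "!!k. k <= N ==> hterm N x y a b k = 0"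
 shows "x = 0" "y = 0"
proof -
 obtain n where N: "N = Suc n" using assms(2) by (cases N) auto
 have n0: "(1 :: complex) + of_nat n ~= 0" by (metis of_nat_Suc of_nat_neq_0)
 have "x = 0 & y = 0"
 proof (cases "a = 0")
  case True
  then have b: "b ~= 0" using assms(1) by simp
  have "hterm N x y a b N = 0" "hterm N x y a b n = 0" using assms(3) N by simp_all
  then show ?thesis using b n0 True by (cases n) (simp_all add: hterm_def N Suc_diff_le)
 next
  case False
  have "hterm N x y a b 0 = 0" "hterm N x y a b 1 = 0" using assms(3) N by simp_all
  then show ?thesis using False n0 by (simp add: hterm_def N)
 qed
 then show "x = 0" "y = 0" by auto
qed

text \<open>Radial directions give multiples of point values, so derivatives alone describe the
  functionals supported on the double points \<open>(u i, w i)\<close>; the condition says that such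
  a functional kills all binary forms of degree \<open>N\<close>.\<close>

definition herm :: "nat => nat set => (nat => complex) => (nat => complex) => (nat => complex) => (nat => complex) => bool" where
 "herm N I u w x y \<longleftrightarrow> (ALL k<=N. (\<Sum>i\<in>I. hterm N (x i) (y i) (u i) (w i) k) = 0)"

text \<open>Applying the functional only to multiples of the linear form \<open>bet u - al w\<close>.\<close>

lemma herm_step:
 assumes "herm (Suc E) I u w x y" "E >= 1"
 shows "herm E I u w (%i. (bet * u i - al * w i) * x i + (x i * bet - y i * al) / of_nat E * u i)
  (%i. (bet * u i - al * w i) * y i + (x i * bet - y i * al) / of_nat E * w i)"
 unfolding herm_def
proof (intro allI impI)
 fix k assume k: "k <= E"
 have "(\<Sum>i\<in>I. bet * hterm (Suc E) (x i) (y i) (u i) (w i) k - al * hterm (Suc E) (x i) (y i) (u i) (w i) (Suc k)) = 0"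
  unfolding sum_subtractf sum_distrib_left[symmetric] using assms(1) k by (simp add: herm_def)
 then show "(\<Sum>i\<in>I. hterm E ((bet * u i - al * w i) * x i + (x i * bet - y i * al) / of_nat E * u i)
  ((bet * u i - al * w i) * y i + (x i * bet - y i * al) / of_nat E * w i) (u i) (w i) k) = 0"
  by (simp only: hterm_step[OF k assms(2)])
qed

text \<open>The change of direction is invertible where the linear form does not vanish: pairing the
  equations with \<open>(bet, - al)\<close> gives \<open>l * t * (E + 1) = 0\<close> for the radial
  correction \<open>t\<close>.\<close>

lemma step_zero:
 fixes l :: complex
 assumes l: "l = bet * a - al * b" "l ~= 0" and E: "E >= 1"
  and z: "l * x + (x * bet - y * al) / of_nat E * a = 0" "l * y + (x * bet - y * al) / of_nat E * b = 0"
 shows "x = 0 & y = 0"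
proof -
 define t where "t = (x * bet - y * al) / of_nat E"
 have t: "x * bet - y * al = of_nat E * t" using E by (simp add: t_def)
 have z': "l * x + t * a = 0" "l * y + t * b = 0" using z by (simp_all add: t_def)
 then have "bet * (l * x + t * a) - al * (l * y + t * b) = 0" by simp
 then have "l * (x * bet - y * al) + t * l = 0" by (simp add: l(1) algebra_simps)
 then have "l * t * (of_nat E + 1) = 0" unfolding t by (simp add: algebra_simps)
 moreover have "(of_nat E + 1 :: complex) ~= 0" by (metis of_nat_Suc of_nat_neq_0 add.commute)
 ultimately have "t = 0" using l(2) by simp
 then show ?thesis using z' l(2) by simp
qed

lemma herm_insert:
 assumes "finite I" "k ~: I" "x k = 0" "y k = 0"
 shows "herm N (insert k I) u w x y \<longleftrightarrow> herm N I u w x y"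
 using assms by (simp add: herm_def hterm_def)

lemma herm_single:
 assumes "finite I" "k ~: I" "herm N (insert k I) u w x y" "N >= 1" "u k ~= 0 | w k ~= 0" "ALL i:I. x i = 0 & y i = 0"
 shows "x k = 0 & y k = 0"
proof -
 have "(\<Sum>i\<in>I. hterm N (x i) (y i) (u i) (w i) m) = 0" for m
  using assms(6) by (intro sum.neutral) (simp add: hterm_def)
 then have "hterm N (x k) (y k) (u k) (w k) m = 0" if "m <= N" for m
  using assms(1-3) that by (simp add: herm_def)
 from hterm_zero[OF assms(5,4) this] show ?thesis by blast
qed

text \<open>Multiplying twice by the linear form that vanishes at the point \<open>k\<close> removes
  this double point at the cost of two degrees; the other directions change invertibly by
  \<open>step_zero\<close>.\<close>

lemma hermite_unique:
 assumes "finite I" "2 * card I <= Suc N" "!!i. i : I ==> u i ~= 0 | w i ~= 0"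
  "!!i j. i : I ==> j : I ==> i ~= j ==> u i * w j ~= u j * w i" "herm N I u w x y"
 shows "ALL i:I. x i = 0 & y i = 0"
 using assms
proof (induction I arbitrary: x y N rule: finite_induct)
 case (insert k I)
 have N1: "N >= 1" using insert.prems(1) insert.hyps by simp
 have I0: "ALL i:I. x i = 0 & y i = 0"
 proof (cases "I = {}")
  case False
  then have "card I >= 1" using insert.hyps by (simp add: Suc_leI card_gt_0_iff)
  then obtain E where N: "N = Suc (Suc E)" "E >= 1" "2 * card I <= Suc E"
   using insert.prems(1) insert.hyps by (intro that[of "N - 2"]) auto
  define l where "l = (%i. w k * u i - u k * w i)"
  have ln: "l i ~= 0" if "i : I" for i
   using insert.prems(3)[of i k] insert.hyps that by (auto simp: l_def mult.commute)
  define x1 where "x1 = (%i. l i * x i + (x i * w k - y i * u k) / of_nat (Suc E) * u i)"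
  define y1 where "y1 = (%i. l i * y i + (x i * w k - y i * u k) / of_nat (Suc E) * w i)"
  define x2 where "x2 = (%i. l i * x1 i + (x1 i * w k - y1 i * u k) / of_nat E * u i)"
  define y2 where "y2 = (%i. l i * y1 i + (x1 i * w k - y1 i * u k) / of_nat E * w i)"
  have h1: "herm (Suc E) (insert k I) u w x1 y1"
   using herm_step[OF insert.prems(4)[unfolded N(1)], of "w k" "u k"] by (simp add: x1_def y1_def l_def)
  have h2: "herm E (insert k I) u w x2 y2"
   using herm_step[OF h1 N(2), of "w k" "u k"] by (simp add: x2_def y2_def l_def)
  have "l k = 0" by (simp add: l_def)
  then have "x2 k = 0" "y2 k = 0" by (simp_all add: x2_def y2_def x1_def y1_def algebra_simps)
  then have "herm E I u w x2 y2" using h2 insert.hyps by (simp add: herm_insert)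
  then have z2: "ALL i:I. x2 i = 0 & y2 i = 0" by (intro insert.IH[OF N(3)]) (use insert.prems in auto)
  show ?thesis
  proof
   fix i assume i: "i : I"
   have "x1 i = 0 & y1 i = 0"
    by (rule step_zero[of "l i" "w k" "u i" "u k" "w i" E]) (use z2 i ln[OF i] N(2) in \<open>auto simp: l_def x2_def y2_def\<close>)
   then show "x i = 0 & y i = 0"
    by (intro step_zero[of "l i" "w k" "u i" "u k" "w i" "Suc E"]) (use ln[OF i] in \<open>simp_all only: l_def x1_def y1_def, auto\<close>)
  qed
 qed simp
 then show ?case using herm_single[OF insert.hyps insert.prems(4) N1 insert.prems(2)[of k]] by simp
qed simp

text \<open>For the parity that \<open>hermite_unique\<close> does not exhaust: at \<open>k\<close>
  the direction is radial, so only a point value occurs there, and a single linear factor removes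
  it.\<close>

lemma hermite_unique':
 assumes I: "finite I" "k ~: I" "2 * card I <= N" and nz: "!!i. i : insert k I ==> u i ~= 0 | w i ~= 0"
  and dist: "!!i j. i : insert k I ==> j : insert k I ==> i ~= j ==> u i * w j ~= u j * w i"
  and h: "herm N (insert k I) u w x y" and k: "x k * w k - y k * u k = 0" and N1: "N >= 1"
 shows "ALL i:insert k I. x i = 0 & y i = 0"
proof -
 have I0: "ALL i:I. x i = 0 & y i = 0"
 proof (cases "I = {}")
  case False
  then have "card I >= 1" using I by (simp add: Suc_leI card_gt_0_iff)
  then obtain E where N: "N = Suc E" "E >= 1" "2 * card I <= Suc E" using I(3) by (intro that[of "N - 1"]) auto
  define l where "l = (%i. w k * u i - u k * w i)"
  have ln: "l i ~= 0" if "i : I" for i using dist[of i k] I(2) that by (auto simp: l_def mult.commute)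
  define x1 where "x1 = (%i. l i * x i + (x i * w k - y i * u k) / of_nat E * u i)"
  define y1 where "y1 = (%i. l i * y i + (x i * w k - y i * u k) / of_nat E * w i)"
  have h1: "herm E (insert k I) u w x1 y1"
   using herm_step[OF h[unfolded N(1)] N(2), of "w k" "u k"] by (simp add: x1_def y1_def l_def)
  have "x1 k = 0" "y1 k = 0" using k by (simp_all add: x1_def y1_def l_def)
  then have "herm E I u w x1 y1" using h1 I by (simp add: herm_insert)
  from hermite_unique[OF I(1) N(3) _ _ this] nz dist have z: "ALL i:I. x1 i = 0 & y1 i = 0" by blast
  show ?thesis
  proof
   fix i assume i: "i : I"
   show "x i = 0 & y i = 0"
    by (rule step_zero[of "l i" "w k" "u i" "u k" "w i" E]) (use z i ln[OF i] N(2) in \<open>auto simp: l_def x1_def y1_def\<close>)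
  qed
 qed simp
 then show ?thesis using herm_single[OF I(1,2) h N1 nz[of k]] by simp
qed

text \<open>A recurrence of order two has a two-dimensional space of solutions. The
  \<open>hterm\<close>s are solutions, since the characteristic root is double, so two entries have
  to be matched: the first two if \<open>a ~= 0\<close>, the last two otherwise.\<close>

lemma tangent_exists:
 fixes f :: "nat => complex"
 assumes ab: "a ~= 0 | b ~= 0" and n: "n >= 1"
  and rec: "!!j. j + 2 <= n ==> f j * b ^ 2 - 2 * f (j + 1) * a * b + f (j + 2) * a ^ 2 = 0"
 shows "EX x y. ALL j<=n. f j = hterm n x y a b j"
proof (cases "a = 0")
 case True
 then have b: "b ~= 0" using ab by simp
 obtain m where m: "n = Suc m" using n by (cases n) auto
 have m0: "(1 :: complex) + of_nat m ~= 0" by (metis of_nat_Suc of_nat_neq_0)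
 define x where "x = f m / b ^ m"
 define y where "y = f n / (of_nat n * b ^ m)"
 have "f j = hterm n x y a b j" if jn: "j <= n" for j
 proof -
  consider "j = n" | "j = m" | "j + 2 <= n" using jn m by linarith
  then show ?thesis
  proof cases
   case 1 then show ?thesis using b m0 True by (simp add: hterm_def y_def m)
  next
   case 2 then show ?thesis using b True by (simp add: hterm_def x_def m Suc_diff_le)
  next
   case 3
   then have "f j * b ^ 2 = 0" using rec[OF 3] True by simp
   then have "f j = 0" using b by simp
   moreover obtain q where "n - j - 1 = Suc q" "n - j = Suc (Suc q)" using 3 by (intro that[of "n - j - 2"]) auto
   ultimately show ?thesis using True by (simp add: hterm_def)
  qed
 qed
 then show ?thesis by blast
next
 case False
 define g where "g = (%j x y. hterm n x y a b j)"
 have grec: "hterm n x y a b j * b ^ 2 - 2 * hterm n x y a b (j + 1) * a * b + hterm n x y a b (j + 2) * a ^ 2 = 0"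
  if j: "j + 2 <= n" for j x y
 proof -
  obtain e where e: "n = j + 2 + e" using j le_iff_add by blast
  show ?thesis unfolding hterm_def e by (cases e; cases j) (simp_all add: power2_eq_square power_add numeral_3_eq_3 numeral_2_eq_2 algebra_simps)
 qed
 define x where "x = f 0 / (of_nat n * a ^ (n - 1))"
 define y where "y = (f 1 - x * of_nat (n - 1) * a ^ (n - 2) * b) / a ^ (n - 1)"
 have h0: "f 0 = hterm n x y a b 0" using n False by (simp add: hterm_def x_def)
 have h1: "f 1 = hterm n x y a b 1"
 proof -
  have "hterm n x y a b 1 = x * of_nat (n - 1) * a ^ (n - 2) * b + y * a ^ (n - 1)"
   by (simp add: hterm_def numeral_2_eq_2)
  also have "y * a ^ (n - 1) = f 1 - x * of_nat (n - 1) * a ^ (n - 2) * b" using False by (simp add: y_def)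
  finally show ?thesis by simp
 qed
 have aux: "R = Q - P" if "P - Q + R = 0" for P Q R :: complex
 proof -
  have "R = (P - Q + R) - (P - Q)" by simp
  also have "\<dots> = Q - P" by (simp add: that)
  finally show ?thesis .
 qed
 have "j <= n --> f j = hterm n x y a b j" for j
 proof (induction j rule: less_induct)
  case (less j)
  show ?case
  proof
   assume j: "j <= n"
   consider "j = 0" | "j = 1" | i where "j = i + 2" by (metis One_nat_def add_2_eq_Suc' not0_implies_Suc)
   then show "f j = hterm n x y a b j"
   proof cases
    case (3 i)
    have i: "i + 2 <= n" using j 3 by simp
    have e: "f i = hterm n x y a b i" "f (i + 1) = hterm n x y a b (i + 1)" using less.IH[of i] less.IH[of "i + 1"] i 3 by auto
    have "f (i + 2) * a ^ 2 = hterm n x y a b (i + 2) * a ^ 2"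
     unfolding aux[OF rec[OF i]] aux[OF grec[OF i]] e ..
    then show ?thesis using False 3 by simp
   qed (use h0 h1 in auto)
  qed
 qed
 then show ?thesis by blast
qed

section \<open>Relations between gradients along a rational normal curve\<close>

lemma sum_two_points:
 assumes "finite A" "x : A" "y : A"
 shows "(\<Sum>a\<in>A. (bet a + (if a = x then 1 else 0) + (if a = y then 1 else 0)) * f a) = (\<Sum>a\<in>A. bet a * f a) + f x + (f y :: complex)"
proof -
 have "(\<Sum>a\<in>A. (if a = z then 1 else 0) * f a) = f z" if "z : A" for z
 proof -
  have "(\<Sum>a\<in>A. (if a = z then 1 else 0) * f a) = (\<Sum>a\<in>A. if a = z then f a else 0)" by (intro sum.cong) auto
  then show ?thesis using assms(1) that by simp
 qed
 then show ?thesis using assms by (simp add: ring_distribs sum.distrib)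
qed

text \<open>\<open>sig\<close> numbers the coordinates as on the standard curve. \<open>L\<close>
  bounds the number of points, so that relations on different initial segments \<open>{1..s}\<close>
  can be compared.\<close>

locale rnc =
 fixes sig :: "'m::finite => nat" and n d :: nat and u w :: "nat => complex" and L :: nat
 assumes sig: "bij_betw sig UNIV {..n}" and n1: "n >= 1" and d1: "d >= 1"
  and uw_nz: "!!i. i : {1..L} ==> u i ~= 0 | w i ~= 0"
  and uw_dist: "!!i j. i : {1..L} ==> j : {1..L} ==> i ~= j ==> u i * w j ~= u j * w i"
begin

text \<open>The degree in \<open>u\<close> and \<open>w\<close> of the partial derivatives of a form
  of degree \<open>d\<close> restricted to the curve; \<open>N\<close> is that of the form
  itself.\<close>

definition M :: nat where "M = n * (d - 1)"
definition N :: nat where "N = n * d"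

lemma NM: "N = M + n" unfolding M_def N_def using d1 by (cases d) simp_all

definition tu :: "nat => 'm" where "tu = inv_into UNIV sig"

lemma st: "j <= n ==> sig (tu j) = j" "sig a <= n" "tu (sig a) = a"
 using sig bij_betw_inv_into_right[OF sig, of j] bij_betw_inv_into_left[OF sig, of a] bij_betwE[OF sig]
 by (auto simp: tu_def)

lemma tu_inj: "j <= n ==> k <= n ==> tu j = tu k \<longleftrightarrow> j = k"
 using st by metis

lemma cardm: "CARD('m) = n + 1" using bij_betw_same_card[OF sig] by simp

text \<open>The exponent of \<open>w\<close> in the restriction of the monomial to the curve, called
  its weight below.\<close>

definition J :: "('m => nat) => nat" where "J al = (\<Sum>a\<in>UNIV. sig a * al a)"

lemma J_le: "al : exps e ==> J al <= n * e"
proof -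
 assume "al : exps e"
 have "J al <= (\<Sum>a\<in>UNIV. n * al a)" unfolding J_def by (intro sum_mono mult_right_mono) (simp_all add: st)
 also have "\<dots> = n * e" using \<open>al : exps e\<close> by (simp add: exps_def flip: sum_distrib_left)
 finally show ?thesis .
qed

definition bump :: "'m => ('m => nat) => 'm => nat" where "bump b al = (%a. al a + (if a = b then 1 else 0))"

lemma bump: "al : exps e ==> bump b al : exps (Suc e)" "J (bump b al) = J al + sig b"
 by (simp_all add: exps_def bump_def sum.distrib J_def ring_distribs if_distrib[of "(*) _"] cong: if_cong)

lemma exps_minus:
 assumes "al : exps d" "al a ~= 0"
 shows "al(a := al a - 1) : exps (d - 1)" "J al = J (al(a := al a - 1)) + sig a"
proof -
 let ?ga = "al(a := al a - 1)"
 have b: "bump a ?ga = al" using assms(2) by (auto simp: bump_def fun_eq_iff)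
 have "(\<Sum>b\<in>UNIV. bump a ?ga b) = (\<Sum>b\<in>UNIV. ?ga b) + 1" unfolding bump_def sum.distrib by simp
 then show "?ga : exps (d - 1)" using assms(1) unfolding b by (simp add: exps_def)
 show "J al = J ?ga + sig a" using bump(2)[of a ?ga] unfolding b .
qed

lemma exps_val:
 assumes "al : exps d" "al a ~= 0"
 shows "sig a <= J al & J al <= sig a + M"
 using J_le[OF exps_minus(1)[OF assms]] exps_minus(2)[OF assms] unfolding M_def by simp

text \<open>Greedy choice: each factor takes the largest coordinate number that still fits.\<close>

lemma exps_weight: "k <= n * e ==> EX bet:exps e. J bet = k"
proof (induction e arbitrary: k)
 case 0
 then show ?case by (intro bexI[of _ "%_. 0"]) (auto simp: J_def exps_def)
next
 case (Suc e)
 define j where "j = min n k"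
 have "k - j <= n * e" using Suc.prems by (auto simp: j_def min_def)
 from Suc.IH[OF this] obtain bet where bet: "bet : exps e" "J bet = k - j" by blast
 show ?case using bet(2) bump(1)[OF bet(1), of "tu j"] bump(2)[of "tu j" bet] st(1)[of j] by (intro bexI[of _ "bump (tu j) bet"]) (auto simp: j_def)
qed

definition T :: "nat => (nat \<times> 'm => complex) => 'm => nat => complex" where
 "T s c a m = (\<Sum>i\<in>{1..s}. c (i, a) * u i ^ (M - m) * w i ^ m)"

text \<open>The moments indexed by the weight \<open>k\<close> of a monomial: its derivative by the
  coordinate with number \<open>j\<close> has weight \<open>k - j\<close>.\<close>

definition S :: "nat => (nat \<times> 'm => complex) => nat => nat => complex" where
 "S s c k j = T s c (tu j) (k - j)"

lemma S_linear:
 "S s (%x. c x + c' x) k j = S s c k j + S s c' k j" "S s (%x. r * c x) k j = r * S s c k j"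
 by (simp_all add: S_def T_def ring_distribs sum.distrib sum_distrib_left mult.assoc)

text \<open>Up to the projective transformation, the linear relations between the gradients of forms at the
 points: see \<open>rel_annihilator\<close>.\<close>

definition R :: "nat => (nat \<times> 'm => complex) set" where
 "R s = {c : supp_in ({1..s} \<times> UNIV). ALL al:exps d. (\<Sum>a\<in>UNIV. of_nat (al a) * S s c (J al) (sig a)) = 0}"

lemma R_rel: "c : R s ==> al : exps d ==> (\<Sum>a\<in>UNIV. of_nat (al a) * S s c (J al) (sig a)) = 0"
 by (simp add: R_def)

lemma subspace_R: "cfun.subspace (R s)"
proof (rule cfun_subspaceI)
 show "(%x. 0) : R s" by (simp add: R_def supp_in_def S_def T_def)
 show "(%x. f x + g x) : R s" if "f : R s" "g : R s" for f g
  using that by (simp add: R_def supp_in_def S_linear ring_distribs sum.distrib)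
 show "(%x. r * f x) : R s" if "f : R s" for r f
  using that by (simp add: R_def supp_in_def S_linear mult.left_commute flip: sum_distrib_left)
qed

section \<open>Dimension bounds for the spaces of relations\<close>

lemma fin_idx: "finite ({1..s::nat} \<times> (UNIV :: 'm set))" by simp

lemma fin_dim_R: "fin_dim (R s)"
 by (rule supp_in_fin_dim[OF fin_idx _ subspace_R]) (auto simp: R_def)

text \<open>Multiplying a monomial of degree \<open>d - 2\<close> by the coordinates numbered
  \<open>x\<close> and \<open>y\<close> gives the same weight for all
  \<open>x + y = j + k + 1\<close>. Comparing two of these relations leaves differences of
  \<open>S\<close>; this is the effect of the quadrics through the curve.\<close>

lemma swap:
 assumes c: "c : R s" and d2: "d >= 2" and jk: "j < n" "k < n" "j + k + 1 <= m" "m <= j + k + 1 + n * (d - 2)"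
 shows "S s c m (Suc j) - S s c m j = S s c m (Suc k) - S s c m k"
proof -
 have "m - (j + k + 1) <= n * (d - 2)" using jk by simp
 from exps_weight[OF this] obtain bet where bet: "bet : exps (d - 2)" "J bet = m - (j + k + 1)" by blast
 have rel: "(\<Sum>a\<in>UNIV. of_nat (bet a) * S s c m (sig a)) + S s c m x + S s c m y = 0" if xy: "x <= n" "y <= n" "x + y = j + k + 1" for x y
 proof -
  let ?al = "bump (tu y) (bump (tu x) bet)"
  have "Suc (Suc (d - 2)) = d" using d2 by simp
  then have al: "?al : exps d" using bump(1)[OF bump(1)[OF bet(1)]] by metis
  have J: "J ?al = m" using bet(2) jk xy by (simp add: bump(2) st)
  have "(\<Sum>a\<in>UNIV. (of_nat (bet a) + (if a = tu x then 1 else 0) + (if a = tu y then 1 else 0)) * S s c m (sig a)) = 0"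
   using R_rel[OF c al] unfolding J by (simp add: bump_def if_distrib[of "of_nat :: nat => complex"] cong: if_cong)
  then show ?thesis by (subst (asm) sum_two_points) (simp_all add: st xy)
 qed
 have "(X :: complex) - Y = Z - W" if "Q + Y + Z = 0" "Q + X + W = 0" for X Y Z W Q
 proof -
  have "X - Y = (Q + X + W) - (Q + Y + Z) + Z - W" by simp
  then show ?thesis unfolding that by simp
 qed
 from this[OF rel[of j "Suc k"] rel[of "Suc j" k]] jk show ?thesis by simp
qed

text \<open>For every weight \<open>m\<close>, one position at which the difference can be exchanged with the differences
 at all other positions.\<close>

definition pos :: "nat => nat" where "pos m = min (n - 1) (m - 1 - n * (d - 2))"

definition B :: "nat => (nat \<times> 'm => complex) => nat => complex" where
 "B s c m = S s c m (Suc (pos m)) - S s c m (pos m)"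

text \<open>As \<open>d >= 3\<close>, the position \<open>pos m\<close> satisfies the bounds of
  \<open>swap\<close> together with every admissible \<open>j\<close>; hence
  \<open>S s c m j\<close> is affine linear in \<open>j\<close>.\<close>

lemma S_diff:
 assumes c: "c : R s" and d3: "d >= 3" and j: "j < n" "j < m" "m <= j + M"
 shows "S s c m (Suc j) - S s c m j = B s c m"
 unfolding B_def
proof (rule swap[OF c _ j(1)])
 define Q where "Q = n * (d - 2)"
 obtain e where e: "d = e + 3" using d3 le_iff_add by (metis add.commute)
 have "n * (d - 1) = Q + n" "n <= Q" unfolding Q_def e by (simp_all add: algebra_simps)
 then have Q: "M = Q + n" "n <= Q" by (simp_all only: M_def)
 have p: "pos m = min (n - 1) (m - 1 - Q)" by (simp add: pos_def Q_def)
 show "pos m < n" using n1 p by simp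
 show "j + pos m + 1 <= m" using j Q unfolding p by (simp add: min_def) linarith
 show "m <= j + pos m + 1 + n * (d - 2)" using j Q unfolding p Q_def[symmetric] by (simp add: min_def) linarith
qed (use d3 in simp)

lemma moments_T:
 assumes "s <= L" "s <= Suc M" "!!m. m <= M ==> T s c a m = 0" "i : {1..s}"
 shows "c (i, a) = 0"
proof -
 have "ALL i:{1..s}. c (i, a) = 0"
  by (rule moments_zero[of "{1..s}" M u w]) (use assms uw_nz uw_dist in \<open>auto simp: T_def\<close>)
 then show ?thesis using assms(4) by blast
qed

text \<open>Each additional point brings \<open>n + 1\<close> coefficients, and a relation in which
  all of these vanish is a relation at the first \<open>s0\<close> points.\<close>

lemma restrict_points:
 assumes s: "s0 <= s"
 shows "cfun.dim (R s) <= cfun.dim (R s0) + (s - s0) * (n + 1)"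
proof -
 define P where "P = (%c (x :: nat \<times> 'm). if fst x : {s0<..s} then c x else (0::complex))"
 have P: "clinear P" by (rule clinearI) (auto simp: P_def)
 have Ss: "S s c k j = S s0 c k j" if "!!i a. i : {s0<..s} ==> c (i, a) = 0" for c k j
  unfolding S_def T_def by (rule sum.mono_neutral_right) (use s that in auto)
 have "{f : R s. P f = 0} <= R s0"
 proof
  fix f assume f: "f : {f : R s. P f = 0}"
  have z: "f (i, a) = 0" if "i : {s0<..s}" for i a
  proof -
   have "P f = 0" using f by blast
   then have "P f (i, a) = 0" by simp
   then show ?thesis using that by (simp add: P_def)
  qed
  have "f : supp_in ({1..s} \<times> UNIV)" using f by (simp add: R_def)
  then have "f : supp_in ({1..s0} \<times> UNIV)" using z by (auto simp: supp_in_def) (metis atLeastAtMost_iff greaterThanAtMost_iff not_le)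
  moreover have "S s f k j = S s0 f k j" for k j by (rule Ss) (rule z)
  ultimately show "f : R s0" using f by (simp add: R_def)
 qed
 then have 1: "cfun.dim {f : R s. P f = 0} <= cfun.dim (R s0)"
  using cfun.subspace_inter[OF subspace_R[of s] cpair.linear_subspace_kernel[OF P]]
  by (intro dim_mono_fin[OF fin_dim_R]) (simp_all add: Int_def)
 let ?A = "{s0<..s} \<times> (UNIV :: 'm set)"
 have "P ` R s <= supp_in ?A" by (auto simp: P_def supp_in_def)
 then have "cfun.dim (P ` R s) <= cfun.dim (supp_in ?A)"
  by (intro dim_mono_fin supp_in_dim(2) fin_dim_subspace rank_nullity(2)[OF P fin_dim_R]) auto
 also have "\<dots> = (s - s0) * (n + 1)" by (simp add: supp_in_dim(1) card_cartesian_product cardm)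
 finally show ?thesis using rank_nullity(1)[OF P fin_dim_R[of s]] 1 by linarith
qed

text \<open>With \<open>M + 1\<close> points the moments determine the coefficients. If the slope
  \<open>B\<close> is zero at a weight, the moments there are constant, and the relation, whose
  exponents sum to \<open>d\<close>, makes the constant zero. Slopes occur for the weights
  \<open>1\<close> to \<open>N - 1\<close>, as the weights \<open>0\<close> and \<open>N\<close>
  have one position only.\<close>

lemma dim_R_base:
 assumes d3: "d >= 3" and L: "Suc M <= L"
 shows "cfun.dim (R (Suc M)) <= N - 1"
proof -
 define P where "P = (%c m. if m : {1..N - 1} then B (Suc M) c m else 0)"
 have P: "clinear P" by (rule clinearI) (auto simp: P_def B_def S_linear fun_eq_iff algebra_simps)
 have "cfun.dim (R (Suc M)) <= card {1..N - 1}"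
 proof (rule dim_le_supp_in[OF P fin_dim_R])
  show "P ` R (Suc M) <= supp_in {1..N - 1}" by (auto simp: P_def supp_in_def)
  fix c assume c: "c : R (Suc M)" and P0: "P c = 0"
  have B0: "B (Suc M) c m = 0" if "1 <= m" "m <= N - 1" for m
   using fun_cong[OF P0, of m] that by (simp add: P_def)
  have S_step: "S (Suc M) c m (Suc j) = S (Suc M) c m j" if "j < n" "j < m" "m <= j + M" for m j
   using S_diff[OF c d3 that] B0[of m] that NM by simp
  have S_const: "S (Suc M) c m j' = S (Suc M) c m j" if j: "j <= j'" "j' <= n" "j' <= m" "m <= j + M" for m j j'
   using j(1) j(2-4)
  proof (induction j' rule: dec_induct)
   case (step k)
   then show ?case using S_step[of k m] by simp
  qed simp
  have S_eq: "S (Suc M) c m j' = S (Suc M) c m j" if "j <= n" "j <= m" "m <= j + M" "j' <= n" "j' <= m" "m <= j' + M" for m j j'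
   using S_const[of j j' m] S_const[of j' j m] that by (cases "j <= j'") auto
  have S0: "S (Suc M) c m j = 0" if j: "j <= n" "j <= m" "m <= j + M" for m j
  proof -
   have "m - j <= n * (d - 1)" using j by (simp add: M_def)
   from exps_weight[OF this] obtain bet where bet: "bet : exps (d - 1)" "J bet = m - j" by blast
   let ?al = "bump (tu j) bet"
   have al: "?al : exps d" "J ?al = m" using bump(1)[OF bet(1), of "tu j"] bump(2)[of "tu j" bet] bet(2) d1 j st by simp_all
   have eqs: "of_nat (?al a) * S (Suc M) c m (sig a) = of_nat (?al a) * S (Suc M) c m j" for a
   proof (cases "?al a = 0")
    case False
    then have "sig a <= m" "m <= sig a + M" using exps_val[OF al(1)] al(2) by blast+
    then show ?thesis using S_eq[of j m "sig a"] j st(2) by simp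
   qed simp
   have "(\<Sum>a\<in>UNIV. of_nat (?al a)) * S (Suc M) c m j = (\<Sum>a\<in>UNIV. of_nat (?al a) * S (Suc M) c m (sig a))"
    unfolding sum_distrib_right by (intro sum.cong refl) (rule eqs[symmetric])
   then have "(\<Sum>a\<in>UNIV. of_nat (?al a)) * S (Suc M) c m j = 0"
    using R_rel[OF c al(1)] unfolding al(2) by (rule trans)
   moreover have "(\<Sum>a\<in>UNIV. of_nat (?al a)) = (of_nat d :: complex)" using al(1) unfolding exps_def by (simp flip: of_nat_sum)
   ultimately show ?thesis using d1 by simp
  qed
  have "T (Suc M) c a m = 0" if "m <= M" for a m
   using S0[of "sig a" "m + sig a"] that by (simp add: S_def st)
  then have "c (i, a) = 0" if "i : {1..Suc M}" for i a using moments_T[OF L _ _ that] by blast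
  then show "c = 0" using c by (auto simp: R_def supp_in_def fun_eq_iff)
 qed simp
 then show ?thesis by simp
qed

text \<open>For \<open>d = 2\<close> the relations say that the moments form an antisymmetric matrix
  of size \<open>n + 1\<close>, which is determined by its entries with
  \<open>j < k\<close>.\<close>

lemma dim_R_quadric:
 assumes d2: "d = 2" and L: "Suc n <= L"
 shows "2 * cfun.dim (R (Suc n)) <= n * (n + 1)"
proof -
 have "n * (d - 1) = n" using d2 by simp
 then have Mn: "M = n" by (simp only: M_def)
 let ?A = "{(j, k). j < k & k <= n}"
 have fA: "finite ?A" by (rule finite_subset[of _ "{..n} \<times> {..n}"]) auto
 define P where "P = (%c (x :: nat \<times> nat). if x : ?A then T (Suc n) c (tu (fst x)) (snd x) else 0)"
 have P: "clinear P" by (rule clinearI) (auto simp: P_def T_def fun_eq_iff ring_distribs sum.distrib sum_distrib_left mult.assoc)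
 have "cfun.dim (R (Suc n)) <= card ?A"
 proof (rule dim_le_supp_in[OF P fin_dim_R fA])
  show "P ` R (Suc n) <= supp_in ?A" by (auto simp: P_def supp_in_def)
  fix c assume c: "c : R (Suc n)" and P0: "P c = 0"
  have P1: "T (Suc n) c (tu j) k = 0" if "j < k" "k <= n" for j k
   using fun_cong[OF P0, of "(j, k)"] that by (simp add: P_def)
  have rel: "T (Suc n) c (tu j) k + T (Suc n) c (tu k) j = 0" if jk: "j <= n" "k <= n" for j k
  proof -
   let ?al = "bump (tu k) (bump (tu j) (%_. 0))"
   have "(%_. 0) : exps 0" by (simp add: exps_def)
   from bump(1)[OF bump(1)[OF this]] have al: "?al : exps d" by (simp add: d2 numeral_2_eq_2)
   have J: "J ?al = j + k" using jk by (simp add: bump(2) st) (simp add: J_def)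
   have "(\<Sum>a\<in>UNIV. (0 + (if a = tu j then 1 else 0) + (if a = tu k then 1 else 0)) * S (Suc n) c (j + k) (sig a)) = 0"
    using R_rel[OF c al] unfolding J by (simp add: bump_def if_distrib[of "of_nat :: nat => complex"] cong: if_cong)
   then show ?thesis by (subst (asm) sum_two_points) (simp_all add: st jk S_def)
  qed
  have Tjk: "T (Suc n) c (tu j) k = 0" if jk: "j <= n" "k <= n" for j k
  proof -
   consider "j < k" | "k < j" | "j = k" by linarith
   then show ?thesis
   proof cases
    case 1 then show ?thesis by (rule P1[OF _ jk(2)])
   next
    case 2 from P1[OF 2 jk(1)] rel[OF jk] show ?thesis by simp
   next
    case 3 from rel[OF jk] show ?thesis unfolding 3 by simp
   qed
  qed
  have Tz: "T (Suc n) c a m = 0" if "m <= M" for a m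
   using Tjk[OF st(2)[of a], of m] that unfolding st(3) Mn .
  have "c (i, a) = 0" if "i : {1..Suc n}" for i a
   by (rule moments_T[OF L _ Tz that]) (simp_all only: Mn le_refl)
  then show "c = 0" using c by (auto simp: R_def supp_in_def fun_eq_iff)
 qed
 moreover have "2 * card ?A <= n * (n + 1)"
 proof -
  have "?A = (\<Union>k\<in>{..n}. (%j. (j, k)) ` {..<k})" by auto
  then have "card ?A <= (\<Sum>k\<le>n. card ((%j. (j, k)) ` {..<k}))" by (simp only: card_UN_le finite_atMost)
  also have "\<dots> = (\<Sum>k\<le>n. k)" by (intro sum.cong) (auto simp: card_image inj_on_def)
  finally show ?thesis using gauss_sum_nat[of n] by (simp add: atLeast0AtMost)
 qed
 ultimately show ?thesis by linarith
qed

lemma dim_R_linear: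
 assumes d2: "d = 1" and L: "1 <= L"
 shows "cfun.dim (R 1) = 0"
proof -
 have "n * (d - 1) = 0" using d2 by simp
 then have M0: "M = 0" by (simp only: M_def)
 have "R 1 <= {0}"
 proof
  fix c assume c: "c : R 1"
  have c1: "c (1, a) = 0" for a
  proof -
   have "(%_. 0) : exps 0" by (simp add: exps_def)
   from bump(1)[OF this, of a] have al: "bump a (%_. 0) : exps d" by (simp add: d2)
   have J: "J (bump a (%_. 0)) = sig a" by (simp add: bump(2)) (simp add: J_def)
   have "(\<Sum>b\<in>UNIV. (if b = a then 1 else 0) * S 1 c (sig a) (sig b)) = 0"
    using R_rel[OF c al] unfolding J by (simp add: bump_def if_distrib cong: if_cong)
   then have "(\<Sum>b\<in>UNIV. S 1 c (sig a) (sig b) * (if b = a then 1 else 0)) = 0" by (simp only: mult.commute)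
   then show ?thesis unfolding sum_unit by (simp add: S_def T_def st M0)
  qed
  have "c (i, a) = 0" for i a
  proof (cases "i = 1")
   case True then show ?thesis using c1 by simp
  next
   case False
   have "c : supp_in ({1..1} \<times> UNIV)" using c by (simp only: R_def mem_Collect_eq)
   then show ?thesis using False by (simp add: supp_in_def)
  qed
  then show "c : {0}" by (simp add: fun_eq_iff)
 qed
 then have "cfun.dim (R 1) <= card ({} :: (nat \<times> 'm => complex) set)" by (intro cfun.dim_le_card) auto
 then show ?thesis by simp
qed

text \<open>In the kernel of \<open>Ph\<close>, \<open>S s c m j\<close> is proportional to
  \<open>j d - m\<close> for \<open>0 < m < N\<close> and zero for the two extreme weights. Such
  coefficients are relations because the sum of \<open>al a * (sig a * d - m)\<close> is zero for
  exponents of weight \<open>m\<close>. Of the \<open>(n + 1) (M + 1)\<close> conditions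
  \<open>N - 1\<close> are void, which leaves \<open>n M + 2\<close>.\<close>

lemma dim_R_lower:
 assumes d2: "d >= 2"
 shows "(n + 1) * s <= cfun.dim (R s) + n * M + 2"
proof -
 \<comment> \<open>The reference position has to be admissible at weight \<open>m\<close> and to
   satisfy \<open>piv m * d ~= m\<close>, so that the proportionality can be solved: position
   \<open>0\<close> for small weights and \<open>n\<close> for large ones.\<close>
 define piv where "piv = (%m. if m <= M then 0 else n)"
 define Ph where "Ph = (%c (x :: nat \<times> nat). let j = fst x; m = fst x + snd x in
  if j <= n & snd x <= M then
   if m = 0 | m = N then S s c m j
   else (of_nat (piv m * d) - of_nat m) * S s c m j - (of_nat (j * d) - of_nat m) * S s c m (piv m)
  else 0)"
 \<comment> \<open>The entries at which the condition compares the reference position with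
   itself.\<close>
 define piv_set where "piv_set = (%m. (0::nat, m)) ` {1..M} \<union> (%m. (n, m)) ` {M - n<..<M}"
 let ?A = "({..n} \<times> {..M}) - piv_set"
 have P: "clinear Ph"
  by (rule clinearI) (auto simp: Ph_def Let_def S_linear fun_eq_iff algebra_simps)
 have img: "Ph ` supp_in ({1..s} \<times> UNIV) <= supp_in ?A"
 proof
  fix h assume "h : Ph ` supp_in ({1..s} \<times> UNIV)"
  then obtain c where h: "h = Ph c" by blast
  have "Ph c (j, m) = 0" if "(j, m) : piv_set" for j m
  proof -
   have "(j = 0 & 1 <= m & m <= M) | (j = n & M - n < m & m < M)" using that by (auto simp: piv_set_def)
   then have "piv (j + m) = j" "j + m ~= 0" "j + m ~= N" using n1 NM by (auto simp: piv_def)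
   then show ?thesis by (auto simp: Ph_def Let_def)
  qed
  moreover have "Ph c (j, m) = 0" if "(j, m) ~: {..n} \<times> {..M}" for j m using that by (auto simp: Ph_def)
  ultimately show "h : supp_in ?A" unfolding h supp_in_def by auto
 qed
 have ker: "{c : supp_in ({1..s} \<times> UNIV). Ph c = 0} <= R s"
 proof
  fix c assume c: "c : {c : supp_in ({1..s} \<times> UNIV). Ph c = 0}"
  have Ph0: "Ph c x = 0" for x using c by simp
  have "(\<Sum>a\<in>UNIV. of_nat (al a) * S s c (J al) (sig a)) = 0" if al: "al : exps d" for al
  proof -
   define m where "m = J al"
   have val: "sig a <= m & m <= sig a + M" if "al a ~= 0" for a
    using exps_val[OF al that] by (simp add: m_def)
   have mN: "m <= N" using J_le[OF al] by (simp add: m_def N_def)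
   have s1: "(\<Sum>a\<in>UNIV. al a) = d" using al by (simp add: exps_def)
   show ?thesis
   proof (cases "m = 0 | m = N")
    case True
    have "of_nat (al a) * S s c m (sig a) = 0" for a
    proof (cases "al a = 0")
     case False
     have "Ph c (sig a, m - sig a) = 0" by (rule Ph0)
     moreover have "sig a + (m - sig a) = m" "m - sig a <= M" using val[OF False] by auto
     ultimately show ?thesis using True st(2)[of a] by (simp add: Ph_def Let_def)
    qed simp
    then show ?thesis unfolding m_def by (intro sum.neutral ballI)
   next
    case False
    let ?p = "of_nat (piv m * d) - of_nat m :: complex"
    have p0: "?p ~= 0"
    proof -
     have "piv m * d ~= m" using False mN by (auto simp: piv_def N_def)
     then show ?thesis by (metis eq_iff_diff_eq_0 of_nat_eq_iff)
    qed
    have "?p * (of_nat (al a) * S s c m (sig a)) = (of_nat (al a) * (of_nat (sig a * d) - of_nat m)) * S s c m (piv m)" for a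
    proof (cases "al a = 0")
     case nz: False
     have "Ph c (sig a, m - sig a) = 0" by (rule Ph0)
     moreover have "sig a + (m - sig a) = m" "m - sig a <= M" using val[OF nz] by auto
     ultimately have "?p * S s c m (sig a) = (of_nat (sig a * d) - of_nat m) * S s c m (piv m)"
      using False st(2)[of a] by (simp add: Ph_def Let_def)
     then show ?thesis by (metis mult.assoc mult.left_commute)
    qed simp
    then have "?p * (\<Sum>a\<in>UNIV. of_nat (al a) * S s c m (sig a)) = (\<Sum>a\<in>UNIV. of_nat (al a) * (of_nat (sig a * d) - of_nat m)) * S s c m (piv m)"
     by (simp only: sum_distrib_left sum_distrib_right)
    also have "(\<Sum>a\<in>UNIV. of_nat (al a) * (of_nat (sig a * d) - of_nat m)) = (of_nat d * of_nat (\<Sum>a\<in>UNIV. sig a * al a) - of_nat m * of_nat (\<Sum>a\<in>UNIV. al a) :: complex)"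
     by (simp add: sum_distrib_left sum_subtractf[symmetric] algebra_simps)
    also have "\<dots> = 0" unfolding s1 J_def[symmetric] m_def by simp
    finally show ?thesis using p0 by (simp add: m_def)
   qed
  qed
  then show "c : R s" using c by (simp add: R_def)
 qed
 have sub: "cfun.subspace {c : supp_in ({1..s} \<times> UNIV). Ph c = 0}"
  using cfun.subspace_inter[OF subspace_supp_in[of "{1..s} \<times> UNIV"] cpair.linear_subspace_kernel[OF P]] by (simp add: Int_def)
 have 1: "cfun.dim {c : supp_in ({1..s} \<times> UNIV). Ph c = 0} <= cfun.dim (R s)" by (rule dim_mono_fin[OF fin_dim_R ker sub])
 have "cfun.dim (Ph ` supp_in ({1..s} \<times> UNIV)) <= cfun.dim (supp_in ?A)"
  by (intro dim_mono_fin supp_in_dim(2) fin_dim_subspace rank_nullity(2)[OF P] img) auto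
 also have "\<dots> = card ?A" by (rule supp_in_dim(1)) auto
 also have "\<dots> <= n * M + 2"
 proof -
  have dis: "(%m. (0::nat, m)) ` {1..M} \<inter> (%m. (n, m)) ` {M - n<..<M} = {}" using n1 by auto
  have "card piv_set = M + (M - Suc (M - n))"
   unfolding piv_set_def by (subst card_Un_disjoint[OF _ _ dis]) (auto simp: card_image inj_on_def)
  moreover have "piv_set <= {..n} \<times> {..M}" by (auto simp: piv_set_def)
  ultimately have "card ?A = (n + 1) * (M + 1) - (M + (M - Suc (M - n)))"
   by (subst card_Diff_subset) (auto simp: card_cartesian_product intro: finite_subset)
  moreover have "n * 1 <= M" unfolding M_def by (rule mult_le_mono2) (use d2 in simp)
  ultimately show ?thesis using n1 by (auto simp: algebra_simps)
 qed
 finally have 2: "cfun.dim (Ph ` supp_in ({1..s} \<times> UNIV)) <= n * M + 2" .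
 have "card ({1..s} \<times> (UNIV :: 'm set)) = (n + 1) * s" by (simp add: card_cartesian_product cardm)
 then show ?thesis using rank_nullity(1)[OF P supp_in_dim(2)[OF fin_idx[of s]]] supp_in_dim(1)[OF fin_idx[of s]] 1 2 by linarith
qed

end

lemma hterm_shift:
 assumes "j <= n" "j <= k" "k <= j + M"
 shows "hterm n x y a b j * a ^ (M - (k - j)) * b ^ (k - j) =
  x * of_nat (n - j) * a ^ (M + n - k - 1) * b ^ k + y * of_nat j * a ^ (M + n - k) * b ^ (k - 1)"
proof -
 obtain e where k: "k = j + e" using assms(2) le_iff_add by blast
 obtain f where M: "M = e + f" using assms(3) k le_iff_add by auto
 obtain g where n: "n = j + g" using assms(1) le_iff_add by blast
 show ?thesis unfolding hterm_def k M n by (cases g; cases j) (simp_all add: power_add algebra_simps)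
qed

lemma herm_subset:
 assumes "finite I" "I' <= I" "!!i. i : I - I' ==> x i = 0 & y i = 0"
 shows "herm N I u w x y \<longleftrightarrow> herm N I' u w x y"
proof -
 have "(\<Sum>i\<in>I. hterm N (x i) (y i) (u i) (w i) k) = (\<Sum>i\<in>I'. hterm N (x i) (y i) (u i) (w i) k)" for k
  by (rule sum.mono_neutral_right) (use assms in \<open>auto simp: hterm_def\<close>)
 then show ?thesis by (simp add: herm_def)
qed

section \<open>Relations tangent to the curve\<close>

context rnc begin

definition H :: "nat => (nat \<times> nat => complex) set" where
 "H s = {h : supp_in ({1..s} \<times> {0, 1}). herm N {1..s} u w (%i. h (i, 0)) (%i. h (i, 1))}"

text \<open>The derivative of the parametrised cone over the curve at the point \<open>i\<close> in
  direction \<open>(h (i, 0), h (i, 1))\<close>: a tangent vector.\<close>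

definition Tan :: "(nat \<times> nat => complex) => nat \<times> 'm => complex" where
 "Tan h = (%(i, a). hterm n (h (i, 0)) (h (i, 1)) (u i) (w i) (sig a))"

text \<open>Chain rule: pairing the gradient of a monomial with a tangent vector differentiates its
  restriction to the curve, a binary monomial of degree \<open>N\<close>.\<close>

lemma Tan_relation:
 assumes al: "al : exps d"
 shows "(\<Sum>a\<in>UNIV. of_nat (al a) * S s (Tan h) (J al) (sig a)) =
  (\<Sum>i\<in>{1..s}. hterm N (h (i, 0)) (h (i, 1)) (u i) (w i) (J al))"
proof -
 let ?k = "J al"
 have kN: "?k <= N" using J_le[OF al] unfolding N_def .
 have s1: "(\<Sum>a\<in>UNIV. al a) = d" using al by (simp add: exps_def)
 have s2: "(\<Sum>a\<in>UNIV. al a * (n - sig a)) = N - ?k"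
 proof -
  have "(\<Sum>a\<in>UNIV. al a * (n - sig a)) + ?k = (\<Sum>a\<in>UNIV. al a * n)"
   unfolding J_def sum.distrib[symmetric]
  proof (intro sum.cong refl)
   fix a show "al a * (n - sig a) + sig a * al a = al a * n"
    using st(2)[of a] by (metis add_mult_distrib2 le_add_diff_inverse2 mult.commute)
  qed
  also have "\<dots> = N" unfolding N_def sum_distrib_right[symmetric] s1 by (rule mult.commute)
  finally show ?thesis by simp
 qed
 have "(\<Sum>a\<in>UNIV. of_nat (al a) * S s (Tan h) ?k (sig a)) =
  (\<Sum>i\<in>{1..s}. \<Sum>a\<in>UNIV. of_nat (al a) * (Tan h (i, a) * u i ^ (M - (?k - sig a)) * w i ^ (?k - sig a)))"
  unfolding S_def T_def st(3) sum_distrib_left by (rule sum.swap)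
 also have "\<dots> = (\<Sum>i\<in>{1..s}. hterm N (h (i, 0)) (h (i, 1)) (u i) (w i) ?k)"
 proof (intro sum.cong refl)
  fix i
  let ?A = "h (i, 0) * u i ^ (N - ?k - 1) * w i ^ ?k" and ?B = "h (i, 1) * u i ^ (N - ?k) * w i ^ (?k - 1)"
  have "of_nat (al a) * (Tan h (i, a) * u i ^ (M - (?k - sig a)) * w i ^ (?k - sig a)) =
    of_nat (al a * (n - sig a)) * ?A + of_nat (sig a * al a) * ?B" for a
  proof (cases "al a = 0")
   case False
   from exps_val[OF al False] have v: "sig a <= ?k" "?k <= sig a + M" by auto
   show ?thesis
    unfolding Tan_def prod.case hterm_shift[OF st(2) v] NM by (simp only: of_nat_mult distrib_left mult.assoc mult.commute mult.left_commute)
  qed simp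
  then have "(\<Sum>a\<in>UNIV. of_nat (al a) * (Tan h (i, a) * u i ^ (M - (?k - sig a)) * w i ^ (?k - sig a))) =
   of_nat (\<Sum>a\<in>UNIV. al a * (n - sig a)) * ?A + of_nat (\<Sum>a\<in>UNIV. sig a * al a) * ?B"
   unfolding of_nat_sum sum_distrib_right sum.distrib[symmetric] by (intro sum.cong refl)
  also have "\<dots> = of_nat (N - ?k) * ?A + of_nat ?k * ?B" unfolding s2 J_def[symmetric] ..
  finally show "(\<Sum>a\<in>UNIV. of_nat (al a) * (Tan h (i, a) * u i ^ (M - (?k - sig a)) * w i ^ (?k - sig a))) =
   hterm N (h (i, 0)) (h (i, 1)) (u i) (w i) ?k" by (simp add: hterm_def mult_ac)
 qed
 finally show ?thesis .
qed

text \<open>\<open>S\<close> is affine linear in the position, so its second differences vanish;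
  written out, they are moments of degree \<open>M - 2\<close> of the left side of the recurrence in
  \<open>tangent_exists\<close>.\<close>

lemma S_second_diff:
 assumes c: "c : R s" and d3: "d >= 3" and j: "j + 2 <= n" and m: "m + 2 <= M"
 shows "(\<Sum>i\<in>{1..s}. (c (i, tu j) * w i ^ 2 - 2 * c (i, tu (j + 1)) * u i * w i + c (i, tu (j + 2)) * u i ^ 2) * u i ^ (M - 2 - m) * w i ^ m) = 0"
proof -
 let ?k = "m + 2 + j"
 have 1: "S s c ?k (Suc j) - S s c ?k j = B s c ?k" by (rule S_diff[OF c d3]) (use j m in auto)
 have 2: "S s c ?k (Suc (Suc j)) - S s c ?k (Suc j) = B s c ?k" by (rule S_diff[OF c d3]) (use j m in auto)
 have "(\<Sum>i\<in>{1..s}. (c (i, tu j) * w i ^ 2 - 2 * c (i, tu (j + 1)) * u i * w i + c (i, tu (j + 2)) * u i ^ 2) * u i ^ (M - 2 - m) * w i ^ m)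
  = S s c ?k j - 2 * S s c ?k (Suc j) + S s c ?k (Suc (Suc j))"
  unfolding S_def T_def sum_distrib_left sum_subtractf[symmetric] sum.distrib[symmetric]
 proof (intro sum.cong refl)
  fix i
  obtain e where M: "M = m + 2 + e" using m le_iff_add by blast
  show "(c (i, tu j) * w i ^ 2 - 2 * c (i, tu (j + 1)) * u i * w i + c (i, tu (j + 2)) * u i ^ 2) * u i ^ (M - 2 - m) * w i ^ m =
   c (i, tu j) * u i ^ (M - (?k - j)) * w i ^ (?k - j) - 2 * (c (i, tu (Suc j)) * u i ^ (M - (?k - Suc j)) * w i ^ (?k - Suc j)) +
   c (i, tu (Suc (Suc j))) * u i ^ (M - (?k - Suc (Suc j))) * w i ^ (?k - Suc (Suc j))"
   unfolding M by (simp add: power2_eq_square algebra_simps)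
 qed
 also have "\<dots> = (S s c ?k (Suc (Suc j)) - S s c ?k (Suc j)) - (S s c ?k (Suc j) - S s c ?k j)" by simp
 finally show ?thesis unfolding 1 2 by simp
qed

text \<open>Binary forms of degree \<open>M - 2\<close> separate up to \<open>M - 1\<close> points,
  so the second differences vanish at each point, and by \<open>tangent_exists\<close> the
  coefficient vectors are tangent.\<close>

lemma R_eq_Tan:
 assumes d3: "d >= 3" and sM: "Suc s <= M" and sL: "s <= L"
 shows "R s = Tan ` H s"
proof (intro set_eqI iffI)
 fix c assume "c : Tan ` H s"
 then obtain h where h: "h : H s" "c = Tan h" by blast
 have "c : supp_in ({1..s} \<times> UNIV)" using h by (auto simp: H_def supp_in_def Tan_def hterm_def)
 moreover have "(\<Sum>a\<in>UNIV. of_nat (al a) * S s c (J al) (sig a)) = 0" if "al : exps d" for al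
  using h(1) J_le[OF that] unfolding h(2) Tan_relation[OF that] H_def herm_def N_def by simp
 ultimately show "c : R s" by (simp add: R_def)
next
 fix c assume c: "c : R s"
 have rec: "c (i, tu j) * w i ^ 2 - 2 * c (i, tu (j + 1)) * u i * w i + c (i, tu (j + 2)) * u i ^ 2 = 0"
  if i: "i : {1..s}" and j: "j + 2 <= n" for i j
 proof -
  let ?e = "%i. c (i, tu j) * w i ^ 2 - 2 * c (i, tu (j + 1)) * u i * w i + c (i, tu (j + 2)) * u i ^ 2"
  have "n * 1 <= M" unfolding M_def by (rule mult_le_mono2) (use d3 in simp)
  then have M2: "2 <= M" using j by simp
  have "ALL i:{1..s}. ?e i = 0"
   by (rule moments_zero[of "{1..s}" "M - 2" u w])
     (use uw_nz uw_dist sM sL M2 S_second_diff[OF c d3 j] in auto)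
  then show ?thesis using i by blast
 qed
 have "ALL i:{1..s}. EX xy. ALL j<=n. c (i, tu j) = hterm n (fst xy) (snd xy) (u i) (w i) j"
 proof
  fix i assume i: "i : {1..s}"
  have "EX x y. ALL j<=n. c (i, tu j) = hterm n x y (u i) (w i) j"
   by (rule tangent_exists[OF uw_nz n1 rec[OF i]]) (use i sL in auto)
  then obtain x y where "ALL j<=n. c (i, tu j) = hterm n x y (u i) (w i) j" by (elim exE)
  then show "EX xy. ALL j<=n. c (i, tu j) = hterm n (fst xy) (snd xy) (u i) (w i) j"
   by (intro exI[of _ "(x, y)"]) simp
 qed
 then obtain t where t: "ALL i:{1..s}. ALL j<=n. c (i, tu j) = hterm n (fst (t i)) (snd (t i)) (u i) (w i) j"
  unfolding bchoice_iff by (elim exE)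
 define h where "h = (%(i, b :: nat). if i : {1..s} then if b = 0 then fst (t i) else if b = 1 then snd (t i) else 0 else 0)"
 have cT: "c = Tan h"
 proof
  fix x :: "nat \<times> 'm" obtain i a where x: "x = (i, a)" by (cases x)
  show "c x = Tan h x"
  proof (cases "i : {1..s}")
   case True
   have "c (i, tu (sig a)) = hterm n (fst (t i)) (snd (t i)) (u i) (w i) (sig a)" using t True st(2) by blast
   then show ?thesis using True by (simp add: x st Tan_def h_def)
  next
   case False
   have "c : supp_in ({1..s} \<times> UNIV)" using c by (simp add: R_def)
   then show ?thesis using False unfolding x by (auto simp: supp_in_def Tan_def h_def hterm_def)
  qed
 qed
 have "h : H s"
  unfolding H_def herm_def
 proof (intro CollectI conjI allI impI)
  show "h : supp_in ({1..s} \<times> {0, 1})" by (auto simp: supp_in_def h_def)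
  fix k assume "k <= N"
  then obtain al where al: "al : exps d" "J al = k" using exps_weight[of k d] N_def by auto
  show "(\<Sum>i\<in>{1..s}. hterm N (h (i, 0)) (h (i, 1)) (u i) (w i) k) = 0"
   using R_rel[OF c al(1)] unfolding cT Tan_relation[OF al(1)] unfolding al(2) .
 qed
 then show "c : Tan ` H s" using cT by blast
qed

lemma N1: "N >= 1" using n1 d1 by (simp add: N_def)

text \<open>The \<open>N + 1\<close> equations give the lower bound. For the upper bound so many
  points are projected away that Hermite interpolation at the remaining ones is unique; if
  \<open>N\<close> is even, half of one point has to be kept.\<close>

lemma dim_H:
 assumes sL: "s <= L"
 shows "cfun.dim (H s) = 2 * s - (N + 1)"
proof -
 let ?A = "{1..s} \<times> {0, 1 :: nat}"
 have fA: "finite ?A" by simp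
 define G where "G = (%(h :: nat \<times> nat => complex) k. if k <= N then \<Sum>i\<in>{1..s}. hterm N (h (i, 0)) (h (i, 1)) (u i) (w i) k else 0)"
 have G: "clinear G"
  by (rule clinearI) (auto simp: G_def fun_eq_iff hterm_add hterm_cmult sum.distrib sum_distrib_left)
 have H: "H s = {h : supp_in ?A. G h = 0}"
  by (auto simp: H_def herm_def G_def fun_eq_iff)
 have subH: "cfun.subspace (H s)"
  unfolding H using cfun.subspace_inter[OF subspace_supp_in[of ?A] cpair.linear_subspace_kernel[OF G]] by (simp add: Int_def)
 have fH: "fin_dim (H s)" by (rule supp_in_fin_dim[OF fA _ subH]) (auto simp: H)
 have "cfun.dim (G ` supp_in ?A) <= cfun.dim (supp_in {..N})"
  by (intro dim_mono_fin supp_in_dim(2) fin_dim_subspace rank_nullity(2)[OF G] fA) (auto simp: G_def supp_in_def)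
 then have low: "2 * s <= cfun.dim (H s) + (N + 1)"
  using rank_nullity(1)[OF G supp_in_dim(2)[OF fA]] supp_in_dim(1)[OF fA] supp_in_dim(1)[of "{..N}"]
  unfolding H by (simp add: card_cartesian_product)
 have hH: "herm N {1..s} u w (%i. h (i, 0)) (%i. h (i, 1))" "h : supp_in ?A" if "h : H s" for h
  using that by (simp_all add: H_def)
 have zero: "h = 0" if h: "h : H s" and z: "!!i. i : {1..s} ==> h (i, 0) = 0 & h (i, 1) = 0" for h
 proof
  fix x :: "nat \<times> nat" obtain i b where x: "x = (i, b)" by (cases x)
  show "h x = 0 x" using z[of i] hH(2)[OF h] unfolding x supp_in_def by (cases "(i, b) : ?A") auto
 qed
 have up: "cfun.dim (H s) <= 2 * s - (N + 1)"
 proof (cases "2 * s <= N + 1")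
  case True
  have "H s <= {0}"
  proof
   fix h assume h: "h : H s"
   have "ALL i:{1..s}. h (i, 0) = 0 & h (i, 1) = 0"
    by (rule hermite_unique[OF _ _ _ _ hH(1)[OF h]]) (use True sL uw_nz uw_dist in auto)
   then show "h : {0}" using zero[OF h] by blast
  qed
  then have "cfun.dim (H s) <= card ({} :: (nat \<times> nat => complex) set)" by (intro cfun.dim_le_card) auto
  then show ?thesis by simp
 next
  case False
  show ?thesis
  proof (cases "even N")
   case False
   then obtain q where q: "N = 2 * q + 1" by (elim oddE)
   define s0 where "s0 = q + 1"
   have s0: "s0 <= s" "2 * s0 = N + 1" using q \<open>\<not> 2 * s <= N + 1\<close> by (auto simp: s0_def)
   define P where "P = (%h (x :: nat \<times> nat). if fst x : {s0<..s} & snd x : {0, 1} then h x else (0::complex))"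
   have P: "clinear P" by (rule clinearI) (auto simp: P_def)
   have "cfun.dim (H s) <= card ({s0<..s} \<times> {0, 1 :: nat})"
   proof (rule dim_le_supp_in[OF P fH])
    show "P ` H s <= supp_in ({s0<..s} \<times> {0, 1})" by (auto simp: P_def supp_in_def)
    fix h assume h: "h : H s" and P0: "P h = 0"
    have z: "h (i, 0) = 0 & h (i, 1) = 0" if "i : {1..s} - {1..s0}" for i
    proof -
     have "P h (i, 0) = 0" "P h (i, 1) = 0" using P0 by simp_all
     then show ?thesis using that by (auto simp: P_def)
    qed
    have "herm N {1..s} u w (%i. h (i, 0)) (%i. h (i, 1)) \<longleftrightarrow> herm N {1..s0} u w (%i. h (i, 0)) (%i. h (i, 1))"
     by (rule herm_subset[OF _ _ z]) (use s0(1) in auto)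
    with hH(1)[OF h] have "herm N {1..s0} u w (%i. h (i, 0)) (%i. h (i, 1))" by blast
    then have "ALL i:{1..s0}. h (i, 0) = 0 & h (i, 1) = 0"
     by (rule hermite_unique[rotated 4]) (use s0 sL uw_nz uw_dist in auto)
    then show "h = 0" using zero[OF h] z by blast
   qed simp
   then show ?thesis using s0 by (simp add: card_cartesian_product)
  next
   case True
   then obtain s0 where s0: "N = 2 * s0" by (elim evenE)
   define k where "k = Suc s0"
   have k: "k <= s" using \<open>\<not> 2 * s <= N + 1\<close> s0 by (simp add: k_def)
   let ?B = "insert (k, 0) ({k<..s} \<times> {0, 1 :: nat})"
   \<comment> \<open>At the point \<open>k\<close> only the component transverse to the radial
     direction is recorded; if it vanishes, \<open>hermite_unique'\<close> applies.\<close>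
   define P where "P = (%h (x :: nat \<times> nat). if x = (k, 0) then h (k, 0) * w k - h (k, 1) * u k
    else if fst x : {k<..s} & snd x : {0, 1} then h x else (0::complex))"
   have P: "clinear P" by (rule clinearI) (auto simp: P_def fun_eq_iff algebra_simps)
   have "cfun.dim (H s) <= card ?B"
   proof (rule dim_le_supp_in[OF P fH])
    show "P ` H s <= supp_in ?B" by (auto simp: P_def supp_in_def)
    fix h assume h: "h : H s" and P0: "P h = 0"
    have z: "h (i, 0) = 0 & h (i, 1) = 0" if "i : {1..s} - {1..k}" for i
    proof -
     have "P h (i, 0) = 0" "P h (i, 1) = 0" using P0 by simp_all
     then show ?thesis using that by (auto simp: P_def)
    qed
    have ik: "{1..k} = insert k {1..s0}" by (auto simp: k_def)
    have kk: "h (k, 0) * w k - h (k, 1) * u k = 0"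
    proof -
     have "P h (k, 0) = 0" using P0 by simp
     then show ?thesis by (simp add: P_def)
    qed
    have "herm N {1..s} u w (%i. h (i, 0)) (%i. h (i, 1)) \<longleftrightarrow> herm N {1..k} u w (%i. h (i, 0)) (%i. h (i, 1))"
     by (rule herm_subset[OF _ _ z]) (use k in auto)
    with hH(1)[OF h] have "herm N {1..k} u w (%i. h (i, 0)) (%i. h (i, 1))" by blast
    then have hk: "herm N (insert k {1..s0}) u w (%i. h (i, 0)) (%i. h (i, 1))" unfolding ik .
    have sub: "i : {1..L}" if "i : insert k {1..s0}" for i using that k sL by (auto simp: k_def)
    have "ALL i:insert k {1..s0}. h (i, 0) = 0 & h (i, 1) = 0"
    proof (rule hermite_unique'[OF _ _ _ _ _ hk kk N1])
     show "u i ~= 0 | w i ~= 0" if "i : insert k {1..s0}" for i by (rule uw_nz[OF sub[OF that]])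
     show "u i * w j ~= u j * w i" if "i : insert k {1..s0}" "j : insert k {1..s0}" "i ~= j" for i j
      by (rule uw_dist[OF sub[OF that(1)] sub[OF that(2)] that(3)])
    qed (simp_all add: s0 k_def)
    then show "h = 0" using zero[OF h] z ik by blast
   qed simp
   also have "\<dots> = 1 + 2 * (s - k)" by (simp add: card_insert_if card_cartesian_product)
   finally show ?thesis using s0 k by (simp add: k_def)
  qed
 qed
 show ?thesis using low up by linarith
qed

lemma dim_R_small:
 assumes d3: "d >= 3" and sM: "Suc s <= M" and sL: "s <= L"
 shows "cfun.dim (R s) = 2 * s - (N + 1)"
proof -
 have T: "clinear Tan" by (rule clinearI) (auto simp: Tan_def fun_eq_iff hterm_add hterm_cmult)
 have "cfun.subspace (H s)"
 proof (rule cfun_subspaceI)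
  show "(%x. 0) : H s" by (simp add: H_def herm_def hterm_def supp_in_def)
  show "(%x. f x + g x) : H s" if "f : H s" "g : H s" for f g
   using that by (simp add: H_def herm_def hterm_add supp_in_def sum.distrib)
  show "(%x. r * f x) : H s" if "f : H s" for r f
   using that by (simp add: H_def herm_def hterm_cmult supp_in_def flip: sum_distrib_left)
 qed
 then have fH: "fin_dim (H s)" by (rule supp_in_fin_dim[of "{1..s} \<times> {0, 1}", rotated 2]) (auto simp: H_def)
 have "cfun.dim (Tan ` H s) = cfun.dim (H s)"
 proof (rule dim_image_inj[OF T fH])
  fix h assume h: "h : H s" "Tan h = 0"
  show "h = 0"
  proof
   fix x :: "nat \<times> nat" obtain i b where x: "x = (i, b)" by (cases x)
   have supp: "h : supp_in ({1..s} \<times> {0, 1})" using h(1) by (simp add: H_def)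
   show "h x = 0 x"
   proof (cases "(i, b) : {1..s} \<times> {0, 1}")
    case True
    have "hterm n (h (i, 0)) (h (i, 1)) (u i) (w i) k = 0" if "k <= n" for k
    proof -
     have "Tan h (i, tu k) = 0" using h(2) by simp
     then show ?thesis using st(1)[OF that] by (simp add: Tan_def)
    qed
    moreover have "u i ~= 0 | w i ~= 0" using True sL by (intro uw_nz) auto
    ultimately have "h (i, 0) = 0" "h (i, 1) = 0" using hterm_zero[OF _ n1] by blast+
    then show ?thesis using True x by auto
   qed (use supp x in \<open>simp add: supp_in_def\<close>)
  qed
 qed
 then show ?thesis unfolding R_eq_Tan[OF assms] dim_H[OF sL] .
qed

text \<open>The upper bound adds \<open>n + 1\<close> per point to the dimension
  \<open>M - n - 3\<close> known for \<open>M - 1\<close> points. If \<open>n + 3 > M\<close>, only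
  \<open>n = 2\<close> and \<open>M = 4\<close> are possible; the truncated subtraction would then
  give a bound too large by one, so the count starts at five points with
  \<open>dim_R_base\<close>.\<close>

lemma dim_R_large:
 assumes d3: "d >= 3" and n2: "n >= 2" and s: "s >= n + 3" "M <= Suc s" "s <= L"
 shows "cfun.dim (R s) + n * M + 2 = (n + 1) * s"
proof (rule antisym)
 show "(n + 1) * s <= cfun.dim (R s) + n * M + 2" by (rule dim_R_lower) (use d3 in simp)
 show "cfun.dim (R s) + n * M + 2 <= (n + 1) * s"
 proof (cases "n + 3 <= M")
  case True
  obtain e where M: "M = n + 3 + e" using True le_iff_add by blast
  obtain t where t: "s = M - 1 + t" using s(2) le_iff_add[of "M - 1" s] by auto
  have "cfun.dim (R (M - 1)) = 2 * (M - 1) - (N + 1)"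
   by (rule dim_R_small[OF d3]) (use M s(2,3) in auto)
  then have "cfun.dim (R (M - 1)) = e" using NM M by simp
  moreover have "cfun.dim (R s) <= cfun.dim (R (M - 1)) + (s - (M - 1)) * (n + 1)"
   by (rule restrict_points) (simp add: t)
  ultimately have "cfun.dim (R s) <= e + t * (n + 1)" by (simp add: t)
  then show ?thesis unfolding t M by (simp add: algebra_simps)
 next
  case False
  obtain q where q: "d = q + 3" using d3 le_iff_add by (metis add.commute)
  have "n * (d - 1) = n * (q + 2)" unfolding q by simp
  then have Mq: "M = n * (q + 2)" by (simp only: M_def)
  have n_eq: "n = 2"
  proof -
   have "n * 2 <= n * (q + 2)" by (rule mult_le_mono2) simp
   then show ?thesis using False n2 Mq by linarith
  qed
  have M4: "M = 4"
  proof -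
   have "n * (q + 2) < n + 3" using False Mq by linarith
   then have "q = 0" unfolding n_eq by simp
   then show ?thesis using Mq n_eq by (metis add_0 mult_2 numeral_Bit0)
  qed
  have N6: "N = 6" unfolding NM M4 unfolding n_eq by simp
  have s5: "5 <= s" using s(1) n_eq by linarith
  have "cfun.dim (R (Suc M)) <= N - 1" by (rule dim_R_base[OF d3]) (use M4 s5 s(3) in linarith)
  then have b: "cfun.dim (R 5) <= 5" unfolding M4 N6 by simp
  have "cfun.dim (R s) <= cfun.dim (R 5) + (s - 5) * (n + 1)" by (rule restrict_points[OF s5])
  moreover have e: "n + 1 = 3" "n * M = 8" unfolding M4 unfolding n_eq by simp_all
  ultimately have "cfun.dim (R s) <= 5 + (s - 5) * 3" using b by (simp only: e)
  then show ?thesis unfolding e using s5 by linarith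
 qed
qed

text \<open>As \<open>h0\<close> is the left side minus the right side, no divisor of degree at most
  \<open>2\<close> is effective. One point suffices for linear forms and \<open>n + 1\<close> points
  for quadrics.\<close>

lemma dim_R_tiny:
 assumes d2: "d <= 2" and s: "s >= n + 3" "s <= L"
 shows "((n + d) choose n) + cfun.dim (R s) <= (n + 1) * s"
proof -
 consider "d = 1" | "d = 2" using d1 d2 by linarith
 then show ?thesis
 proof cases
  case 1
  obtain t where t: "s = 1 + t" using s(1) le_iff_add[of 1 s] by auto
  define r where "r = cfun.dim (R s)"
  have "cfun.dim (R s) <= cfun.dim (R 1) + (s - 1) * (n + 1)" by (rule restrict_points) (use s in simp)
  moreover have "cfun.dim (R 1) = 0" by (rule dim_R_linear[OF 1]) (use s in simp)
  moreover have "s - 1 = t" using t by simp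
  ultimately have "r <= t * (n + 1)" unfolding r_def by simp
  moreover have "(n + d) choose n = n + 1" using 1 by simp
  moreover have "(n + 1) * s = (n + 1) + t * (n + 1)" by (simp add: t)
  ultimately show ?thesis unfolding r_def[symmetric] by linarith
 next
  case 2
  obtain t where t: "s = Suc n + t" using s(1) le_iff_add[of "Suc n" s] by auto
  define r where "r = cfun.dim (R s)"
  define r' where "r' = cfun.dim (R (Suc n))"
  define b where "b = (n + d) choose n"
  have "cfun.dim (R s) <= cfun.dim (R (Suc n)) + (s - Suc n) * (n + 1)" by (rule restrict_points) (use s in simp)
  moreover have "s - Suc n = t" using t by simp
  ultimately have 1: "r <= r' + t * (n + 1)" unfolding r_def r'_def by simp
  have 2: "2 * r' <= n * (n + 1)" unfolding r'_def by (rule dim_R_quadric[OF 2]) (use s in simp)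
  have 3: "2 * b = (n + 2) * (n + 1)"
  proof -
   have "b = (n + 2) choose 2" unfolding b_def \<open>d = 2\<close> using binomial_symmetric[of n "n + 2"] by simp
   then show ?thesis using choose_two[of "n + 2"] by simp
  qed
  have "(n + 1) * s = (n + 1) * Suc n + (n + 1) * t" by (simp add: t algebra_simps)
  then have "b + r <= (n + 1) * s" using 1 2 3 by (simp add: algebra_simps)
  then show ?thesis by (simp only: b_def r_def)
 qed
qed

end

section \<open>Transfer from the standard curve to the given points\<close>

lemma grad_mon: "grad (mon al) x b = of_nat (al b) * mon (al(b := al b - 1)) x"
proof -
 have "grad (mon al) x = (%b. of_nat (al b) * mon (al(b := al b - 1)) x)"
 proof (rule grad_unique[OF PF_mono])
  fix w
  have D: "((%z. \<Prod>k\<in>UNIV. (x k + z * w k) ^ al k) has_field_derivative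
   (\<Sum>b\<in>UNIV. (of_nat (al b) * x b ^ (al b - 1) * w b) * (\<Prod>k\<in>UNIV - {b}. (x k + 0 * w k) ^ al k))) (at 0)"
   by (rule has_field_derivative_prod) (auto intro!: derivative_eq_intros)
  have E: "(of_nat (al b) * x b ^ (al b - 1) * w b) * (\<Prod>k\<in>UNIV - {b}. (x k + 0 * w k) ^ al k) =
    of_nat (al b) * mon (al(b := al b - 1)) x * w b" for b
  proof -
   have "mon (al(b := al b - 1)) x = x b ^ (al b - 1) * (\<Prod>k\<in>UNIV - {b}. x k ^ (al(b := al b - 1)) k)"
    unfolding mon_def by (subst prod.remove[of UNIV b]) simp_all
   also have "(\<Prod>k\<in>UNIV - {b}. x k ^ (al(b := al b - 1)) k) = (\<Prod>k\<in>UNIV - {b}. (x k + 0 * w k) ^ al k)"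
    by (intro prod.cong) auto
   finally show ?thesis by (simp only: mult_ac)
  qed
  show "((%z. mon al (%k. x k + z * w k)) has_field_derivative
   (\<Sum>b\<in>UNIV. of_nat (al b) * mon (al(b := al b - 1)) x * w b)) (at 0)"
   using D unfolding E unfolding mon_def .
 qed
 then show ?thesis by simp
qed

definition lin :: "complex ^ 'm ^ 'm => ('m::finite => complex) => 'm => complex" where
 "lin A x = (%a. \<Sum>b\<in>UNIV. A $ a $ b * x b)"

lemma lin_vec: "($) (A *v v) = lin A (($) v)"
 by (simp add: lin_def matrix_vector_mult_def fun_eq_iff)

lemma lin_mult: "lin A (lin B x) = lin (A ** B) x"
 using lin_vec[of A "B *v vec_lambda x"] lin_vec[of B "vec_lambda x"] lin_vec[of "A ** B" "vec_lambda x"]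
 by (simp add: matrix_vector_mul_assoc vec_lambda_inverse)

lemma lin_one: "lin (mat 1) x = x"
 using lin_vec[of "mat 1" "vec_lambda x"] by (simp add: vec_lambda_inverse)

lemma lin_add: "lin A (%k. x k + z * w k) = (%k. lin A x k + z * lin A w k)"
 by (simp add: lin_def fun_eq_iff ring_distribs sum.distrib sum_distrib_left mult_ac)

lemma lin_PF: "F : PF ==> (%x. F (lin A x)) : PF"
 unfolding lin_def
 by (rule PF_compose[of F "%a x. \<Sum>b\<in>UNIV. A $ a $ b * x b"]) (assumption | intro PF_sum PF_mult PF_const PF_var)+

lemma lin_hom:
 assumes "hom (%_. 1) d F"
 shows "hom (%_. 1) d (%x. F (lin A x))"
proof -
 have "lin A (act (%_. 1) r x) = act (%_. 1) r (lin A x)" for r x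
  by (simp add: lin_def act_def fun_eq_iff sum_distrib_left mult_ac)
 then show ?thesis using assms by (simp add: hom_def)
qed

lemma grad_lin:
 assumes "F : PF"
 shows "(\<Sum>a\<in>UNIV. lin A v a * grad F (lin A x) a) = (\<Sum>b\<in>UNIV. v b * grad (%x. F (lin A x)) x b)"
 using DERIV_unique[OF grad_deriv[OF assms, of "lin A x" "lin A v"]
   grad_deriv[OF lin_PF[OF assms, of A], of x v, unfolded lin_add]] by (simp add: mult.commute)

text \<open>Stars and bars, by listing the exponents along an enumeration of the
  coordinates.\<close>

lemma card_exps: "card (exps d :: ('m::finite => nat) set) = (d + CARD('m) - 1) choose d"
proof -
 obtain xs :: "'m list" where xs: "distinct xs" "set xs = UNIV" using finite_distinct_list[of "UNIV :: 'm set"] by auto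
 have len: "length xs = CARD('m)" using xs distinct_card by metis
 have sm: "sum_list (map al xs) = (\<Sum>k\<in>UNIV. al k)" for al :: "'m => nat"
  using sum_list_distinct_conv_sum_set[OF xs(1), of al] xs(2) by simp
 have "bij_betw (%al. map al xs) (exps d) {l. length l = CARD('m) & sum_list l = d}"
  unfolding bij_betw_def
 proof
  show "inj_on (%al. map al xs) (exps d)" by (rule inj_onI) (use xs(2) in \<open>simp add: fun_eq_iff\<close>)
  show "(%al. map al xs) ` exps d = {l. length l = CARD('m) & sum_list l = d}"
  proof (intro set_eqI iffI)
   fix l assume "l : {l :: nat list. length l = CARD('m) & sum_list l = d}"
   then have l: "length xs = length l" "sum_list l = d" using len by auto
   define al where "al = (%a. the (map_of (zip xs l) a))"
   have m: "map al xs = l"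
    by (rule nth_equalityI) (use l(1) in \<open>auto simp: al_def map_of_zip_nth[OF l(1) xs(1)]\<close>)
   then have "al : exps d" using sm[of al] l(2) by (simp add: exps_def)
   then show "l : (%al. map al xs) ` exps d" using m by blast
  qed (auto simp: sm exps_def len)
 qed
 from bij_betw_same_card[OF this] show ?thesis unfolding card_length_sum_list by (simp only: add.commute)
qed

locale curve_points = points p s + rnc sig n d u w s
 for p :: "nat => complex ^ 'm::finite" and s :: nat and sig :: "'m => nat" and n d u w +
 fixes A :: "complex ^ 'm ^ 'm"
 assumes A: "invertible A" and p_eq: "!!i. i : {1..s} ==> p i = A *v (\<chi> a. u i ^ (n - sig a) * w i ^ sig a)"
begin

definition nu :: "nat => 'm => complex" where "nu i a = u i ^ (n - sig a) * w i ^ sig a"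

lemma p_nu: "i : {1..s} ==> ($) (p i) = lin A (nu i)"
proof -
 assume i: "i : {1..s}"
 have "($) (\<chi> a. u i ^ (n - sig a) * w i ^ sig a) = nu i" by (simp add: fun_eq_iff nu_def)
 then show ?thesis unfolding p_eq[OF i] lin_vec by (rule arg_cong)
qed

lemma mon_nu:
 assumes "ga : exps e"
 shows "mon ga (nu i) = u i ^ (n * e - J ga) * w i ^ J ga"
proof -
 have s1: "(\<Sum>a\<in>UNIV. ga a) = e" using assms by (simp add: exps_def)
 have "(\<Sum>a\<in>UNIV. (n - sig a) * ga a) + J ga = (\<Sum>a\<in>UNIV. n * ga a)"
  unfolding J_def sum.distrib[symmetric]
 proof (intro sum.cong refl)
  fix a show "(n - sig a) * ga a + sig a * ga a = n * ga a"
   using st(2)[of a] by (metis add_mult_distrib le_add_diff_inverse2)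
 qed
 also have "\<dots> = n * e" unfolding sum_distrib_left[symmetric] s1 ..
 finally have s2: "(\<Sum>a\<in>UNIV. (n - sig a) * ga a) = n * e - J ga" by simp
 show ?thesis
  unfolding mon_def nu_def power_mult_distrib prod.distrib power_mult[symmetric] power_sum[symmetric] s2 J_def[symmetric] ..
qed

text \<open>Origin of \<open>R\<close>: its equations are the pairings of the coefficients with the
  gradients of monomials on the standard curve.\<close>

lemma mon_relation:
 assumes al: "al : exps d"
 shows "(\<Sum>i\<in>{1..s}. \<Sum>b\<in>UNIV. c (i, b) * grad (mon al) (nu i) b) = (\<Sum>b\<in>UNIV. of_nat (al b) * S s c (J al) (sig b))"
proof -
 have "c (i, b) * grad (mon al) (nu i) b = of_nat (al b) * (c (i, b) * u i ^ (M - (J al - sig b)) * w i ^ (J al - sig b))" for i b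
 proof (cases "al b = 0")
  case False
  have "J (al(b := al b - 1)) = J al - sig b" using exps_minus(2)[OF al False] by simp
  then show ?thesis
   unfolding grad_mon mon_nu[OF exps_minus(1)[OF al False]] M_def by (simp add: mult_ac)
 qed (simp add: grad_mon)
 then have "(\<Sum>i\<in>{1..s}. \<Sum>b\<in>UNIV. c (i, b) * grad (mon al) (nu i) b) =
  (\<Sum>i\<in>{1..s}. \<Sum>b\<in>UNIV. of_nat (al b) * (c (i, b) * u i ^ (M - (J al - sig b)) * w i ^ (J al - sig b)))"
  by (simp only:)
 also have "\<dots> = (\<Sum>b\<in>UNIV. of_nat (al b) * S s c (J al) (sig b))"
  unfolding S_def T_def st(3) sum_distrib_left by (rule sum.swap)
 finally show ?thesis .
qed

lemma form_relation:
 assumes c: "c : R s" and G: "G : PF" "hom (%_. 1) (int d) G"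
 shows "(\<Sum>i\<in>{1..s}. \<Sum>b\<in>UNIV. c (i, b) * grad G (nu i) b) = 0"
proof -
 obtain r where r: "G = poly_of d r" using G by (rule poly_of_ex)
 have *: "grad (%x. \<Sum>al\<in>X. r al * mon al x) y b = (\<Sum>al\<in>X. r al * grad (mon al) y b)" if "finite X" for X y b
  using that
 proof (induction X rule: finite_induct)
  case (insert al X)
  have 1: "(%x. r al * mon al x) : PF" "(%x. \<Sum>al\<in>X. r al * mon al x) : PF" by (intro PF_sum PF_mult PF_const PF_mono)+
  have "(%x. \<Sum>al\<in>insert al X. r al * mon al x) = (%x. r al * mon al x + (\<Sum>al\<in>X. r al * mon al x))"
   using insert.hyps by simp
  then show ?case
   using insert by (simp add: grad_add[OF 1] grad_cmult[OF PF_mono])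
 qed (simp add: grad_const)
 have "(\<Sum>i\<in>{1..s}. \<Sum>b\<in>UNIV. c (i, b) * grad G (nu i) b) =
  (\<Sum>i\<in>{1..s}. \<Sum>b\<in>UNIV. \<Sum>al\<in>exps d. r al * (c (i, b) * grad (mon al) (nu i) b))"
  unfolding r poly_of_def[abs_def] *[OF finite_exps] sum_distrib_left by (simp only: mult.left_commute)
 also have "\<dots> = (\<Sum>i\<in>{1..s}. \<Sum>al\<in>exps d. \<Sum>b\<in>UNIV. r al * (c (i, b) * grad (mon al) (nu i) b))"
  by (intro sum.cong refl sum.swap)
 also have "\<dots> = (\<Sum>al\<in>exps d. \<Sum>i\<in>{1..s}. \<Sum>b\<in>UNIV. r al * (c (i, b) * grad (mon al) (nu i) b))"
  by (rule sum.swap)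
 also have "\<dots> = 0"
  unfolding sum_distrib_left[symmetric] using mon_relation R_rel[OF c] by (intro sum.neutral ballI) simp
 finally show ?thesis .
qed

text \<open>Gradients pull back by the transpose of \<open>A\<close>, so the coefficients of
  relations are pushed forward by \<open>A\<close>.\<close>

definition Th :: "complex ^ 'm ^ 'm => (nat \<times> 'm => complex) => nat \<times> 'm => complex" where
 "Th A' c = (%(i, a). lin A' (%b. c (i, b)) a)"

lemma Th_supp: "c : supp_in ({1..s} \<times> UNIV) ==> Th A' c : supp_in ({1..s} \<times> UNIV)"
 by (simp add: supp_in_def Th_def lin_def)

lemma Th_pairing:
 assumes F: "F : PF"
 shows "(\<Sum>i\<in>{1..s}. \<Sum>a\<in>UNIV. Th A c (i, a) * grad F (($) (p i)) a) =
  (\<Sum>i\<in>{1..s}. \<Sum>b\<in>UNIV. c (i, b) * grad (%x. F (lin A x)) (nu i) b)"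
proof (rule sum.cong[OF refl])
 fix i assume i: "i : {1..s}"
 show "(\<Sum>a\<in>UNIV. Th A c (i, a) * grad F (($) (p i)) a) = (\<Sum>b\<in>UNIV. c (i, b) * grad (%x. F (lin A x)) (nu i) b)"
  unfolding Th_def prod.case p_nu[OF i] by (rule grad_lin[OF F])
qed

lemma rel_annihilator: "annihilator ({1..s} \<times> UNIV) (grads d) = Th A ` R s"
proof (intro set_eqI iffI)
 fix e assume "e : Th A ` R s"
 then obtain c where c: "c : R s" "e = Th A c" by blast
 have "(\<Sum>x\<in>{1..s} \<times> UNIV. e x * g x) = 0" if "g : grads d" for g
 proof -
  obtain F where F: "F : PF" "hom (%_. 1) (int d) F" "ALL i:{1..s}. ALL a. g (i, a) = grad F (($) (p i)) a"
   using \<open>g : grads d\<close> unfolding grads_def by blast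
  have "(\<Sum>x\<in>{1..s} \<times> UNIV. e x * g x) = (\<Sum>i\<in>{1..s}. \<Sum>a\<in>UNIV. e (i, a) * g (i, a))"
   by (simp add: sum.cartesian_product)
  also have "\<dots> = (\<Sum>i\<in>{1..s}. \<Sum>a\<in>UNIV. Th A c (i, a) * grad F (($) (p i)) a)"
   using F(3) c(2) by (intro sum.cong refl) simp
  also have "\<dots> = 0" unfolding Th_pairing[OF F(1)] by (rule form_relation[OF c(1) lin_PF[OF F(1)] lin_hom[OF F(2)]])
  finally show ?thesis .
 qed
 moreover have "e : supp_in ({1..s} \<times> UNIV)" using c Th_supp by (simp add: R_def)
 ultimately show "e : annihilator ({1..s} \<times> UNIV) (grads d)" by (simp add: annihilator_def)
next
 fix e assume e: "e : annihilator ({1..s} \<times> UNIV) (grads d)"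
 obtain A' where A': "A ** A' = mat 1" "A' ** A = mat 1" using A by (auto simp: invertible_def)
 define c where "c = Th A' e"
 have eT: "e = Th A c"
  by (auto simp: c_def Th_def lin_mult A' lin_one fun_eq_iff)
 have "(\<Sum>b\<in>UNIV. of_nat (al b) * S s c (J al) (sig b)) = 0" if al: "al : exps d" for al
 proof -
  let ?F = "%x. mon al (lin A' x)"
  have F: "?F : PF" "hom (%_. 1) (int d) ?F"
   using lin_PF[OF PF_mono] lin_hom[OF hom_mono, of al] al unfolding wt_one exps_def by auto
  define g where "g = (%(i, a). if i : {1..s} then grad ?F (($) (p i)) a else 0)"
  have "g : grads d" unfolding grads_def using F by (auto simp: g_def supp_in_def)
  then have "(\<Sum>x\<in>{1..s} \<times> UNIV. e x * g x) = 0" using e by (simp add: annihilator_def)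
  then have "(\<Sum>i\<in>{1..s}. \<Sum>a\<in>UNIV. e (i, a) * g (i, a)) = 0" by (simp add: sum.cartesian_product)
  moreover have "(\<Sum>i\<in>{1..s}. \<Sum>a\<in>UNIV. e (i, a) * g (i, a)) = (\<Sum>i\<in>{1..s}. \<Sum>a\<in>UNIV. Th A c (i, a) * grad ?F (($) (p i)) a)"
   unfolding eT[symmetric] by (intro sum.cong refl) (simp add: g_def)
  ultimately have "(\<Sum>i\<in>{1..s}. \<Sum>a\<in>UNIV. Th A c (i, a) * grad ?F (($) (p i)) a) = 0" by (simp only:)
  then show ?thesis unfolding Th_pairing[OF F(1)] lin_mult A' lin_one mon_relation[OF al] .
 qed
 moreover have "c : supp_in ({1..s} \<times> UNIV)" using e Th_supp by (simp add: c_def annihilator_def)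
 ultimately have "c : R s" by (simp add: R_def)
 then show "e : Th A ` R s" using eT by blast
qed

lemma dim_grads: "cfun.dim (grads d) + cfun.dim (R s) = s * CARD('m)"
proof -
 obtain A' where A': "A' ** A = mat 1" using A by (auto simp: invertible_def)
 have T: "clinear (Th A)"
  by (rule clinearI) (auto simp: Th_def lin_def fun_eq_iff ring_distribs sum.distrib sum_distrib_left mult_ac)
 have "cfun.dim (Th A ` R s) = cfun.dim (R s)"
 proof (rule dim_image_inj[OF T fin_dim_R])
  fix c assume "Th A c = 0"
  then have "Th A' (Th A c) = 0" by (simp add: Th_def lin_def fun_eq_iff)
  then show "c = 0" by (simp add: Th_def lin_mult A' lin_one fun_eq_iff)
 qed
 moreover have "grads d <= supp_in ({1..s} \<times> UNIV)" by (auto simp: grads_def)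
 ultimately show ?thesis
  using dim_annihilator[OF fin_idx subspace_grads, of d s] unfolding rel_annihilator
  by (simp add: card_cartesian_product)
qed

end

text \<open>The parametrisation is homogeneous of degree \<open>n\<close>, so the scalar between
  \<open>q\<close> and the point of the curve is absorbed into \<open>u\<close> and \<open>w\<close>
  by an \<open>n\<close>-th root.\<close>

lemma rational_normal_curve_point:
 fixes A :: "complex ^ 'm::finite ^ 'm"
 assumes "proj_pt q = proj_pt (A *v (\<chi> j. u ^ (n - sig j) * w ^ sig j))" "(u, w) ~= (0, 0)" "n >= 1" "!!j. sig j <= n"
 shows "EX u w. (u ~= 0 | w ~= 0) & q = A *v (\<chi> j. u ^ (n - sig j) * w ^ sig j)"
proof -
 obtain c where c: "c ~= 0" "q = c *s (A *v (\<chi> j. u ^ (n - sig j) * w ^ sig j))" using assms(1) by (rule proj_pt_eqD)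
 define rh where "rh = exp (Ln c / of_nat n)"
 have rh: "rh ^ n = c" "rh ~= 0" using assms(3) c(1) by (simp_all add: rh_def flip: exp_of_nat_mult)
 have "(rh * u) ^ (n - sig j) * (rh * w) ^ sig j = c * (u ^ (n - sig j) * w ^ sig j)" for j
 proof -
  have "(rh * u) ^ (n - sig j) * (rh * w) ^ sig j = rh ^ (n - sig j + sig j) * (u ^ (n - sig j) * w ^ sig j)"
   by (simp only: power_add power_mult_distrib mult_ac)
  then show ?thesis using assms(4)[of j] rh(1) by simp
 qed
 then have "(\<chi> j. (rh * u) ^ (n - sig j) * (rh * w) ^ sig j) = c *s (\<chi> j. u ^ (n - sig j) * w ^ sig j)" by (simp add: vec_eq_iff)
 then have "q = A *v (\<chi> j. (rh * u) ^ (n - sig j) * (rh * w) ^ sig j)" using c(2) by (simp add: vector_scalar_commute)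
 then show ?thesis using rh(2) assms(2) by (intro exI[of _ "rh * u"] exI[of _ "rh * w"]) auto
qed

text \<open>Parameters proportional by \<open>t\<close> give coordinates proportional by
  \<open>t ^ n\<close>; hence distinct points have parameters that are not proportional.\<close>

lemma rational_normal_curve_distinct:
 fixes A :: "complex ^ 'm::finite ^ 'm"
 assumes "!!j. sig j <= n" "u ~= 0 | w ~= 0" "u' ~= 0 | w' ~= 0" "u * w' = u' * w"
 shows "proj_pt (A *v (\<chi> j. u ^ (n - sig j) * w ^ sig j)) = proj_pt (A *v (\<chi> j. u' ^ (n - sig j) * w' ^ sig j))"
proof -
 define t where "t = (if u' = 0 then w / w' else u / u')"
 have t: "u = t * u'" "w = t * w'" "t ~= 0" using assms(2-4) by (auto simp: t_def field_simps)
 have "u ^ (n - sig j) * w ^ sig j = t ^ n * (u' ^ (n - sig j) * w' ^ sig j)" for j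
 proof -
  have "u ^ (n - sig j) * w ^ sig j = t ^ (n - sig j + sig j) * (u' ^ (n - sig j) * w' ^ sig j)"
   unfolding t(1,2) by (simp only: power_add power_mult_distrib mult_ac)
  then show ?thesis using assms(1)[of j] by simp
 qed
 then have "(\<chi> j. u ^ (n - sig j) * w ^ sig j) = t ^ n *s (\<chi> j. u' ^ (n - sig j) * w' ^ sig j)" by (simp add: vec_eq_iff)
 then have "A *v (\<chi> j. u ^ (n - sig j) * w ^ sig j) = t ^ n *s (A *v (\<chi> j. u' ^ (n - sig j) * w' ^ sig j))"
  by (simp add: vector_scalar_commute)
 then show ?thesis using proj_pt_smult[of "t ^ n"] t(3) by simp
qed

lemma vdim_double_points:
 assumes "n >= 1"
 shows "vdim n s (int d) (%i. 2) = int ((n + d) choose n) - int s * (int n + 1)"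
proof -
 have "binom (int n + int d) (int n) = int ((n + d) choose n)" by (simp add: binom_def nat_add_distrib)
 moreover have "binom (int n + int 2 - 1) (int n) = int n + 1"
  by (simp add: binom_def nat_add_distrib flip: of_nat_Suc) 
 ultimately show ?thesis by (simp add: vdim_def)
qed

theorem corollary2p6:
  fixes n s :: nat and p :: "nat \<Rightarrow> complex ^ 'm::finite" and C :: "(complex ^ 'm) set set" and d :: int
  assumes "CARD('m) = n + 1" and "n \<ge> 2" and "s \<ge> n + 3"
    and "rational_normal_curve C"
    and "\<And>i. i \<in> {1..s} \<Longrightarrow> p i \<noteq> 0 \<and> proj_pt (p i) \<in> C"
    and "inj_on (\<lambda>i. proj_pt (p i)) {1..s}"
    and "effective p s d (\<lambda>i. 2)"
  shows "(real_of_int d \<ge> (2 * real s - 1) / real n \<longrightarrow> non_special p s d (\<lambda>i. 2)) \<and>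
    ((real s + real n + 2) / real n \<le> real_of_int d \<and> real_of_int d < (2 * real s - 1) / real n \<longrightarrow>
       special p s d (\<lambda>i. 2) \<and>
       int (h1 p s d (\<lambda>i. 2)) =
         F1 (int n + 1 - 1 - 1) (int s) (int n * d - int n - int s - 2) (int n) \<and>
       F1 (int n + 1 - 1 - 1) (int s) (int n * d - int n - int s - 2) (int n) =
         2 * int s - int n * d - 1) \<and>
    (real_of_int d < (real s + real n + 2) / real n \<longrightarrow>
       special p s d (\<lambda>i. 2) \<and>
       int (h1 p s d (\<lambda>i. 2)) =
         F1 (int n + 2 - 1 - 1) (int s) (int n * (d - 2) - 4) (int n) \<and>
       F1 (int n + 2 - 1 - 1) (int s) (int n * (d - 2) - 4) (int n) =
         int s * (int n + 1) - (int n)^2 * (d - 1) - 2)"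
proof -
 have pts: "points p s" using assms(1-3,5,6) by unfold_locales auto
 have dp: "d >= 1" by (rule points.effective_form[OF pts assms(7)])
 define e where "e = nat d"
 have d: "d = int e" "e >= 1" using dp by (simp_all add: e_def)
 obtain A :: "complex ^ 'm ^ 'm" and sig :: "'m => nat" where A: "invertible A" "bij_betw sig UNIV {..CARD('m) - 1}"
  "C = {proj_pt (A *v (\<chi> j. u ^ (CARD('m) - 1 - sig j) * w ^ sig j)) | u w. (u, w) ~= (0, 0)}"
  using assms(4) unfolding rational_normal_curve_def by blast
 have n': "CARD('m) - 1 = n" using assms(1) by simp
 note A = A[unfolded n']
 have sign: "sig j <= n" for j using bij_betwE[OF A(2)] by auto
 have "ALL i:{1..s}. EX uw. (fst uw ~= 0 | snd uw ~= 0) & p i = A *v (\<chi> j. fst uw ^ (n - sig j) * snd uw ^ sig j)"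
 proof
  fix i assume "i : {1..s}"
  then obtain u w where "proj_pt (p i) = proj_pt (A *v (\<chi> j. u ^ (n - sig j) * w ^ sig j))" "(u, w) ~= (0, 0)"
   using assms(5) unfolding A(3) by blast
  from rational_normal_curve_point[OF this _ sign] assms(2)
  obtain u w where "(u ~= 0 | w ~= 0) & p i = A *v (\<chi> j. u ^ (n - sig j) * w ^ sig j)" by auto
  then show "EX uw. (fst uw ~= 0 | snd uw ~= 0) & p i = A *v (\<chi> j. fst uw ^ (n - sig j) * snd uw ^ sig j)"
   by (intro exI[of _ "(u, w)"]) simp
 qed
 then obtain uw where uw: "ALL i:{1..s}. (fst (uw i) ~= 0 | snd (uw i) ~= 0) & p i = A *v (\<chi> j. fst (uw i) ^ (n - sig j) * snd (uw i) ^ sig j)"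
  unfolding bchoice_iff by (elim exE)
 define u where "u = (%i. fst (uw i))"
 define w where "w = (%i. snd (uw i))"
 have uw1: "u i ~= 0 | w i ~= 0" "p i = A *v (\<chi> j. u i ^ (n - sig j) * w i ^ sig j)" if "i : {1..s}" for i
  using bspec[OF uw that] by (simp_all add: u_def w_def)
 interpret points p s by (rule pts)
 interpret rnc sig n e u w s
 proof
  show "u i * w j ~= u j * w i" if ij: "i : {1..s}" "j : {1..s}" "i ~= j" for i j
  proof
   assume "u i * w j = u j * w i"
   from rational_normal_curve_distinct[OF sign uw1(1)[OF ij(1)] uw1(1)[OF ij(2)] this, of A]
   have "proj_pt (p i) = proj_pt (p j)" using uw1(2) ij by simp
   then show False using inj_onD[OF assms(6) _ ij(1,2)] ij(3) by blast
  qed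
 qed (use A(2) assms(2) d(2) uw1(1) in auto)
 interpret curve_points p s sig n e u w A
  by unfold_locales (use A(1) uw1(2) in auto)
 define r where "r = cfun.dim (R s)"
 define b where "b = (n + e) choose n"
 have dg: "cfun.dim (grads e) + r = s * (n + 1)" using dim_grads by (simp add: r_def assms(1))
 have h1r: "h1 p s d (%i. 2) = r" using h1_eq[OF d(2)] dg by (simp add: d(1) assms(1))
 have "card (exps e :: ('m => nat) set) = b"
  unfolding card_exps b_def assms(1) using binomial_symmetric[of n "n + e"] by (simp add: add.commute)
 then have h0r: "h0 p s d (%i. 2) + cfun.dim (grads e) = b" using h0_eq[OF d(2)] by (simp add: d(1))
 have pos: "h0 p s d (%i. 2) > 0" using assms(7) by (simp add: effective_def)
 have vd: "vdim n s d (%i. 2) = int b - int s * (int n + 1)"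
  unfolding d(1) b_def by (rule vdim_double_points) (use assms(2) in simp)
 have dgi: "int (cfun.dim (grads e)) + int r = int s * (int n + 1)" using dg by (metis of_nat_1 of_nat_add of_nat_mult)
 \<comment> \<open>The number \<open>r\<close> of independent relations is both \<open>h1\<close>
   and the excess of \<open>h0\<close> over the virtual dimension.\<close>
 have h0v: "int (h0 p s d (%i. 2)) = vdim n s d (%i. 2) + int r"
  using h0r dgi unfolding vd by linarith
 \<comment> \<open>In degree at most \<open>2\<close> the dimension count contradicts
   effectivity.\<close>
 have e3: "e >= 3"
 proof (rule ccontr)
  assume "\<not> e >= 3"
  then have "b + r <= (n + 1) * s" unfolding b_def r_def by (intro dim_R_tiny) (use assms(3) in auto)
  then show False using h0r dg pos by (simp add: mult.commute)
 qed
 \<comment> \<open>As \<open>h0 > 0\<close>, only the comparison with the virtual dimension matters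
   in the maximum.\<close>
 have special: "special p s d (%i. 2)" if "r > 0"
  using that h0v pos unfolding special_def n' by simp
 have Mi: "int M = int n * (d - 1)" "int N = int n * d"
  using d(2) by (simp_all add: M_def N_def d(1) of_nat_diff)
 have n0: "real n > 0" using assms(2) by simp
 have c1: "real_of_int d >= (2 * real s - 1) / real n \<longleftrightarrow> 2 * int s - 1 <= int n * d"
 proof -
  have "real_of_int d >= (2 * real s - 1) / real n \<longleftrightarrow> real_of_int (2 * int s - 1) <= real_of_int (int n * d)"
   using n0 by (simp add: pos_divide_le_eq mult.commute)
  then show ?thesis by (simp only: of_int_le_iff)
 qed
 have c2: "(real s + real n + 2) / real n <= real_of_int d \<longleftrightarrow> int s + int n + 2 <= int n * d"
 proof -
  have "(real s + real n + 2) / real n <= real_of_int d \<longleftrightarrow> real_of_int (int s + int n + 2) <= real_of_int (int n * d)"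
   using n0 by (simp add: pos_divide_le_eq mult.commute)
  then show ?thesis by (simp only: of_int_le_iff)
 qed
 \<comment> \<open>Since \<open>M = n d - n\<close>, the hypothesis says
   \<open>s + 1 <= M\<close>.\<close>
 have small: "r = 2 * s - (N + 1)" if "int s + int n + 1 <= int n * d"
  unfolding r_def
 proof (rule dim_R_small[OF e3])
  show "Suc s <= M" using that Mi(1) by (simp add: algebra_simps)
 qed simp
 \<comment> \<open>The first argument of \<open>F1\<close> is \<open>n - 1\<close> in the second
   case and \<open>n\<close> in the third, so these are the binomial coefficients that
   occur.\<close>
 have bn: "binom (int n) (int n) = 1" "binom (int n - 1) (int n) = 0" "binom (int n - 1) (int n - 1) = 1"
  "binom (int n + 1) (int n) = int n + 1" "binom (int n) (int n - 1) = int n"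
 proof -
  show "binom (int n) (int n - 1) = int n"
  proof -
   obtain k where k: "n = Suc k" using assms(2) by (cases n) auto
   show ?thesis unfolding k by (simp add: binom_def nat_add_distrib)
  qed
 qed (use assms(2) in \<open>simp_all add: binom_def nat_add_distrib\<close>)
 note bn = bn bn(4)[unfolded add.commute[of "int n" 1]]
 show ?thesis
 proof (intro conjI impI)
  assume "real_of_int d >= (2 * real s - 1) / real n"
  then have nd: "2 * int s - 1 <= int n * d" using c1 by blast
  have "r = 2 * s - (N + 1)" by (rule small) (use nd assms(3) in linarith)
  then have "r = 0" using nd Mi(2) by simp
  then show "non_special p s d (%i. 2)" using h0v unfolding non_special_def n' by simp
 next
  assume a: "(real s + real n + 2) / real n <= real_of_int d & real_of_int d < (2 * real s - 1) / real n"
  then have nd: "int s + int n + 2 <= int n * d" "int n * d < 2 * int s - 1" using c1 c2 by linarith+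
  have "r = 2 * s - (N + 1)" by (rule small) (use nd in linarith)
  then have ri: "int r = 2 * int s - int n * d - 1" "r > 0" using nd Mi(2) by linarith+
  show "special p s d (%i. 2)" by (rule special[OF ri(2)])
  show F: "F1 (int n + 1 - 1 - 1) (int s) (int n * d - int n - int s - 2) (int n) = 2 * int s - int n * d - 1"
   by (simp add: F1_def bn)
  show "int (h1 p s d (%i. 2)) = F1 (int n + 1 - 1 - 1) (int s) (int n * d - int n - int s - 2) (int n)"
   unfolding F h1r ri(1) ..
 next
  assume "real_of_int d < (real s + real n + 2) / real n"
  then have nd: "int n * d < int s + int n + 2" using c2 by linarith
  \<comment> \<open>The bound on \<open>n d\<close> means \<open>M <= s + 1\<close>; at equality
    both computations of \<open>r\<close> apply and agree.\<close>
  have Ms: "M <= Suc s" using nd Mi(1) by (simp add: algebra_simps)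
  have "r + n * M + 2 = (n + 1) * s" unfolding r_def by (rule dim_R_large[OF e3 assms(2,3) Ms]) simp
  then have "int r + int n * int M + 2 = (int n + 1) * int s" by (metis of_nat_1 of_nat_add of_nat_mult of_nat_numeral)
  then have ri: "int r = int s * (int n + 1) - (int n)^2 * (d - 1) - 2" unfolding Mi by (simp add: power2_eq_square algebra_simps)
  \<comment> \<open>\<open>M <= s + 1\<close> gives \<open>r >= s - n - 2\<close>, which is positive
    as \<open>s >= n + 3\<close>.\<close>
  have "r > 0"
  proof -
   have "n * M <= n * Suc s" using Ms by (rule mult_le_mono2)
   then show ?thesis using \<open>r + n * M + 2 = (n + 1) * s\<close> assms(3) by simp
  qed
  then show "special p s d (%i. 2)" by (rule special)
  show F: "F1 (int n + 2 - 1 - 1) (int s) (int n * (d - 2) - 4) (int n) = int s * (int n + 1) - (int n)^2 * (d - 1) - 2"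
   by (simp add: F1_def bn power2_eq_square algebra_simps)
  show "int (h1 p s d (%i. 2)) = F1 (int n + 2 - 1 - 1) (int s) (int n * (d - 2) - 4) (int n)"
   unfolding F h1r ri ..
 qed
qed

end
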